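(* Let $B$ be a standard $d$-dimensional Brownian motion on $[0,T]$ and let $\mathcal F$ be the $\sigma$-algebra generated by $(B_t)_{t\in[0,T]}$. Every $Y\in L^2(\mathcal F)$ can be represented as the series, with pairwise orthogonal summands and convergent in $L^2$, $$Y=\sum_{w\in[d]^\circ_{\mathtt 0}}\frac{\mathbb E\big[Y\,\langle\widehat p_w,\widehat S(\widetilde B)_{0,T}\rangle\big]}{(\widehat p_w,\widehat p_w)_{\widehat{\sqcup\!\sqcup}}}\,\langle\widehat p_w,\widehat S(\widetilde B)_{0,T}\rangle .$$ Moreover, $\widehat p$ is a natural orthogonalisation according to the functor $V\mapsto\widehat{\mathrm{Sh}}{}^\circ(\widetilde V)$: for any injective isometry of finite-dimensional Euclidean spaces $\varphi\colon U\to V$, $$\widehat{\mathrm{Sh}}{}^\circ(\varphi)\circ\widehat p^{\,U}=\widehat p^{\,V}\circ\widehat{\mathrm{Sh}}{}^\circ(\varphi),$$ where $\widehat{\mathrm{Sh}}{}^\circ(\varphi):=T(\mathrm{id}_{\mathbb R}\oplus\varphi)|_{\widehat{\mathrm{Sh}}{}^\circ(\widetilde U)}$.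
   Context: For a $d$-dimensional Euclidean space $V$ set $\widetilde V=\mathbb R\oplus V$; choosing an orthonormal basis of $V$, elements of $T(\widetilde V)=\bigoplus_n\widetilde V^{\otimes n}$ are linear combinations of words in the alphabet $\{\mathtt 0,1,\dots,d\}$, the letter $\mathtt 0$ corresponding to the $\mathbb R$ summand. $\widehat{\mathrm{Sh}}{}^\circ(\widetilde V)\subset T(\widetilde V)$ is spanned by words not ending in $\mathtt 0$ (including the empty word); the set of such words is $[d]^\circ_{\mathtt 0}$. $\widetilde B_t=(t,B_t)$, with $t$ in coordinate $\mathtt 0$, where $B$ is a standard Brownian motion in $V$; $\widehat S(\widetilde B)_{0,T}$ is its Itô signature: $\langle\alpha_1\cdots\alpha_n,\widehat S(\widetilde B)_{0,T}\rangle=\int_{0<t_1<\dots<t_n<T}d\widetilde B^{\alpha_1}_{t_1}\cdots d\widetilde B^{\alpha_n}_{t_n}$, with iterated Riemann integrals for $\mathtt 0$ and Itô integrals for the other letters, extended linearly in the word. Define $(u,v)_{\widehat{\sqcup\!\sqcup}}=\mathbb E\big[\langle u,\widehat S(\widetilde B)_{0,T}\rangle\langle v,\widehat S(\widetilde B)_{0,T}\rangle\big]$; it is positive-definite on $\widehat{\mathrm{Sh}}{}^\circ(\widetilde V)$. For $u,v\in[d]^\circ_{\mathtt 0}$ write $u\sim_{\mathtt 0}v$ if $u$ and $v$ become equal after deleting all letters $\mathtt 0$. On each equivalence class use the linear order $<_{\mathtt 0}$: $u<_{\mathtt 0}v$ if $u$ has fewer letters than $v$, or if they have the same number of letters and $u$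 precedes $v$ lexicographically (with $\mathtt 0<1<\dots<d$). For $w\in[d]^\circ_{\mathtt 0}$ define by Gram–Schmidt $$\widehat p_w=w-\sum_{v\sim_{\mathtt 0}w,\ v<_{\mathtt 0}w}\frac{(w,\widehat p_v)_{\widehat{\sqcup\!\sqcup}}}{(\widehat p_v,\widehat p_v)_{\widehat{\sqcup\!\sqcup}}}\,\widehat p_v .$$ $\widehat p^{\,V}\colon\widehat{\mathrm{Sh}}{}^\circ(\widetilde V)\to\widehat{\mathrm{Sh}}{}^\circ(\widetilde V)$ is the linear map with $\widehat p^{\,V}(w)=\widehat p_w$ for words $w$ in an orthonormal basis of $V$ (the map does not depend on the choice of orthonormal basis). $T(\psi)$ denotes the map $v_1\cdots v_n\mapsto\psi(v_1)\cdots\psi(v_n)$. *)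

theory Defs
  imports "HOL-Probability.Probability" "HOL-Library.Poly_Mapping"
begin

section \<open>Real vector spaces of formal linear combinations\<close>

instantiation poly_mapping :: (type, real_vector) real_vector
begin

lift_definition scaleR_poly_mapping :: "real \<Rightarrow> ('a \<Rightarrow>\<^sub>0 'b) \<Rightarrow> 'a \<Rightarrow>\<^sub>0 'b"
  is "\<lambda>c p k. c *\<^sub>R p k"
  by (erule rev_finite_subset) auto

instance
  by standard (transfer; simp add: scaleR_add_left scaleR_add_right)+

end

lemma lookup_scaleR [simp]: "Poly_Mapping.lookup (c *\<^sub>R p) k = c *\<^sub>R Poly_Mapping.lookup p k"
  by transfer simp

definition lin_ext :: "('k \<Rightarrow> 'b::real_vector) \<Rightarrow> ('k \<Rightarrow>\<^sub>0 real) \<Rightarrow> 'b" where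
  "lin_ext g p = (\<Sum>k\<in>Poly_Mapping.keys p. Poly_Mapping.lookup p k *\<^sub>R g k)"

lemma lin_ext_superset:
  assumes "finite A" "Poly_Mapping.keys p \<subseteq> A"
  shows "lin_ext g p = (\<Sum>k\<in>A. Poly_Mapping.lookup p k *\<^sub>R g k)"
  unfolding lin_ext_def
  by (rule sum.mono_neutral_left) (use assms in \<open>auto simp: in_keys_iff\<close>)

lemma linear_lin_ext: "linear (lin_ext g)"
proof (rule linearI)
  fix p q :: "'a \<Rightarrow>\<^sub>0 real" and c :: real
  let ?A = "Poly_Mapping.keys p \<union> Poly_Mapping.keys q"
  have fin: "finite ?A" by simp
  have "Poly_Mapping.keys (p + q) \<subseteq> ?A" by (rule Poly_Mapping.keys_add)
  then show "lin_ext g (p + q) = lin_ext g p + lin_ext g q"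
    using lin_ext_superset[OF fin, of "p + q" g] lin_ext_superset[OF fin, of p g]
      lin_ext_superset[OF fin, of q g]
    by (simp add: lookup_add scaleR_add_left sum.distrib)
  have "Poly_Mapping.keys (c *\<^sub>R p) \<subseteq> Poly_Mapping.keys p" by (auto simp: in_keys_iff)
  then show "lin_ext g (c *\<^sub>R p) = c *\<^sub>R lin_ext g p"
    using lin_ext_superset[of "Poly_Mapping.keys p" "c *\<^sub>R p" g]
    by (simp add: lin_ext_def scaleR_sum_right)
qed

lemma lin_ext_single [simp]: "lin_ext g (Poly_Mapping.single k 1) = g k"
  by (simp add: lin_ext_def)


section \<open>The tensor algebra\<close>

text \<open>\<open>T(W)\<close>, the direct sum of all tensor powers of \<open>W\<close>, is the free vector space on tuples
  (lists) of vectors, modulo additivity and homogeneity in every entry. Only its vector space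
  structure is needed.\<close>

definition tensor_relations :: "('w::real_vector list \<Rightarrow>\<^sub>0 real) set" where
  "tensor_relations = span
     ({Poly_Mapping.single (xs @ (a + b) # ys) 1 - Poly_Mapping.single (xs @ a # ys) 1
         - Poly_Mapping.single (xs @ b # ys) 1 | xs a b ys. True} \<union>
      {Poly_Mapping.single (xs @ (c *\<^sub>R a) # ys) 1 - c *\<^sub>R Poly_Mapping.single (xs @ a # ys) 1
         | xs c a ys. True})"

definition tensor_eq :: "('w::real_vector list \<Rightarrow>\<^sub>0 real) \<Rightarrow> ('w list \<Rightarrow>\<^sub>0 real) \<Rightarrow> bool" where
  "tensor_eq p q \<longleftrightarrow> p - q \<in> tensor_relations"

lemma subspace_tensor_relations: "subspace tensor_relations"
  by (simp add: tensor_relations_def)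

lemma tensor_relations_add:
  "Poly_Mapping.single (xs @ (a + b) # ys) 1 - Poly_Mapping.single (xs @ a # ys) 1
     - Poly_Mapping.single (xs @ b # ys) 1 \<in> tensor_relations"
  unfolding tensor_relations_def by (rule span_base) blast

lemma tensor_relations_scale:
  "Poly_Mapping.single (xs @ (c *\<^sub>R a) # ys) 1 - c *\<^sub>R Poly_Mapping.single (xs @ a # ys) 1
     \<in> tensor_relations"
  unfolding tensor_relations_def by (rule span_base) blast

quotient_type (overloaded) 'w tensor_alg = "'w::real_vector list \<Rightarrow>\<^sub>0 real" / tensor_eq
proof (intro equivpI reflpI sympI transpI)
  fix p q r :: "'w list \<Rightarrow>\<^sub>0 real"
  note sub = subspace_tensor_relations
  show "tensor_eq p p"
    by (simp add: tensor_eq_def subspace_0[OF sub])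
  show "tensor_eq q p" if "tensor_eq p q"
    using subspace_neg[OF sub that[unfolded tensor_eq_def]] by (simp add: tensor_eq_def)
  show "tensor_eq p r" if "tensor_eq p q" "tensor_eq q r"
    using subspace_add[OF sub that[unfolded tensor_eq_def]] by (simp add: tensor_eq_def)
qed

instantiation tensor_alg :: (real_vector) real_vector
begin

lift_definition zero_tensor_alg :: "'a tensor_alg" is 0 .

lift_definition plus_tensor_alg :: "'a tensor_alg \<Rightarrow> 'a tensor_alg \<Rightarrow> 'a tensor_alg" is "(+)"
  unfolding tensor_eq_def add_diff_add
  by (rule subspace_add[OF subspace_tensor_relations])

lift_definition minus_tensor_alg :: "'a tensor_alg \<Rightarrow> 'a tensor_alg \<Rightarrow> 'a tensor_alg" is "(-)"
proof -
  fix p p' q q' :: "'a list \<Rightarrow>\<^sub>0 real"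
  assume "tensor_eq p p'" "tensor_eq q q'"
  moreover have "p - q - (p' - q') = (p - p') - (q - q')" by simp
  ultimately show "tensor_eq (p - q) (p' - q')"
    unfolding tensor_eq_def by (simp only: subspace_diff[OF subspace_tensor_relations])
qed

lift_definition uminus_tensor_alg :: "'a tensor_alg \<Rightarrow> 'a tensor_alg" is "uminus"
  unfolding tensor_eq_def minus_diff_minus
  by (rule subspace_neg[OF subspace_tensor_relations])

lift_definition scaleR_tensor_alg :: "real \<Rightarrow> 'a tensor_alg \<Rightarrow> 'a tensor_alg" is "scaleR"
  unfolding tensor_eq_def scaleR_right_diff_distrib[symmetric]
  by (rule subspace_scale[OF subspace_tensor_relations])

instance
  by standard
    (transfer; simp add: tensor_eq_def subspace_0[OF subspace_tensor_relations] algebra_simps)+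

end

lift_definition tensor :: "'w::real_vector list \<Rightarrow> 'w tensor_alg"
  is "\<lambda>vs. Poly_Mapping.single vs 1" .

text \<open>\<open>T(\<psi>)\<close>; the case distinction only makes the map total, as \<open>T(\<psi>)\<close> makes sense for linear
  \<open>\<psi>\<close> only.\<close>

lift_definition tensor_map ::
  "('w::real_vector \<Rightarrow> 'x::real_vector) \<Rightarrow> 'w tensor_alg \<Rightarrow> 'x tensor_alg"
  is "\<lambda>\<psi> p. if linear \<psi> then lin_ext (\<lambda>vs. Poly_Mapping.single (map \<psi> vs) 1) p else 0"
proof -
  fix \<psi> :: "'w \<Rightarrow> 'x" and p q :: "'w list \<Rightarrow>\<^sub>0 real"
  assume pq: "tensor_eq p q"
  let ?L = "lin_ext (\<lambda>vs. Poly_Mapping.single (map \<psi> vs) (1::real))"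
  show "tensor_eq (if linear \<psi> then ?L p else 0) (if linear \<psi> then ?L q else 0)"
  proof (cases "linear \<psi>")
    case False
    then show ?thesis
      by (simp add: tensor_eq_def subspace_0[OF subspace_tensor_relations])
  next
    case True
    have "?L r \<in> tensor_relations" if "r \<in> tensor_relations" for r
      using that[unfolded tensor_relations_def]
    proof (induction rule: span_induct)
      case base
      show "subspace {r. ?L r \<in> tensor_relations}"
        by (rule linear_subspace_vimage[OF linear_lin_ext subspace_tensor_relations, unfolded vimage_def])
    next
      case (step r)
      then show ?case
        by (auto simp: linear_diff[OF linear_lin_ext] linear_scale[OF linear_lin_ext]
             linear_add[OF True] linear_scale[OF True] tensor_relations_add tensor_relations_scale)
    qed
    with pq show ?thesis
      by (simp add: tensor_eq_def True flip: linear_diff[OF linear_lin_ext])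
  qed
qed

lemma tensor_map_tensor: "linear \<psi> \<Longrightarrow> tensor_map \<psi> (tensor vs) = tensor (map \<psi> vs)"
  by transfer (simp add: tensor_eq_def subspace_0[OF subspace_tensor_relations])

lemma linear_tensor_map: "linear (tensor_map \<psi>)"
proof (rule linearI)
  show "tensor_map \<psi> (x + y) = tensor_map \<psi> x + tensor_map \<psi> y" for x y
    by transfer
      (simp add: tensor_eq_def linear_add[OF linear_lin_ext] subspace_0[OF subspace_tensor_relations])
  show "tensor_map \<psi> (c *\<^sub>R x) = c *\<^sub>R tensor_map \<psi> x" for c x
    by transfer
      (simp add: tensor_eq_def linear_scale[OF linear_lin_ext] subspace_0[OF subspace_tensor_relations])
qed


section \<open>Words\<close>

text \<open>Linear combinations of words have type \<^typ>\<open>nat list \<Rightarrow>\<^sub>0 real\<close>; they become elements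
  of the tensor algebra once an orthonormal basis is chosen (\<open>realise\<close> below).\<close>

definition words0 :: "nat \<Rightarrow> nat list set" where
  "words0 d = {w. set w \<subseteq> {0..d} \<and> (w \<noteq> [] \<longrightarrow> last w \<noteq> 0)}"

abbreviation word :: "nat list \<Rightarrow> (nat list \<Rightarrow>\<^sub>0 real)" where
  "word w \<equiv> Poly_Mapping.single w 1"

definition equiv0 :: "nat list \<Rightarrow> nat list \<Rightarrow> bool" where
  "equiv0 u v \<longleftrightarrow> filter (\<lambda>a. a \<noteq> 0) u = filter (\<lambda>a. a \<noteq> 0) v"

text \<open>\<^term>\<open>lenlex less_than\<close> compares lengths first and words of equal length lexicographically.\<close>

definition less0 :: "nat list \<Rightarrow> nat list \<Rightarrow> bool" where
  "less0 u v \<longleftrightarrow> (u, v) \<in> lenlex less_than"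


section \<open>Brownian motion and the Ito integral\<close>

definition square_integrable :: "'a measure \<Rightarrow> ('a \<Rightarrow> real) \<Rightarrow> bool" where
  "square_integrable M X \<longleftrightarrow> X \<in> borel_measurable M \<and> integrable M (\<lambda>\<omega>. (X \<omega>)\<^sup>2)"

text \<open>Coordinates are numbered \<open>1, \<dots>, d\<close>, so that they match the letters.\<close>

definition standard_brownian_motion ::
  "'a measure \<Rightarrow> nat \<Rightarrow> real \<Rightarrow> (nat \<Rightarrow> real \<Rightarrow> 'a \<Rightarrow> real) \<Rightarrow> bool" where
  "standard_brownian_motion M d T B \<longleftrightarrow>
     prob_space M \<and>
     (\<forall>i\<in>{1..d}. \<forall>t\<in>{0..T}. B i t \<in> borel_measurable M) \<and>
     (\<forall>i\<in>{1..d}. AE \<omega> in M. B i 0 \<omega> = 0) \<and>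
     (\<forall>i\<in>{1..d}. AE \<omega> in M. continuous_on {0..T} (\<lambda>t. B i t \<omega>)) \<and>
     (\<forall>i\<in>{1..d}. \<forall>s t. 0 \<le> s \<and> s < t \<and> t \<le> T \<longrightarrow>
        distributed M lborel (\<lambda>\<omega>. B i t \<omega> - B i s \<omega>) (normal_density 0 (sqrt (t - s)))) \<and>
     (\<forall>n \<tau>. 0 \<le> \<tau> 0 \<and> (\<forall>k<n. \<tau> k < \<tau> (Suc k)) \<and> \<tau> n \<le> T \<longrightarrow>
        prob_space.indep_vars M (\<lambda>_. borel)
          (\<lambda>(i, k) \<omega>. B i (\<tau> (Suc k)) \<omega> - B i (\<tau> k) \<omega>) ({1..d} \<times> {..<n}))"

definition brownian_filtration ::
  "'a measure \<Rightarrow> nat \<Rightarrow> (nat \<Rightarrow> real \<Rightarrow> 'a \<Rightarrow> real) \<Rightarrow> real \<Rightarrow> 'a measure" where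
  "brownian_filtration M d B t =
     sigma (space M) {B i s -` A \<inter> space M | i s A. i \<in> {1..d} \<and> s \<in> {0..t} \<and> A \<in> sets borel}"

text \<open>A list of triples \<open>(a, b, \<xi>)\<close> stands for the simple process that is the sum of the terms
  \<open>\<xi> 1_{(a, b]}\<close>; the intervals may overlap.\<close>

definition simple_process ::
  "'a measure \<Rightarrow> (real \<Rightarrow> 'a measure) \<Rightarrow> real \<Rightarrow> (real \<times> real \<times> ('a \<Rightarrow> real)) list \<Rightarrow> bool" where
  "simple_process M F t H \<longleftrightarrow>
     (\<forall>(a, b, \<xi>)\<in>set H. 0 \<le> a \<and> a \<le> b \<and> b \<le> t \<and>
        \<xi> \<in> borel_measurable (F a) \<and> square_integrable M \<xi>)"

definition simple_value :: "(real \<times> real \<times> ('a \<Rightarrow> real)) list \<Rightarrow> real \<Rightarrow> 'a \<Rightarrow> real" where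
  "simple_value H s \<omega> = (\<Sum>(a, b, \<xi>)\<leftarrow>H. \<xi> \<omega> * indicator {a<..b} s)"

definition simple_integral ::
  "(real \<Rightarrow> 'a \<Rightarrow> real) \<Rightarrow> (real \<times> real \<times> ('a \<Rightarrow> real)) list \<Rightarrow> 'a \<Rightarrow> real" where
  "simple_integral W H \<omega> = (\<Sum>(a, b, \<xi>)\<leftarrow>H. \<xi> \<omega> * (W b \<omega> - W a \<omega>))"

text \<open>\<open>Z\<close> is (a version of) the Ito integral of \<open>X\<close> with respect to \<open>W\<close> over \<open>[0, t]\<close>.\<close>

definition has_ito_integral ::
  "'a measure \<Rightarrow> (real \<Rightarrow> 'a measure) \<Rightarrow> (real \<Rightarrow> 'a \<Rightarrow> real) \<Rightarrow> (real \<Rightarrow> 'a \<Rightarrow> real) \<Rightarrow> real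
     \<Rightarrow> ('a \<Rightarrow> real) \<Rightarrow> bool" where
  "has_ito_integral M F W X t Z \<longleftrightarrow>
     square_integrable M Z \<and>
     (\<exists>H. (\<forall>n. simple_process M F t (H n)) \<and>
       (\<lambda>n. \<integral>\<^sup>+ s\<in>{0..t}. (\<integral>\<^sup>+ \<omega>. ennreal ((X s \<omega> - simple_value (H n) s \<omega>)\<^sup>2) \<partial>M) \<partial>lborel)
         \<longlonglongrightarrow> 0 \<and>
       (\<lambda>n. \<integral>\<^sup>+ \<omega>. ennreal ((Z \<omega> - simple_integral W (H n) \<omega>)\<^sup>2) \<partial>M) \<longlonglongrightarrow> 0)"

text \<open>The Ito integral process on \<open>[0, T]\<close>: a version with continuous paths, which is unique up to
  indistinguishability. All paths can be taken continuous, since adaptedness to the (not completed)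
  filtration is not required: integrands only enter through their \<open>L\<^sup>2\<close> class.\<close>

definition ito_integral ::
  "'a measure \<Rightarrow> (real \<Rightarrow> 'a measure) \<Rightarrow> real \<Rightarrow> (real \<Rightarrow> 'a \<Rightarrow> real) \<Rightarrow> (real \<Rightarrow> 'a \<Rightarrow> real)
     \<Rightarrow> real \<Rightarrow> 'a \<Rightarrow> real" where
  "ito_integral M F T W X =
     (SOME Z. (\<forall>\<omega>\<in>space M. continuous_on {0..T} (\<lambda>t. Z t \<omega>)) \<and>
              (\<forall>t\<in>{0..T}. has_ito_integral M F W X t (Z t)))"


section \<open>Ito signature and the induced inner product\<close>

text \<open>The argument is the reversed word: the last letter belongs to the outermost integral.\<close>

primrec ito_iterated ::
  "'a measure \<Rightarrow> nat \<Rightarrow> real \<Rightarrow> (nat \<Rightarrow> real \<Rightarrow> 'a \<Rightarrow> real) \<Rightarrow> nat list \<Rightarrow> real \<Rightarrow> 'a \<Rightarrow> real" where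
  "ito_iterated M d T B [] = (\<lambda>t \<omega>. 1)"
| "ito_iterated M d T B (a # w) =
     (if a = 0 then (\<lambda>t \<omega>. integral {0..t} (\<lambda>s. ito_iterated M d T B w s \<omega>))
      else ito_integral M (brownian_filtration M d B) T (B a) (ito_iterated M d T B w))"

definition ito_signature ::
  "'a measure \<Rightarrow> nat \<Rightarrow> real \<Rightarrow> (nat \<Rightarrow> real \<Rightarrow> 'a \<Rightarrow> real) \<Rightarrow> (nat list \<Rightarrow>\<^sub>0 real) \<Rightarrow> 'a \<Rightarrow> real" where
  "ito_signature M d T B p \<omega> = lin_ext (\<lambda>w. ito_iterated M d T B (rev w) T \<omega>) p"

definition sig_inner ::
  "'a measure \<Rightarrow> nat \<Rightarrow> real \<Rightarrow> (nat \<Rightarrow> real \<Rightarrow> 'a \<Rightarrow> real)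
     \<Rightarrow> (nat list \<Rightarrow>\<^sub>0 real) \<Rightarrow> (nat list \<Rightarrow>\<^sub>0 real) \<Rightarrow> real" where
  "sig_inner M d T B u v = (\<integral>\<omega>. ito_signature M d T B u \<omega> * ito_signature M d T B v \<omega> \<partial>M)"


section \<open>Orthogonalisation\<close>

function phat ::
  "'a measure \<Rightarrow> nat \<Rightarrow> real \<Rightarrow> (nat \<Rightarrow> real \<Rightarrow> 'a \<Rightarrow> real) \<Rightarrow> nat list \<Rightarrow> (nat list \<Rightarrow>\<^sub>0 real)" where
  "phat M d T B w = word w -
     (\<Sum>v\<in>{v\<in>words0 d. equiv0 v w \<and> less0 v w}.
        (sig_inner M d T B (word w) (phat M d T B v) /
         sig_inner M d T B (phat M d T B v) (phat M d T B v)) *\<^sub>R phat M d T B v)"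
  by pat_completeness auto
termination
  by (relation "inv_image (lenlex less_than) (\<lambda>(M, d, T, B, w). w)")
    (auto simp: less0_def intro: wf_lenlex)

declare phat.simps [simp del]

definition chaos_summand ::
  "'a measure \<Rightarrow> nat \<Rightarrow> real \<Rightarrow> (nat \<Rightarrow> real \<Rightarrow> 'a \<Rightarrow> real) \<Rightarrow> ('a \<Rightarrow> real) \<Rightarrow> nat list
     \<Rightarrow> 'a \<Rightarrow> real" where
  "chaos_summand M d T B Y w \<omega> =
     (\<integral>\<omega>'. Y \<omega>' * ito_signature M d T B (phat M d T B w) \<omega>' \<partial>M) /
       sig_inner M d T B (phat M d T B w) (phat M d T B w)
     * ito_signature M d T B (phat M d T B w) \<omega>"


section \<open>The functor\<close>

text \<open>A finite-dimensional Euclidean space is given as a subspace \<open>V\<close> of a type of class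
  \<^class>\<open>euclidean_space\<close>; unlike the type itself, it may be zero-dimensional.\<close>

definition orthonormal_basis ::
  "'v::euclidean_space set \<Rightarrow> nat \<Rightarrow> (nat \<Rightarrow> 'v) \<Rightarrow> bool" where
  "orthonormal_basis V d f \<longleftrightarrow>
     (\<forall>i\<in>{1..d}. \<forall>j\<in>{1..d}. f i \<bullet> f j = (if i = j then 1 else 0)) \<and> span (f ` {1..d}) = V"

definition letter :: "(nat \<Rightarrow> 'v::euclidean_space) \<Rightarrow> nat \<Rightarrow> real \<times> 'v" where
  "letter f a = (if a = 0 then (1, 0) else (0, f a))"

definition realise :: "(nat \<Rightarrow> 'v::euclidean_space) \<Rightarrow> (nat list \<Rightarrow>\<^sub>0 real) \<Rightarrow> (real \<times> 'v) tensor_alg" where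
  "realise f = lin_ext (\<lambda>w. tensor (map (letter f) w))"

definition sh_circ :: "nat \<Rightarrow> (nat \<Rightarrow> 'v::euclidean_space) \<Rightarrow> (real \<times> 'v) tensor_alg set" where
  "sh_circ d f = span ((\<lambda>w. realise f (word w)) ` words0 d)"

text \<open>The linear map sending every word \<open>w\<close> of \<^const>\<open>words0\<close> to \<open>p_w\<close>, both read in the
  orthonormal basis \<open>f\<close>; it is determined on \<^term>\<open>sh_circ d f\<close> only. The Brownian motion enters
  through its law alone, so \<open>B\<close> can be any standard \<open>d\<close>-dimensional one, taken in coordinates.\<close>

definition phat_map ::
  "'a measure \<Rightarrow> nat \<Rightarrow> real \<Rightarrow> (nat \<Rightarrow> real \<Rightarrow> 'a \<Rightarrow> real) \<Rightarrow> (nat \<Rightarrow> 'v::euclidean_space)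
     \<Rightarrow> (real \<times> 'v) tensor_alg \<Rightarrow> (real \<times> 'v) tensor_alg" where
  "phat_map M d T B f =
     (SOME P. linear P \<and> (\<forall>w\<in>words0 d. P (realise f (word w)) = realise f (phat M d T B w)))"

text \<open>\<open>T(id \<oplus> \<phi>)\<close>; to be restricted to \<^const>\<open>sh_circ\<close>.\<close>

definition sh_map ::
  "('u::euclidean_space \<Rightarrow> 'v::euclidean_space) \<Rightarrow> (real \<times> 'u) tensor_alg \<Rightarrow> (real \<times> 'v) tensor_alg" where
  "sh_map \<phi> = tensor_map (map_prod id \<phi>)"

end

theory Submission
  imports Defs
begin

text \<open>
  The closed linear span \<open>K\<close> of the processes \<open>t \<mapsto> \<langle>w, S(t)\<rangle>\<close>, with \<open>w\<close> ranging over all words, is stable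
  under integration with respect to time and, by the Ito isometry, to \<open>B\<close>; integration by parts shows
  that it is also stable under multiplication by continuous functions of time, hence by step functions.
  For deterministic step functions \<open>\<theta>\<close>, the exponential martingale \<open>Z\<close> of \<open>\<integral> \<theta> dB\<close> solves
  \<open>dZ = i \<theta> Z dB\<close>, so by Picard iteration its real and imaginary parts belong to \<open>K\<close>. The equation also
  exhibits \<open>Z(T)\<close> as a constant plus stochastic integrals of processes in \<open>K\<close>, that is, as a limit of
  linear combinations of \<open>\<langle>w, S(T)\<rangle>\<close> with \<open>w\<close> not ending in \<open>0\<close>. A square-integrable functional of the
  Brownian path orthogonal to all these vanishes, as its cosine moments against the vectors
  \<open>(B(t\<^sub>1), \<dots>, B(t\<^sub>n))\<close> do. Words with different nonzero letters are orthogonal, so Gram--Schmidt within the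
  classes yields a total orthogonal family.

  Inner products and the order within a class depend on the positions of the zeros only. The
  coefficients of \<open>p_w\<close> therefore do not depend on the nonzero letters, and naturality follows by
  multilinearity.\<close>

section \<open>Square-integrable functions\<close>

text \<open>The Ito integral is a chosen version, so linearity and every identity between stochastic
  integrals hold up to null sets only; hence the many statements of the form
  \<open>l2d ... = 0\<close>. The two identities that Ito's formula would supply, the product rule
  for time with a stochastic integral and the equation of the exponential, are proved by expanding
  the squared norm of a residual into inner products that the isometry computes. For the exponential
  this requires its covariance with every stochastic integral, which is found from Gaussian moments
  on the intervals where \<theta> is constant.

  Real numbers suffice because a phase \<phi> is carried along: \<phi> and \<phi> - pi/2 give the
  real and the imaginary part, and a second shift by pi/2 changes the sign.

  Multiplication by time has to be produced from the letter 0: s X(s) is the integral of u dX(u)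
  plus the integral of X(u) du. It is needed because the integrands of the exponential carry the
  factor \<theta>, while words alone carry none.\<close>

definition l2d :: "'a measure \<Rightarrow> ('a \<Rightarrow> real) \<Rightarrow> ('a \<Rightarrow> real) \<Rightarrow> real" where
  "l2d N f g = (\<integral>x. (f x - g x)\<^sup>2 \<partial>N)"

lemma sqi_measurable [measurable_dest]: "square_integrable N f \<Longrightarrow> f \<in> borel_measurable N"
  by (simp add: square_integrable_def)

lemma sqi_integrable_sq: "square_integrable N f \<Longrightarrow> integrable N (\<lambda>x. (f x)\<^sup>2)"
  by (simp add: square_integrable_def)

lemma sqi_mult:
  assumes "square_integrable N f" "square_integrable N g"
  shows "integrable N (\<lambda>x. f x * g x)"
proof (rule Bochner_Integration.integrable_bound[where f = "\<lambda>x. (f x)\<^sup>2 + (g x)\<^sup>2"])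
  have [measurable]: "f \<in> borel_measurable N" "g \<in> borel_measurable N"
    using assms by (auto simp: square_integrable_def)
  show "integrable N (\<lambda>x. (f x)\<^sup>2 + (g x)\<^sup>2)"
    using assms by (simp add: square_integrable_def)
  show "(\<lambda>x. f x * g x) \<in> borel_measurable N" by measurable
  show "AE x in N. norm (f x * g x) \<le> norm ((f x)\<^sup>2 + (g x)\<^sup>2)"
  proof (rule AE_I2)
    fix x
    have "2 * (\<bar>f x\<bar> * \<bar>g x\<bar>) \<le> (f x)\<^sup>2 + (g x)\<^sup>2"
      using sum_squares_bound[of "\<bar>f x\<bar>" "\<bar>g x\<bar>"] by (simp add: mult.assoc)
    moreover have "0 \<le> \<bar>f x\<bar> * \<bar>g x\<bar>" by simp
    ultimately show "norm (f x * g x) \<le> norm ((f x)\<^sup>2 + (g x)\<^sup>2)"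
      unfolding real_norm_def abs_mult by linarith
  qed
qed

lemma sqi_add:
  assumes "square_integrable N f" "square_integrable N g"
  shows "square_integrable N (\<lambda>x. f x + g x)"
proof -
  have [measurable]: "f \<in> borel_measurable N" "g \<in> borel_measurable N"
    using assms by (auto simp: square_integrable_def)
  have "integrable N (\<lambda>x. (f x)\<^sup>2 + (g x)\<^sup>2 + 2 * (f x * g x))"
    using assms sqi_mult[OF assms] by (simp add: square_integrable_def)
  then show ?thesis
    by (simp add: square_integrable_def power2_sum mult.assoc)
qed

lemma sqi_scale: "square_integrable N f \<Longrightarrow> square_integrable N (\<lambda>x. c * f x)" for c :: real
  by (auto simp: square_integrable_def power_mult_distrib)

lemma sqi_zero [simp]: "square_integrable N (\<lambda>x. 0)"
  by (simp add: square_integrable_def)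

lemma sqi_diff:
  "square_integrable N f \<Longrightarrow> square_integrable N g \<Longrightarrow> square_integrable N (\<lambda>x. f x - g x)"
  using sqi_add[of N f "\<lambda>x. (- 1) * g x"] sqi_scale[of N g "- 1"] by simp

lemma sqi_sum:
  "(\<And>i. i \<in> I \<Longrightarrow> square_integrable N (f i)) \<Longrightarrow> square_integrable N (\<lambda>x. \<Sum>i\<in>I. f i x)"
  by (induction I rule: infinite_finite_induct) (auto intro: sqi_add)

lemma sqi_sum_list:
  "(\<And>i. i \<in> set I \<Longrightarrow> square_integrable N (f i)) \<Longrightarrow> square_integrable N (\<lambda>x. \<Sum>i\<leftarrow>I. f i x)"
  by (induction I) (auto intro: sqi_add)

lemma sqi_AE_cong:
  assumes "square_integrable N f" "g \<in> borel_measurable N" "AE x in N. f x = g x"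
  shows "square_integrable N g"
proof -
  have [measurable]: "f \<in> borel_measurable N" "g \<in> borel_measurable N"
    using assms by (auto simp: square_integrable_def)
  have "integrable N (\<lambda>x. (g x)\<^sup>2) \<longleftrightarrow> integrable N (\<lambda>x. (f x)\<^sup>2)"
    by (rule integrable_cong_AE) (use assms(3) in auto)
  then show ?thesis using assms by (simp add: square_integrable_def)
qed

lemma (in finite_measure) sqi_const [simp]: "square_integrable M (\<lambda>x. c)"
  by (simp add: square_integrable_def)

lemma (in finite_measure) sqi_bounded:
  assumes "f \<in> borel_measurable M" "\<And>x. \<bar>f x\<bar> \<le> c"
  shows "square_integrable M f"
proof -
  have "(f x)\<^sup>2 \<le> c\<^sup>2" for x using power_mono[OF assms(2)[of x], of 2] by simp
  then have "integrable M (\<lambda>x. (f x)\<^sup>2)"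
    using assms(1) by (intro integrable_const_bound[where B = "c\<^sup>2"]) auto
  then show ?thesis using assms(1) by (simp add: square_integrable_def)
qed

lemma (in finite_measure) sqi_integrable:
  assumes "square_integrable M f"
  shows "integrable M f"
  using sqi_mult[OF assms sqi_const[of 1]] by simp

lemma sqi_mult_bounded:
  assumes "square_integrable N f" "g \<in> borel_measurable N" "\<And>x. \<bar>g x\<bar> \<le> c"
  shows "square_integrable N (\<lambda>x. g x * f x)"
proof -
  have [measurable]: "f \<in> borel_measurable N" "g \<in> borel_measurable N"
    using assms by (auto simp: square_integrable_def)
  have "integrable N (\<lambda>x. (g x * f x)\<^sup>2)"
  proof (rule Bochner_Integration.integrable_bound[where f = "\<lambda>x. c\<^sup>2 * (f x)\<^sup>2"])
    show "integrable N (\<lambda>x. c\<^sup>2 * (f x)\<^sup>2)"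
      using assms(1) by (simp add: square_integrable_def)
    have "(g x)\<^sup>2 \<le> c\<^sup>2" for x using power_mono[OF assms(3)[of x], of 2] by simp
    then show "AE x in N. norm ((g x * f x)\<^sup>2) \<le> norm (c\<^sup>2 * (f x)\<^sup>2)"
      by (auto simp: power_mult_distrib intro!: mult_right_mono)
  qed measurable
  then show ?thesis by (simp add: square_integrable_def)
qed

lemma sqi_Cauchy_Schwarz:
  assumes f: "square_integrable N f" and g: "square_integrable N g"
  shows "(\<integral>x. f x * g x \<partial>N)\<^sup>2 \<le> (\<integral>x. (f x)\<^sup>2 \<partial>N) * (\<integral>x. (g x)\<^sup>2 \<partial>N)"
proof -
  let ?a = "\<integral>x. (f x)\<^sup>2 \<partial>N" and ?b = "\<integral>x. f x * g x \<partial>N" and ?c = "\<integral>x. (g x)\<^sup>2 \<partial>N"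
  note [simp] = sqi_integrable_sq[OF f] sqi_integrable_sq[OF g] sqi_mult[OF f g]
  have q: "0 \<le> s\<^sup>2 * ?a - 2 * s * t * ?b + t\<^sup>2 * ?c" for s t
  proof -
    have "0 \<le> (\<integral>x. (s * f x - t * g x)\<^sup>2 \<partial>N)" by simp
    also have "\<dots> = (\<integral>x. s\<^sup>2 * (f x)\<^sup>2 - 2 * s * t * (f x * g x) + t\<^sup>2 * (g x)\<^sup>2 \<partial>N)"
      by (rule Bochner_Integration.integral_cong) (auto simp: power2_eq_square algebra_simps)
    also have "\<dots> = s\<^sup>2 * ?a - 2 * s * t * ?b + t\<^sup>2 * ?c" by simp
    finally show ?thesis .
  qed
  have a: "0 \<le> ?a" and c: "0 \<le> ?c" by simp_all
  show ?thesis
  proof (cases "?c = 0")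
    case False
    \<comment> \<open>The form at s = c, t = b equals c (c a - b^2).\<close>
    have "0 \<le> ?c * (?c * ?a - ?b\<^sup>2)"
      using q[of ?c ?b] by (simp add: power2_eq_square algebra_simps)
    then have "?c * 0 \<le> ?c * (?c * ?a - ?b\<^sup>2)" by simp
    moreover have "0 < ?c" using False c by linarith
    ultimately have "0 \<le> ?c * ?a - ?b\<^sup>2" by (simp only: mult_le_cancel_left_pos)
    then show ?thesis by (simp add: mult.commute)
  next
    case True
    have "?b = 0"
    proof (rule ccontr)
      assume b: "?b \<noteq> 0"
      \<comment> \<open>For c = 0 the form is affine in t, and this t gives it the value - a -
        2.\<close>
      have "0 \<le> ?a - 2 * ((?a + 1) / ?b) * ?b" using q[of 1 "(?a + 1) / ?b"] True by simp
      also have "\<dots> = - ?a - 2" using b by simp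
      finally show False using a by simp
    qed
    then show ?thesis by simp
  qed
qed

lemma l2d_nonneg [simp]: "0 \<le> l2d N f g"
  by (simp add: l2d_def)

lemma l2d_self [simp]: "l2d N f f = 0"
  by (simp add: l2d_def)

lemma l2d_commute: "l2d N f g = l2d N g f"
  by (simp add: l2d_def power2_commute)

text \<open>\<open>l2d\<close> is the square of a distance, so the triangle inequality carries the
  factor 2 from (a + b)^2 \<le> 2 a^2 + 2 b^2.\<close>

lemma l2d_triangle:
  assumes f: "square_integrable N f" and g: "square_integrable N g" and h: "square_integrable N h"
  shows "l2d N f h \<le> 2 * l2d N f g + 2 * l2d N g h"
proof -
  have [simp]: "integrable N (\<lambda>x. (f x - h x)\<^sup>2)" "integrable N (\<lambda>x. (f x - g x)\<^sup>2)"
    "integrable N (\<lambda>x. (g x - h x)\<^sup>2)"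
    using assms by (auto intro: sqi_integrable_sq sqi_diff)
  have "l2d N f h \<le> (\<integral>x. 2 * (f x - g x)\<^sup>2 + 2 * (g x - h x)\<^sup>2 \<partial>N)"
    unfolding l2d_def
  proof (rule integral_mono)
    fix x
    have "0 \<le> (f x - g x - (g x - h x))\<^sup>2" by simp
    then show "(f x - h x)\<^sup>2 \<le> 2 * (f x - g x)\<^sup>2 + 2 * (g x - h x)\<^sup>2"
      by (simp add: power2_eq_square algebra_simps)
  qed simp_all
  then show ?thesis by (simp add: l2d_def)
qed

lemma l2d_add:
  assumes f: "square_integrable N f" and g: "square_integrable N g"
    and f': "square_integrable N f'" and g': "square_integrable N g'"
  shows "l2d N (\<lambda>x. f x + g x) (\<lambda>x. f' x + g' x) \<le> 2 * l2d N f f' + 2 * l2d N g g'"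
  using l2d_triangle[OF sqi_add[OF f g] sqi_add[OF f' g] sqi_add[OF f' g']]
  by (simp add: l2d_def)

lemma l2d_scale: "l2d N (\<lambda>x. c * f x) (\<lambda>x. c * g x) = c\<^sup>2 * l2d N f g"
  by (simp add: l2d_def power_mult_distrib flip: right_diff_distrib)

lemma l2d_AE_cong:
  assumes "square_integrable N f" "square_integrable N f'" "square_integrable N g"
    "square_integrable N g'" "AE x in N. f x = f' x" "AE x in N. g x = g' x"
  shows "l2d N f g = l2d N f' g'"
proof -
  note [measurable] = assms(1-4)[THEN sqi_measurable]
  show ?thesis unfolding l2d_def
    by (rule integral_cong_AE) (use assms(5,6) in auto)
qed

lemma l2d_eq_0_iff_AE:
  assumes "square_integrable N f" "square_integrable N g"
  shows "l2d N f g = 0 \<longleftrightarrow> (AE x in N. f x = g x)"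
  unfolding l2d_def
  by (subst integral_nonneg_eq_0_iff_AE) (auto intro!: sqi_integrable_sq sqi_diff assms)

section \<open>Convergence and completeness in L2\<close>

lemma sqi_iff_nn:
  "square_integrable N f \<longleftrightarrow> f \<in> borel_measurable N \<and> (\<integral>\<^sup>+x. ennreal ((f x)\<^sup>2) \<partial>N) < \<infinity>"
  by (auto simp: square_integrable_def integrable_iff_bounded)

lemma l2d_nn:
  assumes "square_integrable N f" "square_integrable N g"
  shows "(\<integral>\<^sup>+x. ennreal ((f x - g x)\<^sup>2) \<partial>N) = ennreal (l2d N f g)"
  unfolding l2d_def by (rule nn_integral_eq_integral) (auto intro!: sqi_integrable_sq sqi_diff assms)

lemma tendsto_ennreal_0_iff:
  assumes "\<And>n. 0 \<le> f n"
  shows "(\<lambda>n. ennreal (f n)) \<longlonglongrightarrow> 0 \<longleftrightarrow> f \<longlonglongrightarrow> 0"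
  using tendsto_ennreal_iff[of f sequentially 0] assms by simp

lemma l2d_tendsto_nn_iff:
  assumes "\<And>n. square_integrable N (f n)" "square_integrable N g"
  shows "(\<lambda>n. \<integral>\<^sup>+x. ennreal ((f n x - g x)\<^sup>2) \<partial>N) \<longlonglongrightarrow> 0 \<longleftrightarrow> (\<lambda>n. l2d N (f n) g) \<longlonglongrightarrow> 0"
  by (simp add: l2d_nn[OF assms] tendsto_ennreal_0_iff)

lemma inner_tendsto:
  assumes f: "\<And>n. square_integrable N (f n)" "square_integrable N f'"
    and g: "\<And>n. square_integrable N (g n)" "square_integrable N g'"
    and fl: "(\<lambda>n. l2d N (f n) f') \<longlonglongrightarrow> 0" and gl: "(\<lambda>n. l2d N (g n) g') \<longlonglongrightarrow> 0"
  shows "(\<lambda>n. \<integral>x. f n x * g n x \<partial>N) \<longlonglongrightarrow> (\<integral>x. f' x * g' x \<partial>N)"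
proof -
  have CS: "\<bar>\<integral>x. u x * v x \<partial>N\<bar> \<le> sqrt ((\<integral>x. (u x)\<^sup>2 \<partial>N) * (\<integral>x. (v x)\<^sup>2 \<partial>N))"
    if "square_integrable N u" "square_integrable N v" for u v
    using real_sqrt_le_mono[OF sqi_Cauchy_Schwarz[OF that]] by simp
  \<comment> \<open>Cauchy--Schwarz for the three terms of f g - f' g' = (f - f') (g - g') + (f -
    f') g' + f' (g - g').\<close>
  let ?e = "\<lambda>n. sqrt (l2d N (f n) f' * l2d N (g n) g') + sqrt (l2d N (f n) f' * (\<integral>x. (g' x)\<^sup>2 \<partial>N))
     + sqrt ((\<integral>x. (f' x)\<^sup>2 \<partial>N) * l2d N (g n) g')"
  have "?e \<longlonglongrightarrow> sqrt (0 * 0) + sqrt (0 * (\<integral>x. (g' x)\<^sup>2 \<partial>N)) + sqrt ((\<integral>x. (f' x)\<^sup>2 \<partial>N) * 0)"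
    by (intro tendsto_intros fl gl)
  then have e0: "?e \<longlonglongrightarrow> 0" by simp
  show ?thesis
  proof (rule LIM_zero_cancel, rule Lim_null_comparison[OF _ e0], rule always_eventually, rule allI)
    fix n
    have i: "integrable N (\<lambda>x. (f n x - f' x) * (g n x - g' x))"
      "integrable N (\<lambda>x. (f n x - f' x) * g' x)" "integrable N (\<lambda>x. f' x * (g n x - g' x))"
      "integrable N (\<lambda>x. f n x * g n x)" "integrable N (\<lambda>x. f' x * g' x)"
      by (intro sqi_mult sqi_diff f g)+
    have "(\<integral>x. f n x * g n x \<partial>N) - (\<integral>x. f' x * g' x \<partial>N)
       = (\<integral>x. f n x * g n x - f' x * g' x \<partial>N)" using i by simp
    also have "\<dots> = (\<integral>x. (f n x - f' x) * (g n x - g' x) + (f n x - f' x) * g' x + f' x * (g n x - g' x) \<partial>N)"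
      by (rule Bochner_Integration.integral_cong) (auto simp: algebra_simps)
    also have "\<dots> = (\<integral>x. (f n x - f' x) * (g n x - g' x) \<partial>N) + (\<integral>x. (f n x - f' x) * g' x \<partial>N)
        + (\<integral>x. f' x * (g n x - g' x) \<partial>N)" using i by simp
    finally show "norm ((\<integral>x. f n x * g n x \<partial>N) - (\<integral>x. f' x * g' x \<partial>N)) \<le> ?e n"
      using CS[OF sqi_diff[OF f(1)[of n] f(2)] sqi_diff[OF g(1)[of n] g(2)]]
        CS[OF sqi_diff[OF f(1)[of n] f(2)] g(2)] CS[OF f(2) sqi_diff[OF g(1)[of n] g(2)]]
      unfolding l2d_def by (simp del: real_sqrt_mult) 
  qed
qed

lemma inner_tendsto_left:
  assumes f: "\<And>n. square_integrable N (f n)" "square_integrable N f'" and g: "square_integrable N g"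
    and fl: "(\<lambda>n. l2d N (f n) f') \<longlonglongrightarrow> 0"
  shows "(\<lambda>n. \<integral>x. f n x * g x \<partial>N) \<longlonglongrightarrow> (\<integral>x. f' x * g x \<partial>N)"
  using inner_tendsto[OF f g g fl] by simp

text \<open>Fatou's lemma: the Cauchy bound for \<open>f n - f (r k)\<close> survives the limit in
  k. The candidate \<open>g\<close> is given in advance because for stochastic integrals it is a
  pathwise limit that has to be recognised as the limit in L2.\<close>

lemma l2d_limit_of_AE_limit:
  assumes f: "\<And>n. square_integrable N (f n)" and g: "g \<in> borel_measurable N"
    and r: "strict_mono r" and AE: "AE x in N. (\<lambda>n. f (r n) x) \<longlonglongrightarrow> g x"
    and Cauchy: "\<And>e. 0 < e \<Longrightarrow> \<exists>K. \<forall>m\<ge>K. \<forall>n\<ge>K. l2d N (f m) (f n) < e"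
  shows "square_integrable N g" "(\<lambda>n. l2d N (f n) g) \<longlonglongrightarrow> 0"
proof -
  note [measurable] = f[THEN sqi_measurable] g
  have fatou: "(\<integral>\<^sup>+x. ennreal ((f n x - g x)\<^sup>2) \<partial>N) \<le> ennreal e"
    if K: "\<forall>m\<ge>K. l2d N (f n) (f m) < e" for n e K
  proof -
    have "(\<integral>\<^sup>+x. ennreal ((f n x - g x)\<^sup>2) \<partial>N)
        = (\<integral>\<^sup>+x. liminf (\<lambda>k. ennreal ((f n x - f (r k) x)\<^sup>2)) \<partial>N)"
    proof (rule nn_integral_cong_AE, use AE in eventually_elim)
      fix x assume "(\<lambda>n. f (r n) x) \<longlonglongrightarrow> g x"
      then have "(\<lambda>k. ennreal ((f n x - f (r k) x)\<^sup>2)) \<longlonglongrightarrow> ennreal ((f n x - g x)\<^sup>2)"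
        by (intro tendsto_intros)
      then show "ennreal ((f n x - g x)\<^sup>2) = liminf (\<lambda>k. ennreal ((f n x - f (r k) x)\<^sup>2))"
        using lim_imp_Liminf[of sequentially] by fastforce
    qed
    also have "\<dots> \<le> liminf (\<lambda>k. \<integral>\<^sup>+x. ennreal ((f n x - f (r k) x)\<^sup>2) \<partial>N)"
      by (rule nn_integral_liminf) simp
    also have "\<dots> = liminf (\<lambda>k. ennreal (l2d N (f n) (f (r k))))"
      by (simp add: l2d_nn f)
    also have "\<dots> \<le> ennreal e"
    proof (rule Liminf_le)
      show "\<forall>\<^sub>F k in sequentially. ennreal (l2d N (f n) (f (r k))) \<le> ennreal e"
        using K by (intro eventually_sequentiallyI[of K] ennreal_leI less_imp_le)
          (meson le_trans r seq_suble)
    qed simp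
    finally show ?thesis .
  qed
  obtain K where K: "\<forall>m\<ge>K. \<forall>n\<ge>K. l2d N (f m) (f n) < 1" using Cauchy[of 1] by auto
  have "(\<integral>\<^sup>+x. ennreal ((f K x - g x)\<^sup>2) \<partial>N) \<le> ennreal 1"
    by (rule fatou[where K = K]) (use K in auto)
  then have "square_integrable N (\<lambda>x. f K x - g x)"
    by (auto simp: sqi_iff_nn intro: le_less_trans)
  from sqi_diff[OF f[of K] this] show sg: "square_integrable N g" by simp
  show "(\<lambda>n. l2d N (f n) g) \<longlonglongrightarrow> 0"
  proof (rule LIMSEQ_I)
    fix e :: real assume e: "0 < e"
    obtain K where K: "\<forall>m\<ge>K. \<forall>n\<ge>K. l2d N (f m) (f n) < e / 2" using Cauchy[of "e / 2"] e by auto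
    have "l2d N (f n) g \<le> e / 2" if "n \<ge> K" for n
    proof -
      have "ennreal (l2d N (f n) g) \<le> ennreal (e / 2)"
        unfolding l2d_nn[OF f sg, symmetric] by (rule fatou[where K = K]) (use K that in auto)
      then show ?thesis using e by (simp add: ennreal_le_iff)
    qed
    then show "\<exists>no. \<forall>n\<ge>no. norm (l2d N (f n) g - 0) < e"
      using e by (intro exI[of _ K]) fastforce
  qed
qed

lemma (in prob_space) l2_abs_expectation:
  assumes "square_integrable M f"
  shows "(\<integral>x. \<bar>f x\<bar> \<partial>M) \<le> sqrt (\<integral>x. (f x)\<^sup>2 \<partial>M)"
proof -
  have [measurable]: "f \<in> borel_measurable M" using assms by (rule sqi_measurable)
  have "square_integrable M (\<lambda>x. \<bar>f x\<bar>)"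
    using assms by (simp add: square_integrable_def)
  from sqi_Cauchy_Schwarz[OF this sqi_const[of 1]]
  have "(\<integral>x. \<bar>f x\<bar> \<partial>M)\<^sup>2 \<le> (\<integral>x. (f x)\<^sup>2 \<partial>M)" by (simp add: prob_space)
  then show ?thesis by (rule real_le_rsqrt)
qed

text \<open>Along a subsequence whose successive squared distances are below (1/4)^k the increments
  have L1 norm at most (1/2)^k. They are summable almost everywhere, so the subsequence converges
  there.\<close>

lemma (in prob_space) l2_complete:
  assumes f: "\<And>n. square_integrable M (f n)"
    and Cauchy: "\<And>e. 0 < e \<Longrightarrow> \<exists>K. \<forall>m\<ge>K. \<forall>n\<ge>K. l2d M (f m) (f n) < e"
  obtains g where "square_integrable M g" "(\<lambda>n. l2d M (f n) g) \<longlonglongrightarrow> 0"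
proof -
  note [measurable] = f[THEN sqi_measurable]
  have "\<exists>K. \<forall>m\<ge>K. \<forall>n\<ge>K. l2d M (f m) (f n) < (1/4)^k" for k :: nat
    using Cauchy[of "(1/4)^k"] by simp
  then have "\<exists>K. \<forall>k. \<forall>m\<ge>K k. \<forall>n\<ge>K k. l2d M (f m) (f n) < (1/4)^k" by (intro choice allI)
  then obtain K where K: "\<And>k m n. m \<ge> K k \<Longrightarrow> n \<ge> K k \<Longrightarrow> l2d M (f m) (f n) < (1/4)^k"
    by blast
  \<comment> \<open>Strictly increasing because of the summand \<open>k\<close>, and at least
    \<open>K i\<close> for every i \<le> k because of the sum.\<close>
  define r where "r k = (\<Sum>j\<le>k. K j) + k" for k
  have "strict_mono r"
    by (rule strict_monoI_Suc) (simp add: r_def)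
  have rK: "r j \<ge> K k" if "k \<le> j" for j k
    using member_le_sum[of k "{..j}" K] that by (simp add: r_def)
  let ?D = "\<lambda>k x. \<bar>f (r (Suc k)) x - f (r k) x\<bar>"
  have D: "(\<integral>\<^sup>+x. ennreal (?D k x) \<partial>M) \<le> ennreal ((1/2)^k)" for k
  proof -
    have s: "square_integrable M (\<lambda>x. f (r (Suc k)) x - f (r k) x)" by (intro sqi_diff f)
    have "(\<integral>\<^sup>+x. ennreal (?D k x) \<partial>M) = ennreal (\<integral>x. ?D k x \<partial>M)"
      by (rule nn_integral_eq_integral) (use sqi_integrable[OF s] in auto)
    also have "(\<integral>x. ?D k x \<partial>M) \<le> sqrt (l2d M (f (r (Suc k))) (f (r k)))"
      using l2_abs_expectation[OF s] by (simp add: l2d_def)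
    also have "\<dots> \<le> sqrt ((1/4)^k)"
      using K[OF rK[of k "Suc k"] rK[of k k]] by simp
    also have "\<dots> = (1/2)^k"
      by (simp add: real_sqrt_power real_sqrt_divide)
    finally show ?thesis by (simp add: ennreal_leI)
  qed
  have "(\<integral>\<^sup>+x. (suminf (\<lambda>k. ennreal (?D k x))) \<partial>M) = (suminf (\<lambda>k. \<integral>\<^sup>+x. ennreal (?D k x) \<partial>M))"
    by (rule nn_integral_suminf) simp
  also have "\<dots> \<le> (suminf (\<lambda>k. ennreal ((1/2)^k)))"
    by (intro suminf_le D) auto
  also have "\<dots> = ennreal (suminf (\<lambda>k. (1/2)^k))"
    by (rule suminf_ennreal2) (simp_all add: summable_geometric)
  also have "\<dots> < \<infinity>" by simp
  finally have "AE x in M. (suminf (\<lambda>k. ennreal (?D k x))) \<noteq> \<infinity>"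
    by (intro nn_integral_PInf_AE) auto
  then have AE: "AE x in M. convergent (\<lambda>k. f (r k) x)"
  proof eventually_elim
    fix x assume "(suminf (\<lambda>k. ennreal (?D k x))) \<noteq> \<infinity>"
    then have "summable (\<lambda>k. ?D k x)"
      by (intro summable_suminf_not_top) auto
    then have "summable (\<lambda>k. f (r (Suc k)) x - f (r k) x)"
      by (rule summable_rabs_cancel)
    then have "convergent (\<lambda>n. \<Sum>k<n. f (r (Suc k)) x - f (r k) x)"
      by (simp only: summable_iff_convergent)
    then have "convergent (\<lambda>n. f (r n) x - f (r 0) x)"
      by (simp only: sum_lessThan_telescope[of "\<lambda>k. f (r k) x"])
    then have "convergent (\<lambda>n. (f (r n) x - f (r 0) x) + f (r 0) x)"
      by (rule convergent_add) (rule convergent_const)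
    then show "convergent (\<lambda>k. f (r k) x)" by simp
  qed
  define g where "g x = lim (\<lambda>k. f (r k) x)" for x
  have [measurable]: "g \<in> borel_measurable M" unfolding g_def by measurable
  have "AE x in M. (\<lambda>k. f (r k) x) \<longlonglongrightarrow> g x"
    using AE by eventually_elim (simp add: g_def convergent_LIMSEQ_iff)
  from l2d_limit_of_AE_limit[OF f _ \<open>strict_mono r\<close> this Cauchy] that show ?thesis by auto
qed

text \<open>Closed linear spans in \<open>L\<^sup>2\<close>. The inductive definition provides the rule that a linear and
  closed property holds on the span once it holds for the generators.\<close>

inductive_set L2cl :: "'a measure \<Rightarrow> ('a \<Rightarrow> real) set \<Rightarrow> ('a \<Rightarrow> real) set" for N S where
  base: "f \<in> S \<Longrightarrow> square_integrable N f \<Longrightarrow> f \<in> L2cl N S"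
| zero: "(\<lambda>x. 0) \<in> L2cl N S"
| add: "f \<in> L2cl N S \<Longrightarrow> g \<in> L2cl N S \<Longrightarrow> (\<lambda>x. f x + g x) \<in> L2cl N S"
| scale: "f \<in> L2cl N S \<Longrightarrow> (\<lambda>x. c * f x) \<in> L2cl N S"
| lim: "(\<And>n::nat. g n \<in> L2cl N S) \<Longrightarrow> square_integrable N f \<Longrightarrow> (\<lambda>n. l2d N (g n) f) \<longlonglongrightarrow> 0
    \<Longrightarrow> f \<in> L2cl N S"

lemma L2cl_sqi: "f \<in> L2cl N S \<Longrightarrow> square_integrable N f"
  by (induction rule: L2cl.induct) (auto intro: sqi_add sqi_scale)

lemma L2cl_eq0: "f \<in> L2cl N S \<Longrightarrow> square_integrable N g \<Longrightarrow> l2d N f g = 0 \<Longrightarrow> g \<in> L2cl N S"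
  by (rule L2cl.lim[of "\<lambda>_. f"]) auto

lemma L2cl_AE_cong:
  assumes "f \<in> L2cl N S" "g \<in> borel_measurable N" "AE x in N. f x = g x"
  shows "g \<in> L2cl N S"
proof -
  have "square_integrable N g" using assms L2cl_sqi sqi_AE_cong by blast
  then show ?thesis using L2cl_eq0 assms l2d_eq_0_iff_AE[OF L2cl_sqi[OF assms(1)]] by blast
qed

lemma L2cl_diff: "f \<in> L2cl N S \<Longrightarrow> g \<in> L2cl N S \<Longrightarrow> (\<lambda>x. f x - g x) \<in> L2cl N S"
  using L2cl.add[of f N S "\<lambda>x. (- 1) * g x"] L2cl.scale[of g N S "- 1"] by simp

lemma L2cl_sum: "(\<And>i. i \<in> I \<Longrightarrow> f i \<in> L2cl N S) \<Longrightarrow> (\<lambda>x. \<Sum>i\<in>I. f i x) \<in> L2cl N S"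
  by (induction I rule: infinite_finite_induct) (auto intro: L2cl.zero L2cl.add)

lemma L2cl_limit_le:
  assumes "square_integrable N f" and "\<And>e. 0 < e \<Longrightarrow> \<exists>g\<in>L2cl N S. l2d N g f < e"
  shows "f \<in> L2cl N S"
proof -
  have "\<exists>g\<in>L2cl N S. l2d N g f < inverse (Suc n)" for n by (rule assms(2)) simp
  then obtain g where g: "\<And>n. g n \<in> L2cl N S" "\<And>n. l2d N (g n) f < inverse (Suc n)" by metis
  show ?thesis
  proof (rule L2cl.lim[OF g(1) assms(1)])
    show "(\<lambda>n. l2d N (g n) f) \<longlonglongrightarrow> 0"
      by (rule tendsto_sandwich[OF _ _ tendsto_const LIMSEQ_inverse_real_of_nat])
        (auto intro!: always_eventually less_imp_le[OF g(2)] simp del: of_nat_Suc)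
  qed
qed

text \<open>When \<open>S\<close> is itself a linear space, nested limits collapse into a single
  one. This is how actual simple processes and measurable functions are recovered from membership in
  a closed span. The quarters of \<open>e\<close> absorb the factors 2 of
  \<open>l2d_triangle\<close>.\<close>

lemma L2cl_approx:
  assumes "f \<in> L2cl N S" "0 < e"
    and S: "(\<lambda>x. 0) \<in> S" "\<And>f g. f \<in> S \<Longrightarrow> g \<in> S \<Longrightarrow> (\<lambda>x. f x + g x) \<in> S"
      "\<And>f c. f \<in> S \<Longrightarrow> (\<lambda>x. c * f x) \<in> S"
  shows "\<exists>g\<in>S. square_integrable N g \<and> l2d N g f < e"
  using assms(1,2)
proof (induction arbitrary: e rule: L2cl.induct)
  case (base f)
  then show ?case by (intro bexI[of _ f]) auto
next
  case zero
  then show ?case using S(1) by (intro bexI[of _ "\<lambda>x. 0"]) auto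
next
  case (add f g)
  have "0 < e / 4" using add.prems by simp
  obtain f' where f': "f' \<in> S" "square_integrable N f'" "l2d N f' f < e / 4"
    using add.IH(1)[OF \<open>0 < e / 4\<close>] by blast
  obtain g' where g': "g' \<in> S" "square_integrable N g'" "l2d N g' g < e / 4"
    using add.IH(2)[OF \<open>0 < e / 4\<close>] by blast
  have "l2d N (\<lambda>x. f' x + g' x) (\<lambda>x. f x + g x) < e"
    using l2d_add[OF f'(2) g'(2) add.hyps[THEN L2cl_sqi]] f'(3) g'(3) by linarith
  with S(2)[OF f'(1) g'(1)] sqi_add[OF f'(2) g'(2)] show ?case by blast
next
  case (scale f c)
  \<comment> \<open>Dividing by c^2 + 1 instead of c^2 covers c = 0.\<close>
  obtain f' where f': "f' \<in> S" "square_integrable N f'" "l2d N f' f < e / (c\<^sup>2 + 1)"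
    using scale.IH[of "e / (c\<^sup>2 + 1)"] scale.prems by (auto simp: add_nonneg_pos)
  have "c\<^sup>2 * l2d N f' f \<le> (c\<^sup>2 + 1) * l2d N f' f" by (intro mult_right_mono) auto
  also have "\<dots> < e" using f'(3) by (simp add: pos_less_divide_eq add_nonneg_pos mult.commute)
  finally show ?case using f'
    by (intro bexI[of _ "\<lambda>x. c * f' x"]) (auto intro: sqi_scale S simp: l2d_scale)
next
  case (lim g f)
  have "\<forall>\<^sub>F n in sequentially. l2d N (g n) f < e / 4"
    using lim.hyps(3) lim.prems by (intro order_tendstoD(2)) auto
  then obtain n where n: "l2d N (g n) f < e / 4"
    by (auto simp: eventually_sequentially)
  obtain g' where g': "g' \<in> S" "square_integrable N g'" "l2d N g' (g n) < e / 4"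
    using lim.IH[of "e / 4" n] lim.prems by auto
  have "l2d N g' f < e"
    using l2d_triangle[OF g'(2) L2cl_sqi[OF lim.hyps(1)[of n]] lim.hyps(2)] n g'(3) by simp
  then show ?case using g' by auto
qed

lemma L2cl_orthogonal:
  assumes "f \<in> L2cl N S" "square_integrable N Y"
    and S: "\<And>g. g \<in> S \<Longrightarrow> square_integrable N g \<Longrightarrow> (\<integral>x. g x * Y x \<partial>N) = 0"
  shows "(\<integral>x. f x * Y x \<partial>N) = 0"
  using assms(1)
proof (induction rule: L2cl.induct)
  case (add f g)
  then show ?case
    using sqi_mult[OF L2cl_sqi[OF add.hyps(1)] assms(2)] sqi_mult[OF L2cl_sqi[OF add.hyps(2)] assms(2)]
    by (simp add: distrib_right)
next
  case (lim g f)
  from inner_tendsto_left[OF L2cl_sqi[OF lim.hyps(1)] lim.hyps(2) assms(2) lim.hyps(3)] lim.IH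
  show ?case by (simp add: LIMSEQ_const_iff)
qed (simp_all add: S mult.assoc)

text \<open>A bounded map that is linear only up to null sets still carries a closed span into a
  closed span. Exact additivity fails for integrals over time, whose value on a nonintegrable path
  is a default.\<close>

lemma L2cl_image:
  assumes "f \<in> L2cl N S"
    and base: "\<And>f. f \<in> S \<Longrightarrow> square_integrable N f \<Longrightarrow> \<Phi> f \<in> L2cl N' S'"
    and sq: "\<And>f. f \<in> L2cl N S \<Longrightarrow> square_integrable N' (\<Phi> f)"
    and add: "\<And>f g. f \<in> L2cl N S \<Longrightarrow> g \<in> L2cl N S
        \<Longrightarrow> l2d N' (\<lambda>x. \<Phi> f x + \<Phi> g x) (\<Phi> (\<lambda>x. f x + g x)) = 0"
    and scale: "\<And>f c. f \<in> L2cl N S \<Longrightarrow> l2d N' (\<lambda>x. c * \<Phi> f x) (\<Phi> (\<lambda>x. c * f x)) = 0"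
    and bound: "\<And>f g. f \<in> L2cl N S \<Longrightarrow> g \<in> L2cl N S \<Longrightarrow> l2d N' (\<Phi> f) (\<Phi> g) \<le> C * l2d N f g"
  shows "\<Phi> f \<in> L2cl N' S'"
  using assms(1)
proof (induction rule: L2cl.induct)
  case (base f)
  then show ?case by (rule assms(2))
next
  case zero
  \<comment> \<open>Homogeneity with factor 0, as \<Phi> maps 0 to 0 only up to null sets.\<close>
  have "l2d N' (\<lambda>x. 0) (\<Phi> (\<lambda>x. 0)) = 0" using scale[OF L2cl.zero, of 0] by simp
  then show ?case by (rule L2cl_eq0[OF L2cl.zero sq[OF L2cl.zero]])
next
  case (add f g)
  show ?case
    by (rule L2cl_eq0[OF L2cl.add[OF add.IH] sq[OF L2cl.add[OF add.hyps]] assms(4)[OF add.hyps]])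
next
  case (scale f c)
  show ?case
    by (rule L2cl_eq0[OF L2cl.scale[OF scale.IH] sq[OF L2cl.scale[OF scale.hyps]] assms(5)[OF scale.hyps]])
next
  case (lim g f)
  have f: "f \<in> L2cl N S" by (rule L2cl.lim[OF lim.hyps])
  have "(\<lambda>n. C * l2d N (g n) f) \<longlonglongrightarrow> C * 0" by (intro tendsto_intros lim.hyps(3))
  then have "(\<lambda>n. C * l2d N (g n) f) \<longlonglongrightarrow> 0" by simp
  then have "(\<lambda>n. l2d N' (\<Phi> (g n)) (\<Phi> f)) \<longlonglongrightarrow> 0"
    by (rule Lim_null_comparison[rotated]) (auto intro!: always_eventually bound lim.hyps(1) f)
  then show ?case by (rule L2cl.lim[OF lim.IH sq[OF f]])
qed

section \<open>Gaussian expectations\<close>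

lemma tendsto_std_normal_density:
  "((\<lambda>x. std_normal_density x) \<longlongrightarrow> 0) at_top" "((\<lambda>x. std_normal_density x) \<longlongrightarrow> 0) at_bot"
proof -
  have e: "((\<lambda>x::real. exp (- x\<^sup>2 / 2)) \<longlongrightarrow> 0) F" if "filterlim (\<lambda>x::real. x\<^sup>2) at_top F" for F
  proof (rule filterlim_compose[OF exp_at_bot])
    have "filterlim (\<lambda>x::real. (1/2) * x\<^sup>2) at_top F"
      by (rule filterlim_tendsto_pos_mult_at_top[OF tendsto_const _ that]) simp
    then show "filterlim (\<lambda>x::real. - x\<^sup>2 / 2) at_bot F"
      by (simp add: filterlim_uminus_at_bot)
  qed
  have t: "filterlim (\<lambda>x::real. x\<^sup>2) at_top at_top"
    by (rule filterlim_pow_at_top) (auto simp: filterlim_ident)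
  have "filterlim (\<lambda>x::real. (- x)\<^sup>2) at_top at_bot"
    by (rule filterlim_compose[OF t filterlim_uminus_at_top_at_bot])
  then have b: "filterlim (\<lambda>x::real. x\<^sup>2) at_top at_bot" by simp
  show "((\<lambda>x. std_normal_density x) \<longlongrightarrow> 0) at_top" "((\<lambda>x. std_normal_density x) \<longlongrightarrow> 0) at_bot"
    unfolding std_normal_density_def using tendsto_mult_right_zero[OF e[OF t], of "1 / sqrt (2 * pi)"]
      tendsto_mult_right_zero[OF e[OF b], of "1 / sqrt (2 * pi)"]
    by simp_all
qed

lemma integrable_std_normal_bounded:
  fixes g :: "real \<Rightarrow> real"
  assumes [measurable]: "g \<in> borel_measurable borel" and g: "\<And>x. \<bar>g x\<bar> \<le> c"
  shows "integrable lborel (\<lambda>x. std_normal_density x * (x ^ k * g x))"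
proof (rule Bochner_Integration.integrable_bound[where f = "\<lambda>x. c * (std_normal_density x * \<bar>x\<bar> ^ k)"])
  show "integrable lborel (\<lambda>x. c * (std_normal_density x * \<bar>x\<bar> ^ k))"
    by (intro integrable_mult_right integrable_std_normal_moment_abs)
  have "\<bar>std_normal_density x\<bar> * (\<bar>x\<bar> ^ k * \<bar>g x\<bar>) \<le> \<bar>c\<bar> * (\<bar>std_normal_density x\<bar> * \<bar>x\<bar> ^ k)" for x
    using mult_left_mono[OF order_trans[OF g[of x] abs_ge_self[of c]], of "\<bar>std_normal_density x\<bar> * \<bar>x\<bar>^k"]
    by (simp add: mult_ac)
  then show "AE x in lborel. norm (std_normal_density x * (x ^ k * g x)) \<le> norm (c * (std_normal_density x * \<bar>x\<bar> ^ k))"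
    by (simp add: abs_mult power_abs)
qed measurable

text \<open>Stein's identity E[X g(X)] = E[g'(X)]: the difference of the integrands is the
  derivative of \<open>std_normal_density x * g x\<close>, which vanishes at both infinities because
  \<open>g\<close> is bounded.\<close>

lemma std_normal_by_parts:
  fixes g g' :: "real \<Rightarrow> real"
  assumes d: "\<And>x. (g has_real_derivative g' x) (at x)" and c: "continuous_on UNIV g'"
    and b: "\<And>x. \<bar>g x\<bar> \<le> c" and b': "\<And>x. \<bar>g' x\<bar> \<le> c'"
  shows "(\<integral>x. std_normal_density x * (x * g x) \<partial>lborel) = (\<integral>x. std_normal_density x * g' x \<partial>lborel)"
proof -
  have cg: "continuous_on UNIV g"
    using d by (intro DERIV_continuous_on) auto
  have [measurable]: "g \<in> borel_measurable borel" "g' \<in> borel_measurable borel"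
    using cg c by (auto intro: borel_measurable_continuous_onI)
  have i1: "integrable lborel (\<lambda>x. std_normal_density x * (x * g x))"
    using integrable_std_normal_bounded[OF _ b, where k = 1] by simp
  have i2: "integrable lborel (\<lambda>x. std_normal_density x * g' x)"
    using integrable_std_normal_bounded[OF _ b', where k = 0] by simp
  let ?f = "\<lambda>x. std_normal_density x * g' x - std_normal_density x * (x * g x)"
  let ?F = "\<lambda>x. std_normal_density x * g x"
  have dphi: "(std_normal_density has_real_derivative (- (x * std_normal_density x))) (at x)" for x
    unfolding std_normal_density_def[abs_def]
    by (auto intro!: derivative_eq_intros simp: field_simps)
  have z: "(?F \<longlongrightarrow> 0) F" if "(std_normal_density \<longlongrightarrow> 0) F" for F
  proof (rule Lim_null_comparison[of _ "\<lambda>x. std_normal_density x * c"])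
    show "\<forall>\<^sub>F x in F. norm (std_normal_density x * g x) \<le> std_normal_density x * c"
      using b by (auto intro!: always_eventually mult_left_mono simp: abs_mult)
    show "((\<lambda>x. std_normal_density x * c) \<longlongrightarrow> 0) F"
      using tendsto_mult_left_zero[OF that] by simp
  qed
  have "(LBINT x=-\<infinity>..\<infinity>. ?f x) = 0 - 0"
  proof (rule interval_integral_FTC_integrable)
    show "(?F has_vector_derivative ?f x) (at x)" for x
      unfolding has_real_derivative_iff_has_vector_derivative[symmetric]
      by (auto intro!: derivative_eq_intros dphi d simp: algebra_simps)
    show "isCont ?f x" for x
    proof -
      have "isCont g x" "isCont g' x"
        using cg c by (auto simp: continuous_on_eq_continuous_at)
      moreover have "isCont std_normal_density x" using dphi by (rule DERIV_isCont)
      ultimately show ?thesis by (intro continuous_intros)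
    qed
    show "set_integrable lborel (einterval (-\<infinity>) \<infinity>) ?f"
      using i1 i2 by (simp add: set_integrable_def)
    show "((?F \<circ> real_of_ereal) \<longlongrightarrow> 0) (at_right (-\<infinity>))" "((?F \<circ> real_of_ereal) \<longlongrightarrow> 0) (at_left \<infinity>)"
      using z[OF tendsto_std_normal_density(1)] z[OF tendsto_std_normal_density(2)]
      by (simp_all add: ereal_tendsto_simps)
  qed simp
  also have "(LBINT x=-\<infinity>..\<infinity>. ?f x) = (\<integral>x. ?f x \<partial>lborel)"
    by (simp add: interval_lebesgue_integral_def set_lebesgue_integral_def)
  finally show ?thesis using i1 i2 by simp
qed

text \<open>The first two are the parts of the characteristic function; Stein's identity reduces
  those with a factor x to them.\<close>

lemma std_normal_trig:
  fixes t :: real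
  shows "(\<integral>x. std_normal_density x * cos (t * x) \<partial>lborel) = exp (- t\<^sup>2 / 2)"
    and "(\<integral>x. std_normal_density x * sin (t * x) \<partial>lborel) = 0"
    and "(\<integral>x. std_normal_density x * (x * sin (t * x)) \<partial>lborel) = t * exp (- t\<^sup>2 / 2)"
    and "(\<integral>x. std_normal_density x * (x * cos (t * x)) \<partial>lborel) = 0"
proof -
  interpret real_distribution std_normal_distribution by (rule real_dist_normal_dist)
  have i: "integrable std_normal_distribution (\<lambda>x. iexp (t * x))"
    by (rule integrable_iexp) auto
  have "char std_normal_distribution t = complex_of_real (exp (- t\<^sup>2 / 2))"
    by (simp add: char_std_normal_distribution)
  then have e: "(CLINT x|std_normal_distribution. iexp (t * x)) = complex_of_real (exp (- t\<^sup>2 / 2))"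
    by (simp add: char_def)
  have "(\<integral>x. cos (t * x) \<partial>std_normal_distribution) = exp (- t\<^sup>2 / 2)"
    using integral_Re[OF i] e by (simp add: Re_exp)
  then show c: "(\<integral>x. std_normal_density x * cos (t * x) \<partial>lborel) = exp (- t\<^sup>2 / 2)"
    by (subst (asm) integral_real_density) auto
  have "(\<integral>x. sin (t * x) \<partial>std_normal_distribution) = 0"
    using integral_Im[OF i] e by (simp add: Im_exp)
  then show s: "(\<integral>x. std_normal_density x * sin (t * x) \<partial>lborel) = 0"
    by (subst (asm) integral_real_density) auto
  have "(\<integral>x. std_normal_density x * (x * sin (t * x)) \<partial>lborel)
      = (\<integral>x. std_normal_density x * (t * cos (t * x)) \<partial>lborel)"
    by (rule std_normal_by_parts[where c = 1 and c' = "\<bar>t\<bar>"])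
      (auto intro!: derivative_eq_intros continuous_intros mult_left_le simp: abs_mult)
  then show "(\<integral>x. std_normal_density x * (x * sin (t * x)) \<partial>lborel) = t * exp (- t\<^sup>2 / 2)"
    using c by (simp add: mult.left_commute)
  have "(\<integral>x. std_normal_density x * (x * cos (t * x)) \<partial>lborel)
      = (\<integral>x. std_normal_density x * (- t * sin (t * x)) \<partial>lborel)"
    by (rule std_normal_by_parts[where c = 1 and c' = "\<bar>t\<bar>"])
      (auto intro!: derivative_eq_intros continuous_intros mult_left_le simp: abs_mult)
  then show "(\<integral>x. std_normal_density x * (x * cos (t * x)) \<partial>lborel) = 0"
    using s by (simp add: mult.left_commute)
qed

text \<open>All moments are scaled from the standard normal law. The mixed one, of X exp(i t X), is
  what later pairs the exponential with a Brownian increment.\<close>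

lemma (in prob_space) normal_moments:
  fixes t :: real
  assumes X: "distributed M lborel X (normal_density 0 \<sigma>)" and \<sigma>: "0 < \<sigma>"
  shows "square_integrable M X" "expectation X = 0" "expectation (\<lambda>\<omega>. (X \<omega>)\<^sup>2) = \<sigma>\<^sup>2"
    "expectation (\<lambda>\<omega>. iexp (t * X \<omega>)) = complex_of_real (exp (- t\<^sup>2 * \<sigma>\<^sup>2 / 2))"
    "integrable M (\<lambda>\<omega>. iexp (t * X \<omega>))"
    "expectation (\<lambda>\<omega>. X \<omega> * iexp (t * X \<omega>)) = \<i> * complex_of_real (t * \<sigma>\<^sup>2 * exp (- t\<^sup>2 * \<sigma>\<^sup>2 / 2))"
    "integrable M (\<lambda>\<omega>. X \<omega> * iexp (t * X \<omega>))"
proof -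
  let ?N = "\<lambda>\<omega>. X \<omega> / \<sigma>"
  have N: "distributed M lborel ?N std_normal_density"
    using X normal_standard_normal_convert[OF \<sigma>, of X 0] by simp
  have [measurable]: "X \<in> borel_measurable M"
    using distributed_measurable[OF X] by simp
  have E: "expectation (\<lambda>\<omega>. g (X \<omega> / \<sigma>)) = (\<integral>x. std_normal_density x * g x \<partial>lborel)"
    if "g \<in> borel_measurable borel" for g :: "real \<Rightarrow> real"
    using distributed_integral[OF N, of g] that by simp
  have I: "integrable M (\<lambda>\<omega>. g (X \<omega> / \<sigma>)) \<longleftrightarrow> integrable lborel (\<lambda>x. std_normal_density x * g x)"
    if "g \<in> borel_measurable borel" for g :: "real \<Rightarrow> real"
    using distributed_integrable[OF N, of g] that by simp
  have "integrable M (\<lambda>\<omega>. (X \<omega> / \<sigma>)\<^sup>2)"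
    using I[of "\<lambda>x. x\<^sup>2"] integrable_std_normal_moment[of 2] by simp
  then have "integrable M (\<lambda>\<omega>. \<sigma>\<^sup>2 * (X \<omega> / \<sigma>)\<^sup>2)" by simp
  then show sq: "square_integrable M X" using \<sigma> by (simp add: square_integrable_def power_divide)
  show "expectation X = 0" by (rule normal_distributed_expectation[OF \<sigma> X])
  show "expectation (\<lambda>\<omega>. (X \<omega>)\<^sup>2) = \<sigma>\<^sup>2"
    using normal_distributed_variance[OF \<sigma> X] normal_distributed_expectation[OF \<sigma> X] by simp
  have iX: "integrable M X" by (rule sqi_integrable[OF sq])
  show i1: "integrable M (\<lambda>\<omega>. iexp (t * X \<omega>))"
    by (rule integrable_const_bound[where B = 1]) auto
  show i2: "integrable M (\<lambda>\<omega>. X \<omega> * iexp (t * X \<omega>))"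
    by (rule Bochner_Integration.integrable_bound[OF iX]) (auto simp: norm_mult)
  have ex: "exp (- (t * \<sigma>)\<^sup>2 / 2) = exp (- t\<^sup>2 * \<sigma>\<^sup>2 / 2)" by (simp add: power_mult_distrib)
  show "expectation (\<lambda>\<omega>. iexp (t * X \<omega>)) = complex_of_real (exp (- t\<^sup>2 * \<sigma>\<^sup>2 / 2))"
    using integral_Re[OF i1] integral_Im[OF i1] E[of "\<lambda>x. cos (t * \<sigma> * x)"] E[of "\<lambda>x. sin (t * \<sigma> * x)"]
      std_normal_trig(1,2)[of "t * \<sigma>"] \<sigma>
    by (intro complex_eqI) (simp_all add: Re_exp Im_exp power_mult_distrib)
  have 1: "expectation (\<lambda>\<omega>. X \<omega> * cos (t * X \<omega>)) = 0"
    using E[of "\<lambda>x. x * cos (t * \<sigma> * x)"] std_normal_trig(4)[of "t * \<sigma>"] \<sigma>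
    by (simp add: )
  have 2: "expectation (\<lambda>\<omega>. X \<omega> * sin (t * X \<omega>)) = t * \<sigma>\<^sup>2 * exp (- t\<^sup>2 * \<sigma>\<^sup>2 / 2)"
    using E[of "\<lambda>x. x * sin (t * \<sigma> * x)"] std_normal_trig(3)[of "t * \<sigma>"] \<sigma>
    by (simp add: ex power2_eq_square field_simps)
  show "expectation (\<lambda>\<omega>. X \<omega> * iexp (t * X \<omega>)) = \<i> * complex_of_real (t * \<sigma>\<^sup>2 * exp (- t\<^sup>2 * \<sigma>\<^sup>2 / 2))"
    using integral_Re[OF i2] integral_Im[OF i2] 1 2
    by (intro complex_eqI) (simp_all add: Re_exp Im_exp)
qed

lemma sets_Collect_mem:
  assumes "f \<in> measurable N K" "X \<in> sets K"
  shows "{\<omega> \<in> space N. f \<omega> \<in> X} \<in> sets N"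
proof -
  have "{\<omega> \<in> space N. f \<omega> \<in> X} = f -` X \<inter> space N" by auto
  then show ?thesis using assms by (simp add: measurable_sets)
qed

lemma Int_vimage_Times:
  "(f -` C \<inter> S) \<inter> (g -` D \<inter> S) = (\<lambda>\<omega>. (f \<omega>, g \<omega>)) -` (C \<times> D) \<inter> S"
  by auto

section \<open>Brownian increments and the filtration\<close>

locale brownian =
  fixes M :: "'a measure" and d :: nat and T :: real and B :: "nat \<Rightarrow> real \<Rightarrow> 'a \<Rightarrow> real"
  assumes T_pos: "0 < T" and bm: "standard_brownian_motion M d T B"

sublocale brownian \<subseteq> prob_space M
  using bm by (simp add: standard_brownian_motion_def)

context brownian
begin

abbreviation F :: "real \<Rightarrow> 'a measure" where
  "F \<equiv> brownian_filtration M d B"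

lemma B_measurable [measurable]: "i \<in> {1..d} \<Longrightarrow> 0 \<le> t \<Longrightarrow> t \<le> T \<Longrightarrow> B i t \<in> borel_measurable M"
  using bm by (simp add: standard_brownian_motion_def)

lemma AE_B_0: "i \<in> {1..d} \<Longrightarrow> AE \<omega> in M. B i 0 \<omega> = 0"
  using bm by (simp add: standard_brownian_motion_def)

lemma AE_B_continuous: "i \<in> {1..d} \<Longrightarrow> AE \<omega> in M. continuous_on {0..T} (\<lambda>t. B i t \<omega>)"
  using bm by (simp add: standard_brownian_motion_def)

lemma B_increment_distributed:
  "i \<in> {1..d} \<Longrightarrow> 0 \<le> s \<Longrightarrow> s < t \<Longrightarrow> t \<le> T \<Longrightarrow>
    distributed M lborel (\<lambda>\<omega>. B i t \<omega> - B i s \<omega>) (normal_density 0 (sqrt (t - s)))"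
  using bm by (simp add: standard_brownian_motion_def)

lemma B_increments_indep:
  "0 \<le> \<tau> 0 \<Longrightarrow> (\<And>k. k < n \<Longrightarrow> \<tau> k < \<tau> (Suc k)) \<Longrightarrow> \<tau> n \<le> T \<Longrightarrow>
    indep_vars (\<lambda>_. borel) (\<lambda>(i, k) \<omega>. B i (\<tau> (Suc k)) \<omega> - B i (\<tau> k) \<omega>) ({1..d} \<times> {..<n})"
  using bm unfolding standard_brownian_motion_def by blast

lemma space_F [simp]: "space (F t) = space M"
  by (auto simp: brownian_filtration_def space_measure_of_conv)

lemma sets_F: "sets (F t) = sigma_sets (space M)
    {B i s -` A \<inter> space M | i s A. i \<in> {1..d} \<and> s \<in> {0..t} \<and> A \<in> sets borel}"
  unfolding brownian_filtration_def by (intro sets_measure_of) auto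

lemma sets_F_mono: "s \<le> t \<Longrightarrow> sets (F s) \<subseteq> sets (F t)"
  unfolding sets_F by (rule sigma_sets_mono') fastforce

lemma sets_F_subset: "t \<le> T \<Longrightarrow> sets (F t) \<subseteq> sets M"
  unfolding sets_F by (intro sets.sigma_sets_subset) (auto intro!: measurable_sets)

lemma measurable_F_mono: "f \<in> measurable (F s) N \<Longrightarrow> s \<le> t \<Longrightarrow> f \<in> measurable (F t) N"
  using sets_F_mono[of s t] by (auto simp: measurable_def)

lemma measurable_F_M: "f \<in> measurable (F t) N \<Longrightarrow> t \<le> T \<Longrightarrow> f \<in> measurable M N"
  using sets_F_subset[of t] by (auto simp: measurable_def)

lemma B_measurable_F: "i \<in> {1..d} \<Longrightarrow> 0 \<le> s \<Longrightarrow> s \<le> t \<Longrightarrow> B i s \<in> borel_measurable (F t)"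
  by (auto simp: measurable_def sets_F intro!: sigma_sets.Basic)

section \<open>Independence of increments from the past\<close>

definition incr :: "real \<Rightarrow> real \<Rightarrow> 'a \<Rightarrow> nat \<Rightarrow> real" where
  "incr s t \<omega> = (\<lambda>i\<in>{1..d}. B i t \<omega> - B i s \<omega>)"

lemma incr_apply: "i \<in> {1..d} \<Longrightarrow> incr s t \<omega> i = B i t \<omega> - B i s \<omega>"
  by (simp add: incr_def)

lemma incr_measurable:
  "0 \<le> s \<Longrightarrow> s \<le> t \<Longrightarrow> t \<le> T \<Longrightarrow> incr s t \<in> measurable M (\<Pi>\<^sub>M i\<in>{1..d}. borel)"
  unfolding incr_def by (intro measurable_restrict borel_measurable_diff) auto

text \<open>The definition of Brownian motion speaks of increments along one partition at a time.
  The times in \<open>J\<close> are therefore arranged in a grid, and the values of \<open>B\<close>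
  at them become sums of grid increments, all of which are independent of the last
  increment.\<close>

lemma indep_cylinder_incr:
  assumes st: "0 \<le> s" "s < t" "t \<le> T"
    and J: "finite J" "J \<subseteq> {1..d} \<times> {0..s}" and X: "\<And>p. p \<in> J \<Longrightarrow> X p \<in> sets borel"
    and A: "A \<in> sets (\<Pi>\<^sub>M i\<in>{1..d}. (borel :: real measure))"
  defines "G \<equiv> {\<omega> \<in> space M. \<forall>p\<in>J. B (fst p) (snd p) \<omega> \<in> X p}"
  shows "prob (G \<inter> (incr s t -` A \<inter> space M)) = prob G * prob (incr s t -` A \<inter> space M)"
proof -
  \<comment> \<open>With 0 and \<open>s\<close> included, the grid starts where \<open>B\<close>
    vanishes, and once \<open>t\<close> is appended its last interval is the one from
    \<open>s\<close> to \<open>t\<close>.\<close>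
  define R where "R = insert 0 (insert s (snd ` J))"
  have R: "finite R" "0 \<in> R" "s \<in> R" "R \<subseteq> {0..s}"
    using J st by (auto simp: R_def)
  define \<rho> where "\<rho> = sorted_list_of_set R"
  define N where "N = length \<rho>"
  define \<tau> where "\<tau> k = (if k < N then \<rho> ! k else t)" for k
  have set\<rho>: "set \<rho> = R" using R by (simp add: \<rho>_def)
  have srt: "sorted_wrt (<) \<rho>" by (simp add: \<rho>_def)
  have \<tau>R: "\<tau> k \<in> R" if "k < N" for k
    using that set\<rho> nth_mem[of k \<rho>] by (simp add: \<tau>_def N_def)
  have mono: "\<tau> k < \<tau> l" if "k < l" "l \<le> N" for k l
  proof (cases "l < N")
    case True
    then show ?thesis using that srt by (simp add: \<tau>_def N_def sorted_wrt_nth_less)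
  next
    case False
    then have "\<tau> l = t" by (simp add: \<tau>_def)
    moreover have "\<tau> k \<le> s" using \<tau>R[of k] R(4) that False by auto
    ultimately show ?thesis using st by simp
  qed
  have idx: "\<exists>k<N. \<tau> k = r" if "r \<in> R" for r
    using that set\<rho> by (metis N_def \<tau>_def in_set_conv_nth)
  then obtain K where K: "\<And>r. r \<in> R \<Longrightarrow> K r < N \<and> \<tau> (K r) = r" by metis
  have \<tau>0: "\<tau> 0 = 0"
  proof (rule ccontr)
    assume "\<tau> 0 \<noteq> 0"
    then have "0 < K 0" using K[OF R(2)] by (cases "K 0") auto
    then have "\<tau> 0 < 0" using mono[of 0 "K 0"] K[OF R(2)] by auto
    moreover have "\<tau> 0 \<in> R" using \<tau>R[of 0] K[OF R(2)] by auto
    ultimately show False using R(4) by auto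
  qed
  have \<tau>N: "\<tau> N = t" by (simp add: \<tau>_def)
  have N0: "0 < N" using K[OF R(2)] by auto
  have \<tau>s: "\<tau> (N - 1) = s"
  proof (rule ccontr)
    assume "\<tau> (N - 1) \<noteq> s"
    then have "K s < N - 1" using K[OF R(3)] by (cases "K s = N - 1") auto
    then have "s < \<tau> (N - 1)" using mono[of "K s" "N - 1"] K[OF R(3)] by auto
    moreover have "\<tau> (N - 1) \<in> R" using \<tau>R[of "N - 1"] N0 by auto
    ultimately show False using R(4) by auto
  qed
  let ?inc = "\<lambda>(i, k) \<omega>. B i (\<tau> (Suc k)) \<omega> - B i (\<tau> k) \<omega>"
  let ?P = "{1..d} \<times> {..<N - 1}" and ?Q = "{1..d} \<times> {N - 1}"
  have ind: "indep_vars (\<lambda>_. borel) ?inc ({1..d} \<times> {..<N})"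
    by (rule B_increments_indep) (use \<tau>0 \<tau>N mono st in auto)
  have indep: "indep_var (\<Pi>\<^sub>M p\<in>?P. borel) (\<lambda>\<omega>. \<lambda>p\<in>?P. ?inc p \<omega>) (\<Pi>\<^sub>M p\<in>?Q. borel) (\<lambda>\<omega>. \<lambda>p\<in>?Q. ?inc p \<omega>)"
    by (rule indep_var_restrict[OF ind]) (use N0 in auto)
  have KN: "K r \<le> N - 1" if "r \<in> R" for r using K[OF that] by auto
  let ?C = "{x \<in> space (\<Pi>\<^sub>M p\<in>?P. (borel::real measure)). \<forall>p\<in>J. (\<Sum>k<K (snd p). x (fst p, k)) \<in> X p}"
  have sums_meas: "(\<lambda>x. \<Sum>k<K (snd p). x (fst p, k)) \<in> borel_measurable (\<Pi>\<^sub>M p\<in>?P. (borel :: real measure))"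
    if p: "p \<in> J" for p
  proof (intro borel_measurable_sum measurable_component_singleton)
    fix k assume "k \<in> {..<K (snd p)}"
    moreover have "snd p \<in> R" using p by (auto simp: R_def)
    ultimately show "(fst p, k) \<in> ?P" using KN[of "snd p"] p J by auto
  qed
  have C: "?C \<in> sets (\<Pi>\<^sub>M p\<in>?P. borel)"
    by (rule sets.sets_Collect_finite_All[OF _ J(1)]) (rule sets_Collect_mem[OF sums_meas X])
  have Q: "(\<lambda>y. \<lambda>i\<in>{1..d}. y (i, N - 1)) \<in> measurable (\<Pi>\<^sub>M p\<in>?Q. borel) (\<Pi>\<^sub>M i\<in>{1..d}. borel)"
    by (intro measurable_restrict measurable_component_singleton) auto
  let ?D = "(\<lambda>y. \<lambda>i\<in>{1..d}. y (i, N - 1)) -` A \<inter> space (\<Pi>\<^sub>M p\<in>?Q. (borel::real measure))"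
  have D: "?D \<in> sets (\<Pi>\<^sub>M p\<in>?Q. borel)" using Q A by (rule measurable_sets)
  let ?G' = "(\<lambda>\<omega>. \<lambda>p\<in>?P. ?inc p \<omega>) -` ?C \<inter> space M"
  have eqD: "(\<lambda>\<omega>. \<lambda>p\<in>?Q. ?inc p \<omega>) -` ?D \<inter> space M = incr s t -` A \<inter> space M"
  proof -
    have "(\<lambda>i\<in>{1..d}. (\<lambda>p\<in>?Q. ?inc p \<omega>) (i, N - 1)) = incr s t \<omega>" for \<omega>
      using N0 \<tau>s \<tau>N by (auto simp: incr_def fun_eq_iff restrict_def)
    then show ?thesis by (auto simp: space_PiM)
  qed
  have eqG: "?G' = {\<omega> \<in> space M. \<forall>p\<in>J. B (fst p) (snd p) \<omega> - B (fst p) 0 \<omega> \<in> X p}"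
  proof -
    have "(\<Sum>k<K (snd p). (\<lambda>p\<in>?P. ?inc p \<omega>) (fst p, k)) = B (fst p) (snd p) \<omega> - B (fst p) 0 \<omega>"
      if p: "p \<in> J" for p \<omega>
    proof -
      have r: "snd p \<in> R" using p by (auto simp: R_def)
      have "(\<Sum>k<K (snd p). (\<lambda>p\<in>?P. ?inc p \<omega>) (fst p, k))
          = (\<Sum>k<K (snd p). B (fst p) (\<tau> (Suc k)) \<omega> - B (fst p) (\<tau> k) \<omega>)"
        using KN[OF r] p J by (intro sum.cong) auto
      also have "\<dots> = B (fst p) (\<tau> (K (snd p))) \<omega> - B (fst p) (\<tau> 0) \<omega>"
        by (rule sum_lessThan_telescope[of "\<lambda>k. B (fst p) (\<tau> k) \<omega>"])
      finally show ?thesis using K[OF r] \<tau>0 by simp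
    qed
    then show ?thesis by (auto simp: space_PiM)
  qed
  \<comment> \<open>The telescoping sums start from the value at time 0, which is 0 only almost
    surely; hence \<open>G\<close> and \<open>?G'\<close> agree up to a null set.\<close>
  have "AE \<omega> in M. \<forall>p\<in>J. B (fst p) 0 \<omega> = 0"
    using J AE_B_0 by (intro AE_finite_allI) auto
  then have AEG: "AE \<omega> in M. \<omega> \<in> G \<longleftrightarrow> \<omega> \<in> ?G'"
    unfolding eqG G_def by eventually_elim auto
  have mG': "?G' \<in> sets M"
    using indep_var_rv1[OF indep] C by (rule measurable_sets)
  have mG: "G \<in> sets M"
    unfolding G_def
  proof (rule sets.sets_Collect_finite_All[OF _ J(1)])
    fix p assume "p \<in> J"
    then show "{\<omega> \<in> space M. B (fst p) (snd p) \<omega> \<in> X p} \<in> events"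
      using J(2) X st by (intro sets_Collect_mem[of _ _ borel] B_measurable) auto
  qed
  have mD: "incr s t -` A \<inter> space M \<in> sets M"
    using incr_measurable[of s t] st A by (intro measurable_sets) auto
  have "prob (G \<inter> (incr s t -` A \<inter> space M)) = prob (?G' \<inter> (incr s t -` A \<inter> space M))"
    using AEG mG mG' mD by (intro finite_measure_eq_AE) auto
  also have "\<dots> = prob ((\<lambda>\<omega>. ((\<lambda>p\<in>?P. ?inc p \<omega>), (\<lambda>p\<in>?Q. ?inc p \<omega>))) -` (?C \<times> ?D) \<inter> space M)"
    unfolding eqD[symmetric] Int_vimage_Times ..
  also have "\<dots> = prob ?G' * prob ((\<lambda>\<omega>. \<lambda>p\<in>?Q. ?inc p \<omega>) -` ?D \<inter> space M)"
    by (rule indep_varD[OF indep C D])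
  also have "prob ?G' = prob G"
    using AEG mG mG' by (intro finite_measure_eq_AE) auto
  finally show ?thesis unfolding eqD .
qed

text \<open>Cylinder events form an intersection-stable generator of \<open>F s\<close>, and
  independence passes from such generators to the generated sigma-algebras.\<close>

lemma indep_F_incr:
  assumes st: "0 \<le> s" "s < t" "t \<le> T"
  shows "indep_set (sets (F s)) {incr s t -` A \<inter> space M | A. A \<in> sets (\<Pi>\<^sub>M i\<in>{1..d}. borel)}"
proof -
  let ?\<G> = "{{\<omega> \<in> space M. \<forall>p\<in>J. B (fst p) (snd p) \<omega> \<in> X p} | J X.
     finite J \<and> J \<subseteq> {1..d} \<times> {0..s} \<and> (\<forall>p\<in>J. X p \<in> sets borel)}"
  let ?\<D> = "{incr s t -` A \<inter> space M | A. A \<in> sets (\<Pi>\<^sub>M i\<in>{1..d}. (borel :: real measure))}"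
  have "indep_set ?\<G> ?\<D>"
  proof (rule indep_setI)
    show "?\<G> \<subseteq> events"
    proof safe
      fix J and X :: "nat \<times> real \<Rightarrow> real set" assume J: "finite J" "J \<subseteq> {1..d} \<times> {0..s}" "\<forall>p\<in>J. X p \<in> sets borel"
      show "{\<omega> \<in> space M. \<forall>p\<in>J. B (fst p) (snd p) \<omega> \<in> X p} \<in> events"
        using J(1)
      proof (rule sets.sets_Collect_finite_All[rotated])
        fix p assume "p \<in> J"
        then show "{\<omega> \<in> space M. B (fst p) (snd p) \<omega> \<in> X p} \<in> events"
          using J(2,3) st by (intro sets_Collect_mem[of _ _ borel] B_measurable) auto
      qed
    qed
    show "?\<D> \<subseteq> events"
      using incr_measurable[of s t] st by (auto intro: measurable_sets)
    show "prob (a \<inter> b) = prob a * prob b" if "a \<in> ?\<G>" "b \<in> ?\<D>" for a b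
      using that indep_cylinder_incr[OF st] by blast
  qed
  then have "indep_set (sigma_sets (space M) ?\<G>) (sigma_sets (space M) ?\<D>)"
  proof (rule indep_set_sigma_sets)
    show "Int_stable ?\<G>"
    proof (rule Int_stableI)
      fix a b assume "a \<in> ?\<G>" "b \<in> ?\<G>"
      then obtain J X J' X' where
        a: "a = {\<omega> \<in> space M. \<forall>p\<in>J. B (fst p) (snd p) \<omega> \<in> X p}" "finite J" "J \<subseteq> {1..d} \<times> {0..s}"
          "\<forall>p\<in>J. X p \<in> sets borel" and
        b: "b = {\<omega> \<in> space M. \<forall>p\<in>J'. B (fst p) (snd p) \<omega> \<in> X' p}" "finite J'" "J' \<subseteq> {1..d} \<times> {0..s}"
          "\<forall>p\<in>J'. X' p \<in> sets borel" by auto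
      \<comment> \<open>Missing constraints are filled up with \<open>UNIV\<close>, so that both
        cylinders are indexed by \<open>J \<union> J'\<close>.\<close>
      let ?X = "\<lambda>p. (if p \<in> J then X p else UNIV) \<inter> (if p \<in> J' then X' p else UNIV)"
      have "a \<inter> b = {\<omega> \<in> space M. \<forall>p\<in>J \<union> J'. B (fst p) (snd p) \<omega> \<in> ?X p}"
        unfolding a b by (auto split: if_splits)
      then show "a \<inter> b \<in> ?\<G>"
        using a(2-4) b(2-4) by (intro CollectI exI[of _ "J \<union> J'"] exI[of _ ?X]) auto
    qed
    show "Int_stable ?\<D>"
    proof (rule Int_stableI)
      fix a b assume "a \<in> ?\<D>" "b \<in> ?\<D>"
      then obtain A A' where "a = incr s t -` A \<inter> space M" "b = incr s t -` A' \<inter> space M"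
        "A \<in> sets (\<Pi>\<^sub>M i\<in>{1..d}. borel)" "A' \<in> sets (\<Pi>\<^sub>M i\<in>{1..d}. borel)" by auto
      then show "a \<inter> b \<in> ?\<D>" by (intro CollectI exI[of _ "A \<inter> A'"]) auto
    qed
  qed
  moreover have "sets (F s) \<subseteq> sigma_sets (space M) ?\<G>"
    unfolding sets_F
  proof (rule sigma_sets_mono, safe)
    fix i r and A :: "real set" assume "i \<in> {1..d}" "r \<in> {0..s}" "A \<in> sets borel"
    then have "B i r -` A \<inter> space M \<in> ?\<G>"
      by (intro CollectI exI[of _ "{(i, r)}"] exI[of _ "\<lambda>_. A"]) auto
    then show "B i r -` A \<inter> space M \<in> sigma_sets (space M) ?\<G>" by (rule sigma_sets.Basic)
  qed
  moreover have "?\<D> \<subseteq> sigma_sets (space M) ?\<D>" by (auto intro: sigma_sets.Basic)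
  ultimately show ?thesis
    unfolding indep_set_def by (elim indep_sets_mono_sets) (auto split: bool.split)
qed

lemma indep_var_F_incr:
  assumes st: "0 \<le> s" "s < t" "t \<le> T" and \<eta>: "\<eta> \<in> borel_measurable (F s)"
    and g: "g \<in> borel_measurable (\<Pi>\<^sub>M i\<in>{1..d}. borel)"
  shows "indep_var borel \<eta> borel (\<lambda>\<omega>. g (incr s t \<omega>))"
proof -
  let ?\<D> = "{incr s t -` A \<inter> space M | A. A \<in> sets (\<Pi>\<^sub>M i\<in>{1..d}. (borel :: real measure))}"
  have [measurable]: "incr s t \<in> measurable M (\<Pi>\<^sub>M i\<in>{1..d}. borel)"
    using incr_measurable st by auto
  have 1: "sigma_sets (space M) {\<eta> -` A \<inter> space M | A. A \<in> sets borel} \<subseteq> sets (F s)"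
  proof -
    have "{\<eta> -` A \<inter> space M | A. A \<in> sets borel} \<subseteq> sets (F s)"
      using \<eta> by (auto dest: measurable_sets)
    then show ?thesis using sets.sigma_sets_subset[of _ "F s"] by simp
  qed
  have 2: "sigma_sets (space M) {(\<lambda>\<omega>. g (incr s t \<omega>)) -` A \<inter> space M | A. A \<in> sets borel} \<subseteq> ?\<D>"
  proof -
    have eq: "?\<D> = sets (vimage_algebra (space M) (incr s t) (\<Pi>\<^sub>M i\<in>{1..d}. borel))"
      using st by (subst sets_vimage_algebra2) (auto simp del: One_nat_def intro!: measurable_space[OF incr_measurable])
    have "(\<lambda>\<omega>. g (incr s t \<omega>)) -` A \<inter> space M \<in> ?\<D>" if "A \<in> sets borel" for A
    proof -
      have "(\<lambda>\<omega>. g (incr s t \<omega>)) -` A \<inter> space M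
          = incr s t -` (g -` A \<inter> space (\<Pi>\<^sub>M i\<in>{1..d}. borel)) \<inter> space M"
      proof -
        have "incr s t \<omega> \<in> space (\<Pi>\<^sub>M i\<in>{1..d}. borel)" if "\<omega> \<in> space M" for \<omega>
          using that st by (intro measurable_space[OF incr_measurable]) auto
        then show ?thesis by blast
      qed
      then show ?thesis using measurable_sets[OF g that] by blast
    qed
    then have "{(\<lambda>\<omega>. g (incr s t \<omega>)) -` A \<inter> space M | A. A \<in> sets borel} \<subseteq> ?\<D>" by blast
    then show ?thesis unfolding eq
      using sets.sigma_sets_subset[of _ "vimage_algebra (space M) (incr s t) (\<Pi>\<^sub>M i\<in>{1..d}. borel)"] by simp
  qed
  have "indep_set (sigma_sets (space M) {\<eta> -` A \<inter> space M | A. A \<in> sets borel})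
     (sigma_sets (space M) {(\<lambda>\<omega>. g (incr s t \<omega>)) -` A \<inter> space M | A. A \<in> sets borel})"
    using indep_F_incr[OF st] 1 2
    unfolding indep_set_def by (elim indep_sets_mono_sets) (auto split: bool.split)
  moreover have "(\<lambda>\<omega>. g (incr s t \<omega>)) \<in> borel_measurable M"
    using measurable_compose[OF incr_measurable g] st by simp
  ultimately show ?thesis
    unfolding indep_var_eq using measurable_F_M[OF \<eta>] st by auto
qed

lemma F_incr_expectation:
  fixes \<eta> :: "'a \<Rightarrow> real" and g :: "_ \<Rightarrow> real"
  assumes st: "0 \<le> s" "s < t" "t \<le> T" and \<eta>: "\<eta> \<in> borel_measurable (F s)" "integrable M \<eta>"
    and g: "g \<in> borel_measurable (\<Pi>\<^sub>M i\<in>{1..d}. borel)" "integrable M (\<lambda>\<omega>. g (incr s t \<omega>))"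
  shows "integrable M (\<lambda>\<omega>. \<eta> \<omega> * g (incr s t \<omega>))"
    "expectation (\<lambda>\<omega>. \<eta> \<omega> * g (incr s t \<omega>)) = expectation \<eta> * expectation (\<lambda>\<omega>. g (incr s t \<omega>))"
  using indep_var_integrable[OF indep_var_F_incr[OF st \<eta>(1) g(1)] \<eta>(2) g(2)]
    indep_var_lebesgue_integral[OF indep_var_F_incr[OF st \<eta>(1) g(1)] \<eta>(2) g(2)] by auto

section \<open>Moments of the increments over one interval\<close>

lemma indep_incr:
  assumes st: "0 \<le> s" "s < t" "t \<le> T"
  shows "indep_vars (\<lambda>_. borel) (\<lambda>i \<omega>. B i t \<omega> - B i s \<omega>) {1..d}"
proof -
  \<comment> \<open>The partition with the single interval from \<open>s\<close> to
    \<open>t\<close>; its only index is 0.\<close>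
  let ?\<tau> = "\<lambda>k. if k = 0 then s else t"
  have "indep_vars (\<lambda>_. borel) (\<lambda>(i, k) \<omega>. B i (?\<tau> (Suc k)) \<omega> - B i (?\<tau> k) \<omega>) ({1..d} \<times> {..<1})"
    by (rule B_increments_indep) (use st in auto)
  from indep_vars_restrict[OF this, of "{1..d}" "\<lambda>i. {(i, 0)}"]
  have "indep_vars (\<lambda>i. \<Pi>\<^sub>M p\<in>{(i, 0::nat)}. borel)
      (\<lambda>i \<omega>. \<lambda>p\<in>{(i, 0)}. (case p of (i, k) \<Rightarrow> \<lambda>\<omega>. B i (?\<tau> (Suc k)) \<omega> - B i (?\<tau> k) \<omega>) \<omega>) {1..d}"
    by (auto simp: disjoint_family_on_def)
  then have "indep_vars (\<lambda>_. borel) (\<lambda>i \<omega>. (\<lambda>p\<in>{(i, 0)}. (case p of (i, k) \<Rightarrow> \<lambda>\<omega>. B i (?\<tau> (Suc k)) \<omega> - B i (?\<tau> k) \<omega>) \<omega>) (i, 0)) {1..d}"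
    by (rule indep_vars_compose2[where Y = "\<lambda>i f. f (i, 0)"]) (auto intro!: measurable_component_singleton)
  then show ?thesis by simp
qed

lemma incr_moments:
  assumes st: "0 \<le> s" "s \<le> t" "t \<le> T" and i: "i \<in> {1..d}"
  shows "square_integrable M (\<lambda>\<omega>. B i t \<omega> - B i s \<omega>)"
    "expectation (\<lambda>\<omega>. B i t \<omega> - B i s \<omega>) = 0"
    "j \<in> {1..d} \<Longrightarrow> expectation (\<lambda>\<omega>. (B i t \<omega> - B i s \<omega>) * (B j t \<omega> - B j s \<omega>)) = (if i = j then t - s else 0)"
proof -
  have *: "square_integrable M (\<lambda>\<omega>. B i t \<omega> - B i s \<omega>) \<and> expectation (\<lambda>\<omega>. B i t \<omega> - B i s \<omega>) = 0
    \<and> expectation (\<lambda>\<omega>. (B i t \<omega> - B i s \<omega>)\<^sup>2) = t - s" if "i \<in> {1..d}" for i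
  proof (cases "s = t")
    case False
    with st have "s < t" by simp
    then show ?thesis
      using normal_moments(1-3)[OF B_increment_distributed[OF that st(1) _ st(3)]] by simp
  qed (simp add: square_integrable_def)
  from *[OF i] show "square_integrable M (\<lambda>\<omega>. B i t \<omega> - B i s \<omega>)"
    "expectation (\<lambda>\<omega>. B i t \<omega> - B i s \<omega>) = 0" by auto
  assume j: "j \<in> {1..d}"
  show "expectation (\<lambda>\<omega>. (B i t \<omega> - B i s \<omega>) * (B j t \<omega> - B j s \<omega>)) = (if i = j then t - s else 0)"
  proof (cases "i = j \<or> s = t")
    case True
    then show ?thesis using *[OF i] by (auto simp: power2_eq_square)
  next
    case False
    then have "indep_vars (\<lambda>_. borel) (\<lambda>i \<omega>. B i t \<omega> - B i s \<omega>) {i, j}"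
      using st i j by (intro indep_vars_subset[OF indep_incr]) auto
    then have "expectation (\<lambda>\<omega>. \<Prod>k\<in>{i,j}. B k t \<omega> - B k s \<omega>) = (\<Prod>k\<in>{i,j}. expectation (\<lambda>\<omega>. B k t \<omega> - B k s \<omega>))"
      using *[OF i] *[OF j] by (intro indep_vars_lebesgue_integral) (auto intro: sqi_integrable)
    then show ?thesis using False *[OF i] by simp
  qed
qed

text \<open>By independence of the coordinates both expectations factor. In the second one
  coordinate \<open>a\<close> contributes a mixed moment and the others their characteristic
  functions.\<close>

lemma incr_iexp:
  fixes l :: "nat \<Rightarrow> real" and q :: real and Z :: "'a \<Rightarrow> complex"
  assumes st: "0 \<le> s" "s < t" "t \<le> T" and a: "a \<in> {1..d}"
  defines "q \<equiv> (\<Sum>i=1..d. (l i)\<^sup>2) * (t - s) / 2"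
  defines "Z \<equiv> (\<lambda>\<omega>. iexp (\<Sum>i=1..d. l i * (B i t \<omega> - B i s \<omega>)))"
  shows "expectation Z = complex_of_real (exp (- q))" 
    "expectation (\<lambda>\<omega>. (B a t \<omega> - B a s \<omega>) * Z \<omega>) = \<i> * complex_of_real (l a * (t - s) * exp (- q))"
proof -
  let ?D = "\<lambda>i \<omega>. B i t \<omega> - B i s \<omega>"
  note nm = normal_moments[OF B_increment_distributed[OF _ st]]
  have sq: "0 < sqrt (t - s)" "(sqrt (t - s))\<^sup>2 = t - s" using st by auto
  have Z: "Z \<omega> = (\<Prod>i=1..d. iexp (l i * ?D i \<omega>))" for \<omega>
    unfolding Z_def by (subst exp_sum[symmetric]) (auto simp: sum_distrib_left)
  have e: "(\<Prod>i=1..d. complex_of_real (exp (- (l i)\<^sup>2 * (t - s) / 2))) = complex_of_real (exp (- q))"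
  proof -
    have "(\<Prod>i=1..d. exp (- (l i)\<^sup>2 * (t - s) / 2)) = exp (\<Sum>i=1..d. - (l i)\<^sup>2 * (t - s) / 2)"
      by (simp add: exp_sum)
    also have "(\<Sum>i=1..d. - (l i)\<^sup>2 * (t - s) / 2) = - q"
      by (simp add: q_def sum_distrib_right sum_divide_distrib sum_negf)
    finally show ?thesis by (simp flip: of_real_prod)
  qed
  have "indep_vars (\<lambda>_. borel) (\<lambda>i \<omega>. iexp (l i * ?D i \<omega>)) {1..d}"
    by (rule indep_vars_compose2[OF indep_incr[OF st], where Y = "\<lambda>i x. iexp (l i * x)"]) measurable
  then have "expectation Z = (\<Prod>i=1..d. expectation (\<lambda>\<omega>. iexp (l i * ?D i \<omega>)))"
    unfolding Z by (intro indep_vars_lebesgue_integral) (auto intro!: nm(5)[unfolded of_real_mult of_real_diff] sq)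
  also have "\<dots> = (\<Prod>i=1..d. complex_of_real (exp (- (l i)\<^sup>2 * (t - s) / 2)))"
    using sq by (intro prod.cong refl) (subst nm(4), auto)
  finally show "expectation Z = complex_of_real (exp (- q))" using e by simp
  let ?Y = "\<lambda>i x. if i = a then complex_of_real x * iexp (l i * x) else iexp (l i * x)"
  have P: "(B a t \<omega> - B a s \<omega>) * Z \<omega> = (\<Prod>i=1..d. ?Y i (?D i \<omega>))" for \<omega>
  proof -
    have "(\<Prod>i=1..d. ?Y i (?D i \<omega>)) = ?Y a (?D a \<omega>) * (\<Prod>i\<in>{1..d} - {a}. ?Y i (?D i \<omega>))"
      by (rule prod.remove) (use a in auto)
    also have "(\<Prod>i\<in>{1..d} - {a}. ?Y i (?D i \<omega>)) = (\<Prod>i\<in>{1..d} - {a}. iexp (l i * ?D i \<omega>))"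
      by (rule prod.cong) auto
    finally show ?thesis
      unfolding Z using prod.remove[of "{1..d}" a "\<lambda>i. iexp (l i * ?D i \<omega>)"] a by (simp add: mult.assoc)
  qed
  have "indep_vars (\<lambda>_. borel) (\<lambda>i \<omega>. ?Y i (?D i \<omega>)) {1..d}"
    by (rule indep_vars_compose2[OF indep_incr[OF st], where Y = ?Y]) measurable
  then have "expectation (\<lambda>\<omega>. (B a t \<omega> - B a s \<omega>) * Z \<omega>) = (\<Prod>i=1..d. expectation (\<lambda>\<omega>. ?Y i (?D i \<omega>)))"
    unfolding P
  proof (intro indep_vars_lebesgue_integral)
    fix i assume "i \<in> {1..d}"
    then show "integrable M (\<lambda>\<omega>. ?Y i (?D i \<omega>))"
      using nm(5)[of i "l i"] nm(7)[of i "l i"] sq by (cases "i = a") auto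
  qed auto
  also have "\<dots> = (\<Prod>i=1..d. (if i = a then \<i> * complex_of_real (l a * (t - s)) else 1) * complex_of_real (exp (- (l i)\<^sup>2 * (t - s) / 2)))"
  proof (intro prod.cong refl)
    fix i assume "i \<in> {1..d}"
    then show "expectation (\<lambda>\<omega>. ?Y i (?D i \<omega>)) = (if i = a then \<i> * complex_of_real (l a * (t - s)) else 1) * complex_of_real (exp (- (l i)\<^sup>2 * (t - s) / 2))"
      using nm(4)[of i "l i"] nm(6)[of i "l i"] sq by (cases "i = a") auto
  qed
  also have "\<dots> = \<i> * complex_of_real (l a * (t - s) * exp (- q))"
    using a e by (simp add: prod.distrib)
  finally show "expectation (\<lambda>\<omega>. (B a t \<omega> - B a s \<omega>) * Z \<omega>) = \<i> * complex_of_real (l a * (t - s) * exp (- q))" .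
qed

lemma incr_trig:
  fixes l :: "nat \<Rightarrow> real" and q :: real
  assumes st: "0 \<le> s" "s < t" "t \<le> T" 
  defines "q \<equiv> (\<Sum>i=1..d. (l i)\<^sup>2) * (t - s) / 2"
  defines "X \<equiv> (\<lambda>\<omega>. \<Sum>i=1..d. l i * (B i t \<omega> - B i s \<omega>))"
  shows "expectation (\<lambda>\<omega>. cos (X \<omega>)) = exp (- q)" "expectation (\<lambda>\<omega>. sin (X \<omega>)) = 0"
    "a \<in> {1..d} \<Longrightarrow> expectation (\<lambda>\<omega>. (B a t \<omega> - B a s \<omega>) * cos (X \<omega>)) = 0"
    "a \<in> {1..d} \<Longrightarrow> expectation (\<lambda>\<omega>. (B a t \<omega> - B a s \<omega>) * sin (X \<omega>)) = l a * (t - s) * exp (- q)"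
proof -
  have [measurable]: "X \<in> borel_measurable M"
    unfolding X_def using st by (intro borel_measurable_sum borel_measurable_times borel_measurable_diff B_measurable) auto
  have i1: "integrable M (\<lambda>\<omega>. iexp (X \<omega>))"
    by (rule integrable_const_bound[where B = 1]) auto
  show "expectation (\<lambda>\<omega>. cos (X \<omega>)) = exp (- q)" "expectation (\<lambda>\<omega>. sin (X \<omega>)) = 0"
  proof -
    have "expectation (\<lambda>\<omega>. iexp (X \<omega>)) = complex_of_real (exp (- q))"
    \<comment> \<open>Without coordinates \<open>X\<close> is 0; otherwise coordinate 1 serves as
      the \<open>a\<close> of \<open>incr_iexp\<close>.\<close>
    proof (cases "d = 0")
      case True
      then show ?thesis by (simp add: X_def q_def prob_space)
    next
      case False
      then show ?thesis using incr_iexp(1)[OF st, of 1 l] by (simp add: X_def q_def)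
    qed
    then show "expectation (\<lambda>\<omega>. cos (X \<omega>)) = exp (- q)" "expectation (\<lambda>\<omega>. sin (X \<omega>)) = 0"
      using integral_Re[OF i1] integral_Im[OF i1] by (simp_all add: Re_exp Im_exp)
  qed
  assume a: "a \<in> {1..d}"
  have iD: "integrable M (\<lambda>\<omega>. B a t \<omega> - B a s \<omega>)"
    using st by (intro sqi_integrable incr_moments a) auto
  have i2: "integrable M (\<lambda>\<omega>. (B a t \<omega> - B a s \<omega>) * iexp (X \<omega>))"
  proof (rule Bochner_Integration.integrable_bound[OF iD])
    have [measurable]: "B a t \<in> borel_measurable M" "B a s \<in> borel_measurable M"
      using st a by auto
    show "(\<lambda>\<omega>. (B a t \<omega> - B a s \<omega>) * iexp (X \<omega>)) \<in> borel_measurable M" by measurable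
  qed (auto simp: norm_mult simp flip: of_real_diff)
  have "expectation (\<lambda>\<omega>. (B a t \<omega> - B a s \<omega>) * iexp (X \<omega>)) = \<i> * complex_of_real (l a * (t - s) * exp (- q))"
    using incr_iexp(2)[OF st a, of l] by (simp add: X_def q_def)
  then show "expectation (\<lambda>\<omega>. (B a t \<omega> - B a s \<omega>) * cos (X \<omega>)) = 0"
    "expectation (\<lambda>\<omega>. (B a t \<omega> - B a s \<omega>) * sin (X \<omega>)) = l a * (t - s) * exp (- q)"
    using integral_Re[OF i2] integral_Im[OF i2] by (simp_all add: Re_exp Im_exp)
qed

end

section \<open>Simple integrals\<close>

lemma integral_sum_list_mult:
  assumes "\<And>p. p \<in> set H \<Longrightarrow> square_integrable N (f p)" "\<And>q. q \<in> set K \<Longrightarrow> square_integrable N (g q)"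
  shows "(\<integral>x. (\<Sum>p\<leftarrow>H. f p x) * (\<Sum>q\<leftarrow>K. g q x) \<partial>N) = (\<Sum>p\<leftarrow>H. \<Sum>q\<leftarrow>K. \<integral>x. f p x * g q x \<partial>N)"
proof -
  have K: "(\<integral>x. h x * (\<Sum>q\<leftarrow>K. g q x) \<partial>N) = (\<Sum>q\<leftarrow>K. \<integral>x. h x * g q x \<partial>N)"
    if "square_integrable N h" for h
    using assms(2)
  proof (induction K)
    case (Cons q K)
    have "integrable N (\<lambda>x. h x * g q x)" "integrable N (\<lambda>x. h x * (\<Sum>q\<leftarrow>K. g q x))"
      using Cons.prems by (auto intro!: sqi_mult that sqi_sum_list)
    then show ?case using Cons by (simp add: distrib_left)
  qed simp
  show ?thesis using assms(1)
  proof (induction H)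
    case (Cons p H)
    have s: "square_integrable N (\<lambda>x. \<Sum>q\<leftarrow>K. g q x)" by (rule sqi_sum_list) (rule assms(2))
    have "integrable N (\<lambda>x. f p x * (\<Sum>q\<leftarrow>K. g q x))"
      "integrable N (\<lambda>x. (\<Sum>p\<leftarrow>H. f p x) * (\<Sum>q\<leftarrow>K. g q x))"
      using Cons.prems by (auto intro!: sqi_mult s sqi_sum_list)
    then show ?case using Cons K[of "f p"] by (simp add: distrib_right)
  qed simp
qed

lemma integral_indicator_Ioc_mult:
  "(\<integral>s. indicator {a<..b} s * indicator {a'<..b'} s \<partial>lborel) = max 0 (min b b' - max a a')"
  for a b a' b' :: real
proof -
  have "(\<lambda>s. indicator {a<..b} s * indicator {a'<..b'} s :: real) = indicator {max a a'<..min b b'}"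
    by (auto simp: indicator_def fun_eq_iff)
  then have "(\<integral>s. indicator {a<..b} s * indicator {a'<..b'} s \<partial>lborel) = measure lborel {max a a'<..min b b'}"
    by simp
  also have "measure lborel {c<..e} = max 0 (e - c)" for c e :: real
    by (cases "c \<le> e") auto
  finally show ?thesis .
qed

context brownian
begin

abbreviation P :: "(real \<times> 'a) measure" where "P \<equiv> lborel \<Otimes>\<^sub>M M"

sublocale P: pair_sigma_finite lborel M ..

section \<open>Inner products of increments with adapted coefficients\<close>

lemma incr_expectation_0:
  assumes st: "0 \<le> s" "s \<le> t" "t \<le> T" and i: "i \<in> {1..d}"
    and \<eta>: "\<eta> \<in> borel_measurable (F s)" "integrable M \<eta>"
  shows "integrable M (\<lambda>\<omega>. \<eta> \<omega> * (B i t \<omega> - B i s \<omega>))" "expectation (\<lambda>\<omega>. \<eta> \<omega> * (B i t \<omega> - B i s \<omega>)) = 0"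
proof -
  have "integrable M (\<lambda>\<omega>. \<eta> \<omega> * (B i t \<omega> - B i s \<omega>)) \<and> expectation (\<lambda>\<omega>. \<eta> \<omega> * (B i t \<omega> - B i s \<omega>)) = 0"
  proof (cases "s = t")
    case False
    have "(\<lambda>x. x i) \<in> borel_measurable (\<Pi>\<^sub>M i\<in>{1..d}. (borel :: real measure))"
      using i by (rule measurable_component_singleton)
    from F_incr_expectation[OF st(1) _ st(3) \<eta> this] incr_moments[OF st i] False st i
    show ?thesis by (simp add: incr_apply sqi_integrable)
  qed simp
  then show "integrable M (\<lambda>\<omega>. \<eta> \<omega> * (B i t \<omega> - B i s \<omega>))" "expectation (\<lambda>\<omega>. \<eta> \<omega> * (B i t \<omega> - B i s \<omega>)) = 0"
    by auto
qed

lemma incr_expectation_2: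
  assumes st: "0 \<le> s" "s \<le> t" "t \<le> T" and i: "i \<in> {1..d}" and j: "j \<in> {1..d}"
    and \<eta>: "\<eta> \<in> borel_measurable (F s)" "integrable M \<eta>"
  shows "integrable M (\<lambda>\<omega>. \<eta> \<omega> * ((B i t \<omega> - B i s \<omega>) * (B j t \<omega> - B j s \<omega>)))"
    "expectation (\<lambda>\<omega>. \<eta> \<omega> * ((B i t \<omega> - B i s \<omega>) * (B j t \<omega> - B j s \<omega>)))
       = (if i = j then (t - s) * expectation \<eta> else 0)"
proof -
  have "integrable M (\<lambda>\<omega>. \<eta> \<omega> * ((B i t \<omega> - B i s \<omega>) * (B j t \<omega> - B j s \<omega>))) \<and>
    expectation (\<lambda>\<omega>. \<eta> \<omega> * ((B i t \<omega> - B i s \<omega>) * (B j t \<omega> - B j s \<omega>)))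
       = (if i = j then (t - s) * expectation \<eta> else 0)"
  proof (cases "s = t")
    case False
    have "(\<lambda>x. x i * x j) \<in> borel_measurable (\<Pi>\<^sub>M i\<in>{1..d}. (borel :: real measure))"
      using i j by (intro borel_measurable_times measurable_component_singleton)
    from F_incr_expectation[OF st(1) _ st(3) \<eta> this] incr_moments[OF st i] incr_moments[OF st j] False st i j
      sqi_mult[OF incr_moments(1)[OF st i] incr_moments(1)[OF st j]]
    show ?thesis by (simp add: incr_apply)
  qed simp
  then show "integrable M (\<lambda>\<omega>. \<eta> \<omega> * ((B i t \<omega> - B i s \<omega>) * (B j t \<omega> - B j s \<omega>)))"
    "expectation (\<lambda>\<omega>. \<eta> \<omega> * ((B i t \<omega> - B i s \<omega>) * (B j t \<omega> - B j s \<omega>)))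
       = (if i = j then (t - s) * expectation \<eta> else 0)" by auto
qed

lemma sqi_mult_incr:
  assumes st: "0 \<le> s" "s \<le> t" "t \<le> T" and i: "i \<in> {1..d}"
    and \<eta>: "\<eta> \<in> borel_measurable (F s)" "square_integrable M \<eta>"
  shows "square_integrable M (\<lambda>\<omega>. \<eta> \<omega> * (B i t \<omega> - B i s \<omega>))"
proof -
  have [measurable]: "\<eta> \<in> borel_measurable M" using \<eta>(2) by (rule sqi_measurable)
  have [measurable]: "B i t \<in> borel_measurable M" "B i s \<in> borel_measurable M" using st i by auto
  have "integrable M (\<lambda>\<omega>. (\<eta> \<omega>)\<^sup>2 * ((B i t \<omega> - B i s \<omega>) * (B i t \<omega> - B i s \<omega>)))"
    using \<eta> by (intro incr_expectation_2 st i) (auto simp: square_integrable_def)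
  then show ?thesis
    by (simp add: square_integrable_def power_mult_distrib power2_eq_square[of "B i t _ - _"])
qed

lemma incr_term_inner_aux:
  assumes i: "i \<in> {1..d}" and j: "j \<in> {1..d}"
    and ab: "0 \<le> a" "a \<le> a'" "a' \<le> b" "b \<le> b'" "b' \<le> T"
    and \<xi>: "\<xi> \<in> borel_measurable (F a)" "square_integrable M \<xi>"
    and \<xi>': "\<xi>' \<in> borel_measurable (F a')" "square_integrable M \<xi>'"
  shows "expectation (\<lambda>\<omega>. (\<xi> \<omega> * (B i b \<omega> - B i a \<omega>)) * (\<xi>' \<omega> * (B j b' \<omega> - B j a' \<omega>)))
     = (if i = j then (b - a') * expectation (\<lambda>\<omega>. \<xi> \<omega> * \<xi>' \<omega>) else 0)"
proof -
  have m1: "\<xi> \<in> borel_measurable (F a')" "\<xi> \<in> borel_measurable (F b)" "\<xi>' \<in> borel_measurable (F b)"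
    using \<xi> \<xi>' ab by (auto intro: measurable_F_mono)
  have mB: "B k r \<in> borel_measurable (F a')" if "k \<in> {1..d}" "0 \<le> r" "r \<le> a'" for k r
    using that by (rule B_measurable_F)
  have mB': "B k r \<in> borel_measurable (F b)" if "k \<in> {1..d}" "0 \<le> r" "r \<le> b" for k r
    using that by (rule B_measurable_F)
  \<comment> \<open>The first increment is split at \<open>a'\<close> and the second at
    \<open>b\<close>. The coefficients \<open>?U\<close>, \<open>?V\<close> and \<open>?W\<close>
    are known before the Brownian factors that they multiply, and only \<open>?V\<close>, which
    meets two increments over the same interval, contributes.\<close>
  let ?U = "\<lambda>\<omega>. (\<xi> \<omega> * (B i a' \<omega> - B i a \<omega>)) * \<xi>' \<omega>"
  let ?V = "\<lambda>\<omega>. \<xi> \<omega> * \<xi>' \<omega>"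
  let ?W = "\<lambda>\<omega>. (\<xi> \<omega> * (B i b \<omega> - B i a \<omega>)) * \<xi>' \<omega>"
  have U: "?U \<in> borel_measurable (F a')" "integrable M ?U"
    using ab i by (intro borel_measurable_times borel_measurable_diff m1 mB \<xi>' sqi_mult sqi_mult_incr \<xi>; simp)+
  have V: "?V \<in> borel_measurable (F a')" "integrable M ?V"
    using ab i by (intro borel_measurable_times m1 \<xi>' sqi_mult \<xi>; simp)+
  have W: "?W \<in> borel_measurable (F b)" "integrable M ?W"
    using ab i by (intro borel_measurable_times borel_measurable_diff m1 mB' \<xi>' sqi_mult sqi_mult_incr \<xi>; simp)+
  have st: "0 \<le> a'" "b \<le> T" "0 \<le> b" using ab by auto
  note e1 = incr_expectation_0[OF st(1) ab(3) st(2) j U]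
  note e2 = incr_expectation_2[OF st(1) ab(3) st(2) i j V]
  note e3 = incr_expectation_0[OF st(3) ab(4) ab(5) j W]
  have "expectation (\<lambda>\<omega>. (\<xi> \<omega> * (B i b \<omega> - B i a \<omega>)) * (\<xi>' \<omega> * (B j b' \<omega> - B j a' \<omega>)))
     = expectation (\<lambda>\<omega>. ?U \<omega> * (B j b \<omega> - B j a' \<omega>)
         + ?V \<omega> * ((B i b \<omega> - B i a' \<omega>) * (B j b \<omega> - B j a' \<omega>)) + ?W \<omega> * (B j b' \<omega> - B j b \<omega>))"
    by (rule Bochner_Integration.integral_cong) (auto simp: algebra_simps)
  also have "\<dots> = (if i = j then (b - a') * expectation ?V else 0)"
    using e1 e2 e3 by simp
  finally show ?thesis .
qed

text \<open>The factor \<open>max 0 (min b b' - max a a')\<close> is the length of the intersection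
  of the two intervals. By symmetry the first interval may be assumed to start first. The intervals
  are then disjoint, overlapping or nested, and whatever sticks out beyond the intersection has
  expectation 0.\<close>

lemma incr_term_inner:
  assumes i: "i \<in> {1..d}" and j: "j \<in> {1..d}"
    and ab: "0 \<le> a" "a \<le> b" "b \<le> T" and ab': "0 \<le> a'" "a' \<le> b'" "b' \<le> T"
    and \<xi>: "\<xi> \<in> borel_measurable (F a)" "square_integrable M \<xi>"
    and \<xi>': "\<xi>' \<in> borel_measurable (F a')" "square_integrable M \<xi>'"
  shows "expectation (\<lambda>\<omega>. (\<xi> \<omega> * (B i b \<omega> - B i a \<omega>)) * (\<xi>' \<omega> * (B j b' \<omega> - B j a' \<omega>)))
     = (if i = j then max 0 (min b b' - max a a') * expectation (\<lambda>\<omega>. \<xi> \<omega> * \<xi>' \<omega>) else 0)"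
proof -
  have main: "expectation (\<lambda>\<omega>. (\<xi> \<omega> * (B i b \<omega> - B i a \<omega>)) * (\<xi>' \<omega> * (B j b' \<omega> - B j a' \<omega>)))
     = (if i = j then max 0 (min b b' - max a a') * expectation (\<lambda>\<omega>. \<xi> \<omega> * \<xi>' \<omega>) else 0)"
    if i: "i \<in> {1..d}" and j: "j \<in> {1..d}"
      and ab: "0 \<le> a" "a \<le> b" "b \<le> T" and ab': "a \<le> a'" "a' \<le> b'" "b' \<le> T"
      and \<xi>: "\<xi> \<in> borel_measurable (F a)" "square_integrable M \<xi>"
      and \<xi>': "\<xi>' \<in> borel_measurable (F a')" "square_integrable M \<xi>'"
    for i j a b a' b' \<xi> \<xi>'
  proof (cases "b \<le> a'")
    case True
    let ?W = "\<lambda>\<omega>. (\<xi> \<omega> * (B i b \<omega> - B i a \<omega>)) * \<xi>' \<omega>"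
    have "\<xi> \<in> borel_measurable (F a')" "B i b \<in> borel_measurable (F a')" "B i a \<in> borel_measurable (F a')"
      using \<xi> ab ab' True i by (auto intro: measurable_F_mono B_measurable_F)
    then have "?W \<in> borel_measurable (F a')" using \<xi>'(1) by measurable
    moreover have "integrable M ?W" using ab by (intro sqi_mult sqi_mult_incr \<xi> \<xi>' i) auto
    ultimately show ?thesis
      using incr_expectation_0(2)[of a' b' j ?W] True ab ab' j by (simp add: mult.assoc)
  next
    case b: False
    show ?thesis
    proof (cases "b \<le> b'")
      case True
      then show ?thesis
        using incr_term_inner_aux[OF i j ab(1) ab'(1) _ True ab'(3) \<xi> \<xi>'] b ab' by simp
    next
      case False
      let ?W = "\<lambda>\<omega>. \<xi> \<omega> * (\<xi>' \<omega> * (B j b' \<omega> - B j a' \<omega>))"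
      have "\<xi> \<in> borel_measurable (F b')" "\<xi>' \<in> borel_measurable (F b')"
        "B j b' \<in> borel_measurable (F b')" "B j a' \<in> borel_measurable (F b')"
        using \<xi> \<xi>' ab ab' j by (auto intro: measurable_F_mono B_measurable_F)
      then have W: "?W \<in> borel_measurable (F b')" by measurable
      have iW: "integrable M ?W" using ab ab' by (intro sqi_mult sqi_mult_incr \<xi> \<xi>' j) auto
      have e1: "integrable M (\<lambda>\<omega>. ?W \<omega> * (B i b \<omega> - B i b' \<omega>))"
        "expectation (\<lambda>\<omega>. ?W \<omega> * (B i b \<omega> - B i b' \<omega>)) = 0"
        using incr_expectation_0[of b' b i ?W] W iW False ab ab' i by auto
      have e2: "expectation (\<lambda>\<omega>. (\<xi> \<omega> * (B i b' \<omega> - B i a \<omega>)) * (\<xi>' \<omega> * (B j b' \<omega> - B j a' \<omega>)))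
          = (if i = j then (b' - a') * expectation (\<lambda>\<omega>. \<xi> \<omega> * \<xi>' \<omega>) else 0)"
        using ab ab' by (intro incr_term_inner_aux i j \<xi> \<xi>') auto
      have i2: "integrable M (\<lambda>\<omega>. (\<xi> \<omega> * (B i b' \<omega> - B i a \<omega>)) * (\<xi>' \<omega> * (B j b' \<omega> - B j a' \<omega>)))"
        using ab ab' by (intro sqi_mult sqi_mult_incr \<xi> \<xi>' i j) auto
      have "expectation (\<lambda>\<omega>. (\<xi> \<omega> * (B i b \<omega> - B i a \<omega>)) * (\<xi>' \<omega> * (B j b' \<omega> - B j a' \<omega>)))
        = expectation (\<lambda>\<omega>. (\<xi> \<omega> * (B i b' \<omega> - B i a \<omega>)) * (\<xi>' \<omega> * (B j b' \<omega> - B j a' \<omega>))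
            + ?W \<omega> * (B i b \<omega> - B i b' \<omega>))"
        by (rule Bochner_Integration.integral_cong) (auto simp: algebra_simps)
      also have "\<dots> = (if i = j then (b' - a') * expectation (\<lambda>\<omega>. \<xi> \<omega> * \<xi>' \<omega>) else 0)"
        using e1 e2 i2 by simp
      finally show ?thesis using False ab' by simp
    qed
  qed
  show ?thesis
  proof (cases "a \<le> a'")
    case True
    then show ?thesis using assms by (intro main) auto
  next
    case False
    then have "expectation (\<lambda>\<omega>. (\<xi>' \<omega> * (B j b' \<omega> - B j a' \<omega>)) * (\<xi> \<omega> * (B i b \<omega> - B i a \<omega>)))
     = (if j = i then max 0 (min b' b - max a' a) * expectation (\<lambda>\<omega>. \<xi>' \<omega> * \<xi> \<omega>) else 0)"
      using assms by (intro main) auto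
    moreover have "(\<lambda>\<omega>. (\<xi>' \<omega> * (B j b' \<omega> - B j a' \<omega>)) * (\<xi> \<omega> * (B i b \<omega> - B i a \<omega>)))
      = (\<lambda>\<omega>. (\<xi> \<omega> * (B i b \<omega> - B i a \<omega>)) * (\<xi>' \<omega> * (B j b' \<omega> - B j a' \<omega>)))"
      "(\<lambda>\<omega>. \<xi>' \<omega> * \<xi> \<omega>) = (\<lambda>\<omega>. \<xi> \<omega> * \<xi>' \<omega>)"
      by (simp_all only: fun_eq_iff mult.commute simp_thms)
    ultimately show ?thesis by (cases "i = j") (simp_all only: min.commute[of b'] max.commute[of a'] refl if_True if_False not_sym eq_commute[of j i])
  qed
qed

section \<open>Simple processes on the product space and their isometry\<close>

definition sv :: "(real \<times> real \<times> ('a \<Rightarrow> real)) list \<Rightarrow> real \<times> 'a \<Rightarrow> real" where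
  "sv H = (\<lambda>(s, \<omega>). simple_value H s \<omega>)"

lemma sqi_P_mult:
  assumes "square_integrable lborel f" "square_integrable M g"
  shows "square_integrable P (\<lambda>(s, \<omega>). g \<omega> * f s)"
proof -
  note [measurable] = assms[THEN sqi_measurable]
  have "(\<integral>\<^sup>+p. ennreal ((case p of (s, \<omega>) \<Rightarrow> g \<omega> * f s)\<^sup>2) \<partial>P)
      = (\<integral>\<^sup>+s. \<integral>\<^sup>+\<omega>. ennreal ((g \<omega> * f s)\<^sup>2) \<partial>M \<partial>lborel)"
    by (subst nn_integral_fst[symmetric]) auto
  also have "\<dots> = (\<integral>\<^sup>+s. (\<integral>\<^sup>+\<omega>. ennreal ((g \<omega>)\<^sup>2) \<partial>M) * ennreal ((f s)\<^sup>2) \<partial>lborel)"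
    by (simp add: power_mult_distrib ennreal_mult nn_integral_multc)
  also have "\<dots> = (\<integral>\<^sup>+\<omega>. ennreal ((g \<omega>)\<^sup>2) \<partial>M) * (\<integral>\<^sup>+s. ennreal ((f s)\<^sup>2) \<partial>lborel)"
    by (simp add: nn_integral_cmult)
  also have "\<dots> < \<infinity>"
    using assms by (auto simp: sqi_iff_nn ennreal_mult_less_top)
  finally show ?thesis by (simp add: sqi_iff_nn)
qed

lemma sqi_indicator_Ioc [simp]: "square_integrable lborel (\<lambda>s::real. indicator {a<..b} s)"
proof -
  have "integrable lborel (indicator {a<..b} :: real \<Rightarrow> real)"
  proof (rule integrable_real_indicator)
    show "emeasure lborel {a<..b} < \<infinity>" by (cases "a \<le> b") (simp_all add: emeasure_lborel_Ioc)
  qed simp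
  then show ?thesis
    by (simp add: square_integrable_def power2_eq_square flip: indicator_inter_arith)
qed

lemma integral_P_mult:
  assumes "square_integrable lborel f" "square_integrable M g" "square_integrable lborel f'" "square_integrable M g'"
  shows "(\<integral>p. (case p of (s, \<omega>) \<Rightarrow> g \<omega> * f s) * (case p of (s, \<omega>) \<Rightarrow> g' \<omega> * f' s) \<partial>P)
     = (\<integral>s. f s * f' s \<partial>lborel) * expectation (\<lambda>\<omega>. g \<omega> * g' \<omega>)"
proof -
  have "integrable P (\<lambda>p. (case p of (s, \<omega>) \<Rightarrow> g \<omega> * f s) * (case p of (s, \<omega>) \<Rightarrow> g' \<omega> * f' s))"
    by (intro sqi_mult sqi_P_mult assms)
  from P.integral_fst'[OF this]
  have "(\<integral>p. (case p of (s, \<omega>) \<Rightarrow> g \<omega> * f s) * (case p of (s, \<omega>) \<Rightarrow> g' \<omega> * f' s) \<partial>P)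
     = (\<integral>s. \<integral>\<omega>. (f s * f' s) * (g \<omega> * g' \<omega>) \<partial>M \<partial>lborel)" by (simp add: mult_ac)
  then show ?thesis by (simp add: mult.commute)
qed

lemma simple_processD:
  assumes "simple_process M F t H" "(a, b, \<xi>) \<in> set H"
  shows "0 \<le> a" "a \<le> b" "b \<le> t" "\<xi> \<in> borel_measurable (F a)" "square_integrable M \<xi>"
  using assms by (auto simp: simple_process_def)

lemma simple_process_mono: "simple_process M F s H \<Longrightarrow> s \<le> t \<Longrightarrow> simple_process M F t H"
  by (fastforce simp: simple_process_def)

lemma sqi_sv:
  assumes H: "simple_process M F t H"
  shows "square_integrable P (sv H)"
proof -
  have "square_integrable P (\<lambda>p. \<Sum>q\<leftarrow>H. (case p of (s, \<omega>) \<Rightarrow> snd (snd q) \<omega> * indicator {fst q<..fst (snd q)} s))"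
    using H by (intro sqi_sum_list sqi_P_mult) (auto dest: simple_processD)
  moreover have "sv H = (\<lambda>p. \<Sum>q\<leftarrow>H. (case p of (s, \<omega>) \<Rightarrow> snd (snd q) \<omega> * indicator {fst q<..fst (snd q)} s))"
    by (auto simp: sv_def simple_value_def fun_eq_iff case_prod_unfold)
  ultimately show ?thesis by simp
qed

lemma sqi_simple_integral:
  assumes H: "simple_process M F t H" and t: "t \<le> T" and i: "i \<in> {1..d}"
  shows "square_integrable M (simple_integral (B i) H)"
proof -
  have "square_integrable M (\<lambda>\<omega>. \<Sum>q\<leftarrow>H. snd (snd q) \<omega> * (B i (fst (snd q)) \<omega> - B i (fst q) \<omega>))"
  proof (rule sqi_sum_list)
    fix q assume "q \<in> set H"
    then show "square_integrable M (\<lambda>\<omega>. snd (snd q) \<omega> * (B i (fst (snd q)) \<omega> - B i (fst q) \<omega>))"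
      using simple_processD[OF H, of "fst q" "fst (snd q)" "snd (snd q)"] t
      by (intro sqi_mult_incr i) auto
  qed
  moreover have "simple_integral (B i) H = (\<lambda>\<omega>. \<Sum>q\<leftarrow>H. snd (snd q) \<omega> * (B i (fst (snd q)) \<omega> - B i (fst q) \<omega>))"
    by (auto simp: simple_integral_def fun_eq_iff case_prod_unfold)
  ultimately show ?thesis by simp
qed

text \<open>Terms are compared in pairs: on both sides a pair contributes the length of the
  intersection of its intervals times the expectation of the product of its coefficients.
  Overlapping intervals thus need no common refinement.\<close>

lemma simple_isometry:
  assumes H: "simple_process M F T H" and H': "simple_process M F T H'"
    and i: "i \<in> {1..d}" and j: "j \<in> {1..d}"
  shows "expectation (\<lambda>\<omega>. simple_integral (B i) H \<omega> * simple_integral (B j) H' \<omega>)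
     = (if i = j then (\<integral>p. sv H p * sv H' p \<partial>P) else 0)"
proof -
  let ?f = "\<lambda>i q \<omega>. snd (snd q) \<omega> * (B i (fst (snd q)) \<omega> - B i (fst q) \<omega>)"
  let ?g = "\<lambda>q p. (case p of (s, \<omega>) \<Rightarrow> snd (snd q) \<omega> * (indicator {fst q<..fst (snd q)} s :: real))"
  have f: "simple_integral (B i) H = (\<lambda>\<omega>. \<Sum>q\<leftarrow>H. ?f i q \<omega>)" for i H
    by (auto simp: simple_integral_def fun_eq_iff case_prod_unfold)
  have g: "sv H = (\<lambda>p. \<Sum>q\<leftarrow>H. ?g q p)" for H
    by (auto simp: sv_def simple_value_def fun_eq_iff case_prod_unfold)
  have qD: "0 \<le> fst q" "fst q \<le> fst (snd q)" "fst (snd q) \<le> T" "snd (snd q) \<in> borel_measurable (F (fst q))"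
    "square_integrable M (snd (snd q))" if "q \<in> set H \<or> q \<in> set H'" for q
    using that simple_processD[OF H, of "fst q" "fst (snd q)" "snd (snd q)"]
      simple_processD[OF H', of "fst q" "fst (snd q)" "snd (snd q)"] by auto
  have sf: "square_integrable M (?f i q)" if "q \<in> set H \<or> q \<in> set H'" "i \<in> {1..d}" for q i
    using qD[OF that(1)] that(2) by (intro sqi_mult_incr) auto
  have sg: "square_integrable P (?g q)" if "q \<in> set H \<or> q \<in> set H'" for q
    using qD[OF that(1)] by (intro sqi_P_mult) auto
  have "expectation (\<lambda>\<omega>. simple_integral (B i) H \<omega> * simple_integral (B j) H' \<omega>)
     = (\<Sum>q\<leftarrow>H. \<Sum>r\<leftarrow>H'. \<integral>\<omega>. ?f i q \<omega> * ?f j r \<omega> \<partial>M)"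
    unfolding f by (rule integral_sum_list_mult) (auto intro!: sf i j)
  also have "\<dots> = (\<Sum>q\<leftarrow>H. \<Sum>r\<leftarrow>H'. (if i = j then \<integral>p. ?g q p * ?g r p \<partial>P else 0))"
  proof (intro arg_cong[where f = sum_list] map_cong refl)
    fix q r assume q: "q \<in> set H" and r: "r \<in> set H'"
    have "(\<integral>\<omega>. ?f i q \<omega> * ?f j r \<omega> \<partial>M)
       = (if i = j then max 0 (min (fst (snd q)) (fst (snd r)) - max (fst q) (fst r))
            * expectation (\<lambda>\<omega>. snd (snd q) \<omega> * snd (snd r) \<omega>) else 0)"
      using qD[of q] qD[of r] q r by (intro incr_term_inner i j) auto
    also have "\<dots> = (if i = j then \<integral>p. ?g q p * ?g r p \<partial>P else 0)"
      using qD[of q] qD[of r] q r by (simp add: integral_P_mult integral_indicator_Ioc_mult)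
    finally show "(\<integral>\<omega>. ?f i q \<omega> * ?f j r \<omega> \<partial>M) = (if i = j then \<integral>p. ?g q p * ?g r p \<partial>P else 0)" .
  qed
  also have "\<dots> = (if i = j then (\<integral>p. sv H p * sv H' p \<partial>P) else 0)"
    unfolding g by (subst integral_sum_list_mult) (auto intro!: sg)
  finally show ?thesis .
qed

text \<open>Terms that start after \<open>t\<close> are removed, because replacing their end by
  \<open>min b t\<close> would make it precede the start.\<close>

definition trunc :: "real \<Rightarrow> (real \<times> real \<times> ('a \<Rightarrow> real)) list \<Rightarrow> (real \<times> real \<times> ('a \<Rightarrow> real)) list" where
  "trunc t H = map (\<lambda>(a, b, \<xi>). (a, min b t, \<xi>)) (filter (\<lambda>(a, b, \<xi>). a \<le> t) H)"

definition scale_list :: "real \<Rightarrow> (real \<times> real \<times> ('a \<Rightarrow> real)) list \<Rightarrow> (real \<times> real \<times> ('a \<Rightarrow> real)) list" where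
  "scale_list c H = map (\<lambda>(a, b, \<xi>). (a, b, \<lambda>\<omega>. c * \<xi> \<omega>)) H"

lemma simple_process_trunc: "simple_process M F u H \<Longrightarrow> t \<le> u \<Longrightarrow> simple_process M F t (trunc t H)"
  by (fastforce simp: simple_process_def trunc_def)

lemma simple_process_append:
  "simple_process M F t (H @ H') \<longleftrightarrow> simple_process M F t H \<and> simple_process M F t H'"
  unfolding simple_process_def set_append ball_Un ..

lemma simple_process_scale: "simple_process M F t H \<Longrightarrow> simple_process M F t (scale_list c H)"
  by (fastforce simp: simple_process_def scale_list_def intro: sqi_scale)

lemma sv_append: "sv (H @ H') = (\<lambda>p. sv H p + sv H' p)"
  by (auto simp: sv_def simple_value_def fun_eq_iff)

lemma sv_scale: "sv (scale_list c H) = (\<lambda>p. c * sv H p)"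
  by (induction H) (auto simp: sv_def simple_value_def scale_list_def fun_eq_iff algebra_simps)

lemma sv_trunc: "sv (trunc t H) (s, \<omega>) = indicator {..t} s * sv H (s, \<omega>)"
  by (induction H) (auto simp: sv_def simple_value_def trunc_def indicator_def distrib_left)

text \<open>In this form, continuity in \<open>t\<close> is apparent.\<close>

definition spath :: "nat \<Rightarrow> (real \<times> real \<times> ('a \<Rightarrow> real)) list \<Rightarrow> real \<Rightarrow> 'a \<Rightarrow> real" where
  "spath i H t \<omega> = (\<Sum>(a, b, \<xi>)\<leftarrow>H. \<xi> \<omega> * (B i (min b t) \<omega> - B i (min a t) \<omega>))"

lemma spath_trunc:
  assumes "simple_process M F u H"
  shows "spath i H t = simple_integral (B i) (trunc t H)"
  using assms
proof (induction H)
  case (Cons p H)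
  obtain a b \<xi> where p: "p = (a, b, \<xi>)" by (cases p) auto
  have "a \<le> b" using Cons.prems by (auto simp: p simple_process_def)
  moreover have "simple_process M F u H" using Cons.prems by (auto simp: simple_process_def)
  ultimately show ?case
    using Cons.IH by (auto simp: p spath_def simple_integral_def trunc_def fun_eq_iff)
qed (simp add: spath_def simple_integral_def trunc_def fun_eq_iff)

lemma spath_T: "simple_process M F T H \<Longrightarrow> spath i H T = simple_integral (B i) H"
proof (induction H)
  case (Cons p H)
  obtain a b \<xi> where p: "p = (a, b, \<xi>)" by (cases p) auto
  have "a \<le> b" "b \<le> T" using Cons.prems by (auto simp: p simple_process_def)
  moreover have "simple_process M F T H" using Cons.prems by (auto simp: simple_process_def)
  ultimately show ?case
    using Cons.IH by (auto simp: p spath_def simple_integral_def fun_eq_iff)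
qed (simp add: spath_def simple_integral_def fun_eq_iff)

lemma spath_append: "spath i (H @ H') t \<omega> = spath i H t \<omega> + spath i H' t \<omega>"
  by (simp add: spath_def)

lemma spath_scale: "spath i (scale_list c H) t \<omega> = c * spath i H t \<omega>"
  by (induction H) (auto simp: spath_def scale_list_def algebra_simps)

lemma spath_measurable_F:
  assumes H: "simple_process M F T H" and t: "0 \<le> t" and i: "i \<in> {1..d}"
  shows "spath i H t \<in> borel_measurable (F t)"
  using H
proof (induction H)
  case (Cons p H)
  obtain a b \<xi> where p: "p = (a, b, \<xi>)" by (cases p) auto
  have ab: "0 \<le> a" "a \<le> b" and \<xi>: "\<xi> \<in> borel_measurable (F a)"
    using Cons.prems by (auto simp: p simple_process_def)
  have "(\<lambda>\<omega>. \<xi> \<omega> * (B i (min b t) \<omega> - B i (min a t) \<omega>)) \<in> borel_measurable (F t)"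
  proof (cases "a \<le> t")
    case True
    have [measurable]: "\<xi> \<in> borel_measurable (F t)" using \<xi> True by (rule measurable_F_mono)
    have [measurable]: "B i (min b t) \<in> borel_measurable (F t)" "B i (min a t) \<in> borel_measurable (F t)"
      using ab t i by (auto intro!: B_measurable_F)
    show ?thesis by measurable
  next
    case False
    then have "min b t = t" "min a t = t" using ab by auto
    then show ?thesis by simp
  qed
  moreover have "spath i H t \<in> borel_measurable (F t)"
    using Cons by (auto simp: simple_process_def)
  ultimately have "(\<lambda>\<omega>. \<xi> \<omega> * (B i (min b t) \<omega> - B i (min a t) \<omega>) + spath i H t \<omega>) \<in> borel_measurable (F t)"
    by measurable
  moreover have "spath i (p # H) t = (\<lambda>\<omega>. \<xi> \<omega> * (B i (min b t) \<omega> - B i (min a t) \<omega>) + spath i H t \<omega>)"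
    by (auto simp: spath_def p)
  ultimately show ?case by simp
qed (simp add: spath_def[abs_def])

section \<open>The martingale property and the maximal inequality\<close>

lemma sqi_spath:
  assumes H: "simple_process M F T H" and t: "0 \<le> t" "t \<le> T" and i: "i \<in> {1..d}"
  shows "square_integrable M (spath i H t)"
  unfolding spath_trunc[OF H] by (rule sqi_simple_integral[OF simple_process_trunc[OF H t(2)] t(2) i])

lemma spath_martingale:
  assumes H: "simple_process M F T H" and st: "0 \<le> s" "s \<le> t" "t \<le> T" and i: "i \<in> {1..d}"
    and \<eta>: "\<eta> \<in> borel_measurable (F s)" "square_integrable M \<eta>"
  shows "expectation (\<lambda>\<omega>. \<eta> \<omega> * (spath i H t \<omega> - spath i H s \<omega>)) = 0"
  using H
proof (induction H)
  case (Cons p H)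
  obtain a b \<xi> where p: "p = (a, b, \<xi>)" by (cases p) auto
  have ab: "0 \<le> a" "a \<le> b" "b \<le> T" and \<xi>: "\<xi> \<in> borel_measurable (F a)" "square_integrable M \<xi>"
    using Cons.prems by (auto simp: p simple_process_def)
  have H: "simple_process M F T H" using Cons.prems by (auto simp: simple_process_def)
  let ?u = "\<lambda>\<omega>. \<eta> \<omega> * (\<xi> \<omega> * (B i (min b t) \<omega> - B i (min a t) \<omega>) - \<xi> \<omega> * (B i (min b s) \<omega> - B i (min a s) \<omega>))"
  have u: "integrable M ?u \<and> expectation ?u = 0"
  proof -
    \<comment> \<open>Between \<open>s\<close> and \<open>t\<close> the term moves only from time
      \<open>max s a\<close> to \<open>min b t\<close>, and at its start both \<open>\<eta>\<close>
      and \<open>\<xi>\<close> are known. The outer \<open>max\<close> in the next formula makes the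
      increment vanish when this interval is empty.\<close>
    define c where "c = max s a"
    have "integrable M (\<lambda>\<omega>. (\<eta> \<omega> * \<xi> \<omega>) * (B i (max c (min b t)) \<omega> - B i c \<omega>))
      \<and> expectation (\<lambda>\<omega>. (\<eta> \<omega> * \<xi> \<omega>) * (B i (max c (min b t)) \<omega> - B i c \<omega>)) = 0"
    proof (cases "c \<le> T")
      case True
      have [measurable]: "\<eta> \<in> borel_measurable (F c)" "\<xi> \<in> borel_measurable (F c)"
        using \<eta> \<xi> by (auto intro: measurable_F_mono simp: c_def)
      have "(\<lambda>\<omega>. \<eta> \<omega> * \<xi> \<omega>) \<in> borel_measurable (F c)" by measurable
      then show ?thesis
        using True ab st sqi_mult[OF \<eta>(2) \<xi>(2)] i
          incr_expectation_0[of c "max c (min b t)" i "\<lambda>\<omega>. \<eta> \<omega> * \<xi> \<omega>"] by (auto simp: c_def)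
    next
      case False
      then show ?thesis using st ab by (auto simp: c_def)
    qed
    moreover have "?u \<omega> = (\<eta> \<omega> * \<xi> \<omega>) * (B i (max c (min b t)) \<omega> - B i c \<omega>)" for \<omega>
    proof -
      consider "a < s" "b \<le> s" | "a = s" "b = s" | "a \<le> s" "s < b" | "s < a" "a \<le> t" | "t < a" using ab by linarith
      then show ?thesis
        by cases (use ab st in \<open>auto simp: c_def min_def max_def algebra_simps\<close>)
    qed
    ultimately show ?thesis by (simp only:)
  qed
  have "integrable M (\<lambda>\<omega>. \<eta> \<omega> * (spath i H t \<omega> - spath i H s \<omega>))"
    using st by (intro sqi_mult sqi_diff sqi_spath \<eta> H i) auto
  then have "expectation (\<lambda>\<omega>. ?u \<omega> + \<eta> \<omega> * (spath i H t \<omega> - spath i H s \<omega>)) = 0"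
    using u Cons.IH[OF H] by simp
  moreover have "?u \<omega> + \<eta> \<omega> * (spath i H t \<omega> - spath i H s \<omega>) = \<eta> \<omega> * (spath i (p # H) t \<omega> - spath i (p # H) s \<omega>)" for \<omega>
    by (simp add: spath_def p algebra_simps)
  ultimately show ?case by simp
qed (simp add: spath_def)

text \<open>Doob's argument: on the event \<open>A k\<close> that the level is exceeded first at
  step k, the martingale property bounds the integral of S_k^2 by that of S_T^2, and these events
  are disjoint.\<close>

lemma spath_maximal_finite:
  fixes \<tau> :: "nat \<Rightarrow> real"
  assumes H: "simple_process M F T H" and i: "i \<in> {1..d}" and \<tau>: "mono \<tau>" "0 \<le> \<tau> 0" "\<tau> n \<le> T" and l: "0 < l"
  shows "prob {\<omega> \<in> space M. \<exists>k\<le>n. l < \<bar>spath i H (\<tau> k) \<omega>\<bar>} \<le> expectation (\<lambda>\<omega>. (spath i H T \<omega>)\<^sup>2) / l\<^sup>2"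
proof -
  let ?S = "\<lambda>k. spath i H (\<tau> k)" and ?ST = "spath i H T"
  define A where "A k = {\<omega> \<in> space M. l < \<bar>?S k \<omega>\<bar> \<and> (\<forall>j<k. \<not> l < \<bar>?S j \<omega>\<bar>)}" for k
  have \<tau>k: "0 \<le> \<tau> k" "k \<le> n \<Longrightarrow> \<tau> k \<le> T" for k
    using monoD[OF \<tau>(1), of 0 k] monoD[OF \<tau>(1), of k n] \<tau> by auto
  have mF: "?S j \<in> borel_measurable (F (\<tau> k))" if "j \<le> k" for j k
    using measurable_F_mono[OF spath_measurable_F[OF H \<tau>k(1) i]] monoD[OF \<tau>(1) that] by blast
  have AF: "A k \<in> sets (F (\<tau> k))" for k
  proof -
    have L: "{\<omega> \<in> space (F (\<tau> k)). l < \<bar>?S j \<omega>\<bar>} \<in> sets (F (\<tau> k))" if "j \<le> k" for j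
      using borel_measurable_abs[OF mF[OF that]] by (simp add: borel_measurable_iff_greater)
    have "{\<omega> \<in> space (F (\<tau> k)). l < \<bar>?S k \<omega>\<bar> \<and> (\<forall>j\<in>{..<k}. \<not> l < \<bar>?S j \<omega>\<bar>)} \<in> sets (F (\<tau> k))"
      by (intro sets.sets_Collect_conj sets.sets_Collect_finite_All' sets.sets_Collect_finite_All sets.sets_Collect_neg L) auto
    moreover have "{\<omega> \<in> space (F (\<tau> k)). l < \<bar>?S k \<omega>\<bar> \<and> (\<forall>j\<in>{..<k}. \<not> l < \<bar>?S j \<omega>\<bar>)} = A k"
      unfolding A_def space_F by blast
    ultimately show ?thesis by metis
  qed
  then have AM: "k \<le> n \<Longrightarrow> A k \<in> events" for k using sets_F_subset[OF \<tau>k(2)] by auto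
  have disj: "disjoint_family_on A {..n}"
    by (auto simp: disjoint_family_on_def A_def) (metis linorder_neqE_nat)
  have U: "{\<omega> \<in> space M. \<exists>k\<le>n. l < \<bar>?S k \<omega>\<bar>} = (\<Union>k\<in>{..n}. A k)"
  proof safe
    fix \<omega> k assume \<omega>: "\<omega> \<in> space M" "k \<le> n" "l < \<bar>?S k \<omega>\<bar>"
    define m where "m = (LEAST k. l < \<bar>?S k \<omega>\<bar>)"
    have "l < \<bar>?S m \<omega>\<bar>" unfolding m_def using \<omega>(3) by (rule LeastI)
    moreover have "m \<le> k" unfolding m_def using \<omega>(3) by (rule Least_le)
    moreover have "\<not> l < \<bar>?S j \<omega>\<bar>" if "j < m" for j using that unfolding m_def by (rule not_less_Least)
    ultimately show "\<omega> \<in> (\<Union>k\<in>{..n}. A k)" using \<omega> by (auto simp: A_def)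
  qed (auto simp: A_def)
  have sT: "square_integrable M ?ST" using T_pos by (intro sqi_spath H i) auto
  have iA: "integrable M (\<lambda>\<omega>. indicator (A k) \<omega> * (?ST \<omega>)\<^sup>2)" if "k \<le> n" for k
    using integrable_mult_indicator[OF AM[OF that] sqi_integrable_sq[OF sT]] by simp
  have trm: "l\<^sup>2 * prob (A k) \<le> expectation (\<lambda>\<omega>. indicator (A k) \<omega> * (?ST \<omega>)\<^sup>2)" if k: "k \<le> n" for k
  proof -
    let ?\<eta> = "\<lambda>\<omega>. indicator (A k) \<omega> * ?S k \<omega>"
    have sk: "square_integrable M (?S k)" using \<tau>k k by (intro sqi_spath H i) auto
    have [measurable]: "A k \<in> events" using AM k by auto
    have s\<eta>: "square_integrable M ?\<eta>"
      by (rule sqi_mult_bounded[where c = 1]) (use sk in \<open>auto simp: indicator_def\<close>)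
    have [measurable]: "A k \<in> sets (F (\<tau> k))" "?S k \<in> borel_measurable (F (\<tau> k))" using AF mF by auto
    have "?\<eta> \<in> borel_measurable (F (\<tau> k))" by measurable
    then have 0: "expectation (\<lambda>\<omega>. ?\<eta> \<omega> * (?ST \<omega> - ?S k \<omega>)) = 0"
      using \<tau>k k by (intro spath_martingale H i s\<eta>) auto
    have i0: "integrable M (\<lambda>\<omega>. ?\<eta> \<omega> * (?ST \<omega> - ?S k \<omega>))" by (intro sqi_mult s\<eta> sqi_diff sT sk)
    have iS: "integrable M (\<lambda>\<omega>. indicator (A k) \<omega> * (?S k \<omega>)\<^sup>2)"
      using integrable_mult_indicator[OF AM[OF k] sqi_integrable_sq[OF sk]] by simp
    have "l\<^sup>2 * prob (A k) = expectation (\<lambda>\<omega>. indicator (A k) \<omega> * l\<^sup>2)" by simp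
    also have "\<dots> \<le> expectation (\<lambda>\<omega>. indicator (A k) \<omega> * (?S k \<omega>)\<^sup>2)"
    proof (rule integral_mono)
      have "l\<^sup>2 \<le> (?S k \<omega>)\<^sup>2" if "\<omega> \<in> A k" for \<omega>
        using that l power_mono[of l "\<bar>?S k \<omega>\<bar>" 2] by (auto simp: A_def)
      then show "indicator (A k) \<omega> * l\<^sup>2 \<le> indicator (A k) \<omega> * (?S k \<omega>)\<^sup>2" for \<omega>
        by (auto simp: indicator_def)
      show "integrable M (\<lambda>\<omega>. indicator (A k) \<omega> * l\<^sup>2)"
        by (intro integrable_mult_left integrable_real_indicator AM k) (simp add: less_top[symmetric])
    qed (rule iS)
    \<comment> \<open>A term of expectation 0 is added in order to use S_k^2 + 2 S_k (S_T - S_k)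
      \<le> S_T^2.\<close>
    also have "\<dots> = expectation (\<lambda>\<omega>. indicator (A k) \<omega> * (?S k \<omega>)\<^sup>2 + 2 * (?\<eta> \<omega> * (?ST \<omega> - ?S k \<omega>)))"
      using i0 iS 0 by simp
    also have "\<dots> \<le> expectation (\<lambda>\<omega>. indicator (A k) \<omega> * (?ST \<omega>)\<^sup>2)"
    proof (rule integral_mono)
      fix \<omega>
      have "0 \<le> (?ST \<omega> - ?S k \<omega>)\<^sup>2" by simp
      then have "(?S k \<omega>)\<^sup>2 + 2 * (?S k \<omega> * (?ST \<omega> - ?S k \<omega>)) \<le> (?ST \<omega>)\<^sup>2"
        by (simp add: power2_eq_square algebra_simps)
      then show "indicator (A k) \<omega> * (?S k \<omega>)\<^sup>2 + 2 * (?\<eta> \<omega> * (?ST \<omega> - ?S k \<omega>)) \<le> indicator (A k) \<omega> * (?ST \<omega>)\<^sup>2"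
        by (auto simp: indicator_def)
    qed (use i0 iS iA k in auto)
    finally show ?thesis .
  qed
  have "l\<^sup>2 * prob {\<omega> \<in> space M. \<exists>k\<le>n. l < \<bar>?S k \<omega>\<bar>} = (\<Sum>k\<le>n. l\<^sup>2 * prob (A k))"
    unfolding U using AM disj by (subst finite_measure_finite_Union) (auto simp: sum_distrib_left)
  also have "\<dots> \<le> (\<Sum>k\<le>n. expectation (\<lambda>\<omega>. indicator (A k) \<omega> * (?ST \<omega>)\<^sup>2))"
    by (intro sum_mono trm) auto
  also have "\<dots> = expectation (\<lambda>\<omega>. \<Sum>k\<le>n. indicator (A k) \<omega> * (?ST \<omega>)\<^sup>2)"
    using iA by (subst Bochner_Integration.integral_sum) auto
  also have "\<dots> \<le> expectation (\<lambda>\<omega>. (?ST \<omega>)\<^sup>2)"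
  proof (rule integral_mono)
    show "integrable M (\<lambda>\<omega>. \<Sum>k\<le>n. indicator (A k) \<omega> * (?ST \<omega>)\<^sup>2)"
      by (intro Bochner_Integration.integrable_sum iA) auto
    fix \<omega>
    have "(\<Sum>k\<le>n. indicator (A k) \<omega> :: real) = indicator (\<Union>k\<in>{..n}. A k) \<omega>"
      using disj by (subst indicator_UN_disjoint) auto
    then show "(\<Sum>k\<le>n. indicator (A k) \<omega> * (?ST \<omega>)\<^sup>2) \<le> (?ST \<omega>)\<^sup>2"
      by (simp add: sum_distrib_right[symmetric] indicator_def)
  qed (rule sqi_integrable_sq[OF sT])
  finally show ?thesis using l by (simp add: field_simps)
qed

lemma spath_continuous:
  assumes H: "simple_process M F T H" and c: "continuous_on {0..T} (\<lambda>t. B i t \<omega>)"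
  shows "continuous_on {0..T} (\<lambda>t. spath i H t \<omega>)"
  using H
proof (induction H)
  case (Cons p H)
  obtain a b \<xi> where p: "p = (a, b, \<xi>)" by (cases p) auto
  have ab: "0 \<le> a" "a \<le> b" "b \<le> T" using Cons.prems by (auto simp: p simple_process_def)
  have m: "continuous_on {0..T} (\<lambda>t. B i (min r t) \<omega>)" if "0 \<le> r" "r \<le> T" for r
    by (rule continuous_on_compose2[OF c]) (use that in \<open>auto intro!: continuous_intros\<close>)
  have "continuous_on {0..T} (\<lambda>t. spath i H t \<omega>)" using Cons by (auto simp: simple_process_def)
  then have "continuous_on {0..T} (\<lambda>t. \<xi> \<omega> * (B i (min b t) \<omega> - B i (min a t) \<omega>) + spath i H t \<omega>)"
    using ab by (intro continuous_intros m) auto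
  then show ?case by (simp add: spath_def p)
qed (simp add: spath_def)

text \<open>Dyadic grids are nested, so the exceptional events increase and the bound for each grid
  passes to their union. Continuity of the paths extends it from dyadic times to all times.\<close>

lemma spath_maximal:
  assumes H: "simple_process M F T H" and i: "i \<in> {1..d}" and l: "0 < l"
  obtains U where "U \<in> events" "prob U \<le> expectation (\<lambda>\<omega>. (spath i H T \<omega>)\<^sup>2) / l\<^sup>2"
    "AE \<omega> in M. \<omega> \<notin> U \<longrightarrow> (\<forall>t\<in>{0..T}. \<bar>spath i H t \<omega>\<bar> \<le> l)"
proof -
  define \<tau> where "\<tau> n k = T * real k / 2 ^ n" for n k :: nat
  define U where "U n = {\<omega> \<in> space M. \<exists>k\<le>2^n. l < \<bar>spath i H (\<tau> n k) \<omega>\<bar>}" for n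
  have \<tau>: "0 \<le> \<tau> n k" "k \<le> 2 ^ n \<Longrightarrow> \<tau> n k \<le> T" for n k
  proof -
    show "0 \<le> \<tau> n k" using T_pos by (simp add: \<tau>_def)
    assume "k \<le> 2 ^ n"
    then have "real k \<le> 2 ^ n" using of_nat_le_iff[of k "2^n", where 'a = real] by simp
    then show "\<tau> n k \<le> T" using T_pos by (simp add: \<tau>_def divide_le_eq)
  qed
  have UM: "U n \<in> events" for n
  proof -
    have m: "spath i H (\<tau> n k) \<in> borel_measurable M" if "k \<in> {..2^n}" for k
      using \<tau>[of n k] \<tau>(2)[of k n] that by (intro sqi_measurable[OF sqi_spath[OF H _ _ i]]) auto
    have "{\<omega> \<in> space M. l < \<bar>spath i H (\<tau> n k) \<omega>\<bar>} \<in> events" if "k \<in> {..2^n}" for k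
      using borel_measurable_abs[OF m[OF that]] by (simp add: borel_measurable_iff_greater)
    then have "{\<omega> \<in> space M. \<exists>k\<in>{..2^n}. l < \<bar>spath i H (\<tau> n k) \<omega>\<bar>} \<in> events"
      by (intro sets.sets_Collect_finite_Ex) auto
    moreover have "{\<omega> \<in> space M. \<exists>k\<in>{..2^n}. l < \<bar>spath i H (\<tau> n k) \<omega>\<bar>} = U n"
      unfolding U_def by blast
    ultimately show ?thesis by metis
  qed
  have Ub: "prob (U n) \<le> expectation (\<lambda>\<omega>. (spath i H T \<omega>)\<^sup>2) / l\<^sup>2" for n
    unfolding U_def
  proof (rule spath_maximal_finite[OF H i _ _ _ l])
    show "mono (\<tau> n)" using T_pos by (auto simp: mono_def \<tau>_def intro!: divide_right_mono)
  qed (use \<tau> in auto)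
  have "incseq U"
  proof (rule incseq_SucI, safe)
    fix n \<omega> assume "\<omega> \<in> U n"
    then obtain k where "\<omega> \<in> space M" "k \<le> 2 ^ n" "l < \<bar>spath i H (\<tau> n k) \<omega>\<bar>" by (auto simp: U_def)
    moreover have "\<tau> n k = \<tau> (Suc n) (2 * k)" by (simp add: \<tau>_def)
    ultimately show "\<omega> \<in> U (Suc n)" by (auto simp: U_def intro!: exI[of _ "2 * k"])
  qed
  then have "(\<lambda>n. prob (U n)) \<longlonglongrightarrow> prob (\<Union>n. U n)"
    using UM by (intro finite_Lim_measure_incseq) auto
  then have 1: "prob (\<Union>n. U n) \<le> expectation (\<lambda>\<omega>. (spath i H T \<omega>)\<^sup>2) / l\<^sup>2"
    by (rule LIMSEQ_le_const2) (use Ub in auto)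
  have 2: "AE \<omega> in M. \<omega> \<notin> (\<Union>n. U n) \<longrightarrow> (\<forall>t\<in>{0..T}. \<bar>spath i H t \<omega>\<bar> \<le> l)"
    using AE_B_continuous[OF i] AE_space
  proof eventually_elim
    case (elim \<omega>)
    note c = spath_continuous[OF H elim(1)]
    show ?case
    proof (intro impI ballI)
      fix t assume \<omega>: "\<omega> \<notin> (\<Union>n. U n)" and t: "t \<in> {0..T}"
      \<comment> \<open>Selects the grid point just below \<open>t\<close>, at distance less than T
        / 2^n.\<close>
      define k where "k n = nat \<lfloor>t * 2 ^ n / T\<rfloor>" for n
      have k: "real (k n) \<le> t * 2 ^ n / T" "t * 2 ^ n / T < real (k n) + 1" for n
        using t T_pos by (auto simp: k_def)
      have k2: "k n \<le> 2 ^ n" for n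
      proof -
        have "t * 2 ^ n / T \<le> 2 ^ n" using t T_pos by (simp add: divide_le_eq)
        with k(1)[of n] have "real (k n) \<le> 2 ^ n" by linarith
        then show ?thesis using of_nat_le_iff[of "k n" "2 ^ n", where 'a = real] by simp
      qed
      have "(\<lambda>n. \<tau> n (k n)) \<longlonglongrightarrow> t"
      proof (rule tendsto_sandwich[of "\<lambda>n. t - T * (1/2) ^ n" _ _ "\<lambda>n. t"])
        have "(\<lambda>n. t - T * (1/2) ^ n) \<longlonglongrightarrow> t - T * 0"
          by (intro tendsto_intros LIMSEQ_realpow_zero) auto
        then show "(\<lambda>n. t - T * (1/2) ^ n) \<longlonglongrightarrow> t" by simp
        show "\<forall>\<^sub>F n in sequentially. t - T * (1/2) ^ n \<le> \<tau> n (k n)"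
        proof (rule always_eventually, rule allI)
          fix n
          have "t * 2 ^ n < (real (k n) + 1) * T" using k(2)[of n] T_pos by (simp add: divide_less_eq)
          then have "(t * 2 ^ n - T) / 2 ^ n \<le> T * real (k n) / 2 ^ n"
            by (intro divide_right_mono) (auto simp: algebra_simps)
          moreover have "(t * 2 ^ n - T) / 2 ^ n = t - T * (1/2) ^ n"
            by (simp add: diff_divide_distrib power_divide)
          ultimately show "t - T * (1/2) ^ n \<le> \<tau> n (k n)" by (simp add: \<tau>_def)
        qed
        show "\<forall>\<^sub>F n in sequentially. \<tau> n (k n) \<le> t"
        proof (rule always_eventually, rule allI)
          fix n
          have "real (k n) * T \<le> t * 2 ^ n" using k(1)[of n] T_pos by (simp add: pos_le_divide_eq)
          then show "\<tau> n (k n) \<le> t" by (simp add: \<tau>_def pos_divide_le_eq mult.commute)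
        qed
      qed simp
      moreover have "\<tau> n (k n) \<in> {0..T}" for n using \<tau>[of n "k n"] \<tau>(2)[OF k2] by auto
      ultimately have "(\<lambda>n. spath i H (\<tau> n (k n)) \<omega>) \<longlonglongrightarrow> spath i H t \<omega>"
        using c t by (intro continuous_on_tendsto_compose[OF c]) auto
      then have "(\<lambda>n. \<bar>spath i H (\<tau> n (k n)) \<omega>\<bar>) \<longlonglongrightarrow> \<bar>spath i H t \<omega>\<bar>" by (rule tendsto_rabs)
      moreover have "\<bar>spath i H (\<tau> n (k n)) \<omega>\<bar> \<le> l" for n
        using \<omega> elim(2) k2[of n] by (auto simp: U_def not_less)
      ultimately show "\<bar>spath i H t \<omega>\<bar> \<le> l" by (intro LIMSEQ_le_const2) auto
    qed
  qed
  show ?thesis by (rule that[OF _ 1 2]) (use UM in auto)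
qed

end

section \<open>The Ito integral\<close>

lemma l2d_mult_bounded:
  assumes f: "square_integrable N f" "square_integrable N f'"
    and g: "g \<in> borel_measurable N" "\<And>x. \<bar>g x\<bar> \<le> c"
  shows "l2d N (\<lambda>x. g x * f x) (\<lambda>x. g x * f' x) \<le> c\<^sup>2 * l2d N f f'"
proof -
  have "integrable N (\<lambda>x. (g x * (f x - f' x))\<^sup>2)" "integrable N (\<lambda>x. (f x - f' x)\<^sup>2)"
    by (intro sqi_integrable_sq sqi_mult_bounded[OF _ g] sqi_diff f)+
  moreover have "(g x)\<^sup>2 \<le> c\<^sup>2" for x using power_mono[OF g(2)[of x], of 2] by simp
  ultimately have "(\<integral>x. (g x * (f x - f' x))\<^sup>2 \<partial>N) \<le> (\<integral>x. c\<^sup>2 * (f x - f' x)\<^sup>2 \<partial>N)"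
    by (intro integral_mono) (auto simp: power_mult_distrib intro!: mult_right_mono)
  then show ?thesis by (simp add: l2d_def right_diff_distrib)
qed

lemma integral_sq_l2d: "(\<integral>x. (f x)\<^sup>2 \<partial>N) = l2d N f (\<lambda>x. 0)"
  by (simp add: l2d_def)

lemma l2d_expand:
  assumes "square_integrable N f" "square_integrable N g"
  shows "l2d N f g = (\<integral>x. f x * f x \<partial>N) - 2 * (\<integral>x. f x * g x \<partial>N) + (\<integral>x. g x * g x \<partial>N)"
proof -
  have "l2d N f g = (\<integral>x. f x * f x - 2 * (f x * g x) + g x * g x \<partial>N)"
    unfolding l2d_def by (rule Bochner_Integration.integral_cong) (auto simp: power2_eq_square algebra_simps)
  then show ?thesis
    using sqi_mult[OF assms] sqi_mult[OF assms(1) assms(1)] sqi_mult[OF assms(2) assms(2)] by simp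
qed

text \<open>Only inner products occur on the right, so the isometry can evaluate the norm of a
  residual f + g - h.\<close>

lemma l2d_add_expand:
  assumes f: "square_integrable N f" and g: "square_integrable N g" and h: "square_integrable N h"
  shows "l2d N (\<lambda>x. f x + g x) h = (\<integral>x. f x * f x \<partial>N) + (\<integral>x. g x * g x \<partial>N) + (\<integral>x. h x * h x \<partial>N)
    + 2 * (\<integral>x. f x * g x \<partial>N) - 2 * (\<integral>x. f x * h x \<partial>N) - 2 * (\<integral>x. g x * h x \<partial>N)"
proof -
  have "l2d N (\<lambda>x. f x + g x) h
      = (\<integral>x. f x * f x + g x * g x + h x * h x + 2 * (f x * g x) - 2 * (f x * h x) - 2 * (g x * h x) \<partial>N)"
    unfolding l2d_def by (rule Bochner_Integration.integral_cong) (auto simp: power2_eq_square algebra_simps)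
  then show ?thesis
    using sqi_mult[OF f f] sqi_mult[OF g g] sqi_mult[OF h h] sqi_mult[OF f g] sqi_mult[OF f h] sqi_mult[OF g h]
    by simp
qed

context brownian
begin

text \<open>Extension by 0 turns processes on \<open>[0, t]\<close> into functions on one product
  space, whose L2 structure then serves all horizons.\<close>

definition cut :: "real \<Rightarrow> (real \<Rightarrow> 'a \<Rightarrow> real) \<Rightarrow> real \<times> 'a \<Rightarrow> real" where
  "cut t X = (\<lambda>(s, \<omega>). indicator {0..t} s * X s \<omega>)"

definition simple_values :: "(real \<times> 'a \<Rightarrow> real) set" where
  "simple_values = {sv H | H. simple_process M F T H}"

text \<open>The admissible integrands: adaptedness is encoded as approximability by simple
  processes.\<close>

definition adm :: "(real \<Rightarrow> 'a \<Rightarrow> real) \<Rightarrow> bool" where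
  "adm X \<longleftrightarrow> cut T X \<in> L2cl P simple_values"

lemma cut_eq: "t \<le> T \<Longrightarrow> cut t X = (\<lambda>p. indicator ({..t} \<times> UNIV) p * cut T X p)"
  by (auto simp: cut_def fun_eq_iff indicator_def)

lemma atMost_Times_measurable [measurable]: "(indicator ({..t} \<times> UNIV) :: _ \<Rightarrow> real) \<in> borel_measurable P"
proof -
  have "(\<lambda>p :: real \<times> 'a. indicator {..t} (fst p) :: real) \<in> borel_measurable P" by measurable
  moreover have "(\<lambda>p :: real \<times> 'a. indicator {..t} (fst p) :: real) = indicator ({..t} \<times> UNIV)"
    by (auto simp: fun_eq_iff indicator_def)
  ultimately show ?thesis by (simp only:)
qed

lemma sqi_cut: "square_integrable P (cut T X) \<Longrightarrow> t \<le> T \<Longrightarrow> square_integrable P (cut t X)"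
  unfolding cut_eq by (rule sqi_mult_bounded[where c = 1, OF _ atMost_Times_measurable]) (simp_all add: indicator_def)

lemma adm_sqi: "adm X \<Longrightarrow> square_integrable P (cut T X)"
  by (auto simp: adm_def dest: L2cl_sqi)

lemma sv_trunc_eq: "sv (trunc t H) = (\<lambda>p. indicator ({..t} \<times> UNIV) p * sv H p)"
  by (auto simp: fun_eq_iff sv_trunc indicator_def)

lemma sv_zero: "simple_process M F t H \<Longrightarrow> s \<notin> {0..t} \<Longrightarrow> simple_value H s \<omega> = 0"
proof (induction H)
  case (Cons p H)
  then show ?case by (cases p) (auto simp: simple_process_def simple_value_def indicator_def)
qed (simp add: simple_value_def)

text \<open>Simple processes on \<open>[0, t]\<close> and \<open>cut t X\<close> both vanish at
  other times, so the restricted time integral is a squared distance on the whole product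
  space.\<close>

lemma has_ito_integral_iff:
  assumes X: "square_integrable P (cut t X)" and t: "t \<le> T" and i: "i \<in> {1..d}"
  shows "has_ito_integral M F (B i) X t Z \<longleftrightarrow> square_integrable M Z \<and>
     (\<exists>H. (\<forall>n. simple_process M F t (H n)) \<and> (\<lambda>n. l2d P (sv (H n)) (cut t X)) \<longlonglongrightarrow> 0 \<and>
       (\<lambda>n. l2d M (simple_integral (B i) (H n)) Z) \<longlonglongrightarrow> 0)"
proof -
  have 1: "(\<integral>\<^sup>+ s\<in>{0..t}. (\<integral>\<^sup>+ \<omega>. ennreal ((X s \<omega> - simple_value H s \<omega>)\<^sup>2) \<partial>M) \<partial>lborel)
      = (\<integral>\<^sup>+p. ennreal ((sv H p - cut t X p)\<^sup>2) \<partial>P)" if H: "simple_process M F t H" for H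
  proof -
    have [measurable]: "sv H \<in> borel_measurable P" "cut t X \<in> borel_measurable P"
      using sqi_sv[OF H] X by (auto dest: sqi_measurable)
    have "(\<integral>\<^sup>+p. ennreal ((sv H p - cut t X p)\<^sup>2) \<partial>P)
        = (\<integral>\<^sup>+ s. \<integral>\<^sup>+ \<omega>. ennreal ((sv H (s, \<omega>) - cut t X (s, \<omega>))\<^sup>2) \<partial>M \<partial>lborel)"
      by (subst nn_integral_fst[symmetric]) auto
    also have "\<dots> = (\<integral>\<^sup>+ s\<in>{0..t}. (\<integral>\<^sup>+ \<omega>. ennreal ((X s \<omega> - simple_value H s \<omega>)\<^sup>2) \<partial>M) \<partial>lborel)"
    proof (rule nn_integral_cong)
      fix s
      show "(\<integral>\<^sup>+ \<omega>. ennreal ((sv H (s, \<omega>) - cut t X (s, \<omega>))\<^sup>2) \<partial>M)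
          = (\<integral>\<^sup>+ \<omega>. ennreal ((X s \<omega> - simple_value H s \<omega>)\<^sup>2) \<partial>M) * indicator {0..t} s"
        using sv_zero[OF H, of s] by (cases "s \<in> {0..t}") (simp_all add: sv_def cut_def power2_commute)
    qed
    finally show ?thesis ..
  qed
  have eq: "((\<lambda>n. \<integral>\<^sup>+ s\<in>{0..t}. (\<integral>\<^sup>+ \<omega>. ennreal ((X s \<omega> - simple_value (H n) s \<omega>)\<^sup>2) \<partial>M) \<partial>lborel)
         \<longlonglongrightarrow> 0 \<and>
       (\<lambda>n. \<integral>\<^sup>+ \<omega>. ennreal ((Z \<omega> - simple_integral (B i) (H n) \<omega>)\<^sup>2) \<partial>M) \<longlonglongrightarrow> 0)
     \<longleftrightarrow> ((\<lambda>n. l2d P (sv (H n)) (cut t X)) \<longlonglongrightarrow> 0 \<and>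
       (\<lambda>n. l2d M (simple_integral (B i) (H n)) Z) \<longlonglongrightarrow> 0)"
    if H: "\<forall>n. simple_process M F t (H n)" and Z: "square_integrable M Z" for H
  proof -
    have "square_integrable P (sv (H n))" "square_integrable M (simple_integral (B i) (H n))" for n
      using H by (auto intro: sqi_sv sqi_simple_integral[OF _ t i])
    from l2d_tendsto_nn_iff[of P "\<lambda>n. sv (H n)", OF this(1) X]
      l2d_tendsto_nn_iff[of M "\<lambda>n. simple_integral (B i) (H n)", OF this(2) Z]
    show ?thesis using H by (simp add: 1 power2_commute[of "Z _"])
  qed
  show ?thesis
    unfolding has_ito_integral_def using eq by blast
qed

text \<open>The difference of two simple processes is again one, obtained by appending a list scaled
  by - 1. Its integral up to \<open>t\<close> is that of its truncation, whose norm is not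
  larger.\<close>

lemma spath_l2d:
  assumes H: "simple_process M F T H" "simple_process M F T H'" and t: "0 \<le> t" "t \<le> T" and i: "i \<in> {1..d}"
  shows "l2d M (spath i H t) (spath i H' t) \<le> l2d P (sv H) (sv H')"
proof -
  let ?D = "H @ scale_list (- 1) H'"
  have D: "simple_process M F T ?D" using H by (simp add: simple_process_append simple_process_scale)
  have Dt: "simple_process M F T (trunc t ?D)"
    using simple_process_mono[OF simple_process_trunc[OF D t(2)] t(2)] .
  have "l2d M (spath i H t) (spath i H' t) = expectation (\<lambda>\<omega>. spath i ?D t \<omega> * spath i ?D t \<omega>)"
    by (simp add: l2d_def spath_append spath_scale power2_eq_square)
  also have "\<dots> = (\<integral>p. sv (trunc t ?D) p * sv (trunc t ?D) p \<partial>P)"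
    unfolding spath_trunc[OF D] using simple_isometry[OF Dt Dt i i] by simp
  also have "\<dots> = l2d P (\<lambda>p. indicator ({..t} \<times> UNIV) p * sv H p) (\<lambda>p. indicator ({..t} \<times> UNIV) p * sv H' p)"
    by (simp add: sv_trunc_eq l2d_def sv_append sv_scale power2_eq_square algebra_simps)
  also have "\<dots> \<le> 1\<^sup>2 * l2d P (sv H) (sv H')"
    by (rule l2d_mult_bounded[OF sqi_sv[OF H(1)] sqi_sv[OF H(2)] atMost_Times_measurable]) (simp add: indicator_def)
  finally show ?thesis by simp
qed

text \<open>Along rapidly converging simple integrands the integrals converge uniformly in time, almost surely,
  by the maximal inequality and the Borel--Cantelli lemma.\<close>

lemma ito_integral_exists:
  assumes X: "adm X" and i: "i \<in> {1..d}"
  shows "\<exists>Z. (\<forall>\<omega>\<in>space M. continuous_on {0..T} (\<lambda>t. Z t \<omega>)) \<and>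
     (\<forall>t\<in>{0..T}. has_ito_integral M F (B i) X t (Z t))"
proof -
  \<comment> \<open>At this rate consecutive integrals differ in squared norm by at most (1/8)^n.
    The maximal inequality with level (1/2)^n then bounds the probability by (1/8)^n / (1/4)^n =
    (1/2)^n, which is summable.\<close>
  have "\<exists>g\<in>simple_values. square_integrable P g \<and> l2d P g (cut T X) < (1/8)^n / 4" for n :: nat
  proof (rule L2cl_approx[OF X[unfolded adm_def]])
    show "(\<lambda>x. 0) \<in> simple_values"
      unfolding simple_values_def
      by (rule CollectI, rule exI[of _ "[]"]) (auto simp: sv_def simple_value_def simple_process_def fun_eq_iff)
    show "(\<lambda>x. f x + g x) \<in> simple_values" if "f \<in> simple_values" "g \<in> simple_values" for f g
      using that by (auto simp: simple_values_def simple_process_append sv_append[symmetric])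
    show "(\<lambda>x. c * f x) \<in> simple_values" if "f \<in> simple_values" for f c
      using that by (auto simp: simple_values_def sv_scale[symmetric] intro: simple_process_scale)
  qed simp
  then have "\<exists>H. simple_process M F T H \<and> l2d P (sv H) (cut T X) < (1/8)^n / 4" for n :: nat
    unfolding simple_values_def by blast
  then have "\<exists>H. \<forall>n. simple_process M F T (H n) \<and> l2d P (sv (H n)) (cut T X) < (1/8)^n / 4"
    by (intro choice allI)
  then obtain H where H: "\<And>n. simple_process M F T (H n)"
    and Hd: "\<And>n. l2d P (sv (H n)) (cut T X) < (1/8)^n / 4" by blast
  note sX = adm_sqi[OF X]
  have Hlim: "(\<lambda>n. l2d P (sv (H n)) (cut T X)) \<longlonglongrightarrow> 0"
  proof (rule tendsto_sandwich[OF _ _ tendsto_const])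
    have "(\<lambda>n. (1/8)^n / 4 :: real) \<longlonglongrightarrow> 0 / 4" by (intro tendsto_intros LIMSEQ_realpow_zero) auto
    then show "(\<lambda>n. (1/8)^n / 4 :: real) \<longlonglongrightarrow> 0" by simp
    show "\<forall>\<^sub>F n in sequentially. l2d P (sv (H n)) (cut T X) \<le> (1/8)^n / 4"
      by (rule always_eventually, rule allI, rule less_imp_le, rule Hd)
  qed simp
  define D where "D n = H (Suc n) @ scale_list (- 1) (H n)" for n
  have D: "simple_process M F T (D n)" for n
    using H by (simp add: D_def simple_process_append simple_process_scale)
  have spD: "spath i (D n) t \<omega> = spath i (H (Suc n)) t \<omega> - spath i (H n) t \<omega>" for n t \<omega>
    by (simp add: D_def spath_append spath_scale)
  have ED: "expectation (\<lambda>\<omega>. (spath i (D n) T \<omega>)\<^sup>2) \<le> (1/8)^n" for n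
  proof -
    have "expectation (\<lambda>\<omega>. (spath i (D n) T \<omega>)\<^sup>2) = l2d M (spath i (H (Suc n)) T) (spath i (H n) T)"
      by (simp add: l2d_def spD)
    also have "\<dots> \<le> l2d P (sv (H (Suc n))) (sv (H n))"
      using T_pos by (intro spath_l2d H i) auto
    also have "\<dots> \<le> 2 * l2d P (sv (H (Suc n))) (cut T X) + 2 * l2d P (cut T X) (sv (H n))"
      by (intro l2d_triangle sX sqi_sv[OF H])
    also have "\<dots> \<le> 2 * ((1/8)^Suc n / 4) + 2 * ((1/8)^n / 4)"
      using Hd[of "Suc n"] Hd[of n] by (simp add: l2d_commute[of P "cut T X"])
    also have "\<dots> \<le> (1/8)^n" by simp
    finally show ?thesis .
  qed
  have "\<exists>U. U \<in> events \<and> prob U \<le> (1/2)^n \<and>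
      (AE \<omega> in M. \<omega> \<notin> U \<longrightarrow> (\<forall>t\<in>{0..T}. \<bar>spath i (D n) t \<omega>\<bar> \<le> (1/2)^n))" for n
  proof -
    obtain U where U: "U \<in> events" "prob U \<le> expectation (\<lambda>\<omega>. (spath i (D n) T \<omega>)\<^sup>2) / ((1/2)^n)\<^sup>2"
      "AE \<omega> in M. \<omega> \<notin> U \<longrightarrow> (\<forall>t\<in>{0..T}. \<bar>spath i (D n) t \<omega>\<bar> \<le> (1/2)^n)"
      using spath_maximal[OF D i, of "(1/2)^n" n] by auto
    have "expectation (\<lambda>\<omega>. (spath i (D n) T \<omega>)\<^sup>2) / ((1/2)^n)\<^sup>2 \<le> (1/8)^n / ((1/2)^n)\<^sup>2"
      by (intro divide_right_mono ED) simp
    also have "\<dots> = (1/8)^n / (1/4)^n" by (simp add: power2_eq_square flip: power_mult_distrib)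
    also have "\<dots> = (1/2)^n" by (simp flip: power_divide)
    finally show ?thesis using U by (intro exI[of _ U]) auto
  qed
  then have "\<exists>U. \<forall>n. U n \<in> events \<and> prob (U n) \<le> (1/2)^n \<and>
      (AE \<omega> in M. \<omega> \<notin> U n \<longrightarrow> (\<forall>t\<in>{0..T}. \<bar>spath i (D n) t \<omega>\<bar> \<le> (1/2)^n))"
    by (intro choice allI)
  then obtain U where U: "\<And>n. U n \<in> events" "\<And>n. prob (U n) \<le> (1/2)^n"
    "\<And>n. AE \<omega> in M. \<omega> \<notin> U n \<longrightarrow> (\<forall>t\<in>{0..T}. \<bar>spath i (D n) t \<omega>\<bar> \<le> (1/2)^n)" by blast
  have "summable (\<lambda>n. prob (U n))"
    by (rule summable_comparison_test'[where g = "\<lambda>n. (1/2)^n"]) (auto intro: U)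
  then have "AE \<omega> in M. eventually (\<lambda>n. \<omega> \<in> space M - U n) sequentially"
    by (intro borel_cantelli_AE1 U) (auto simp: less_top[symmetric])
  moreover have "AE \<omega> in M. \<forall>n. \<omega> \<notin> U n \<longrightarrow> (\<forall>t\<in>{0..T}. \<bar>spath i (D n) t \<omega>\<bar> \<le> (1/2)^n)"
    using U(3) by (simp add: AE_all_countable)
  ultimately have AE: "AE \<omega> in M. continuous_on {0..T} (\<lambda>t. B i t \<omega>) \<and>
      eventually (\<lambda>n. \<forall>t\<in>{0..T}. \<bar>spath i (D n) t \<omega>\<bar> \<le> (1/2)^n) sequentially"
    using AE_B_continuous[OF i]
  proof eventually_elim
    case (elim \<omega>)
    from elim(1) have "eventually (\<lambda>n. \<forall>t\<in>{0..T}. \<bar>spath i (D n) t \<omega>\<bar> \<le> (1/2)^n) sequentially"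
      by (rule eventually_mono) (use elim(2) in blast)
    with elim(3) show ?case ..
  qed
  then obtain N where N: "{\<omega> \<in> space M. \<not> (continuous_on {0..T} (\<lambda>t. B i t \<omega>) \<and>
      eventually (\<lambda>n. \<forall>t\<in>{0..T}. \<bar>spath i (D n) t \<omega>\<bar> \<le> (1/2)^n) sequentially)} \<subseteq> N"
    "emeasure M N = 0" "N \<in> events" by (rule AE_E)
  \<comment> \<open>The value 0 on the null set keeps every path continuous.\<close>
  define Z where "Z t \<omega> = (if \<omega> \<in> N then 0 else lim (\<lambda>n. spath i (H n) t \<omega>))" for t \<omega>
  have ul: "uniform_limit {0..T} (\<lambda>n t. spath i (H n) t \<omega>) (\<lambda>t. Z t \<omega>) sequentially"
    and cB: "continuous_on {0..T} (\<lambda>t. B i t \<omega>)"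
    if \<omega>: "\<omega> \<in> space M" "\<omega> \<notin> N" for \<omega>
  proof -
    have ev: "eventually (\<lambda>n. \<forall>t\<in>{0..T}. \<bar>spath i (D n) t \<omega>\<bar> \<le> (1/2)^n) sequentially"
      and "continuous_on {0..T} (\<lambda>t. B i t \<omega>)" using N(1) \<omega> by auto
    then show "continuous_on {0..T} (\<lambda>t. B i t \<omega>)" by simp
    have "uniform_limit {0..T} (\<lambda>n t. \<Sum>k<n. spath i (D k) t \<omega>) (\<lambda>t. suminf (\<lambda>k. spath i (D k) t \<omega>)) sequentially"
      by (rule Weierstrass_m_test_ev[where M = "\<lambda>n. (1/2)^n"]) (use ev in auto)
    then have "uniform_limit {0..T} (\<lambda>n t. (\<Sum>k<n. spath i (D k) t \<omega>) + spath i (H 0) t \<omega>)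
        (\<lambda>t. suminf (\<lambda>k. spath i (D k) t \<omega>) + spath i (H 0) t \<omega>) sequentially"
      by (intro uniform_limit_add uniform_limit_const)
    moreover have "(\<Sum>k<n. spath i (D k) t \<omega>) + spath i (H 0) t \<omega> = spath i (H n) t \<omega>" for n t
      by (simp add: spD sum_lessThan_telescope[of "\<lambda>k. spath i (H k) t \<omega>"])
    ultimately have u: "uniform_limit {0..T} (\<lambda>n t. spath i (H n) t \<omega>)
        (\<lambda>t. suminf (\<lambda>k. spath i (D k) t \<omega>) + spath i (H 0) t \<omega>) sequentially" by simp
    have "Z t \<omega> = suminf (\<lambda>k. spath i (D k) t \<omega>) + spath i (H 0) t \<omega>" if "t \<in> {0..T}" for t
      using tendsto_uniform_limitI[OF u that] \<omega> by (simp add: Z_def limI)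
    then show "uniform_limit {0..T} (\<lambda>n t. spath i (H n) t \<omega>) (\<lambda>t. Z t \<omega>) sequentially"
      using u unfolding uniform_limit_iff by simp
  qed
  show ?thesis
  proof (intro exI[of _ Z] conjI ballI)
    fix \<omega> assume \<omega>: "\<omega> \<in> space M"
    show "continuous_on {0..T} (\<lambda>t. Z t \<omega>)"
    proof (cases "\<omega> \<in> N")
      case False
      show ?thesis
        by (rule uniform_limit_theorem[OF _ ul[OF \<omega> False]])
          (auto intro!: always_eventually spath_continuous[OF H cB[OF \<omega> False]])
    qed (simp add: Z_def)
  next
    fix t assume t: "t \<in> {0..T}"
    then have t': "0 \<le> t" "t \<le> T" by auto
    note sp = sqi_spath[OF H t' i]
    note [measurable] = sp[THEN sqi_measurable] N(3)
    have [measurable]: "Z t \<in> borel_measurable M" unfolding Z_def by measurable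
    have AEl: "AE \<omega> in M. (\<lambda>n. spath i (H (id n)) t \<omega>) \<longlonglongrightarrow> Z t \<omega>"
    proof -
      have "AE \<omega> in M. \<omega> \<notin> N" using N(2,3) by (intro AE_not_in) auto
      then show ?thesis using AE_space
      proof eventually_elim
        case (elim \<omega>)
        then show ?case using tendsto_uniform_limitI[OF ul t] by simp
      qed
    qed
    have Cauchy: "\<exists>K. \<forall>m\<ge>K. \<forall>n\<ge>K. l2d M (spath i (H m) t) (spath i (H n) t) < e" if e: "0 < e" for e
    proof -
      obtain K where K: "\<And>n. n \<ge> K \<Longrightarrow> l2d P (sv (H n)) (cut T X) < e / 4"
        using order_tendstoD(2)[OF Hlim, of "e / 4"] e by (auto simp: eventually_sequentially)
      have "l2d M (spath i (H m) t) (spath i (H n) t) < e" if "m \<ge> K" "n \<ge> K" for m n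
      proof -
        have "l2d M (spath i (H m) t) (spath i (H n) t) \<le> l2d P (sv (H m)) (sv (H n))"
          by (intro spath_l2d H t' i)
        also have "\<dots> \<le> 2 * l2d P (sv (H m)) (cut T X) + 2 * l2d P (cut T X) (sv (H n))"
          by (intro l2d_triangle sX sqi_sv[OF H])
        also have "\<dots> < e" using K[OF that(1)] K[OF that(2)] by (simp add: l2d_commute[of P "cut T X"])
        finally show ?thesis .
      qed
      then show ?thesis by blast
    qed
    note lim = l2d_limit_of_AE_limit[of M "\<lambda>n. spath i (H n) t", OF sp \<open>Z t \<in> borel_measurable M\<close> strict_mono_id AEl Cauchy]
    show "has_ito_integral M F (B i) X t (Z t)"
      unfolding has_ito_integral_iff[OF sqi_cut[OF sX t'(2)] t'(2) i]
    \<comment> \<open>One sequence on \<open>[0, T]\<close>, truncated at \<open>t\<close>,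
      witnesses the integral at every time, so all times share the paths that converge
      uniformly.\<close>
    proof (intro conjI exI[of _ "\<lambda>n. trunc t (H n)"] allI)
      show "square_integrable M (Z t)" by (rule lim(1))
      show "simple_process M F t (trunc t (H n))" for n by (rule simple_process_trunc[OF H t'(2)])
      show "(\<lambda>n. l2d M (simple_integral (B i) (trunc t (H n))) (Z t)) \<longlonglongrightarrow> 0"
        using lim(2) by (simp add: spath_trunc[OF H])
      show "(\<lambda>n. l2d P (sv (trunc t (H n))) (cut t X)) \<longlonglongrightarrow> 0"
      proof (rule Lim_null_comparison[OF always_eventually Hlim], rule allI)
        fix n
        have "l2d P (sv (trunc t (H n))) (cut t X) \<le> 1\<^sup>2 * l2d P (sv (H n)) (cut T X)"
          unfolding sv_trunc_eq cut_eq[OF t'(2)]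
          by (rule l2d_mult_bounded[OF sqi_sv[OF H] sX atMost_Times_measurable]) (simp add: indicator_def)
        then show "norm (l2d P (sv (trunc t (H n))) (cut t X)) \<le> l2d P (sv (H n)) (cut T X)" by simp
      qed
    qed
  qed
qed

section \<open>Isometry, linearity and adaptedness of the Ito integral\<close>

definition J :: "nat \<Rightarrow> (real \<Rightarrow> 'a \<Rightarrow> real) \<Rightarrow> real \<Rightarrow> 'a \<Rightarrow> real" where
  "J i X = ito_integral M F T (B i) X"

lemma
  assumes "adm X" "i \<in> {1..d}"
  shows J_continuous: "\<omega> \<in> space M \<Longrightarrow> continuous_on {0..T} (\<lambda>t. J i X t \<omega>)"
    and J_has_ito: "0 \<le> t \<Longrightarrow> t \<le> T \<Longrightarrow> has_ito_integral M F (B i) X t (J i X t)"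
  using someI_ex[OF ito_integral_exists[OF assms]] unfolding J_def ito_integral_def by auto

lemma J_limit:
  assumes X: "adm X" and i: "i \<in> {1..d}" and t: "0 \<le> t" "t \<le> T"
  shows "\<exists>H. (\<forall>n. simple_process M F t (H n)) \<and> (\<lambda>n. l2d P (sv (H n)) (cut t X)) \<longlonglongrightarrow> 0 \<and>
    (\<lambda>n. l2d M (simple_integral (B i) (H n)) (J i X t)) \<longlonglongrightarrow> 0"
  using J_has_ito[OF X i t] unfolding has_ito_integral_iff[OF sqi_cut[OF adm_sqi[OF X] t(2)] t(2) i] by blast

lemma sqi_J:
  assumes "adm X" "i \<in> {1..d}" "0 \<le> t" "t \<le> T"
  shows "square_integrable M (J i X t)"
  using J_has_ito[OF assms] by (simp add: has_ito_integral_def)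

text \<open>Each factor has its own horizon and its own approximating simple processes; all of these
  are simple on \<open>[0, T]\<close>, where \<open>simple_isometry\<close> applies, and both sides
  pass to the limit.\<close>

lemma J_inner:
  assumes X: "adm X" and Y: "adm Y" and i: "i \<in> {1..d}" and j: "j \<in> {1..d}"
    and s: "0 \<le> s" "s \<le> T" and t: "0 \<le> t" "t \<le> T"
  shows "expectation (\<lambda>\<omega>. J i X s \<omega> * J j Y t \<omega>) = (if i = j then (\<integral>p. cut s X p * cut t Y p \<partial>P) else 0)"
proof -
  obtain H where H: "\<And>n. simple_process M F s (H n)" "(\<lambda>n. l2d P (sv (H n)) (cut s X)) \<longlonglongrightarrow> 0"
    "(\<lambda>n. l2d M (simple_integral (B i) (H n)) (J i X s)) \<longlonglongrightarrow> 0" using J_limit[OF X i s] by blast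
  obtain K where K: "\<And>n. simple_process M F t (K n)" "(\<lambda>n. l2d P (sv (K n)) (cut t Y)) \<longlonglongrightarrow> 0"
    "(\<lambda>n. l2d M (simple_integral (B j) (K n)) (J j Y t)) \<longlonglongrightarrow> 0" using J_limit[OF Y j t] by blast
  have "(\<lambda>n. expectation (\<lambda>\<omega>. simple_integral (B i) (H n) \<omega> * simple_integral (B j) (K n) \<omega>))
      \<longlonglongrightarrow> expectation (\<lambda>\<omega>. J i X s \<omega> * J j Y t \<omega>)"
    by (rule inner_tendsto[OF sqi_simple_integral[OF H(1) s(2) i] sqi_J[OF X i s]
          sqi_simple_integral[OF K(1) t(2) j] sqi_J[OF Y j t] H(3) K(3)])
  moreover have "(\<lambda>n. \<integral>p. sv (H n) p * sv (K n) p \<partial>P) \<longlonglongrightarrow> (\<integral>p. cut s X p * cut t Y p \<partial>P)"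
    by (rule inner_tendsto[OF sqi_sv[OF H(1)] sqi_cut[OF adm_sqi[OF X] s(2)]
          sqi_sv[OF K(1)] sqi_cut[OF adm_sqi[OF Y] t(2)] H(2) K(2)])
  moreover have "expectation (\<lambda>\<omega>. simple_integral (B i) (H n) \<omega> * simple_integral (B j) (K n) \<omega>)
      = (if i = j then (\<integral>p. sv (H n) p * sv (K n) p \<partial>P) else 0)" for n
    by (rule simple_isometry[OF simple_process_mono[OF H(1) s(2)] simple_process_mono[OF K(1) t(2)] i j])
  ultimately show ?thesis
    by (cases "i = j") (auto dest: LIMSEQ_unique simp: LIMSEQ_const_iff)
qed

lemma simple_integral_expectation_0:
  assumes H: "simple_process M F T H" and i: "i \<in> {1..d}"
  shows "expectation (simple_integral (B i) H) = 0"
proof -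
  have 0: "spath i H 0 \<omega> = 0" for \<omega>
    using H
  proof (induction H)
    case (Cons p H)
    then show ?case by (cases p) (auto simp: simple_process_def spath_def)
  qed (simp add: spath_def)
  have "expectation (\<lambda>\<omega>. 1 * (spath i H T \<omega> - spath i H 0 \<omega>)) = 0"
    using T_pos by (intro spath_martingale H i) auto
  then show ?thesis by (simp add: 0 spath_T[OF H])
qed

lemma J_expectation:
  assumes X: "adm X" and i: "i \<in> {1..d}" and t: "0 \<le> t" "t \<le> T"
  shows "expectation (J i X t) = 0"
proof -
  obtain H where H: "\<And>n. simple_process M F t (H n)" "(\<lambda>n. l2d P (sv (H n)) (cut t X)) \<longlonglongrightarrow> 0"
    "(\<lambda>n. l2d M (simple_integral (B i) (H n)) (J i X t)) \<longlonglongrightarrow> 0" using J_limit[OF X i t] by blast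
  have "(\<lambda>n. expectation (\<lambda>\<omega>. simple_integral (B i) (H n) \<omega> * 1)) \<longlonglongrightarrow> expectation (\<lambda>\<omega>. J i X t \<omega> * 1)"
    by (rule inner_tendsto_left[OF sqi_simple_integral[OF H(1) t(2) i] sqi_J[OF X i t] sqi_const H(3)])
  moreover have "expectation (\<lambda>\<omega>. simple_integral (B i) (H n) \<omega> * 1) = 0" for n
    using simple_integral_expectation_0[OF simple_process_mono[OF H(1) t(2)] i] by simp
  ultimately show ?thesis by (simp add: LIMSEQ_const_iff)
qed

text \<open>Adaptedness up to null sets, as a closed span: \<open>F t\<close> is not completed, and
  the chosen version of an integral is only an L2 limit of \<open>F t\<close>-measurable
  functions.\<close>

abbreviation ad :: "real \<Rightarrow> ('a \<Rightarrow> real) set" where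
  "ad t \<equiv> L2cl M (borel_measurable (F t))"

lemma simple_integral_measurable_F:
  assumes "simple_process M F t H" and i: "i \<in> {1..d}"
  shows "simple_integral (B i) H \<in> borel_measurable (F t)"
  using assms(1)
proof (induction H)
  case (Cons p H)
  obtain a b \<xi> where p: "p = (a, b, \<xi>)" by (cases p) auto
  have ab: "0 \<le> a" "a \<le> b" "b \<le> t" and \<xi>: "\<xi> \<in> borel_measurable (F a)"
    using Cons.prems by (auto simp: p simple_process_def)
  have [measurable]: "\<xi> \<in> borel_measurable (F t)" "B i b \<in> borel_measurable (F t)" "B i a \<in> borel_measurable (F t)"
    "simple_integral (B i) H \<in> borel_measurable (F t)"
    using ab \<xi> i Cons by (auto intro: measurable_F_mono B_measurable_F simp: simple_process_def)
  have "(\<lambda>\<omega>. \<xi> \<omega> * (B i b \<omega> - B i a \<omega>) + simple_integral (B i) H \<omega>) \<in> borel_measurable (F t)"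
    by measurable
  moreover have "simple_integral (B i) (p # H) = (\<lambda>\<omega>. \<xi> \<omega> * (B i b \<omega> - B i a \<omega>) + simple_integral (B i) H \<omega>)"
    by (auto simp: simple_integral_def p)
  ultimately show ?case by simp
qed (simp add: simple_integral_def[abs_def])

lemma J_ad:
  assumes X: "adm X" and i: "i \<in> {1..d}" and t: "0 \<le> t" "t \<le> T"
  shows "J i X t \<in> ad t"
proof -
  obtain H where H: "\<And>n. simple_process M F t (H n)" "(\<lambda>n. l2d P (sv (H n)) (cut t X)) \<longlonglongrightarrow> 0"
    "(\<lambda>n. l2d M (simple_integral (B i) (H n)) (J i X t)) \<longlonglongrightarrow> 0" using J_limit[OF X i t] by blast
  have "simple_integral (B i) (H n) \<in> ad t" for n
    by (rule L2cl.base[OF simple_integral_measurable_F[OF H(1) i] sqi_simple_integral[OF H(1) t(2) i]])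
  then show ?thesis by (rule L2cl.lim[OF _ sqi_J[OF X i t] H(3)])
qed

lemma J_l2d:
  assumes X: "adm X" and Y: "adm Y" and i: "i \<in> {1..d}"
    and s: "0 \<le> s" "s \<le> T" and t: "0 \<le> t" "t \<le> T"
  shows "l2d M (J i X s) (J i Y t) = l2d P (cut s X) (cut t Y)"
proof -
  note sX = sqi_J[OF X i s] and sY = sqi_J[OF Y i t]
  note cX = sqi_cut[OF adm_sqi[OF X] s(2)] and cY = sqi_cut[OF adm_sqi[OF Y] t(2)]
  show ?thesis
    unfolding l2d_expand[OF sX sY] l2d_expand[OF cX cY]
    by (simp only: J_inner[OF X X i i s s] J_inner[OF X Y i i s t] J_inner[OF Y Y i i t t] if_True refl)
qed

lemma cut_add: "cut t (\<lambda>s \<omega>. X s \<omega> + Y s \<omega>) = (\<lambda>p. cut t X p + cut t Y p)"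
  by (auto simp: cut_def fun_eq_iff algebra_simps)

lemma cut_scale: "cut t (\<lambda>s \<omega>. c * X s \<omega>) = (\<lambda>p. c * cut t X p)"
  by (auto simp: cut_def fun_eq_iff)

lemma adm_add: "adm X \<Longrightarrow> adm Y \<Longrightarrow> adm (\<lambda>s \<omega>. X s \<omega> + Y s \<omega>)"
  by (simp add: adm_def cut_add L2cl.add)

lemma adm_scale: "adm X \<Longrightarrow> adm (\<lambda>s \<omega>. c * X s \<omega>)"
  by (simp add: adm_def cut_scale L2cl.scale)

text \<open>The isometry carries the residual over to the integrands, where additivity is
  exact.\<close>

lemma J_add:
  assumes X: "adm X" and Y: "adm Y" and i: "i \<in> {1..d}" and t: "0 \<le> t" "t \<le> T"
  shows "l2d M (\<lambda>\<omega>. J i X t \<omega> + J i Y t \<omega>) (J i (\<lambda>s \<omega>. X s \<omega> + Y s \<omega>) t) = 0"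
proof -
  note XY = adm_add[OF X Y]
  note sX = sqi_J[OF X i t] and sY = sqi_J[OF Y i t] and sXY = sqi_J[OF XY i t]
  note cX = sqi_cut[OF adm_sqi[OF X] t(2)] and cY = sqi_cut[OF adm_sqi[OF Y] t(2)]
    and cXY = sqi_cut[OF adm_sqi[OF XY] t(2)]
  have "l2d M (\<lambda>\<omega>. J i X t \<omega> + J i Y t \<omega>) (J i (\<lambda>s \<omega>. X s \<omega> + Y s \<omega>) t)
      = l2d P (\<lambda>p. cut t X p + cut t Y p) (cut t (\<lambda>s \<omega>. X s \<omega> + Y s \<omega>))"
    unfolding l2d_add_expand[OF sX sY sXY] l2d_add_expand[OF cX cY cXY]
    by (simp only: J_inner[OF _ _ i i t t] X Y XY if_True refl)
  then show ?thesis by (simp add: cut_add)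
qed

lemma J_scale:
  assumes X: "adm X" and i: "i \<in> {1..d}" and t: "0 \<le> t" "t \<le> T"
  shows "l2d M (\<lambda>\<omega>. c * J i X t \<omega>) (J i (\<lambda>s \<omega>. c * X s \<omega>) t) = 0"
proof -
  note cX = adm_scale[OF X, of c]
  note J = sqi_J[OF X i t] sqi_J[OF cX i t]
  note C = sqi_cut[OF adm_sqi[OF X] t(2)] sqi_cut[OF adm_sqi[OF cX] t(2)]
  have e: "l2d N (\<lambda>x. c * f x) g = c\<^sup>2 * (\<integral>x. f x * f x \<partial>N) - 2 * c * (\<integral>x. f x * g x \<partial>N) + (\<integral>x. g x * g x \<partial>N)"
    if "square_integrable N f" "square_integrable N g" for N :: "'z measure" and f g
    by (subst l2d_expand[OF sqi_scale[OF that(1)] that(2)]) (simp add: power2_eq_square mult_ac)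
  have "l2d M (\<lambda>\<omega>. c * J i X t \<omega>) (J i (\<lambda>s \<omega>. c * X s \<omega>) t) = l2d P (\<lambda>p. c * cut t X p) (cut t (\<lambda>s \<omega>. c * X s \<omega>))"
    unfolding e[OF J] e[OF C] by (simp only: J_inner[OF _ _ i i t t] X cX if_True refl)
  then show ?thesis by (simp add: cut_scale)
qed

section \<open>The iterated integrals as processes\<close>

lemma ad_approx:
  assumes "f \<in> ad t" "0 < e"
  shows "\<exists>g\<in>borel_measurable (F t). square_integrable M g \<and> l2d M g f < e"
  by (rule L2cl_approx[OF assms]) auto

text \<open>Since \<open>l2d\<close> is a squared distance, the last condition is Hoelder continuity
  of order 1/2 in mean square, the regularity of Brownian motion itself. It makes step
  approximations converge, and both kinds of integration preserve it.\<close>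

definition nice :: "(real \<Rightarrow> 'a \<Rightarrow> real) \<Rightarrow> bool" where
  "nice X \<longleftrightarrow> (\<forall>\<omega>\<in>space M. continuous_on {0..T} (\<lambda>t. X t \<omega>)) \<and> (\<forall>t\<in>{0..T}. X t \<in> ad t) \<and>
     (\<exists>C\<ge>0. \<forall>s\<in>{0..T}. \<forall>t\<in>{0..T}. l2d M (X s) (X t) \<le> C * \<bar>t - s\<bar>)"

lemma niceD:
  assumes "nice X"
  shows "\<omega> \<in> space M \<Longrightarrow> continuous_on {0..T} (\<lambda>t. X t \<omega>)"
    and "0 \<le> t \<Longrightarrow> t \<le> T \<Longrightarrow> X t \<in> ad t" and "0 \<le> t \<Longrightarrow> t \<le> T \<Longrightarrow> square_integrable M (X t)"
  using assms L2cl_sqi[of "X t" M "borel_measurable (F t)"] unfolding nice_def by auto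

text \<open>Sampling a path at the dyadic time below \<open>s\<close> gives a function with
  countably many measurable pieces; by continuity these functions converge pointwise.\<close>

lemma cut_measurable:
  assumes c: "\<And>\<omega>. \<omega> \<in> space M \<Longrightarrow> continuous_on {0..T} (\<lambda>t. X t \<omega>)"
    and m: "\<And>t. 0 \<le> t \<Longrightarrow> t \<le> T \<Longrightarrow> X t \<in> borel_measurable M"
  shows "cut T X \<in> borel_measurable P"
proof -
  define r where "r n k = max 0 (min T (real_of_int k / 2 ^ n))" for n :: nat and k :: int
  have r: "0 \<le> r n k" "r n k \<le> T" for n k using T_pos by (auto simp: r_def)
  define u where "u n = (\<lambda>p. indicator {0..T} (fst p) * X (r n \<lfloor>fst p * 2 ^ n\<rfloor>) (snd p))" for n
  have um: "u n \<in> borel_measurable P" for n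
  proof -
    have "(\<lambda>p. X (r n k) (snd p)) \<in> borel_measurable P" for k
      by (rule measurable_compose[OF measurable_snd m[OF r]])
    moreover have "(\<lambda>p. \<lfloor>fst p * 2 ^ n\<rfloor>) \<in> measurable P (count_space UNIV)" by measurable
    ultimately have "(\<lambda>p. X (r n \<lfloor>fst p * 2 ^ n\<rfloor>) (snd p)) \<in> borel_measurable P"
      by (rule measurable_compose_countable)
    then show ?thesis unfolding u_def by measurable
  qed
  have ul: "(\<lambda>n. u n p) \<longlonglongrightarrow> cut T X p" if p: "p \<in> space P" for p
  proof -
    obtain s \<omega> where p': "p = (s, \<omega>)" "\<omega> \<in> space M" using p by (auto simp: space_pair_measure)
    show ?thesis
    proof (cases "s \<in> {0..T}")
      case True
      have "(\<lambda>n. r n \<lfloor>s * 2 ^ n\<rfloor>) \<longlonglongrightarrow> s"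
      proof (rule tendsto_sandwich[of "\<lambda>n. s - (1/2) ^ n" _ _ "\<lambda>n. s"])
        have "(\<lambda>n. s - (1/2) ^ n) \<longlonglongrightarrow> s - 0" by (intro tendsto_intros LIMSEQ_realpow_zero) auto
        then show "(\<lambda>n. s - (1/2) ^ n) \<longlonglongrightarrow> s" by simp
        show "\<forall>\<^sub>F n in sequentially. s - (1/2) ^ n \<le> r n \<lfloor>s * 2 ^ n\<rfloor>"
        proof (rule always_eventually, rule allI)
          fix n
          have "(s * 2 ^ n - 1) / 2 ^ n \<le> real_of_int \<lfloor>s * 2 ^ n\<rfloor> / 2 ^ n"
            by (rule divide_right_mono) (linarith, simp)
          moreover have "(s * 2 ^ n - 1) / 2 ^ n = s - (1/2)^n" by (simp add: diff_divide_distrib power_divide)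
          moreover have "s - (1/2)^n \<le> T"
          proof -
            have "(0::real) \<le> (1/2)^n" by simp
            then show ?thesis using True by (simp only: atLeastAtMost_iff) linarith
          qed
          ultimately show "s - (1/2) ^ n \<le> r n \<lfloor>s * 2 ^ n\<rfloor>" by (auto simp: r_def)
        qed
        show "\<forall>\<^sub>F n in sequentially. r n \<lfloor>s * 2 ^ n\<rfloor> \<le> s"
        proof (rule always_eventually, rule allI)
          fix n
          have "real_of_int \<lfloor>s * 2 ^ n\<rfloor> / 2 ^ n \<le> s" by (simp add: pos_divide_le_eq)
          then show "r n \<lfloor>s * 2 ^ n\<rfloor> \<le> s" using True by (auto simp: r_def)
        qed
      qed simp
      then have "(\<lambda>n. X (r n \<lfloor>s * 2 ^ n\<rfloor>) \<omega>) \<longlonglongrightarrow> X s \<omega>"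
        using True r by (intro continuous_on_tendsto_compose[OF c[OF p'(2)]]) auto
      then show ?thesis using True by (simp add: u_def cut_def p')
    qed (simp add: u_def cut_def p')
  qed
  show ?thesis by (rule borel_measurable_LIMSEQ_real[OF ul um])
qed

lemma nice_cut_measurable: "nice X \<Longrightarrow> cut T X \<in> borel_measurable P"
  by (rule cut_measurable) (auto dest: niceD sqi_measurable)

lemma nn_P_le:
  assumes [measurable]: "f \<in> borel_measurable P" "A \<in> sets borel"
    and le: "AE s in lborel. (\<integral>\<^sup>+\<omega>. ennreal ((f (s, \<omega>))\<^sup>2) \<partial>M) \<le> ennreal K * indicator A s"
    and A: "A \<subseteq> {a..b}" "a \<le> b" and K: "0 \<le> K"
  shows "square_integrable P f" "(\<integral>p. (f p)\<^sup>2 \<partial>P) \<le> K * (b - a)"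
proof -
  have "(\<integral>\<^sup>+p. ennreal ((f p)\<^sup>2) \<partial>P) = (\<integral>\<^sup>+s. \<integral>\<^sup>+\<omega>. ennreal ((f (s, \<omega>))\<^sup>2) \<partial>M \<partial>lborel)"
    by (subst nn_integral_fst[symmetric]) auto
  also have "\<dots> \<le> (\<integral>\<^sup>+s. ennreal K * indicator A s \<partial>lborel)" by (rule nn_integral_mono_AE[OF le])
  also have "\<dots> = ennreal K * emeasure lborel A" by (rule nn_integral_cmult_indicator) simp
  also have "\<dots> \<le> ennreal K * emeasure lborel {a..b}" by (intro mult_left_mono emeasure_mono A) auto
  also have "\<dots> = ennreal (K * (b - a))" using A K by (simp add: ennreal_mult)
  finally have 1: "(\<integral>\<^sup>+p. ennreal ((f p)\<^sup>2) \<partial>P) \<le> ennreal (K * (b - a))" .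
  then show sq: "square_integrable P f" by (auto simp: sqi_iff_nn intro: le_less_trans)
  have "(\<integral>\<^sup>+p. ennreal ((f p)\<^sup>2) \<partial>P) = ennreal (\<integral>p. (f p)\<^sup>2 \<partial>P)"
    by (rule nn_integral_eq_integral[OF sqi_integrable_sq[OF sq]]) simp
  with 1 show "(\<integral>p. (f p)\<^sup>2 \<partial>P) \<le> K * (b - a)" using A K by (simp add: ennreal_le_iff)
qed

lemma nice_bounded:
  assumes "nice X"
  obtains K where "0 \<le> K" "\<And>t. 0 \<le> t \<Longrightarrow> t \<le> T \<Longrightarrow> expectation (\<lambda>\<omega>. (X t \<omega>)\<^sup>2) \<le> K"
proof -
  obtain C where C: "0 \<le> C" "\<And>s t. s \<in> {0..T} \<Longrightarrow> t \<in> {0..T} \<Longrightarrow> l2d M (X s) (X t) \<le> C * \<bar>t - s\<bar>"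
    using assms unfolding nice_def by blast
  have "expectation (\<lambda>\<omega>. (X t \<omega>)\<^sup>2) \<le> 2 * (C * T) + 2 * expectation (\<lambda>\<omega>. (X 0 \<omega>)\<^sup>2)" if "0 \<le> t" "t \<le> T" for t
  proof -
    have "expectation (\<lambda>\<omega>. (X t \<omega>)\<^sup>2) \<le> 2 * l2d M (X t) (X 0) + 2 * l2d M (X 0) (\<lambda>\<omega>. 0)"
      unfolding integral_sq_l2d using that by (intro l2d_triangle niceD(3)[OF assms]) auto
    also have "l2d M (X t) (X 0) \<le> C * \<bar>0 - t\<bar>" using that T_pos by (intro C) auto
    also have "\<dots> \<le> C * T" using that C(1) by (intro mult_left_mono) auto
    finally show ?thesis by (simp add: integral_sq_l2d)
  qed
  moreover have "0 \<le> 2 * (C * T) + 2 * expectation (\<lambda>\<omega>. (X 0 \<omega>)\<^sup>2)" using C T_pos by (intro add_nonneg_nonneg) auto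
  ultimately show ?thesis by (rule that[rotated])
qed

lemma nn_sq: "square_integrable M f \<Longrightarrow> (\<integral>\<^sup>+\<omega>. ennreal ((f \<omega>)\<^sup>2) \<partial>M) = ennreal (expectation (\<lambda>\<omega>. (f \<omega>)\<^sup>2))"
  by (rule nn_integral_eq_integral[OF sqi_integrable_sq]) auto

lemma nice_sqi_cut:
  assumes X: "nice X"
  shows "square_integrable P (cut T X)"
proof -
  obtain K where K: "0 \<le> K" "\<And>t. 0 \<le> t \<Longrightarrow> t \<le> T \<Longrightarrow> expectation (\<lambda>\<omega>. (X t \<omega>)\<^sup>2) \<le> K"
    using nice_bounded[OF X] by blast
  have "(\<integral>\<^sup>+\<omega>. ennreal ((cut T X (s, \<omega>))\<^sup>2) \<partial>M) \<le> ennreal K * indicator {0..T} s" for s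
    by (cases "s \<in> {0..T}") (simp_all add: cut_def nn_sq[OF niceD(3)[OF X]] K ennreal_leI)
  then show ?thesis
    using T_pos by (intro nn_P_le(1)[OF nice_cut_measurable[OF X], of "{0..T}" K 0 T] K) auto
qed

text \<open>On each interval of a uniform grid the simple process takes a measurable approximation
  of the value at the left end. The approximation costs at most 2 / n and the freezing in time at
  most 2 C T / n at each time.\<close>

lemma nice_adm:
  assumes X: "nice X"
  shows "adm X"
  unfolding adm_def
proof (rule L2cl_limit_le[OF nice_sqi_cut[OF X]])
  obtain C where C: "0 \<le> C" "\<And>s t. s \<in> {0..T} \<Longrightarrow> t \<in> {0..T} \<Longrightarrow> l2d M (X s) (X t) \<le> C * \<bar>t - s\<bar>"
    using X unfolding nice_def by blast
  fix e :: real assume e: "0 < e"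
  \<comment> \<open>Makes the total error, \<open>T * (2 * (1 + C * T) / n)\<close>, smaller than
    \<open>e\<close>.\<close>
  obtain n :: nat where n: "T * (2 * (1 + C * T)) / e < real n" using reals_Archimedean2 by blast
  have n0: "0 < real n"
    by (rule le_less_trans[OF _ n]) (use T_pos C e in \<open>auto intro!: divide_nonneg_nonneg mult_nonneg_nonneg\<close>)
  define \<tau> where "\<tau> k = T * real k / real n" for k :: nat
  have \<tau>: "0 \<le> \<tau> k" "\<tau> k \<le> \<tau> (Suc k)" "k \<le> n \<Longrightarrow> \<tau> k \<le> T" for k
    using T_pos n0 by (auto simp: \<tau>_def divide_simps)
  have "\<exists>g\<in>borel_measurable (F (\<tau> k)). square_integrable M g \<and> l2d M g (X (\<tau> k)) < 1 / real n" if "k \<le> n" for k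
    using that n0 \<tau> by (intro ad_approx niceD(2)[OF X]) auto
  then have "\<forall>k. \<exists>g. k \<le> n \<longrightarrow> g \<in> borel_measurable (F (\<tau> k)) \<and> square_integrable M g \<and> l2d M g (X (\<tau> k)) < 1 / real n"
    by blast
  from choice[OF this] obtain \<xi> where \<xi>: "\<And>k. k \<le> n \<Longrightarrow> \<xi> k \<in> borel_measurable (F (\<tau> k))" "\<And>k. k \<le> n \<Longrightarrow> square_integrable M (\<xi> k)"
    "\<And>k. k \<le> n \<Longrightarrow> l2d M (\<xi> k) (X (\<tau> k)) < 1 / real n" by blast
  define H where "H = map (\<lambda>k. (\<tau> k, \<tau> (Suc k), \<xi> k)) [0..<n]"
  have H: "simple_process M F T H"
    unfolding simple_process_def H_def using \<tau> \<xi> by auto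
  have val: "simple_value H s \<omega> = \<xi> k \<omega>" if k: "k < n" "\<tau> k < s" "s \<le> \<tau> (Suc k)" for s \<omega> k
  proof -
    have mono: "\<tau> i \<le> \<tau> j" if "i \<le> j" for i j using that T_pos n0 by (auto simp: \<tau>_def divide_simps)
    have "simple_value H s \<omega> = (\<Sum>j\<in>{0..<n}. \<xi> j \<omega> * indicator {\<tau> j<..\<tau> (Suc j)} s)"
      by (simp add: simple_value_def H_def o_def interv_sum_list_conv_sum_set_nat)
    also have "\<dots> = (\<Sum>j\<in>{0..<n}. if j = k then \<xi> k \<omega> else 0)"
    proof (intro sum.cong refl)
      fix j
      show "\<xi> j \<omega> * indicator {\<tau> j<..\<tau> (Suc j)} s = (if j = k then \<xi> k \<omega> else 0)"
      proof (cases "j = k")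
        case True
        then show ?thesis using k by simp
      next
        case False
        then have "s \<notin> {\<tau> j<..\<tau> (Suc j)}"
          using k mono[of "Suc j" k] mono[of "Suc k" j] by (cases j k rule: linorder_cases) auto
        then show ?thesis using False by simp
      qed
    qed
    also have "\<dots> = \<xi> k \<omega>" using k by simp
    finally show ?thesis .
  qed
  let ?K = "2 * (1 + C * T) / real n"
  have K0: "0 \<le> ?K" using C T_pos n0 by auto
  \<comment> \<open>Time 0 lies in none of the half-open intervals; being a null set, it can be left
    out.\<close>
  have le: "(\<integral>\<^sup>+\<omega>. ennreal ((sv H (s, \<omega>) - cut T X (s, \<omega>))\<^sup>2) \<partial>M) \<le> ennreal ?K * indicator {0..T} s" if s: "s \<noteq> 0" for s
  proof (cases "s \<in> {0..T}")
    case True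
    define m where "m = \<lceil>s * real n / T\<rceil>"
    have s0: "0 < s * real n / T" "s * real n / T \<le> real n" using s True T_pos n0 by (auto simp: divide_simps)
    then have m: "1 \<le> m" "m \<le> int n" unfolding m_def by linarith+
    define k where "k = nat (m - 1)"
    have k: "k < n" using m by (auto simp: k_def)
    have k2: "real k < s * real n / T" "s * real n / T \<le> real k + 1"
      using m unfolding k_def m_def by linarith+
    have k3: "\<tau> k < s" "s \<le> \<tau> (Suc k)"
      using k2 T_pos n0 by (auto simp: \<tau>_def field_simps)
    have dist: "\<bar>s - \<tau> k\<bar> \<le> T / real n"
    proof -
      have "\<tau> (Suc k) = \<tau> k + T / real n" by (simp add: \<tau>_def distrib_left add_divide_distrib)
      then show ?thesis using k3 by simp
    qed
    have sk: "square_integrable M (\<xi> k)" "square_integrable M (X s)" "square_integrable M (X (\<tau> k))"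
      using \<xi>(2)[of k] k True \<tau>(1,3)[of k] by (auto intro: niceD(3)[OF X])
    have "l2d M (\<xi> k) (X s) \<le> 2 * l2d M (\<xi> k) (X (\<tau> k)) + 2 * l2d M (X (\<tau> k)) (X s)"
      by (rule l2d_triangle[OF sk(1,3,2)])
    also have "\<dots> \<le> 2 * (1 / real n) + 2 * (C * (T / real n))"
    proof -
      have "l2d M (X (\<tau> k)) (X s) \<le> C * \<bar>s - \<tau> k\<bar>" using True k \<tau>(1,3)[of k] by (intro C) auto
      also have "\<dots> \<le> C * (T / real n)" by (intro mult_left_mono dist C)
      finally show ?thesis using \<xi>(3)[of k] k by simp
    qed
    also have "\<dots> = ?K" by (simp add: field_simps add_divide_distrib)
    finally have "ennreal (l2d M (\<xi> k) (X s)) \<le> ennreal ?K" by (rule ennreal_leI)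
    moreover have "(\<integral>\<^sup>+\<omega>. ennreal ((sv H (s, \<omega>) - cut T X (s, \<omega>))\<^sup>2) \<partial>M) = ennreal (l2d M (\<xi> k) (X s))"
      using True by (simp add: sv_def val[OF k k3] cut_def l2d_nn[OF sk(1,2)])
    ultimately show ?thesis using True by simp
  next
    case False
    then show ?thesis using sv_zero[OF H, of s] by (simp add: sv_def cut_def)
  qed
  have "(\<integral>p. (sv H p - cut T X p)\<^sup>2 \<partial>P) \<le> ?K * (T - 0)"
  proof (rule nn_P_le(2)[where A = "{0..T}"])
    show "(\<lambda>p. sv H p - cut T X p) \<in> borel_measurable P"
      using sqi_measurable[OF sqi_sv[OF H]] nice_cut_measurable[OF X] by measurable
    show "AE s in lborel. (\<integral>\<^sup>+\<omega>. ennreal ((sv H (s, \<omega>) - cut T X (s, \<omega>))\<^sup>2) \<partial>M) \<le> ennreal ?K * indicator {0..T} s"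
      using AE_lborel_singleton[of 0] by eventually_elim (rule le)
  qed (use T_pos K0 in auto)
  also have "\<dots> < e" using n n0 e by (simp add: field_simps)
  finally have "l2d P (sv H) (cut T X) < e" by (simp add: l2d_def)
  moreover have "sv H \<in> L2cl P simple_values"
    using H by (intro L2cl.base sqi_sv[OF H]) (auto simp: simple_values_def)
  ultimately show "\<exists>g\<in>L2cl P simple_values. l2d P g (cut T X) < e" by blast
qed

lemma cut_diff_eq:
  assumes "0 \<le> s" "s \<le> t" "t \<le> T"
  shows "cut t X p - cut s X p = indicator ({s<..t} \<times> UNIV) p * cut T X p"
proof (cases p)
  case (Pair r \<omega>)
  consider "r < 0" | "0 \<le> r" "r \<le> s" | "s < r" "r \<le> t" | "t < r" by linarith
  then show ?thesis using assms by cases (simp_all add: cut_def Pair)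
qed

lemma nice_cut_l2d:
  assumes X: "nice X" and K: "0 \<le> K" "\<And>t. 0 \<le> t \<Longrightarrow> t \<le> T \<Longrightarrow> expectation (\<lambda>\<omega>. (X t \<omega>)\<^sup>2) \<le> K"
    and s: "0 \<le> s" "s \<le> T" and t: "0 \<le> t" "t \<le> T"
  shows "l2d P (cut s X) (cut t X) \<le> K * \<bar>t - s\<bar>"
proof -
  have *: "l2d P (cut t X) (cut s X) \<le> K * (t - s)" if st: "0 \<le> s" "s \<le> t" "t \<le> T" for s t
    unfolding l2d_def
  proof (rule nn_P_le(2)[where A = "{s<..t}"])
    show "(\<lambda>p. cut t X p - cut s X p) \<in> borel_measurable P"
      using sqi_cut[OF nice_sqi_cut[OF X], of t] sqi_cut[OF nice_sqi_cut[OF X], of s] st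
      by (auto intro!: borel_measurable_diff dest: sqi_measurable)
    have "(\<integral>\<^sup>+\<omega>. ennreal ((cut t X (r, \<omega>) - cut s X (r, \<omega>))\<^sup>2) \<partial>M) \<le> ennreal K * indicator {s<..t} r" for r
    proof (cases "r \<in> {s<..t}")
      case True
      then show ?thesis using st nn_sq[OF niceD(3)[OF X, of r]] K(2)[of r] by (simp add: cut_def ennreal_leI)
    next
      case False
      then have "cut t X (r, \<omega>) - cut s X (r, \<omega>) = 0" for \<omega> using st by (auto simp: cut_def indicator_def)
      then show ?thesis by simp
    qed
    then show "AE r in lborel. (\<integral>\<^sup>+\<omega>. ennreal ((cut t X (r, \<omega>) - cut s X (r, \<omega>))\<^sup>2) \<partial>M) \<le> ennreal K * indicator {s<..t} r"
      by simp
  qed (use st K in auto)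
  show ?thesis
    using *[of s t] *[of t s] s t by (cases "s \<le> t") (auto simp: l2d_commute)
qed

text \<open>By the isometry the squared increment is the integral of the second moment over the
  elapsed time, so any bound on the second moments serves as \<open>C\<close>.\<close>

lemma nice_J:
  assumes X: "nice X" and i: "i \<in> {1..d}"
  shows "nice (J i X)"
  unfolding nice_def
proof (intro conjI ballI)
  note a = nice_adm[OF X]
  show "continuous_on {0..T} (\<lambda>t. J i X t \<omega>)" if "\<omega> \<in> space M" for \<omega> using that by (rule J_continuous[OF a i])
  show "J i X t \<in> ad t" if "t \<in> {0..T}" for t using that by (intro J_ad a i) auto
  obtain K where K: "0 \<le> K" "\<And>t. 0 \<le> t \<Longrightarrow> t \<le> T \<Longrightarrow> expectation (\<lambda>\<omega>. (X t \<omega>)\<^sup>2) \<le> K"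
    using nice_bounded[OF X] by blast
  show "\<exists>C\<ge>0. \<forall>s\<in>{0..T}. \<forall>t\<in>{0..T}. l2d M (J i X s) (J i X t) \<le> C * \<bar>t - s\<bar>"
    using K nice_cut_l2d[OF X K] by (intro exI[of _ K]) (auto simp: J_l2d[OF a a i])
qed

section \<open>Integrals with respect to time\<close>

definition tint :: "real set \<Rightarrow> (real \<times> 'a \<Rightarrow> real) \<Rightarrow> 'a \<Rightarrow> real" where
  "tint A f \<omega> = (\<integral>s. indicator A s * f (s, \<omega>) \<partial>lborel)"

text \<open>Cauchy--Schwarz in time for each \<omega>, against the indicator of a set of length at
  most \<open>T\<close>, followed by Tonelli's theorem.\<close>

lemma tint_bound:
  assumes f: "square_integrable P f" and A: "A \<in> sets borel" "A \<subseteq> {0..T}"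
  shows "square_integrable M (tint A f)"
    "expectation (\<lambda>\<omega>. (tint A f \<omega>)\<^sup>2) \<le> T * (\<integral>p. (indicator (A \<times> UNIV) p * f p)\<^sup>2 \<partial>P)"
proof -
  have [measurable]: "f \<in> borel_measurable P" using f by (rule sqi_measurable)
  note [measurable] = A(1)
  have m [measurable]: "(\<lambda>p. indicator A (fst p) * f p) \<in> borel_measurable P" by measurable
  have ind: "indicator A (fst p) = (indicator (A \<times> UNIV) p :: real)" for p :: "real \<times> 'a"
    by (cases p) (auto simp: indicator_def)
  have sf: "square_integrable P (\<lambda>p. indicator A (fst p) * f p)"
    by (rule sqi_mult_bounded[OF f, where c = 1]) (auto simp: indicator_def)
  have eA: "emeasure lborel A \<le> ennreal T"
    using emeasure_mono[OF A(2), of lborel] T_pos by simp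
  have sA: "square_integrable lborel (indicator A :: real \<Rightarrow> real)"
    using eA by (simp add: sqi_iff_nn power2_eq_square flip: indicator_inter_arith)
      (auto simp: nn_integral_indicator ennreal_indicator intro: le_less_trans)
  have [measurable]: "tint A f \<in> borel_measurable M"
    unfolding tint_def[abs_def] by (rule lborel.borel_measurable_lebesgue_integral) measurable
  have pt: "ennreal ((tint A f \<omega>)\<^sup>2) \<le> ennreal T * (\<integral>\<^sup>+s. ennreal ((indicator A s * f (s, \<omega>))\<^sup>2) \<partial>lborel)"
    if \<omega>: "\<omega> \<in> space M" for \<omega>
  proof (cases "(\<integral>\<^sup>+s. ennreal ((indicator A s * f (s, \<omega>))\<^sup>2) \<partial>lborel) = \<infinity>")
    case True
    then show ?thesis using T_pos by (simp add: ennreal_mult_top)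
  next
    case False
    have [measurable]: "(\<lambda>s. f (s, \<omega>)) \<in> borel_measurable lborel" using \<omega> by measurable
    let ?h = "\<lambda>s. indicator A s * f (s, \<omega>)"
    have sh: "square_integrable lborel ?h" using False by (auto simp: sqi_iff_nn less_top)
    have "(\<integral>s. indicator A s * ?h s \<partial>lborel)\<^sup>2 \<le> (\<integral>s. (indicator A s)\<^sup>2 \<partial>lborel) * (\<integral>s. (?h s)\<^sup>2 \<partial>lborel)"
      by (rule sqi_Cauchy_Schwarz[OF sA sh])
    also have "(\<lambda>s. indicator A s * ?h s) = ?h" by (auto simp: indicator_def)
    also have "(\<integral>s. (indicator A s)\<^sup>2 \<partial>lborel) = measure lborel A"
      by (simp add: power2_eq_square flip: indicator_inter_arith)
    also have "measure lborel A \<le> T"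
      using eA T_pos by (simp add: measure_def enn2real_leI)
    finally have "(tint A f \<omega>)\<^sup>2 \<le> T * (\<integral>s. (?h s)\<^sup>2 \<partial>lborel)"
      by (simp add: tint_def mult_right_mono)
    then have "ennreal ((tint A f \<omega>)\<^sup>2) \<le> ennreal T * ennreal (\<integral>s. (?h s)\<^sup>2 \<partial>lborel)"
      using T_pos by (simp add: ennreal_leI flip: ennreal_mult')
    also have "ennreal (\<integral>s. (?h s)\<^sup>2 \<partial>lborel) = (\<integral>\<^sup>+s. ennreal ((?h s)\<^sup>2) \<partial>lborel)"
      by (rule nn_integral_eq_integral[symmetric, OF sqi_integrable_sq[OF sh]]) simp
    finally show ?thesis .
  qed
  have "(\<integral>\<^sup>+\<omega>. ennreal ((tint A f \<omega>)\<^sup>2) \<partial>M)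
      \<le> (\<integral>\<^sup>+\<omega>. ennreal T * (\<integral>\<^sup>+s. ennreal ((indicator A s * f (s, \<omega>))\<^sup>2) \<partial>lborel) \<partial>M)"
    by (rule nn_integral_mono) (rule pt)
  also have "\<dots> = ennreal T * (\<integral>\<^sup>+\<omega>. \<integral>\<^sup>+s. ennreal ((indicator A s * f (s, \<omega>))\<^sup>2) \<partial>lborel \<partial>M)"
    by (rule nn_integral_cmult) (rule lborel.borel_measurable_nn_integral, measurable)
  also have "(\<integral>\<^sup>+\<omega>. \<integral>\<^sup>+s. ennreal ((indicator A s * f (s, \<omega>))\<^sup>2) \<partial>lborel \<partial>M)
      = (\<integral>\<^sup>+p. ennreal ((indicator A (fst p) * f p)\<^sup>2) \<partial>P)"
    by (subst P.nn_integral_snd[symmetric]) auto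
  also have "\<dots> = ennreal (\<integral>p. (indicator A (fst p) * f p)\<^sup>2 \<partial>P)"
    by (rule nn_integral_eq_integral[OF sqi_integrable_sq[OF sf]]) simp
  finally have le: "(\<integral>\<^sup>+\<omega>. ennreal ((tint A f \<omega>)\<^sup>2) \<partial>M) \<le> ennreal (T * (\<integral>p. (indicator A (fst p) * f p)\<^sup>2 \<partial>P))"
    using T_pos by (simp add: ennreal_mult')
  then show s: "square_integrable M (tint A f)"
    by (auto simp: sqi_iff_nn intro: le_less_trans)
  show "expectation (\<lambda>\<omega>. (tint A f \<omega>)\<^sup>2) \<le> T * (\<integral>p. (indicator (A \<times> UNIV) p * f p)\<^sup>2 \<partial>P)"
    using le T_pos unfolding nn_sq[OF s] ind by (simp add: ennreal_le_iff)
qed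

lemma sqi_P_Times_indicator:
  assumes "A \<in> sets borel" "A \<subseteq> {0..T}"
  shows "square_integrable P (\<lambda>p. indicator A (fst p))"
proof -
  have "emeasure lborel A \<le> ennreal T"
    using emeasure_mono[OF assms(2), of lborel] T_pos by simp
  then have sA: "square_integrable lborel (indicator A :: real \<Rightarrow> real)"
    using assms by (simp add: sqi_iff_nn power2_eq_square flip: indicator_inter_arith)
      (auto simp: nn_integral_indicator ennreal_indicator intro: le_less_trans)
  from sqi_P_mult[OF this sqi_const[of 1]] show ?thesis by (simp add: case_prod_unfold)
qed

lemma AE_tint_integrable:
  assumes f: "square_integrable P f" and A: "A \<in> sets borel" "A \<subseteq> {0..T}"
  shows "AE \<omega> in M. integrable lborel (\<lambda>s. indicator A s * f (s, \<omega>))"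
proof -
  have "integrable P (\<lambda>p. indicator A (fst p) * f p)"
    by (rule sqi_mult[OF sqi_P_Times_indicator[OF A] f])
  then have "integrable P (\<lambda>(s, \<omega>). indicator A s * f (s, \<omega>))" by (simp add: case_prod_unfold)
  from P.AE_integrable_snd[OF this] show ?thesis .
qed

lemma tint_add:
  assumes f: "square_integrable P f" and g: "square_integrable P g" and A: "A \<in> sets borel" "A \<subseteq> {0..T}"
  shows "AE \<omega> in M. tint A (\<lambda>p. f p + g p) \<omega> = tint A f \<omega> + tint A g \<omega>"
  using AE_tint_integrable[OF f A] AE_tint_integrable[OF g A]
  by eventually_elim (simp add: tint_def distrib_left)

lemma tint_scale: "tint A (\<lambda>p. c * f p) \<omega> = c * tint A f \<omega>"
  by (simp add: tint_def mult.left_commute)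

text \<open>By boundedness it suffices to integrate simple processes. Their terms starting up to
  \<open>t\<close> have \<open>F t\<close>-measurable coefficients, and the later ones contribute
  0.\<close>

lemma tint_ad:
  assumes f: "f \<in> L2cl P simple_values" and t: "0 \<le> t" "t \<le> T"
  shows "tint {0..t} f \<in> ad t"
proof (rule L2cl_image[OF f, where \<Phi> = "tint {0..t}" and C = T])
  have A: "{0..t} \<in> sets borel" "{0..t} \<subseteq> {0..T}" using t by auto
  note sq = tint_bound(1)[OF L2cl_sqi A]
  show "square_integrable M (tint {0..t} f)" if "f \<in> L2cl P simple_values" for f using that by (rule sq)
  show "l2d M (\<lambda>x. tint {0..t} f x + tint {0..t} g x) (tint {0..t} (\<lambda>x. f x + g x)) = 0"
    if "f \<in> L2cl P simple_values" "g \<in> L2cl P simple_values" for f g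
  proof (rule l2d_eq_0_iff_AE[OF sqi_add[OF sq[OF that(1)] sq[OF that(2)]] sq[OF L2cl.add[OF that]], THEN iffD2])
    show "AE x in M. tint {0..t} f x + tint {0..t} g x = tint {0..t} (\<lambda>x. f x + g x) x"
      using tint_add[OF that[THEN L2cl_sqi] A] by eventually_elim simp
  qed
  show "l2d M (\<lambda>x. c * tint {0..t} f x) (tint {0..t} (\<lambda>x. c * f x)) = 0" for c f
    by (simp add: l2d_def tint_scale)
  show "l2d M (tint {0..t} f) (tint {0..t} g) \<le> T * l2d P f g"
    if fg: "f \<in> L2cl P simple_values" "g \<in> L2cl P simple_values" for f g
  proof -
    let ?h = "\<lambda>p. f p + (- 1) * g p"
    have h: "?h \<in> L2cl P simple_values" by (intro L2cl.add L2cl.scale fg)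
    have "AE \<omega> in M. tint {0..t} ?h \<omega> = tint {0..t} f \<omega> - tint {0..t} g \<omega>"
      using tint_add[OF L2cl_sqi[OF fg(1)] L2cl_sqi[OF L2cl.scale[OF fg(2), of "- 1"]] A]
    proof eventually_elim
      case (elim \<omega>)
      have "tint {0..t} (\<lambda>p. (- 1) * g p) \<omega> = - tint {0..t} g \<omega>" by (subst tint_scale) simp
      with elim show ?case by linarith
    qed
    then have "l2d M (tint {0..t} f) (tint {0..t} g) = expectation (\<lambda>\<omega>. (tint {0..t} ?h \<omega>)\<^sup>2)"
      unfolding l2d_def using sq[OF fg(1)] sq[OF fg(2)] sq[OF h]
      by (intro integral_cong_AE borel_measurable_power borel_measurable_diff) (auto dest: sqi_measurable)
    also have "\<dots> \<le> T * (\<integral>p. (indicator ({0..t} \<times> UNIV) p * ?h p)\<^sup>2 \<partial>P)"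
      by (rule tint_bound(2)[OF L2cl_sqi[OF h] A])
    also have "\<dots> \<le> T * (\<integral>p. (?h p)\<^sup>2 \<partial>P)"
    proof (intro mult_left_mono integral_mono')
      show "integrable P (\<lambda>p. (?h p)\<^sup>2)" by (rule sqi_integrable_sq[OF L2cl_sqi[OF h]])
    qed (use T_pos in \<open>auto simp: indicator_def\<close>)
    finally show ?thesis by (simp add: l2d_def)
  qed
  fix f assume "f \<in> simple_values" "square_integrable P f"
  then obtain H where H: "simple_process M F T H" and f: "f = sv H" by (auto simp: simple_values_def)
  have "tint {0..t} (sv H) \<in> borel_measurable (F t)"
  proof -
    have len: "(\<integral>s. indicator {0..t} s * indicator {a<..b} s \<partial>lborel) = (0::real)" if "t < a" for a b
    proof -
      have "(\<lambda>s. indicator {0..t} s * indicator {a<..b} s :: real) = (\<lambda>s. 0)" using that by (auto simp: indicator_def fun_eq_iff)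
      then show ?thesis by simp
    qed
    have int: "integrable lborel (\<lambda>s::real. indicator {0..t} s * indicator {a<..b} s :: real)" for a b
    proof -
      have "square_integrable lborel (\<lambda>s::real. indicator {0..t} s :: real)"
        using t by (simp add: square_integrable_def power2_eq_square flip: indicator_inter_arith)
      then show ?thesis by (intro sqi_mult) auto
    qed
    have eq: "tint {0..t} (sv H) \<omega> = (\<Sum>(a, b, \<xi>)\<leftarrow>H. \<xi> \<omega> * (\<integral>s. indicator {0..t} s * indicator {a<..b} s \<partial>lborel))
      \<and> integrable lborel (\<lambda>s. indicator {0..t} s * sv H (s, \<omega>))" for H \<omega>
    proof (induction H)
      case (Cons p H)
      obtain a b \<xi> where p: "p = (a, b, \<xi>)" by (cases p) auto
      have e: "(\<lambda>s. indicator {0..t} s * sv (p # H) (s, \<omega>))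
          = (\<lambda>s. \<xi> \<omega> * (indicator {0..t} s * indicator {a<..b} s) + indicator {0..t} s * sv H (s, \<omega>))"
        by (auto simp: sv_def simple_value_def p fun_eq_iff algebra_simps)
      show ?case using Cons int[of a b] unfolding tint_def e by (simp add: p)
    qed (simp add: tint_def sv_def simple_value_def)
    have "(\<lambda>\<omega>. \<Sum>(a, b, \<xi>)\<leftarrow>H. \<xi> \<omega> * (\<integral>s. indicator {0..t} s * indicator {a<..b} s \<partial>lborel)) \<in> borel_measurable (F t)"
      using H
    proof (induction H)
      case (Cons p H)
      obtain a b \<xi> where p: "p = (a, b, \<xi>)" by (cases p) auto
      have \<xi>: "\<xi> \<in> borel_measurable (F a)" and H: "simple_process M F T H"
        using Cons.prems by (auto simp: p simple_process_def)
      have "(\<lambda>\<omega>. \<xi> \<omega> * (\<integral>s. indicator {0..t} s * indicator {a<..b} s \<partial>lborel)) \<in> borel_measurable (F t)"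
      proof (cases "a \<le> t")
        case True
        then have "\<xi> \<in> borel_measurable (F t)" using \<xi> measurable_F_mono by blast
        then show ?thesis by measurable
      qed (simp add: len)
      then show ?case using Cons.IH[OF H] by (simp add: p)
    qed simp
    then show ?thesis using eq by (simp add: fun_eq_iff[symmetric] cong: measurable_cong)
  qed
  then show "tint {0..t} f \<in> ad t"
    unfolding f by (rule L2cl.base) (rule tint_bound(1)[OF sqi_sv[OF H] A])
qed

definition R :: "(real \<Rightarrow> 'a \<Rightarrow> real) \<Rightarrow> real \<Rightarrow> 'a \<Rightarrow> real" where
  "R X t \<omega> = integral {0..t} (\<lambda>s. X s \<omega>)"

lemma R_eq_tint:
  assumes c: "continuous_on {0..T} (\<lambda>t. X t \<omega>)" and t: "0 \<le> t" "t \<le> T"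
  shows "R X t \<omega> = tint {0..t} (cut T X) \<omega>"
proof -
  have "continuous_on {0..t} (\<lambda>t. X t \<omega>)" using c by (rule continuous_on_subset) (use t in auto)
  from set_borel_integral_eq_integral(2)[OF borel_integrable_atLeastAtMost'[OF this]]
  have "R X t \<omega> = (\<integral>s. indicator {0..t} s *\<^sub>R X s \<omega> \<partial>lborel)" by (simp add: R_def set_lebesgue_integral_def)
  also have "\<dots> = tint {0..t} (cut T X) \<omega>"
    unfolding tint_def using t by (intro Bochner_Integration.integral_cong) (auto simp: cut_def indicator_def)
  finally show ?thesis .
qed

text \<open>The squared increment is at most \<open>T\<close> times the integral of the second
  moment over the elapsed time; this is linear in \<open>t - s\<close>, as \<open>nice\<close>
  demands.\<close>

lemma nice_R:
  assumes X: "nice X"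
  shows "nice (R X)"
  unfolding nice_def
proof (intro conjI ballI)
  note a = nice_adm[OF X]
  note sX = nice_sqi_cut[OF X]
  show "continuous_on {0..T} (\<lambda>t. R X t \<omega>)" if "\<omega> \<in> space M" for \<omega>
    unfolding R_def by (intro indefinite_integral_continuous_1 integrable_continuous_real niceD(1)[OF X that])
  have tint: "R X t \<in> borel_measurable M \<and> (AE \<omega> in M. tint {0..t} (cut T X) \<omega> = R X t \<omega>)" if "t \<in> {0..T}" for t
  proof -
    have eq: "tint {0..t} (cut T X) \<omega> = R X t \<omega>" if "\<omega> \<in> space M" for \<omega>
      using R_eq_tint[of X \<omega> t, OF niceD(1)[OF X that]] \<open>t \<in> {0..T}\<close> by simp
    have "tint {0..t} (cut T X) \<in> borel_measurable M"
      using that by (intro sqi_measurable[OF tint_bound(1)] sX) auto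
    then show ?thesis using eq by (auto cong: measurable_cong)
  qed
  show ad: "R X t \<in> ad t" if "t \<in> {0..T}" for t
    using that tint[OF that] by (intro L2cl_AE_cong[OF tint_ad[OF a[unfolded adm_def]]]) auto
  obtain K where K: "0 \<le> K" "\<And>t. 0 \<le> t \<Longrightarrow> t \<le> T \<Longrightarrow> expectation (\<lambda>\<omega>. (X t \<omega>)\<^sup>2) \<le> K"
    using nice_bounded[OF X] by blast
  have *: "l2d M (R X t) (R X s) \<le> T * K * (t - s)" if st: "0 \<le> s" "s \<le> t" "t \<le> T" for s t
  proof -
    have A: "{s<..t} \<in> sets borel" "{s<..t} \<subseteq> {0..T}" "{0..s} \<in> sets borel" "{0..s} \<subseteq> {0..T}" using st by auto
    have "AE \<omega> in M. R X t \<omega> - R X s \<omega> = tint {s<..t} (cut T X) \<omega>"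
      using AE_tint_integrable[OF sX A(1,2)] AE_tint_integrable[OF sX A(3,4)] AE_space
    proof eventually_elim
      case (elim \<omega>)
      have "(\<lambda>r. indicator {0..t} r * cut T X (r, \<omega>))
          = (\<lambda>r. indicator {s<..t} r * cut T X (r, \<omega>) + indicator {0..s} r * cut T X (r, \<omega>))"
        using st by (auto simp: fun_eq_iff indicator_def)
      then have "tint {0..t} (cut T X) \<omega> = tint {s<..t} (cut T X) \<omega> + tint {0..s} (cut T X) \<omega>"
        unfolding tint_def using elim by simp
      then show ?case
        using st R_eq_tint[of X \<omega> t, OF niceD(1)[OF X elim(3)]] R_eq_tint[of X \<omega> s, OF niceD(1)[OF X elim(3)]] by simp
    qed
    moreover have "R X t \<in> borel_measurable M" "R X s \<in> borel_measurable M" using tint st by auto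
    ultimately have "l2d M (R X t) (R X s) = expectation (\<lambda>\<omega>. (tint {s<..t} (cut T X) \<omega>)\<^sup>2)"
      unfolding l2d_def using sqi_measurable[OF tint_bound(1)[OF sX A(1,2)]]
      by (intro integral_cong_AE) auto
    also have "\<dots> \<le> T * (\<integral>p. (indicator ({s<..t} \<times> UNIV) p * cut T X p)\<^sup>2 \<partial>P)"
      by (rule tint_bound(2)[OF sX A(1,2)])
    also have "(\<integral>p. (indicator ({s<..t} \<times> UNIV) p * cut T X p)\<^sup>2 \<partial>P) = l2d P (cut s X) (cut t X)"
      unfolding l2d_def
    proof (rule Bochner_Integration.integral_cong[OF refl])
      fix p :: "real \<times> 'a"
      have "indicator ({s<..t} \<times> UNIV) p * cut T X p = cut t X p - cut s X p"
        using cut_diff_eq[OF st] by simp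
      then show "(indicator ({s<..t} \<times> UNIV) p * cut T X p)\<^sup>2 = (cut s X p - cut t X p)\<^sup>2"
        by (simp add: power2_commute)
    qed
    also have "\<dots> \<le> K * \<bar>t - s\<bar>" using st by (intro nice_cut_l2d X K) auto
    finally show ?thesis using st T_pos by (simp add: mult_left_mono mult.assoc)
  qed
  have "l2d M (R X s) (R X t) \<le> T * K * \<bar>t - s\<bar>" if "s \<in> {0..T}" "t \<in> {0..T}" for s t
    using *[of s t] *[of t s] that by (cases "s \<le> t") (auto simp: l2d_commute)
  then show "\<exists>C\<ge>0. \<forall>s\<in>{0..T}. \<forall>t\<in>{0..T}. l2d M (R X s) (R X t) \<le> C * \<bar>t - s\<bar>"
    using K T_pos by (intro exI[of _ "T * K"]) auto
qed

lemma nice_const: "nice (\<lambda>t \<omega>. c)"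
  unfolding nice_def by (auto intro: L2cl.base)

abbreviation Iw :: "nat list \<Rightarrow> real \<Rightarrow> 'a \<Rightarrow> real" where
  "Iw \<equiv> ito_iterated M d T B"

lemma Iw_Cons: "Iw (a # w) = (if a = 0 then R (Iw w) else J a (Iw w))"
  by (auto simp: J_def R_def fun_eq_iff)

lemma nice_Iw: "set w \<subseteq> {0..d} \<Longrightarrow> nice (Iw w)"
proof (induction w)
  case Nil
  have "Iw [] = (\<lambda>t \<omega>. 1)" by simp
  then show ?case using nice_const[of 1] by simp
next
  case (Cons a w)
  then show ?case unfolding Iw_Cons using nice_R[of "Iw w"] nice_J[of "Iw w" a] by auto
qed

section \<open>Covariances of the iterated integrals\<close>

lemma R_inner:
  assumes X: "nice X" and s: "0 \<le> s" "s \<le> T" and V: "square_integrable M V"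
  shows "expectation (\<lambda>\<omega>. R X s \<omega> * V \<omega>) = integral {0..s} (\<lambda>r. expectation (\<lambda>\<omega>. X r \<omega> * V \<omega>))"
proof -
  note sX = nice_sqi_cut[OF X]
  let ?g = "\<lambda>p. indicator {0..s} (fst p) * V (snd p)"
  have "square_integrable lborel (indicator {0..s} :: real \<Rightarrow> real)"
    using s by (simp add: square_integrable_def power2_eq_square flip: indicator_inter_arith)
  from sqi_P_mult[OF this V] have sg: "square_integrable P ?g"
    by (simp add: case_prod_unfold mult.commute)
  from sqi_mult[OF sX sg] have i: "integrable P (\<lambda>(r, \<omega>). cut T X (r, \<omega>) * ?g (r, \<omega>))"
    by (simp add: case_prod_unfold)
  have "expectation (\<lambda>\<omega>. R X s \<omega> * V \<omega>) = (\<integral>\<omega>. \<integral>r. cut T X (r, \<omega>) * ?g (r, \<omega>) \<partial>lborel \<partial>M)"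
  proof (rule Bochner_Integration.integral_cong[OF refl])
    fix \<omega> assume "\<omega> \<in> space M"
    then have "R X s \<omega> = tint {0..s} (cut T X) \<omega>" using s by (intro R_eq_tint niceD(1)[OF X]) auto
    then show "R X s \<omega> * V \<omega> = (\<integral>r. cut T X (r, \<omega>) * ?g (r, \<omega>) \<partial>lborel)"
      by (simp add: tint_def mult_ac)
  qed
  also have "\<dots> = (\<integral>r. \<integral>\<omega>. cut T X (r, \<omega>) * ?g (r, \<omega>) \<partial>M \<partial>lborel)"
    unfolding P.integral_snd[OF i] P.integral_fst[OF i] ..
  also have "\<dots> = (\<integral>r. indicator {0..s} r *\<^sub>R expectation (\<lambda>\<omega>. X r \<omega> * V \<omega>) \<partial>lborel)"
    using s by (intro Bochner_Integration.integral_cong refl) (auto simp: cut_def indicator_def)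
  also have "\<dots> = integral {0..s} (\<lambda>r. expectation (\<lambda>\<omega>. X r \<omega> * V \<omega>))"
  proof -
    have "integrable lborel (\<lambda>r. \<integral>\<omega>. cut T X (r, \<omega>) * ?g (r, \<omega>) \<partial>M)"
      by (rule P.integrable_fst[OF i])
    moreover have "(\<lambda>r. \<integral>\<omega>. cut T X (r, \<omega>) * ?g (r, \<omega>) \<partial>M) = (\<lambda>r. indicator {0..s} r *\<^sub>R expectation (\<lambda>\<omega>. X r \<omega> * V \<omega>))"
      using s by (auto simp: cut_def indicator_def fun_eq_iff)
    ultimately have "set_integrable lborel {0..s} (\<lambda>r. expectation (\<lambda>\<omega>. X r \<omega> * V \<omega>))"
      by (simp add: set_integrable_def)
    from set_borel_integral_eq_integral(2)[OF this] show ?thesis by (simp add: set_lebesgue_integral_def)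
  qed
  finally show ?thesis .
qed

lemma cut_inner:
  assumes X: "square_integrable P (cut T X)" and Y: "square_integrable P (cut T Y)"
    and s: "0 \<le> s" "s \<le> T" and t: "0 \<le> t" "t \<le> T"
  shows "(\<integral>p. cut s X p * cut t Y p \<partial>P) = integral {0..min s t} (\<lambda>r. expectation (\<lambda>\<omega>. X r \<omega> * Y r \<omega>))"
proof -
  have i: "integrable P (\<lambda>p. cut s X p * cut t Y p)"
    by (rule sqi_mult[OF sqi_cut[OF X s(2)] sqi_cut[OF Y t(2)]])
  have eq: "(\<integral>\<omega>. cut s X (r, \<omega>) * cut t Y (r, \<omega>) \<partial>M) = indicator {0..min s t} r *\<^sub>R expectation (\<lambda>\<omega>. X r \<omega> * Y r \<omega>)" for r
    by (auto simp: cut_def indicator_def)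
  have "(\<integral>p. cut s X p * cut t Y p \<partial>P) = (\<integral>r. \<integral>\<omega>. cut s X (r, \<omega>) * cut t Y (r, \<omega>) \<partial>M \<partial>lborel)"
    by (rule P.integral_fst'[OF i, symmetric])
  moreover have "set_integrable lborel {0..min s t} (\<lambda>r. expectation (\<lambda>\<omega>. X r \<omega> * Y r \<omega>))"
    using P.integrable_fst'[OF i] unfolding set_integrable_def by (simp only: eq)
  from set_borel_integral_eq_integral(2)[OF this]
  show ?thesis using calculation by (simp only: eq set_lebesgue_integral_def)
qed

end

text \<open>Covariances of iterated integrals; as in \<^const>\<open>ito_iterated\<close>, the words are reversed.\<close>

fun kern :: "nat list \<Rightarrow> nat list \<Rightarrow> real \<Rightarrow> real \<Rightarrow> real" where
  "kern [] [] s t = 1"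
| "kern [] (b # v) s t = (if b = 0 then integral {0..t} (\<lambda>r. kern [] v s r) else 0)"
| "kern (a # u) [] s t = (if a = 0 then integral {0..s} (\<lambda>r. kern u [] r t) else 0)"
| "kern (a # u) (b # v) s t =
    (if a = 0 then integral {0..s} (\<lambda>r. kern u (b # v) r t)
     else if b = 0 then integral {0..t} (\<lambda>r. kern (a # u) v s r)
     else if a = b then integral {0..min s t} (\<lambda>r. kern u v r r) else 0)"

text \<open>Zeros at the head only integrate, and by induction they integrate 0. Two nonzero heads
  either differ, which gives 0, or cancel and leave lists whose nonzero letters still
  differ.\<close>

lemma kern_eq_0: "filter (\<lambda>a. a \<noteq> 0) u \<noteq> filter (\<lambda>a. a \<noteq> 0) v \<Longrightarrow> kern u v s t = 0"
proof (induction u v s t rule: kern.induct)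
  case (2 b v s t)
  then have "b = 0 \<Longrightarrow> kern [] v s = (\<lambda>r. 0)" by (intro ext) simp
  then show ?case by simp
next
  case (4 a u b v s t)
  have "a \<noteq> 0 \<Longrightarrow> b = 0 \<Longrightarrow> kern (a # u) v s = (\<lambda>r. 0)"
    using "4.IH"(2) "4.prems" by (intro ext) simp
  moreover have "a = 0 \<Longrightarrow> (\<lambda>r. kern u (b # v) r t) = (\<lambda>r. 0)"
    using "4.IH"(1) "4.prems" by (intro ext) simp
  moreover have "a \<noteq> 0 \<Longrightarrow> a = b \<Longrightarrow> (\<lambda>r. kern u v r r) = (\<lambda>r. 0)"
    using "4.IH"(3) "4.prems" by (intro ext) simp
  ultimately show ?case by auto
qed auto

definition zero_pattern :: "nat list \<Rightarrow> nat list" where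
  "zero_pattern = map (\<lambda>a. if a = 0 then 0 else 1)"

lemma zero_pattern_simps [simp]:
  "zero_pattern [] = []" "zero_pattern (0 # w) = 0 # zero_pattern w"
  "a \<noteq> 0 \<Longrightarrow> zero_pattern (a # w) = 1 # zero_pattern w"
  by (simp_all add: zero_pattern_def)

text \<open>\<open>kern\<close> compares letters with 0 and nonzero heads with each other. When the
  nonzero letters agree in order, the second comparison always succeeds, before and after they are
  replaced by 1.\<close>

lemma kern_zero_pattern:
  "filter (\<lambda>a. a \<noteq> 0) u = filter (\<lambda>a. a \<noteq> 0) v \<Longrightarrow> kern u v s t = kern (zero_pattern u) (zero_pattern v) s t"
proof (induction u v s t rule: kern.induct)
  case (2 b v s t)
  have "b = 0 \<Longrightarrow> kern [] v s = kern [] (zero_pattern v) s"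
    using 2 by (intro ext) simp
  then show ?case using 2 by (cases "b = 0") simp_all
next
  case (3 a u s t)
  then show ?case by (cases "a = 0") simp_all
next
  case (4 a u b v s t)
  consider "a = 0" | "a \<noteq> 0" "b = 0" | "a \<noteq> 0" "b \<noteq> 0" by blast
  then show ?case
  proof cases
    case 1
    show ?thesis
    proof (cases "b = 0")
      case True
      then show ?thesis using 1 "4.IH"(1)[OF 1] "4.prems" by simp
    next
      case False
      then show ?thesis using 1 "4.IH"(1)[OF 1] "4.prems" by simp
    qed
  next
    case 2
    then have "kern (a # u) v s = kern (1 # zero_pattern u) (zero_pattern v) s"
      using "4.IH"(2)[OF 2] "4.prems" by (intro ext) simp
    then show ?thesis using 2 by simp
  next
    case 3
    then have "a = b" using "4.prems" by simp
    then show ?thesis using 3 "4.IH"(3)[OF 3] "4.prems" by simp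
  qed
qed simp

context brownian
begin

lemma Iw_inner:
  assumes "set u \<subseteq> {0..d}" "set v \<subseteq> {0..d}" "0 \<le> s" "s \<le> T" "0 \<le> t" "t \<le> T"
  shows "expectation (\<lambda>\<omega>. Iw u s \<omega> * Iw v t \<omega>) = kern u v s t"
  using assms
proof (induction u v s t rule: kern.induct)
  case (1 s t)
  then show ?case by (simp add: prob_space)
next
  case (2 b v s t)
  note v = nice_Iw[of v]
  show ?case
  proof (cases "b = 0")
    case True
    have "expectation (\<lambda>\<omega>. R (Iw v) t \<omega> * Iw [] s \<omega>) = integral {0..t} (\<lambda>r. expectation (\<lambda>\<omega>. Iw v r \<omega> * Iw [] s \<omega>))"
      using "2.prems" by (intro R_inner nice_Iw niceD(3)[OF nice_Iw]) auto
    also have "\<dots> = integral {0..t} (\<lambda>r. kern [] v s r)"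
    proof (rule Henstock_Kurzweil_Integration.integral_cong)
      fix r assume "r \<in> {0..t}"
      then show "expectation (\<lambda>\<omega>. Iw v r \<omega> * Iw [] s \<omega>) = kern [] v s r"
        using "2.IH"[OF True, of r] "2.prems" by (simp add: mult.commute)
    qed
    finally show ?thesis using True by (simp add: Iw_Cons mult.commute del: ito_iterated.simps(2))
  next
    case False
    then show ?thesis using "2.prems" J_expectation[OF nice_adm[OF v], of b t] by (simp add: Iw_Cons del: ito_iterated.simps(2))
  qed
next
  case (3 a u s t)
  note u = nice_Iw[of u]
  show ?case
  proof (cases "a = 0")
    case True
    have "expectation (\<lambda>\<omega>. R (Iw u) s \<omega> * Iw [] t \<omega>) = integral {0..s} (\<lambda>r. expectation (\<lambda>\<omega>. Iw u r \<omega> * Iw [] t \<omega>))"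
      using "3.prems" by (intro R_inner nice_Iw niceD(3)[OF nice_Iw]) auto
    also have "\<dots> = integral {0..s} (\<lambda>r. kern u [] r t)"
    proof (rule Henstock_Kurzweil_Integration.integral_cong)
      fix r assume "r \<in> {0..s}"
      then show "expectation (\<lambda>\<omega>. Iw u r \<omega> * Iw [] t \<omega>) = kern u [] r t"
        using "3.IH"[OF True, of r] "3.prems" by simp
    qed
    finally show ?thesis using True by (simp add: Iw_Cons del: ito_iterated.simps(2))
  next
    case False
    then show ?thesis using "3.prems" J_expectation[OF nice_adm[OF u], of a s] by (simp add: Iw_Cons del: ito_iterated.simps(2))
  qed
next
  case (4 a u b v s t)
  have nu: "nice (Iw u)" and nv: "nice (Iw v)" using "4.prems" by (auto intro!: nice_Iw)
  \<comment> \<open>The cases follow the recursion of \<open>kern\<close>: integrals over time are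
    pulled out of the expectation until both outermost integrals are stochastic, where the isometry
    applies.\<close>
  consider "a = 0" | "a \<noteq> 0" "b = 0" | "a \<noteq> 0" "b \<noteq> 0" by blast
  then show ?case
  proof cases
    case 1
    have "expectation (\<lambda>\<omega>. R (Iw u) s \<omega> * Iw (b # v) t \<omega>) = integral {0..s} (\<lambda>r. expectation (\<lambda>\<omega>. Iw u r \<omega> * Iw (b # v) t \<omega>))"
      using "4.prems" by (intro R_inner nu niceD(3)[OF nice_Iw]) auto
    also have "\<dots> = integral {0..s} (\<lambda>r. kern u (b # v) r t)"
      using "4.prems" by (intro Henstock_Kurzweil_Integration.integral_cong "4.IH"(1) 1) auto
    finally show ?thesis using 1 by (simp add: Iw_Cons del: ito_iterated.simps(2))
  next
    case 2
    have "expectation (\<lambda>\<omega>. R (Iw v) t \<omega> * Iw (a # u) s \<omega>) = integral {0..t} (\<lambda>r. expectation (\<lambda>\<omega>. Iw v r \<omega> * Iw (a # u) s \<omega>))"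
      using "4.prems" by (intro R_inner nv niceD(3)[OF nice_Iw]) auto
    also have "\<dots> = integral {0..t} (\<lambda>r. expectation (\<lambda>\<omega>. Iw (a # u) s \<omega> * Iw v r \<omega>))" by (simp only: mult.commute)
    also have "\<dots> = integral {0..t} (\<lambda>r. kern (a # u) v s r)"
      using "4.prems" by (intro Henstock_Kurzweil_Integration.integral_cong "4.IH"(2) 2) auto
    finally show ?thesis using 2 by (simp add: Iw_Cons mult.commute del: ito_iterated.simps(2))
  next
    case 3
    have ab: "a \<in> {1..d}" "b \<in> {1..d}" using 3 "4.prems"(1,2) by auto
    have "expectation (\<lambda>\<omega>. J a (Iw u) s \<omega> * J b (Iw v) t \<omega>) = (if a = b then (\<integral>p. cut s (Iw u) p * cut t (Iw v) p \<partial>P) else 0)"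
      using "4.prems" by (intro J_inner nice_adm nu nv ab) auto
    also have "(\<integral>p. cut s (Iw u) p * cut t (Iw v) p \<partial>P) = integral {0..min s t} (\<lambda>r. expectation (\<lambda>\<omega>. Iw u r \<omega> * Iw v r \<omega>))"
      using "4.prems" by (intro cut_inner nice_sqi_cut nu nv) auto
    finally have e: "expectation (\<lambda>\<omega>. J a (Iw u) s \<omega> * J b (Iw v) t \<omega>)
      = (if a = b then integral {0..min s t} (\<lambda>r. expectation (\<lambda>\<omega>. Iw u r \<omega> * Iw v r \<omega>)) else 0)" .
    have "integral {0..min s t} (\<lambda>r. expectation (\<lambda>\<omega>. Iw u r \<omega> * Iw v r \<omega>)) = integral {0..min s t} (\<lambda>r. kern u v r r)"
      if "a = b" using "4.prems" that by (intro Henstock_Kurzweil_Integration.integral_cong "4.IH"(3) 3) auto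
    then show ?thesis using 3 e by (simp add: Iw_Cons del: ito_iterated.simps(2))
  qed
qed

section \<open>The closed span of the iterated integrals as processes\<close>

text \<open>The closed linear span of the iterated integrals, as processes on \<open>[0, T]\<close>.\<close>

inductive KP :: "(real \<Rightarrow> 'a \<Rightarrow> real) \<Rightarrow> bool" where
  base: "set w \<subseteq> {0..d} \<Longrightarrow> KP (Iw w)"
| zero: "KP (\<lambda>s \<omega>. 0)"
| add: "KP X \<Longrightarrow> KP Y \<Longrightarrow> KP (\<lambda>s \<omega>. X s \<omega> + Y s \<omega>)"
| scale: "KP X \<Longrightarrow> KP (\<lambda>s \<omega>. c * X s \<omega>)"
| lim: "(\<And>n::nat. KP (G n)) \<Longrightarrow> square_integrable P (cut T X)
    \<Longrightarrow> (\<lambda>n. l2d P (cut T (G n)) (cut T X)) \<longlonglongrightarrow> 0 \<Longrightarrow> KP X"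

lemma adm_zero: "adm (\<lambda>s \<omega>. 0)"
  using L2cl.zero[of P simple_values] by (simp add: adm_def cut_def case_prod_unfold)

lemma adm_lim:
  "(\<And>n::nat. adm (G n)) \<Longrightarrow> square_integrable P (cut T X)
    \<Longrightarrow> (\<lambda>n. l2d P (cut T (G n)) (cut T X)) \<longlonglongrightarrow> 0 \<Longrightarrow> adm X"
  unfolding adm_def by (rule L2cl.lim)

lemma KP_adm: "KP X \<Longrightarrow> adm X"
  by (induction rule: KP.induct) (auto intro: nice_adm nice_Iw adm_zero adm_add adm_scale adm_lim)

lemma KP_sqi: "KP X \<Longrightarrow> square_integrable P (cut T X)"
  by (intro adm_sqi KP_adm)

lemma KP_eq0: "KP X \<Longrightarrow> square_integrable P (cut T Y) \<Longrightarrow> l2d P (cut T X) (cut T Y) = 0 \<Longrightarrow> KP Y"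
  by (rule KP.lim[of "\<lambda>_. X"]) auto

lemma KP_diff: "KP X \<Longrightarrow> KP Y \<Longrightarrow> KP (\<lambda>s \<omega>. X s \<omega> - Y s \<omega>)"
  using KP.add[of X "\<lambda>s \<omega>. (- 1) * Y s \<omega>"] KP.scale[of Y "- 1"] by simp

lemma KP_sum: "(\<And>i. i \<in> I \<Longrightarrow> KP (f i)) \<Longrightarrow> KP (\<lambda>s \<omega>. \<Sum>i\<in>I. f i s \<omega>)"
  by (induction I rule: infinite_finite_induct) (auto intro: KP.zero KP.add)

lemma cut_diff: "cut t (\<lambda>s \<omega>. X s \<omega> - Y s \<omega>) = (\<lambda>p. cut t X p - cut t Y p)"
  by (auto simp: cut_def fun_eq_iff algebra_simps)

text \<open>The counterpart of \<open>L2cl_image\<close> for processes; linearity and boundedness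
  are asked for on the product space, up to null sets.\<close>

lemma KP_image:
  assumes "KP X"
    and base: "\<And>w. set w \<subseteq> {0..d} \<Longrightarrow> KP (\<Phi> (Iw w))"
    and sq: "\<And>X. KP X \<Longrightarrow> square_integrable P (cut T (\<Phi> X))"
    and add: "\<And>X Y. KP X \<Longrightarrow> KP Y
        \<Longrightarrow> l2d P (cut T (\<lambda>s \<omega>. \<Phi> X s \<omega> + \<Phi> Y s \<omega>)) (cut T (\<Phi> (\<lambda>s \<omega>. X s \<omega> + Y s \<omega>))) = 0"
    and scale: "\<And>X c. KP X \<Longrightarrow> l2d P (cut T (\<lambda>s \<omega>. c * \<Phi> X s \<omega>)) (cut T (\<Phi> (\<lambda>s \<omega>. c * X s \<omega>))) = 0"
    and bound: "\<And>X Y. KP X \<Longrightarrow> KP Y \<Longrightarrow> l2d P (cut T (\<Phi> X)) (cut T (\<Phi> Y)) \<le> C * l2d P (cut T X) (cut T Y)"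
  shows "KP (\<Phi> X)"
  using assms(1)
proof (induction rule: KP.induct)
  case (base w)
  then show ?case by (rule assms(2))
next
  case zero
  have "l2d P (cut T (\<lambda>s \<omega>. 0)) (cut T (\<Phi> (\<lambda>s \<omega>. 0))) = 0" using scale[OF KP.zero, of 0] by simp
  then show ?case by (rule KP_eq0[OF KP.zero sq[OF KP.zero]])
next
  case (add X Y)
  show ?case
    by (rule KP_eq0[OF KP.add[OF add.IH] sq[OF KP.add[OF add.hyps]] assms(4)[OF add.hyps]])
next
  case (scale X c)
  show ?case
    by (rule KP_eq0[OF KP.scale[OF scale.IH] sq[OF KP.scale[OF scale.hyps]] assms(5)[OF scale.hyps]])
next
  case (lim G X)
  have X: "KP X" by (rule KP.lim[OF lim.hyps])
  have "(\<lambda>n. l2d P (cut T (\<Phi> (G n))) (cut T (\<Phi> X))) \<longlonglongrightarrow> 0"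
    by (rule Lim_null_comparison[OF _ tendsto_mult_right_zero[OF lim.hyps(3), of C]])
      (auto intro!: always_eventually bound lim.hyps(1) X)
  then show ?case by (rule KP.lim[OF lim.IH sq[OF X]])
qed

text \<open>The bound \<open>K\<close> may depend on time, as the exponentially weighted estimates
  of the Picard iteration require.\<close>

lemma P_l2d_le:
  assumes X: "cut T X \<in> borel_measurable P" and Y: "cut T Y \<in> borel_measurable P" and t: "0 \<le> t" "t \<le> T"
    and sX: "\<And>s. 0 \<le> s \<Longrightarrow> s \<le> t \<Longrightarrow> square_integrable M (X s)"
    and sY: "\<And>s. 0 \<le> s \<Longrightarrow> s \<le> t \<Longrightarrow> square_integrable M (Y s)"
    and K: "\<And>s. 0 \<le> s \<Longrightarrow> s \<le> t \<Longrightarrow> l2d M (X s) (Y s) \<le> K s"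
    and I: "(K has_integral I) {0..t}" and Km: "K \<in> borel_measurable borel" "\<And>s. 0 \<le> K s"
  shows "l2d P (cut t X) (cut t Y) \<le> I" "square_integrable P (\<lambda>p. cut t X p - cut t Y p)"
proof -
  note [measurable] = X Y Km(1)
  have [measurable]: "cut t X \<in> borel_measurable P" "cut t Y \<in> borel_measurable P"
    unfolding cut_eq[OF t(2)] by measurable
  have "(\<integral>\<^sup>+p. ennreal ((cut t X p - cut t Y p)\<^sup>2) \<partial>P)
      = (\<integral>\<^sup>+s. \<integral>\<^sup>+\<omega>. ennreal ((cut t X (s, \<omega>) - cut t Y (s, \<omega>))\<^sup>2) \<partial>M \<partial>lborel)"
    by (subst nn_integral_fst[symmetric]) auto
  also have "\<dots> \<le> (\<integral>\<^sup>+s. ennreal (indicator {0..t} s * K s) \<partial>lborel)"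
  proof (rule nn_integral_mono)
    fix s
    show "(\<integral>\<^sup>+\<omega>. ennreal ((cut t X (s, \<omega>) - cut t Y (s, \<omega>))\<^sup>2) \<partial>M) \<le> ennreal (indicator {0..t} s * K s)"
    proof (cases "s \<in> {0..t}")
      case True
      then show ?thesis using K[of s] by (simp add: cut_def l2d_nn[OF sX sY] ennreal_leI)
    qed (simp add: cut_def)
  qed
  also have "\<dots> = ennreal I"
    using nn_integral_has_integral_lebesgue[OF Km(2) I]
    by (simp add: nn_integral_completion mult.commute indicator_mult_ennreal ennreal_mult' ennreal_indicator)
  finally have 1: "(\<integral>\<^sup>+p. ennreal ((cut t X p - cut t Y p)\<^sup>2) \<partial>P) \<le> ennreal I" .
  then show sq: "square_integrable P (\<lambda>p. cut t X p - cut t Y p)"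
    by (auto simp: sqi_iff_nn intro: le_less_trans)
  have I0: "0 \<le> I" using has_integral_nonneg[OF I] Km(2) by auto
  have "(\<integral>\<^sup>+p. ennreal ((cut t X p - cut t Y p)\<^sup>2) \<partial>P) = ennreal (l2d P (cut t X) (cut t Y))"
    unfolding l2d_def by (rule nn_integral_eq_integral[OF sqi_integrable_sq[OF sq]]) simp
  with 1 show "l2d P (cut t X) (cut t Y) \<le> I" using I0 by (simp add: ennreal_le_iff)
qed

lemma P_l2d_le_const:
  assumes X: "cut T X \<in> borel_measurable P" and Y: "cut T Y \<in> borel_measurable P"
    and sX: "\<And>s. 0 \<le> s \<Longrightarrow> s \<le> T \<Longrightarrow> square_integrable M (X s)"
    and sY: "\<And>s. 0 \<le> s \<Longrightarrow> s \<le> T \<Longrightarrow> square_integrable M (Y s)"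
    and K: "\<And>s. 0 \<le> s \<Longrightarrow> s \<le> T \<Longrightarrow> l2d M (X s) (Y s) \<le> K" "0 \<le> K"
  shows "l2d P (cut T X) (cut T Y) \<le> T * K" "square_integrable P (\<lambda>p. cut T X p - cut T Y p)"
  using P_l2d_le[OF X Y _ _ sX sY K(1), of T "T * K"] has_integral_const_real[of K 0 T] T_pos K(2)
  by auto

section \<open>Stability of the span under both kinds of integration\<close>

lemma J_cut_measurable: "adm X \<Longrightarrow> i \<in> {1..d} \<Longrightarrow> cut T (J i X) \<in> borel_measurable P"
  by (rule cut_measurable) (auto intro: J_continuous sqi_measurable[OF sqi_J])

lemma cut_zero: "cut t (\<lambda>s \<omega>. 0) = (\<lambda>p. 0)"
  by (auto simp: cut_def)

lemma cut_l2d_mono: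
  assumes X: "square_integrable P (cut T X)" and Y: "square_integrable P (cut T Y)" and st: "s \<le> t" "t \<le> T"
  shows "l2d P (cut s X) (cut s Y) \<le> l2d P (cut t X) (cut t Y)"
proof -
  have eq: "cut s Z = (\<lambda>p. indicator ({..s} \<times> UNIV) p * cut t Z p)" for Z
    using st by (auto simp: cut_def fun_eq_iff indicator_def)
  have "l2d P (\<lambda>p. indicator ({..s} \<times> UNIV) p * cut t X p) (\<lambda>p. indicator ({..s} \<times> UNIV) p * cut t Y p)
      \<le> 1\<^sup>2 * l2d P (cut t X) (cut t Y)"
    by (rule l2d_mult_bounded[OF sqi_cut[OF X st(2)] sqi_cut[OF Y st(2)] atMost_Times_measurable]) (simp add: indicator_def)
  then show ?thesis by (simp add: eq[symmetric])
qed

lemma sqi_cut_J: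
  assumes X: "adm X" and i: "i \<in> {1..d}"
  shows "square_integrable P (cut T (J i X))"
proof -
  have "square_integrable P (\<lambda>p. cut T (J i X) p - cut T (\<lambda>s \<omega>. 0) p)"
  proof (rule P_l2d_le_const(2)[where K = "l2d P (cut T X) (cut T (\<lambda>s \<omega>. 0))"])
    fix s assume s: "0 \<le> s" "s \<le> T"
    have "l2d M (J i X s) (\<lambda>\<omega>. 0) = expectation (\<lambda>\<omega>. J i X s \<omega> * J i X s \<omega>)"
      by (simp add: l2d_def power2_eq_square)
    also have "\<dots> = l2d P (cut s X) (cut s (\<lambda>s \<omega>. 0))"
      unfolding J_inner[OF X X i i s s] by (simp add: l2d_def power2_eq_square cut_zero)
    also have "\<dots> \<le> l2d P (cut T X) (cut T (\<lambda>s \<omega>. 0))"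
      using s by (intro cut_l2d_mono adm_sqi X adm_zero) auto
    finally show "l2d M (J i X s) (\<lambda>\<omega>. 0) \<le> l2d P (cut T X) (cut T (\<lambda>s \<omega>. 0))" .
  qed (auto intro: sqi_J X i J_cut_measurable[OF X i] simp: cut_zero)
  then show ?thesis by (simp add: cut_zero)
qed

lemma P_l2d_eq_0:
  assumes "square_integrable P (cut T X)" "square_integrable P (cut T Y)"
    and "\<And>s. 0 \<le> s \<Longrightarrow> s \<le> T \<Longrightarrow> square_integrable M (X s)" "\<And>s. 0 \<le> s \<Longrightarrow> s \<le> T \<Longrightarrow> square_integrable M (Y s)"
    and "\<And>s. 0 \<le> s \<Longrightarrow> s \<le> T \<Longrightarrow> l2d M (X s) (Y s) = 0"
  shows "l2d P (cut T X) (cut T Y) = 0"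
  using P_l2d_le_const(1)[of X Y 0] assms l2d_nonneg[of P "cut T X" "cut T Y"] by (auto dest: sqi_measurable)

text \<open>On words, integration adds a letter at the head of the reversed word. Linearity and the
  bound from the isometry extend this to the closed span.\<close>

lemma KP_J:
  assumes X: "KP X" and i: "i \<in> {1..d}"
  shows "KP (J i X)"
proof (rule KP_image[OF X, where C = T])
  show "KP (J i (Iw w))" if "set w \<subseteq> {0..d}" for w
    using that i KP.base[of "i # w"] by (auto simp: Iw_Cons simp del: ito_iterated.simps(2))
  show sq: "square_integrable P (cut T (J i X))" if "KP X" for X by (intro sqi_cut_J KP_adm that i)
  show "l2d P (cut T (\<lambda>s \<omega>. J i X s \<omega> + J i Y s \<omega>)) (cut T (J i (\<lambda>s \<omega>. X s \<omega> + Y s \<omega>))) = 0"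
    if "KP X" "KP Y" for X Y
  proof (rule P_l2d_eq_0)
    show "square_integrable P (cut T (\<lambda>s \<omega>. J i X s \<omega> + J i Y s \<omega>))"
      unfolding cut_add by (intro sqi_add sq that)
    show "square_integrable P (cut T (J i (\<lambda>s \<omega>. X s \<omega> + Y s \<omega>)))" by (intro sq KP.add that)
  qed (auto intro!: sqi_add sqi_J KP_adm KP.add that i J_add)
  show "l2d P (cut T (\<lambda>s \<omega>. c * J i X s \<omega>)) (cut T (J i (\<lambda>s \<omega>. c * X s \<omega>))) = 0" if "KP X" for X c
  proof (rule P_l2d_eq_0)
    show "square_integrable P (cut T (\<lambda>s \<omega>. c * J i X s \<omega>))"
      unfolding cut_scale by (intro sqi_scale sq that)
    show "square_integrable P (cut T (J i (\<lambda>s \<omega>. c * X s \<omega>)))" by (intro sq KP.scale that)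
  qed (auto intro!: sqi_scale sqi_J KP_adm KP.scale that i J_scale)
  show "l2d P (cut T (J i X)) (cut T (J i Y)) \<le> T * l2d P (cut T X) (cut T Y)" if "KP X" "KP Y" for X Y
  proof (rule P_l2d_le_const(1))
    show "l2d M (J i X s) (J i Y s) \<le> l2d P (cut T X) (cut T Y)" if s: "0 \<le> s" "s \<le> T" for s
      unfolding J_l2d[OF KP_adm[OF \<open>KP X\<close>] KP_adm[OF \<open>KP Y\<close>] i s s]
      using s by (intro cut_l2d_mono KP_sqi \<open>KP X\<close> \<open>KP Y\<close>) auto
  qed (auto intro!: sqi_J KP_adm that i J_cut_measurable)
qed

text \<open>Extends \<open>R\<close>, which suits continuous paths, to the members of
  \<open>KP\<close>, whose paths need not be continuous.\<close>

definition TI :: "(real \<Rightarrow> 'a \<Rightarrow> real) \<Rightarrow> real \<Rightarrow> 'a \<Rightarrow> real" where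
  "TI X t = tint {0..t} (cut T X)"

lemma TI_measurable:
  assumes X: "square_integrable P (cut T X)"
  shows "cut T (TI X) \<in> borel_measurable P"
proof -
  have [measurable]: "cut T X \<in> borel_measurable P" using X by (rule sqi_measurable)
  have "(\<lambda>p. \<integral>s. (if 0 \<le> s \<and> s \<le> fst p then 1 else 0) * cut T X (s, snd p) \<partial>lborel) \<in> borel_measurable P"
    by (rule lborel.borel_measurable_lebesgue_integral) measurable
  then have "(\<lambda>p. indicator {0..T} (fst p) * (\<integral>s. (if 0 \<le> s \<and> s \<le> fst p then 1 else 0) * cut T X (s, snd p) \<partial>lborel)) \<in> borel_measurable P"
    by measurable
  moreover have "(\<lambda>p. indicator {0..T} (fst p) * (\<integral>s. (if 0 \<le> s \<and> s \<le> fst p then 1 else 0) * cut T X (s, snd p) \<partial>lborel)) = cut T (TI X)"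
    unfolding cut_def[of T "TI X"] TI_def tint_def
    by (intro ext) (simp add: case_prod_unfold indicator_def of_bool_def)
  ultimately show ?thesis by simp
qed

lemma sqi_TI: "square_integrable P (cut T X) \<Longrightarrow> 0 \<le> t \<Longrightarrow> t \<le> T \<Longrightarrow> square_integrable M (TI X t)"
  unfolding TI_def by (rule tint_bound(1)) auto

lemma TI_l2d:
  assumes X: "square_integrable P (cut T X)" and Y: "square_integrable P (cut T Y)" and t: "0 \<le> t" "t \<le> T"
  shows "l2d M (TI X t) (TI Y t) \<le> T * l2d P (cut T X) (cut T Y)"
    "l2d M (\<lambda>\<omega>. TI X t \<omega> + TI Y t \<omega>) (TI (\<lambda>s \<omega>. X s \<omega> + Y s \<omega>) t) = 0"
    "l2d M (\<lambda>\<omega>. c * TI X t \<omega>) (TI (\<lambda>s \<omega>. c * X s \<omega>) t) = 0"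
proof -
  have A: "{0..t} \<in> sets borel" "{0..t} \<subseteq> {0..T}" using t by auto
  have XY: "square_integrable P (cut T (\<lambda>s \<omega>. X s \<omega> + Y s \<omega>))" unfolding cut_add by (rule sqi_add[OF X Y])
  show "l2d M (\<lambda>\<omega>. TI X t \<omega> + TI Y t \<omega>) (TI (\<lambda>s \<omega>. X s \<omega> + Y s \<omega>) t) = 0"
  proof (rule l2d_eq_0_iff_AE[OF sqi_add[OF sqi_TI[OF X t] sqi_TI[OF Y t]] sqi_TI[OF XY t], THEN iffD2])
    show "AE \<omega> in M. TI X t \<omega> + TI Y t \<omega> = TI (\<lambda>s \<omega>. X s \<omega> + Y s \<omega>) t \<omega>"
      using tint_add[OF X Y A] unfolding TI_def cut_add by eventually_elim simp
  qed
  show "l2d M (\<lambda>\<omega>. c * TI X t \<omega>) (TI (\<lambda>s \<omega>. c * X s \<omega>) t) = 0"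
    by (simp add: l2d_def TI_def cut_scale tint_scale)
  let ?h = "\<lambda>p. cut T X p + (- 1) * cut T Y p"
  have h: "square_integrable P ?h" by (intro sqi_add sqi_scale X Y)
  have "AE \<omega> in M. TI X t \<omega> - TI Y t \<omega> = tint {0..t} ?h \<omega>"
    using tint_add[OF X sqi_scale[OF Y, of "- 1"] A]
  proof eventually_elim
    case (elim \<omega>)
    have "tint {0..t} (\<lambda>p. (- 1) * cut T Y p) \<omega> = - tint {0..t} (cut T Y) \<omega>" by (subst tint_scale) simp
    with elim show ?case unfolding TI_def by linarith
  qed
  then have "l2d M (TI X t) (TI Y t) = expectation (\<lambda>\<omega>. (tint {0..t} ?h \<omega>)\<^sup>2)"
    unfolding l2d_def using sqi_TI[OF X t] sqi_TI[OF Y t] tint_bound(1)[OF h A]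
    by (intro integral_cong_AE borel_measurable_power borel_measurable_diff) (auto dest: sqi_measurable)
  also have "\<dots> \<le> T * (\<integral>p. (indicator ({0..t} \<times> UNIV) p * ?h p)\<^sup>2 \<partial>P)"
    by (rule tint_bound(2)[OF h A])
  also have "\<dots> \<le> T * (\<integral>p. (?h p)\<^sup>2 \<partial>P)"
  proof (intro mult_left_mono integral_mono')
    show "integrable P (\<lambda>p. (?h p)\<^sup>2)" by (rule sqi_integrable_sq[OF h])
  qed (use T_pos in \<open>auto simp: indicator_def\<close>)
  finally show "l2d M (TI X t) (TI Y t) \<le> T * l2d P (cut T X) (cut T Y)" by (simp add: l2d_def)
qed

lemma sqi_cut_TI:
  assumes X: "square_integrable P (cut T X)"
  shows "square_integrable P (cut T (TI X))"
proof -
  have z: "square_integrable P (cut T (\<lambda>s \<omega>. 0))" by (simp add: cut_zero)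
  have "TI (\<lambda>s \<omega>. 0) t = (\<lambda>\<omega>. 0)" for t by (simp add: TI_def cut_zero tint_def fun_eq_iff)
  then have "square_integrable P (\<lambda>p. cut T (TI X) p - cut T (\<lambda>s \<omega>. 0) p)"
    using TI_l2d(1)[OF X z] T_pos
    by (intro P_l2d_le_const(2)[where K = "T * l2d P (cut T X) (cut T (\<lambda>s \<omega>. 0))"])
      (auto intro: sqi_TI X TI_measurable simp: cut_zero)
  then show ?thesis by (simp add: cut_zero)
qed

lemma R_TI:
  assumes X: "nice X" and t: "0 \<le> t" "t \<le> T"
  shows "square_integrable M (R X t)" "l2d M (R X t) (TI X t) = 0"
proof -
  show s: "square_integrable M (R X t)" using t by (intro niceD(3)[OF nice_R[OF X]])
  show "l2d M (R X t) (TI X t) = 0"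
    using R_eq_tint[of X _ t, OF niceD(1)[OF X]] t
    by (subst l2d_eq_0_iff_AE[OF s sqi_TI[OF nice_sqi_cut[OF X] t]]) (auto simp: TI_def)
qed

lemma KP_R:
  assumes X: "nice X" and "KP (R X)"
  shows "KP (TI X)"
  by (rule KP_eq0[OF assms(2) sqi_cut_TI[OF nice_sqi_cut[OF X]]
        P_l2d_eq_0[OF nice_sqi_cut[OF nice_R[OF X]] sqi_cut_TI[OF nice_sqi_cut[OF X]]
          R_TI(1)[OF X] sqi_TI[OF nice_sqi_cut[OF X]] R_TI(2)[OF X]]])

lemma KP_TI:
  assumes X: "KP X"
  shows "KP (TI X)"
proof (rule KP_image[OF X, where C = "T * T"])
  show "KP (TI (Iw w))" if "set w \<subseteq> {0..d}" for w
    using that KP.base[of "0 # w"] by (intro KP_R nice_Iw) (auto simp: Iw_Cons simp del: ito_iterated.simps(2))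
  show sq: "square_integrable P (cut T (TI X))" if "KP X" for X by (intro sqi_cut_TI KP_sqi that)
  show "l2d P (cut T (\<lambda>s \<omega>. TI X s \<omega> + TI Y s \<omega>)) (cut T (TI (\<lambda>s \<omega>. X s \<omega> + Y s \<omega>))) = 0"
    if "KP X" "KP Y" for X Y
  proof (rule P_l2d_eq_0)
    show "square_integrable P (cut T (\<lambda>s \<omega>. TI X s \<omega> + TI Y s \<omega>))"
      unfolding cut_add by (intro sqi_add sq that)
    show "square_integrable P (cut T (TI (\<lambda>s \<omega>. X s \<omega> + Y s \<omega>)))" by (intro sq KP.add that)
  qed (auto intro!: sqi_add sqi_TI KP_sqi KP.add that TI_l2d(2))
  show "l2d P (cut T (\<lambda>s \<omega>. c * TI X s \<omega>)) (cut T (TI (\<lambda>s \<omega>. c * X s \<omega>))) = 0" if "KP X" for X c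
  proof (rule P_l2d_eq_0)
    show "square_integrable P (cut T (\<lambda>s \<omega>. c * TI X s \<omega>))"
      unfolding cut_scale by (intro sqi_scale sq that)
    show "square_integrable P (cut T (TI (\<lambda>s \<omega>. c * X s \<omega>)))" by (intro sq KP.scale that)
  qed (auto intro!: sqi_scale sqi_TI KP_sqi KP.scale that TI_l2d(3))
  show "l2d P (cut T (TI X)) (cut T (TI Y)) \<le> (T * T) * l2d P (cut T X) (cut T Y)" if "KP X" "KP Y" for X Y
    unfolding mult.assoc
    using T_pos by (intro P_l2d_le_const(1)) (auto intro!: sqi_TI KP_sqi that TI_measurable TI_l2d(1))
qed

section \<open>Multiplication by functions of time\<close>

lemma sqi_cut_time:
  assumes X: "square_integrable P (cut T X)" and g: "g \<in> borel_measurable borel" and c: "\<And>s. s \<in> {0..T} \<Longrightarrow> \<bar>g s\<bar> \<le> c"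
  shows "square_integrable P (cut T (\<lambda>s \<omega>. g s * X s \<omega>))"
    "l2d P (cut T (\<lambda>s \<omega>. g s * X s \<omega>)) (\<lambda>p. 0) \<le> c\<^sup>2 * l2d P (cut T X) (\<lambda>p. 0)"
proof -
  note [measurable] = g
  have eq: "cut T (\<lambda>s \<omega>. g s * X s \<omega>) = (\<lambda>p. (indicator {0..T} (fst p) * g (fst p)) * cut T X p)"
    by (auto simp: cut_def fun_eq_iff indicator_def)
  have m: "(\<lambda>p. indicator {0..T} (fst p) * g (fst p)) \<in> borel_measurable P" by measurable
  have "\<bar>g 0\<bar> \<le> c" by (rule c) (use T_pos in simp)
  then have c0: "0 \<le> c" using abs_ge_zero[of "g 0"] by linarith
  have b: "\<bar>indicator {0..T} (fst p) * g (fst p)\<bar> \<le> c" for p :: "real \<times> 'a"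
    using c[of "fst p"] c0 by (auto simp: indicator_def)
  show "square_integrable P (cut T (\<lambda>s \<omega>. g s * X s \<omega>))"
    unfolding eq by (rule sqi_mult_bounded[OF X m b])
  show "l2d P (cut T (\<lambda>s \<omega>. g s * X s \<omega>)) (\<lambda>p. 0) \<le> c\<^sup>2 * l2d P (cut T X) (\<lambda>p. 0)"
    using l2d_mult_bounded[OF X sqi_zero m b] unfolding eq by simp
qed

lemma nice_times_time:
  assumes X: "nice X"
  shows "nice (\<lambda>s \<omega>. s * X s \<omega>)"
  unfolding nice_def
proof (intro conjI ballI)
  show "continuous_on {0..T} (\<lambda>t. t * X t \<omega>)" if "\<omega> \<in> space M" for \<omega>
    by (intro continuous_intros niceD(1)[OF X that])
  show "(\<lambda>\<omega>. t * X t \<omega>) \<in> ad t" if "t \<in> {0..T}" for t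
    using that by (intro L2cl.scale niceD(2)[OF X]) auto
  obtain K where K: "0 \<le> K" "\<And>t. 0 \<le> t \<Longrightarrow> t \<le> T \<Longrightarrow> expectation (\<lambda>\<omega>. (X t \<omega>)\<^sup>2) \<le> K"
    using nice_bounded[OF X] by blast
  obtain C where C: "0 \<le> C" "\<And>s t. s \<in> {0..T} \<Longrightarrow> t \<in> {0..T} \<Longrightarrow> l2d M (X s) (X t) \<le> C * \<bar>t - s\<bar>"
    using X unfolding nice_def by blast
  have "l2d M (\<lambda>\<omega>. s * X s \<omega>) (\<lambda>\<omega>. t * X t \<omega>) \<le> (2 * T\<^sup>2 * C + 2 * T * K) * \<bar>t - s\<bar>"
    if s: "s \<in> {0..T}" and t: "t \<in> {0..T}" for s t
  proof -
    have "l2d M (\<lambda>\<omega>. s * X s \<omega>) (\<lambda>\<omega>. t * X t \<omega>)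
        \<le> 2 * l2d M (\<lambda>\<omega>. s * X s \<omega>) (\<lambda>\<omega>. s * X t \<omega>) + 2 * l2d M (\<lambda>\<omega>. s * X t \<omega>) (\<lambda>\<omega>. t * X t \<omega>)"
      using s t by (intro l2d_triangle sqi_scale niceD(3)[OF X]) auto
    also have "l2d M (\<lambda>\<omega>. s * X s \<omega>) (\<lambda>\<omega>. s * X t \<omega>) = s\<^sup>2 * l2d M (X s) (X t)" by (rule l2d_scale)
    also have "\<dots> \<le> T\<^sup>2 * (C * \<bar>t - s\<bar>)"
      using s t C by (intro mult_mono power_mono) auto
    also have "l2d M (\<lambda>\<omega>. s * X t \<omega>) (\<lambda>\<omega>. t * X t \<omega>) = (s - t)\<^sup>2 * expectation (\<lambda>\<omega>. (X t \<omega>)\<^sup>2)"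
      by (simp add: l2d_def power_mult_distrib flip: left_diff_distrib)
    also have "\<dots> \<le> (\<bar>t - s\<bar> * T) * K"
    proof (intro mult_mono K)
      have "(s - t)\<^sup>2 = \<bar>t - s\<bar> * \<bar>t - s\<bar>" by (simp add: power2_eq_square abs_if algebra_simps)
      also have "\<dots> \<le> \<bar>t - s\<bar> * T" using s t by (intro mult_left_mono) auto
      finally show "(s - t)\<^sup>2 \<le> \<bar>t - s\<bar> * T" .
    qed (use s t in auto)
    finally show ?thesis by (simp add: algebra_simps)
  qed
  moreover have "0 \<le> 2 * T\<^sup>2 * C + 2 * T * K" using C K T_pos by simp
  ultimately show "\<exists>C\<ge>0. \<forall>s\<in>{0..T}. \<forall>t\<in>{0..T}. l2d M (\<lambda>\<omega>. s * X s \<omega>) (\<lambda>\<omega>. t * X t \<omega>) \<le> C * \<bar>t - s\<bar>"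
    by blast
qed

end

lemma zero_derivative_Icc:
  fixes g :: "real \<Rightarrow> real"
  assumes "\<And>x. x \<in> {0..b} \<Longrightarrow> (g has_real_derivative 0) (at x within {0..b})" "g 0 = 0" "s \<in> {0..b}"
  shows "g s = 0"
proof -
  obtain c where c: "\<And>x. x \<in> {0..b} \<Longrightarrow> g x = c"
    using has_field_derivative_zero_constant[of "{0..b}" g] assms(1) by auto
  have "0 \<in> {0..b}" using assms(3) by auto
  then show ?thesis using c assms by metis
qed

text \<open>Both sides vanish at 0 and have the same derivative.\<close>

lemma primitive_by_parts:
  fixes f :: "real \<Rightarrow> real"
  assumes f: "continuous_on {0..b} f" and s: "s \<in> {0..b}"
  shows "integral {0..s} (\<lambda>u. integral {0..u} f) = s * integral {0..s} f - integral {0..s} (\<lambda>u. u * f u)"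
proof -
  have d: "((\<lambda>x. integral {0..x} h) has_real_derivative h x) (at x within {0..b})"
    if "continuous_on {0..b} h" "x \<in> {0..b}" for h :: "real \<Rightarrow> real" and x
    using integral_has_real_derivative[OF that] .
  have c1: "continuous_on {0..b} (\<lambda>u. integral {0..u} f)"
    by (rule indefinite_integral_continuous_1[OF integrable_continuous_real[OF f]])
  have c2: "continuous_on {0..b} (\<lambda>u. u * f u)" by (intro continuous_intros f)
  have "integral {0..s} (\<lambda>u. integral {0..u} f) - (s * integral {0..s} f - integral {0..s} (\<lambda>u. u * f u)) = 0"
    by (rule zero_derivative_Icc[OF _ _ s])
      (auto intro!: derivative_eq_intros d[OF c1] d[OF c2] d[OF f])
  then show ?thesis by simp
qed

text \<open>The deterministic identity behind the product rule for time and a stochastic integral.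
  With f(u) the second moment of the integrand, the six terms are the inner products in the expanded
  square of the residual. Partial integration reduces them to s^2 \<Phi>(s), s \<Psi>(s) and
  \<Xi>(s), whose coefficients cancel.\<close>

lemma primitive_by_parts_identity:
  fixes f :: "real \<Rightarrow> real"
  assumes f: "continuous_on {0..b} f" and s: "s \<in> {0..b}"
  defines "\<Phi> \<equiv> \<lambda>u. integral {0..u} f" and "\<Psi> \<equiv> \<lambda>u. integral {0..u} (\<lambda>r. r * f r)"
    and "\<Xi> \<equiv> \<lambda>u. integral {0..u} (\<lambda>r. r * (r * f r))"
  shows "s\<^sup>2 * \<Phi> s + \<Xi> s + integral {0..s} (\<lambda>u. integral {0..s} (\<lambda>r. \<Phi> (min r u)))
    - 2 * s * \<Psi> s - 2 * s * integral {0..s} \<Phi> + 2 * integral {0..s} \<Psi> = 0"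
proof -
  have c\<Phi>: "continuous_on {0..b} \<Phi>" unfolding \<Phi>_def
    by (rule indefinite_integral_continuous_1[OF integrable_continuous_real[OF f]])
  have cf: "continuous_on {0..b} (\<lambda>u. u * f u)" by (intro continuous_intros f)
  have 1: "integral {0..u} \<Phi> = u * \<Phi> u - \<Psi> u" if "u \<in> {0..b}" for u
    using primitive_by_parts[OF f that] by (simp add: \<Phi>_def \<Psi>_def)
  have 2: "integral {0..s} \<Psi> = s * \<Psi> s - \<Xi> s"
    using primitive_by_parts[OF cf s] by (simp add: \<Psi>_def \<Xi>_def)
  have sub: "{0..s} \<subseteq> {0..b}" using s by auto
  have in\<Phi>: "\<Phi> integrable_on {0..s}" "(\<lambda>u. u * \<Phi> u) integrable_on {0..s}"
    by (intro integrable_continuous_real continuous_intros continuous_on_subset[OF c\<Phi> sub])+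
  have in\<Psi>: "\<Psi> integrable_on {0..s}" unfolding \<Psi>_def
    by (intro integrable_continuous_real indefinite_integral_continuous_1 continuous_on_subset[OF cf sub])
  \<comment> \<open>The integral is split at \<open>u\<close>, where the minimum changes from
    \<open>r\<close> to \<open>u\<close>.\<close>
  have 3: "integral {0..s} (\<lambda>r. \<Phi> (min r u)) = integral {0..u} \<Phi> + (s - u) * \<Phi> u" if u: "u \<in> {0..s}" for u
  proof -
    have c: "continuous_on {0..s} (\<lambda>r. \<Phi> (min r u))"
      by (rule continuous_on_compose2[OF c\<Phi>]) (use u s in \<open>auto intro!: continuous_intros\<close>)
    have "integral {0..s} (\<lambda>r. \<Phi> (min r u)) = integral {0..u} (\<lambda>r. \<Phi> (min r u)) + integral {u..s} (\<lambda>r. \<Phi> (min r u))"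
      using u by (intro Henstock_Kurzweil_Integration.integral_combine[symmetric] integrable_continuous_real c) auto
    also have "integral {0..u} (\<lambda>r. \<Phi> (min r u)) = integral {0..u} \<Phi>"
      by (intro Henstock_Kurzweil_Integration.integral_cong) auto
    also have "integral {u..s} (\<lambda>r. \<Phi> (min r u)) = integral {u..s} (\<lambda>r. \<Phi> u)"
      by (intro Henstock_Kurzweil_Integration.integral_cong) auto
    finally show ?thesis using u by simp
  qed
  have "integral {0..s} (\<lambda>u. integral {0..s} (\<lambda>r. \<Phi> (min r u))) = integral {0..s} (\<lambda>u. s * \<Phi> u - \<Psi> u)"
    using s by (intro Henstock_Kurzweil_Integration.integral_cong) (simp add: 3 1 algebra_simps)
  also have "\<dots> = s * integral {0..s} \<Phi> - integral {0..s} \<Psi>"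
    using in\<Phi> in\<Psi> by (subst Henstock_Kurzweil_Integration.integral_diff) (auto intro: integrable_on_mult_right)
  finally have 4: "integral {0..s} (\<lambda>u. integral {0..s} (\<lambda>r. \<Phi> (min r u))) = s * integral {0..s} \<Phi> - integral {0..s} \<Psi>" .
  show ?thesis
    unfolding 4 unfolding 1[OF s] 2 by (simp add: power2_eq_square algebra_simps)
qed

context brownian
begin

lemma nice_inner_continuous:
  assumes X: "nice X"
  shows "continuous_on {0..T} (\<lambda>u. expectation (\<lambda>\<omega>. X u \<omega> * X u \<omega>))"
  unfolding continuous_on_sequentially comp_def
proof (intro allI ballI impI)
  obtain C where C: "0 \<le> C" "\<And>s t. s \<in> {0..T} \<Longrightarrow> t \<in> {0..T} \<Longrightarrow> l2d M (X s) (X t) \<le> C * \<bar>t - s\<bar>"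
    using X unfolding nice_def by blast
  fix x :: "nat \<Rightarrow> real" and a assume a: "a \<in> {0..T}" and x: "(\<forall>n. x n \<in> {0..T}) \<and> x \<longlonglongrightarrow> a"
  have "(\<lambda>n. C * \<bar>a - x n\<bar>) \<longlonglongrightarrow> C * \<bar>a - a\<bar>" using x by (intro tendsto_intros) auto
  then have "(\<lambda>n. C * \<bar>a - x n\<bar>) \<longlonglongrightarrow> 0" by simp
  then have l: "(\<lambda>n. l2d M (X (x n)) (X a)) \<longlonglongrightarrow> 0"
    by (rule Lim_null_comparison[rotated]) (use a x C in auto)
  have s: "square_integrable M (X (x n))" "square_integrable M (X a)" for n
    using a x by (auto intro!: niceD(3)[OF X])
  show "(\<lambda>n. expectation (\<lambda>\<omega>. X (x n) \<omega> * X (x n) \<omega>)) \<longlonglongrightarrow> expectation (\<lambda>\<omega>. X a \<omega> * X a \<omega>)"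
    by (rule inner_tendsto[OF s s l l])
qed

text \<open>By the isometry both sides have computable inner products, and their difference has norm \<open>0\<close>.\<close>

lemma J_times_time:
  assumes X: "nice X" and i: "i \<in> {1..d}" and s: "0 \<le> s" "s \<le> T"
  shows "l2d M (\<lambda>\<omega>. J i (\<lambda>u \<omega>. u * X u \<omega>) s \<omega> + R (J i X) s \<omega>) (\<lambda>\<omega>. s * J i X s \<omega>) = 0"
proof -
  \<comment> \<open>All inner products of the residual depend on the integrand through this function
    alone.\<close>
  define f where "f u = expectation (\<lambda>\<omega>. X u \<omega> * X u \<omega>)" for u
  let ?Y = "\<lambda>u \<omega>. u * X u \<omega>" and ?M = "J i X"
  note Y = nice_times_time[OF X] and nM = nice_J[OF X i]
  have cf: "continuous_on {0..T} f" unfolding f_def by (rule nice_inner_continuous[OF X])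
  have sT: "s \<in> {0..T}" using s by auto
  note aX = nice_adm[OF X] and aY = nice_adm[OF Y]
  note sM = sqi_J[OF aX i s] and sN = sqi_J[OF aY i s] and sA = niceD(3)[OF nice_R[OF nM] s]
  have MM: "expectation (\<lambda>\<omega>. ?M r \<omega> * ?M u \<omega>) = integral {0..min r u} f" if "0 \<le> r" "r \<le> T" "0 \<le> u" "u \<le> T" for r u
    unfolding J_inner[OF aX aX i i that] cut_inner[OF nice_sqi_cut[OF X] nice_sqi_cut[OF X] that]
    by (simp add: f_def[abs_def])
  have MN: "expectation (\<lambda>\<omega>. ?M r \<omega> * J i ?Y u \<omega>) = integral {0..min r u} (\<lambda>r. r * f r)" if "0 \<le> r" "r \<le> T" "0 \<le> u" "u \<le> T" for r u
    unfolding J_inner[OF aX aY i i that] cut_inner[OF nice_sqi_cut[OF X] nice_sqi_cut[OF Y] that]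
    by (simp add: f_def[abs_def] mult.left_commute)
  have NN: "expectation (\<lambda>\<omega>. J i ?Y s \<omega> * J i ?Y s \<omega>) = integral {0..s} (\<lambda>r. r * (r * f r))"
    unfolding J_inner[OF aY aY i i s s] cut_inner[OF nice_sqi_cut[OF Y] nice_sqi_cut[OF Y] s s]
    by (simp add: f_def[abs_def] mult.left_commute mult.assoc)
  have AV: "expectation (\<lambda>\<omega>. R ?M s \<omega> * V \<omega>) = integral {0..s} (\<lambda>r. expectation (\<lambda>\<omega>. ?M r \<omega> * V \<omega>))"
    if "square_integrable M V" for V by (rule R_inner[OF nM s that])
  have AM: "expectation (\<lambda>\<omega>. R ?M s \<omega> * ?M u \<omega>) = integral {0..s} (\<lambda>r. integral {0..min r u} f)" if "0 \<le> u" "u \<le> T" for u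
    unfolding AV[OF sqi_J[OF aX i that]]
    using s that by (intro Henstock_Kurzweil_Integration.integral_cong MM) auto
  have AN: "expectation (\<lambda>\<omega>. R ?M s \<omega> * J i ?Y s \<omega>) = integral {0..s} (\<lambda>r. integral {0..r} (\<lambda>r. r * f r))"
    unfolding AV[OF sN] using s MN[of _ s] by (intro Henstock_Kurzweil_Integration.integral_cong) (auto simp: min_absorb1)
  have AA: "expectation (\<lambda>\<omega>. R ?M s \<omega> * R ?M s \<omega>) = integral {0..s} (\<lambda>u. integral {0..s} (\<lambda>r. integral {0..min r u} f))"
    unfolding AV[OF sA] using s AM by (intro Henstock_Kurzweil_Integration.integral_cong) (auto simp: mult.commute)
  have AMs: "expectation (\<lambda>\<omega>. R ?M s \<omega> * ?M s \<omega>) = integral {0..s} (\<lambda>r. integral {0..r} f)"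
    unfolding AM[OF s] by (intro Henstock_Kurzweil_Integration.integral_cong) auto
  have "l2d M (\<lambda>\<omega>. J i ?Y s \<omega> + R ?M s \<omega>) (\<lambda>\<omega>. s * ?M s \<omega>)
     = expectation (\<lambda>\<omega>. J i ?Y s \<omega> * J i ?Y s \<omega>) + expectation (\<lambda>\<omega>. R ?M s \<omega> * R ?M s \<omega>)
       + s\<^sup>2 * expectation (\<lambda>\<omega>. ?M s \<omega> * ?M s \<omega>) + 2 * expectation (\<lambda>\<omega>. R ?M s \<omega> * J i ?Y s \<omega>)
       - 2 * s * expectation (\<lambda>\<omega>. ?M s \<omega> * J i ?Y s \<omega>) - 2 * s * expectation (\<lambda>\<omega>. R ?M s \<omega> * ?M s \<omega>)"
    unfolding l2d_add_expand[OF sN sA sqi_scale[OF sM]]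
    by (simp add: power2_eq_square mult_ac)
  also have "\<dots> = 0"
    using primitive_by_parts_identity[OF cf sT]
    unfolding NN AA MM[OF s s] AN MN[OF s s] AMs by (simp add: algebra_simps)
  finally show ?thesis .
qed

text \<open>Product rule: s times an iterated integral I is the integral of u times its integrand,
  which is in the span by induction, plus the time integral of I. For the letter 0 this holds
  pathwise, for the other letters by \<open>J_times_time\<close>.\<close>

lemma KP_times_time_Iw: "set w \<subseteq> {0..d} \<Longrightarrow> KP (\<lambda>s \<omega>. s * Iw w s \<omega>)"
proof (induction w)
  case Nil
  \<comment> \<open>The process s itself is the iterated integral of the word 0.\<close>
  have eq: "cut T (Iw [0]) = cut T (\<lambda>s \<omega>. s * Iw [] s \<omega>)" by (auto simp: cut_def fun_eq_iff indicator_def)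
  show ?case
    by (rule KP_eq0[OF KP.base[of "[0]"]]) (use nice_sqi_cut[OF nice_Iw[of "[0]"]] in \<open>simp_all only: eq l2d_self, auto\<close>)
next
  case (Cons a w)
  let ?X = "Iw w" and ?Y = "\<lambda>u \<omega>. u * Iw w u \<omega>"
  have X: "nice ?X" using Cons.prems by (intro nice_Iw) auto
  note Y = nice_times_time[OF X]
  have KY: "KP ?Y" using Cons by auto
  have Ka: "KP (Iw (a # w))" and na: "nice (Iw (a # w))" using KP.base nice_Iw Cons.prems by blast+
  let ?Z = "\<lambda>s \<omega>. s * Iw (a # w) s \<omega>"
  note nZ = nice_times_time[OF na]
  show ?case
  proof (cases "a = 0")
    case True
    have Ia: "Iw (a # w) = R ?X" using True by (simp add: Iw_Cons del: ito_iterated.simps(2))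
    have K: "KP (\<lambda>s \<omega>. TI ?Y s \<omega> + TI (R ?X) s \<omega>)"
      using Ka unfolding Ia by (intro KP.add KP_TI KY)
    show ?thesis
    proof (rule KP_eq0[OF K nice_sqi_cut[OF nZ]], rule P_l2d_eq_0[OF KP_sqi[OF K] nice_sqi_cut[OF nZ]])
      fix s assume s: "0 \<le> s" "s \<le> T"
      have nR: "nice (R ?X)" by (rule nice_R[OF X])
      show sq: "square_integrable M (\<lambda>\<omega>. TI ?Y s \<omega> + TI (R ?X) s \<omega>)"
        by (intro sqi_add sqi_TI nice_sqi_cut Y nR s)
      show sZ: "square_integrable M (?Z s)" by (rule niceD(3)[OF nZ s])
      have "TI ?Y s \<omega> + TI (R ?X) s \<omega> = ?Z s \<omega>" if \<omega>: "\<omega> \<in> space M" for \<omega>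
      proof -
        have "R (R ?X) s \<omega> = s * R ?X s \<omega> - R ?Y s \<omega>"
          unfolding R_def by (rule primitive_by_parts[OF niceD(1)[OF X \<omega>]]) (use s in auto)
        then show ?thesis
          using R_eq_tint[of ?Y \<omega> s, OF niceD(1)[OF Y \<omega>] s] R_eq_tint[of "R ?X" \<omega> s, OF niceD(1)[OF nR \<omega>] s]
          by (simp add: TI_def Ia del: ito_iterated.simps(2))
      qed
      then show "l2d M (\<lambda>\<omega>. TI ?Y s \<omega> + TI (R ?X) s \<omega>) (?Z s) = 0"
        by (subst l2d_eq_0_iff_AE[OF sq sZ]) auto
    qed
  next
    case False
    then have i: "a \<in> {1..d}" using Cons.prems by auto
    have Ia: "Iw (a # w) = J a ?X" using False by (simp add: Iw_Cons del: ito_iterated.simps(2))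
    have K: "KP (\<lambda>s \<omega>. J a ?Y s \<omega> + TI (J a ?X) s \<omega>)"
      by (rule KP.add[OF KP_J[OF KY i] KP_TI[OF Ka[unfolded Ia]]])
    have nJ: "nice (J a ?X)" using na unfolding Ia .
    show ?thesis
    proof (rule KP_eq0[OF K nice_sqi_cut[OF nZ]], rule P_l2d_eq_0[OF KP_sqi[OF K] nice_sqi_cut[OF nZ]])
      fix s assume s: "0 \<le> s" "s \<le> T"
      note sY = sqi_J[OF nice_adm[OF Y] i s] and sT = sqi_TI[OF nice_sqi_cut[OF nJ] s]
      show sq: "square_integrable M (\<lambda>\<omega>. J a ?Y s \<omega> + TI (J a ?X) s \<omega>)" by (rule sqi_add[OF sY sT])
      show sZ: "square_integrable M (?Z s)" by (rule niceD(3)[OF nZ s])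
      have "AE \<omega> in M. R (J a ?X) s \<omega> = TI (J a ?X) s \<omega>"
        using R_TI(2)[OF nJ s] l2d_eq_0_iff_AE[OF R_TI(1)[OF nJ s] sT] by simp
      moreover have "AE \<omega> in M. J a ?Y s \<omega> + R (J a ?X) s \<omega> = s * J a ?X s \<omega>"
        using J_times_time[OF X i s] l2d_eq_0_iff_AE[OF sqi_add[OF sY R_TI(1)[OF nJ s]] sZ[unfolded Ia]] by simp
      ultimately have "AE \<omega> in M. J a ?Y s \<omega> + TI (J a ?X) s \<omega> = ?Z s \<omega>"
        unfolding Ia by eventually_elim simp
      then show "l2d M (\<lambda>\<omega>. J a ?Y s \<omega> + TI (J a ?X) s \<omega>) (?Z s) = 0"
        using l2d_eq_0_iff_AE[OF sq sZ] by simp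
    qed
  qed
qed

text \<open>Multiplication by a bounded function of time is linear and bounded on the product space,
  so words suffice.\<close>

lemma KP_mult_time_image:
  assumes X: "KP X" and g: "g \<in> borel_measurable borel" and c: "\<And>s. s \<in> {0..T} \<Longrightarrow> \<bar>g s\<bar> \<le> c"
    and base: "\<And>w. set w \<subseteq> {0..d} \<Longrightarrow> KP (\<lambda>s \<omega>. g s * Iw w s \<omega>)"
  shows "KP (\<lambda>s \<omega>. g s * X s \<omega>)"
proof (rule KP_image[OF X, where C = "c\<^sup>2" and \<Phi> = "\<lambda>X s \<omega>. g s * X s \<omega>"])
  show "square_integrable P (cut T (\<lambda>s \<omega>. g s * X s \<omega>))" if "KP X" for X
    by (rule sqi_cut_time(1)[OF KP_sqi[OF that] g c])
  show "l2d P (cut T (\<lambda>s \<omega>. g s * X s \<omega> + g s * Y s \<omega>)) (cut T (\<lambda>s \<omega>. g s * (X s \<omega> + Y s \<omega>))) = 0" for X Y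
    by (simp add: distrib_left)
  show "l2d P (cut T (\<lambda>s \<omega>. b * (g s * X s \<omega>))) (cut T (\<lambda>s \<omega>. g s * (b * X s \<omega>))) = 0" for X b
    by (simp add: mult.left_commute)
  show "l2d P (cut T (\<lambda>s \<omega>. g s * X s \<omega>)) (cut T (\<lambda>s \<omega>. g s * Y s \<omega>)) \<le> c\<^sup>2 * l2d P (cut T X) (cut T Y)"
    if "KP X" "KP Y" for X Y
    using sqi_cut_time(2)[OF KP_sqi[OF KP_diff[OF that]] g c]
    unfolding right_diff_distrib cut_diff by (simp add: l2d_def)
qed (rule base)

lemma KP_times_time:
  assumes X: "KP X"
  shows "KP (\<lambda>s \<omega>. s * X s \<omega>)"
  by (rule KP_mult_time_image[OF X, where c = T and g = "\<lambda>s. s"]) (auto intro: KP_times_time_Iw)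

lemma KP_times_polynomial:
  assumes "real_polynomial_function g" "KP X"
  shows "KP (\<lambda>s \<omega>. g s * X s \<omega>)"
  using assms
proof (induction arbitrary: X rule: real_polynomial_function.induct)
  case (linear g)
  have "g s = g 1 * s" for s using linear(1)[THEN bounded_linear.linear, THEN linear_scale, of s 1] by (simp add: mult.commute)
  then have "(\<lambda>s \<omega>. g s * X s \<omega>) = (\<lambda>s \<omega>. g 1 * (s * X s \<omega>))" by (metis mult.assoc)
  then show ?case using KP.scale[OF KP_times_time[OF linear(2)], of "g 1"] by simp
next
  case (const c)
  then show ?case by (rule KP.scale)
next
  case (add g h)
  show ?case unfolding distrib_right by (intro KP.add add)
next
  case (mult g h)
  show ?case unfolding mult.assoc by (intro mult)
qed

text \<open>Bounded pointwise convergence of the factors is enough, by dominated convergence with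
  majorant (2 c)^2 X^2.\<close>

lemma KP_times_limit:
  assumes X: "KP X" and g: "\<And>n. g n \<in> borel_measurable borel" and h: "h \<in> borel_measurable borel"
    and c: "\<And>n s. s \<in> {0..T} \<Longrightarrow> \<bar>g n s\<bar> \<le> c" and lim: "\<And>s. s \<in> {0..T} \<Longrightarrow> (\<lambda>n. g n s) \<longlonglongrightarrow> h s"
    and K: "\<And>n::nat. KP (\<lambda>s \<omega>. g n s * X s \<omega>)"
  shows "KP (\<lambda>s \<omega>. h s * X s \<omega>)"
proof (rule KP.lim[OF K])
  have ch: "\<bar>h s\<bar> \<le> c" if "s \<in> {0..T}" for s
    by (rule LIMSEQ_le_const2[OF tendsto_rabs[OF lim[OF that]]]) (use c that in auto)
  show sh: "square_integrable P (cut T (\<lambda>s \<omega>. h s * X s \<omega>))"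
    by (rule sqi_cut_time(1)[OF KP_sqi[OF X] h ch])
  note [measurable] = sqi_measurable[OF sh] sqi_measurable[OF KP_sqi[OF K]]
  have "(\<lambda>n. \<integral>p. (cut T (\<lambda>s \<omega>. g n s * X s \<omega>) p - cut T (\<lambda>s \<omega>. h s * X s \<omega>) p)\<^sup>2 \<partial>P) \<longlonglongrightarrow> (\<integral>p. 0 \<partial>P)"
  proof (rule integral_dominated_convergence[where w = "\<lambda>p. (2 * c)\<^sup>2 * (cut T X p)\<^sup>2"])
    show "integrable P (\<lambda>p. (2 * c)\<^sup>2 * (cut T X p)\<^sup>2)"
      using sqi_integrable_sq[OF KP_sqi[OF X]] by simp
    show "AE p in P. (\<lambda>n. (cut T (\<lambda>s \<omega>. g n s * X s \<omega>) p - cut T (\<lambda>s \<omega>. h s * X s \<omega>) p)\<^sup>2) \<longlonglongrightarrow> 0"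
    proof (rule AE_I2)
      fix p :: "real \<times> 'a"
      show "(\<lambda>n. (cut T (\<lambda>s \<omega>. g n s * X s \<omega>) p - cut T (\<lambda>s \<omega>. h s * X s \<omega>) p)\<^sup>2) \<longlonglongrightarrow> 0"
      proof (cases "fst p \<in> {0..T}")
        case True
        have "(\<lambda>n. (g n (fst p) * X (fst p) (snd p) - h (fst p) * X (fst p) (snd p))\<^sup>2)
            \<longlonglongrightarrow> (h (fst p) * X (fst p) (snd p) - h (fst p) * X (fst p) (snd p))\<^sup>2"
          by (intro tendsto_intros lim True)
        then show ?thesis using True by (simp add: cut_def case_prod_unfold)
      qed (simp add: cut_def case_prod_unfold)
    qed
    show "AE p in P. norm ((cut T (\<lambda>s \<omega>. g n s * X s \<omega>) p - cut T (\<lambda>s \<omega>. h s * X s \<omega>) p)\<^sup>2) \<le> (2 * c)\<^sup>2 * (cut T X p)\<^sup>2" for n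
    proof (rule AE_I2)
      fix p :: "real \<times> 'a"
      show "norm ((cut T (\<lambda>s \<omega>. g n s * X s \<omega>) p - cut T (\<lambda>s \<omega>. h s * X s \<omega>) p)\<^sup>2) \<le> (2 * c)\<^sup>2 * (cut T X p)\<^sup>2"
      proof (cases "fst p \<in> {0..T}")
        case True
        have "\<bar>g n (fst p) - h (fst p)\<bar> \<le> 2 * c" using c[OF True, of n] ch[OF True] by linarith
        then have "(g n (fst p) - h (fst p))\<^sup>2 \<le> (2 * c)\<^sup>2" using power_mono[of "\<bar>g n (fst p) - h (fst p)\<bar>" "2 * c" 2] by simp
        then show ?thesis using True mult_right_mono[of _ _ "(X (fst p) (snd p))\<^sup>2"]
          by (simp add: cut_def case_prod_unfold power_mult_distrib flip: left_diff_distrib)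
      qed (simp add: cut_def case_prod_unfold)
    qed
  qed simp_all
  then show "(\<lambda>n. l2d P (cut T (\<lambda>s \<omega>. g n s * X s \<omega>)) (cut T (\<lambda>s \<omega>. h s * X s \<omega>))) \<longlonglongrightarrow> 0"
    by (simp add: l2d_def)
qed

lemma KP_times_continuous:
  assumes X: "KP X" and g: "continuous_on UNIV g"
  shows "KP (\<lambda>s \<omega>. g s * X s \<omega>)"
proof -
  have "\<exists>p. real_polynomial_function p \<and> (\<forall>x\<in>{0..T}. \<bar>g x - p x\<bar> < inverse (Suc n))" for n
  proof -
    have "0 < inverse (real (Suc n))" by simp
    from Stone_Weierstrass_real_polynomial_function[OF compact_Icc continuous_on_subset[OF g subset_UNIV] this]
    show ?thesis by metis
  qed
  then have "\<forall>n. \<exists>p. real_polynomial_function p \<and> (\<forall>x\<in>{0..T}. \<bar>g x - p x\<bar> < inverse (Suc n))" by blast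
  from choice[OF this] obtain p where p: "\<And>n. real_polynomial_function (p n)"
    "\<And>n x. x \<in> {0..T} \<Longrightarrow> \<bar>g x - p n x\<bar> < inverse (Suc n)" by blast
  have "compact (g ` {0..T})" by (intro compact_continuous_image continuous_on_subset[OF g]) auto
  then have "bounded (g ` {0..T})" by (rule compact_imp_bounded)
  then obtain c where c: "\<And>x. x \<in> {0..T} \<Longrightarrow> \<bar>g x\<bar> \<le> c" unfolding bounded_iff by (metis imageI real_norm_def)
  show ?thesis
  proof (rule KP_times_limit[OF X, where g = p and c = "c + 1"])
    show "p n \<in> borel_measurable borel" for n
      using continuous_real_polymonial_function[OF p(1)]
      by (intro borel_measurable_continuous_onI) (simp add: continuous_on_eq_continuous_within)
    show "g \<in> borel_measurable borel" using g by (rule borel_measurable_continuous_onI)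
    show "\<bar>p n s\<bar> \<le> c + 1" if "s \<in> {0..T}" for n s
    proof -
      have "inverse (real (Suc n)) \<le> 1" by (simp add: inverse_le_1_iff)
      then show ?thesis using p(2)[OF that, of n] c[OF that] by linarith
    qed
    show "(\<lambda>n. p n s) \<longlonglongrightarrow> g s" if "s \<in> {0..T}" for s
    proof (rule LIM_zero_cancel, rule Lim_null_comparison[OF _ LIMSEQ_inverse_real_of_nat])
      show "\<forall>\<^sub>F n in sequentially. norm (p n s - g s) \<le> inverse (real (Suc n))"
      proof (rule always_eventually, rule allI)
        fix n show "norm (p n s - g s) \<le> inverse (real (Suc n))"
          using p(2)[OF that, of n] by (simp only: real_norm_def abs_minus_commute less_imp_le)
      qed
    qed
  qed (rule KP_times_polynomial[OF p(1) X])
qed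

lemma KP_times_atMost:
  assumes X: "KP X"
  shows "KP (\<lambda>s \<omega>. indicator {..r} s * X s \<omega>)"
\<comment> \<open>For n > 0 these are continuous ramps, equal to 1 up to \<open>r\<close> and to 0
  from r + 1/n on; the limit has the value 1 at \<open>r\<close>.\<close>
proof (rule KP_times_limit[OF X, where c = 1 and g = "\<lambda>n s. max 0 (min 1 (1 - real n * (s - r)))"])
  have c: "continuous_on UNIV (\<lambda>s. max 0 (min 1 (1 - real n * (s - r))))" for n by (intro continuous_intros)
  show "(\<lambda>s. max 0 (min 1 (1 - real n * (s - r)))) \<in> borel_measurable borel" for n
    by (rule borel_measurable_continuous_onI[OF c])
  show "KP (\<lambda>s \<omega>. max 0 (min 1 (1 - real n * (s - r))) * X s \<omega>)" for n
    by (rule KP_times_continuous[OF X c])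
  show "(\<lambda>n. max 0 (min 1 (1 - real n * (s - r)))) \<longlonglongrightarrow> indicator {..r} s" for s
  proof (cases "s \<le> r")
    case True
    then have "real n * (s - r) \<le> 0" for n by (simp add: mult_nonneg_nonpos)
    then have "max 0 (min 1 (1 - real n * (s - r))) = 1" for n by (simp add: min_absorb1)
    then show ?thesis using True by simp
  next
    case False
    obtain N where N: "1 / (s - r) < real N" using reals_Archimedean2 by blast
    have "max 0 (min 1 (1 - real n * (s - r))) = 0" if "n \<ge> N" for n
    proof -
      have "1 / (s - r) < real n" using N that by (meson less_le_trans of_nat_le_iff)
      then have "1 < real n * (s - r)" using False by (simp add: pos_divide_less_eq)
      then show ?thesis by simp
    qed
    then have "\<forall>\<^sub>F n in sequentially. max 0 (min 1 (1 - real n * (s - r))) = 0"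
      by (rule eventually_sequentiallyI)
    then show ?thesis using False by (simp add: tendsto_eventually)
  qed
qed auto

text \<open>The words are reversed, as \<open>ito_iterated\<close> expects them, so
  \<open>hd w \<noteq> 0\<close> says that the word does not end in 0.\<close>

definition Hcl :: "('a \<Rightarrow> real) set" where
  "Hcl = L2cl M {Iw w T | w. set w \<subseteq> {0..d} \<and> (w \<noteq> [] \<longrightarrow> hd w \<noteq> 0)}"

text \<open>A final stochastic integral appends a nonzero letter to every word, whichever letter it
  ended in before. Sums and limits are transferred by the isometry.\<close>

lemma KP_J_Hcl:
  assumes X: "KP X" and i: "i \<in> {1..d}"
  shows "J i X T \<in> Hcl"
  using X
proof (induction rule: KP.induct)
  case (base w)
  have "J i (Iw w) T = Iw (i # w) T" using i by (simp add: Iw_Cons del: ito_iterated.simps(2))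
  moreover have "square_integrable M (J i (Iw w) T)"
    using T_pos by (intro sqi_J nice_adm nice_Iw base i) auto
  ultimately show ?case
    unfolding Hcl_def using base i by (intro L2cl.base) (auto intro!: exI[of _ "i # w"])
next
  case zero
  have T: "0 \<le> T" "T \<le> T" using T_pos by auto
  have "l2d M (\<lambda>\<omega>. 0 * J i (\<lambda>s \<omega>. 0) T \<omega>) (J i (\<lambda>s \<omega>. 0 * 0) T) = 0" by (rule J_scale[OF adm_zero i T])
  then have "l2d M (\<lambda>\<omega>. 0) (J i (\<lambda>s \<omega>. 0) T) = 0" by simp
  then show ?case unfolding Hcl_def by (rule L2cl_eq0[OF L2cl.zero sqi_J[OF adm_zero i T]])
next
  case (add X Y)
  have T: "0 \<le> T" "T \<le> T" using T_pos by auto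
  note XY = add.hyps[THEN KP_adm]
  show ?case
    using L2cl_eq0[OF L2cl.add[OF add.IH[unfolded Hcl_def]] sqi_J[OF adm_add[OF XY] i T] J_add[OF XY i T]]
    by (simp add: Hcl_def)
next
  case (scale X c)
  have T: "0 \<le> T" "T \<le> T" using T_pos by auto
  note X = scale.hyps[THEN KP_adm]
  show ?case
    using L2cl_eq0[OF L2cl.scale[OF scale.IH[unfolded Hcl_def]] sqi_J[OF adm_scale[OF X] i T] J_scale[OF X i T]]
    by (simp add: Hcl_def)
next
  case (lim G X)
  have T: "0 \<le> T" "T \<le> T" using T_pos by auto
  note X = KP_adm[OF KP.lim[OF lim.hyps]]
  have "(\<lambda>n. l2d M (J i (G n) T) (J i X T)) \<longlonglongrightarrow> 0"
    using lim.hyps(3) by (simp only: J_l2d[OF KP_adm[OF lim.hyps(1)] X i T T])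
  then show ?case
    using L2cl.lim[OF lim.IH[unfolded Hcl_def] sqi_J[OF X i T]] by (simp add: Hcl_def)
qed

lemma const_Hcl: "(\<lambda>\<omega>. c) \<in> Hcl"
proof -
  have "Iw [] T \<in> Hcl" unfolding Hcl_def by (intro L2cl.base) (auto intro!: exI[of _ "[]"])
  then have "(\<lambda>\<omega>. c * Iw [] T \<omega>) \<in> Hcl" unfolding Hcl_def by (rule L2cl.scale)
  then show ?thesis by simp
qed

end

section \<open>Trigonometric functionals of the Brownian motion\<close>

lemma square_sum_le:
  fixes f :: "'i \<Rightarrow> real"
  shows "(\<Sum>i\<in>I. f i)\<^sup>2 \<le> real (card I) * (\<Sum>i\<in>I. (f i)\<^sup>2)"
  using sum_squared_le_sum_of_squares[of f I] by (simp add: mult.commute)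

text \<open>The data of one linear combination of Brownian values, with coefficient
  \<open>l j\<close> for coordinate \<open>idx j\<close> at time \<open>tm j\<close>; the aim is to
  place its cosine in \<open>Hcl\<close>.\<close>

locale brownian_exponential = brownian M d T B
  for M :: "'a measure" and d :: nat and T :: real and B :: "nat \<Rightarrow> real \<Rightarrow> 'a \<Rightarrow> real" +
  fixes n :: nat and idx :: "nat \<Rightarrow> nat" and tm :: "nat \<Rightarrow> real" and l :: "nat \<Rightarrow> real"
  assumes idx: "j < n \<Longrightarrow> idx j \<in> {1..d}" and tm: "j < n \<Longrightarrow> 0 \<le> tm j" "j < n \<Longrightarrow> tm j \<le> T"
begin

text \<open>\<open>q\<close> is the bracket of the Wiener integral \<open>Xt\<close> of \<open>theta\<close>, and \<open>E0 \<phi>\<close> is the real part of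
  \<open>exp (i \<phi>)\<close> times the exponential martingale of \<open>i Xt\<close>. On the intervals selected by \<open>elem\<close>, \<open>theta\<close>
  is constant.\<close>

definition Xt :: "real \<Rightarrow> 'a \<Rightarrow> real" where
  "Xt t \<omega> = (\<Sum>j<n. l j * B (idx j) (min t (tm j)) \<omega>)"

definition theta :: "nat \<Rightarrow> real \<Rightarrow> real" where
  "theta a r = (\<Sum>j<n. (if idx j = a then l j else 0) * indicator {..tm j} r)"

definition q :: "real \<Rightarrow> real" where
  "q t = (\<Sum>j<n. \<Sum>k<n. if idx j = idx k then l j * l k * min t (min (tm j) (tm k)) else 0)"

definition E0 :: "real \<Rightarrow> real \<Rightarrow> 'a \<Rightarrow> real" where
  "E0 \<phi> t \<omega> = exp (q t / 2) * cos (Xt t \<omega> + \<phi>)"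

definition elem :: "real \<Rightarrow> real \<Rightarrow> bool" where
  "elem u v \<longleftrightarrow> (\<forall>j<n. tm j \<le> u \<or> v \<le> tm j)"

text \<open>Induction on the number of times \<open>tm j\<close> strictly inside the interval, which
  is split at one of them. A property that combines over adjacent intervals then has to be checked
  only where \<open>theta\<close> is constant.\<close>

lemma elementary_induct:
  assumes "0 \<le> u" "u \<le> v" "v \<le> T"
    and base: "\<And>u v. 0 \<le> u \<Longrightarrow> u \<le> v \<Longrightarrow> v \<le> T \<Longrightarrow> elem u v \<Longrightarrow> Q u v"
    and step: "\<And>u w v. 0 \<le> u \<Longrightarrow> u \<le> w \<Longrightarrow> w \<le> v \<Longrightarrow> v \<le> T \<Longrightarrow> Q u w \<Longrightarrow> Q w v \<Longrightarrow> Q u v"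
  shows "Q u v"
  using assms(1-3)
proof (induction "card {j \<in> {..<n}. u < tm j \<and> tm j < v}" arbitrary: u v rule: less_induct)
  case less
  show ?case
  proof (cases "elem u v")
    case True
    then show ?thesis using base less.prems by blast
  next
    case False
    then obtain j where j: "j < n" "u < tm j" "tm j < v" by (auto simp: elem_def not_le)
    have "card {k \<in> {..<n}. u < tm k \<and> tm k < tm j} < card {j \<in> {..<n}. u < tm j \<and> tm j < v}"
      "card {k \<in> {..<n}. tm j < tm k \<and> tm k < v} < card {j \<in> {..<n}. u < tm j \<and> tm j < v}"
      using j by (auto intro!: psubset_card_mono)
    then have "Q u (tm j)" "Q (tm j) v" using less j by auto
    then show ?thesis using step[of u "tm j" v] j less.prems by auto
  qed
qed

lemma elem_subinterval: "elem u v \<Longrightarrow> u \<le> r \<Longrightarrow> r \<le> v \<Longrightarrow> elem u r"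
  by (force simp: elem_def)

lemma theta_elem: "elem u v \<Longrightarrow> u < r \<Longrightarrow> r \<le> v \<Longrightarrow> theta a r = theta a v"
  unfolding theta_def by (intro sum.cong refl) (force simp: elem_def indicator_def)

lemma Xt_elem:
  assumes "elem u v" "u < v"
  shows "Xt v \<omega> = Xt u \<omega> + (\<Sum>a=1..d. theta a v * (B a v \<omega> - B a u \<omega>))"
proof -
  have "(\<Sum>a=1..d. theta a v * (B a v \<omega> - B a u \<omega>))
      = (\<Sum>a=1..d. \<Sum>j<n. if a = idx j then indicator {..tm j} v * l j * (B a v \<omega> - B a u \<omega>) else 0)"
    unfolding theta_def sum_distrib_right by (intro sum.cong refl) auto
  also have "\<dots> = (\<Sum>j<n. \<Sum>a=1..d. if a = idx j then indicator {..tm j} v * l j * (B a v \<omega> - B a u \<omega>) else 0)"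
    by (rule sum.swap)
  also have "\<dots> = (\<Sum>j<n. indicator {..tm j} v * l j * (B (idx j) v \<omega> - B (idx j) u \<omega>))"
    using idx by (intro sum.cong refl) (simp add: sum.delta)
  also have "\<dots> = (\<Sum>j<n. l j * B (idx j) (min v (tm j)) \<omega> - l j * B (idx j) (min u (tm j)) \<omega>)"
  proof (intro sum.cong refl)
    fix j assume "j \<in> {..<n}"
    then have "tm j \<le> u \<or> v \<le> tm j" using assms by (auto simp: elem_def)
    then show "indicator {..tm j} v * l j * (B (idx j) v \<omega> - B (idx j) u \<omega>)
      = l j * B (idx j) (min v (tm j)) \<omega> - l j * B (idx j) (min u (tm j)) \<omega>"
      using assms(2) by (auto simp: min_def algebra_simps)
  qed
  also have "\<dots> = Xt v \<omega> - Xt u \<omega>" by (simp add: Xt_def sum_subtractf)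
  finally show ?thesis by simp
qed

lemma q_elem:
  assumes "elem u v" "u < v"
  shows "q v = q u + (\<Sum>a=1..d. (theta a v)\<^sup>2) * (v - u)"
proof -
  let ?i = "\<lambda>j. indicator {..tm j} v :: real"
  have "(\<Sum>a=1..d. (theta a v)\<^sup>2)
    = (\<Sum>a=1..d. \<Sum>j<n. \<Sum>k<n. if a = idx j then (if idx j = idx k then l j * l k * (?i j * ?i k) else 0) else 0)"
    unfolding theta_def power2_eq_square sum_product by (intro sum.cong refl) auto
  also have "\<dots> = (\<Sum>j<n. \<Sum>a=1..d. if a = idx j then (\<Sum>k<n. if idx j = idx k then l j * l k * (?i j * ?i k) else 0) else 0)"
    by (subst sum.swap) (auto intro!: sum.cong)
  also have "\<dots> = (\<Sum>j<n. \<Sum>k<n. if idx j = idx k then l j * l k * (?i j * ?i k) else 0)"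
  proof (rule sum.cong[OF refl])
    fix j assume "j \<in> {..<n}"
    then have "idx j \<in> {1..d}" using idx by simp
    then show "(\<Sum>a=1..d. if a = idx j then (\<Sum>k<n. if idx j = idx k then l j * l k * (?i j * ?i k) else 0) else 0)
      = (\<Sum>k<n. if idx j = idx k then l j * l k * (?i j * ?i k) else 0)" by simp
  qed
  finally have "(\<Sum>a=1..d. (theta a v)\<^sup>2) * (v - u)
     = (\<Sum>j<n. \<Sum>k<n. if idx j = idx k then l j * l k * (?i j * ?i k) * (v - u) else 0)"
    by (simp add: sum_distrib_right if_distrib[of "\<lambda>x. x * (v - u)"] cong: if_cong)
  also have "\<dots> = (\<Sum>j<n. \<Sum>k<n. (if idx j = idx k then l j * l k * min v (min (tm j) (tm k)) else 0)
      - (if idx j = idx k then l j * l k * min u (min (tm j) (tm k)) else 0))"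
  proof (intro sum.cong refl)
    fix j k assume "j \<in> {..<n}" "k \<in> {..<n}"
    then have "tm j \<le> u \<or> v \<le> tm j" "tm k \<le> u \<or> v \<le> tm k" using assms by (auto simp: elem_def)
    \<comment> \<open>Across such an interval the minimum in \<open>q\<close> grows by
      \<open>v - u\<close> if both times lie beyond it, and stays constant otherwise.\<close>
    then consider "v \<le> tm j" "v \<le> tm k" | "tm j \<le> u \<or> tm k \<le> u" by blast
    then have "?i j * ?i k * (v - u) = min v (min (tm j) (tm k)) - min u (min (tm j) (tm k))"
    proof cases
      case 1
      then show ?thesis using assms(2) by simp
    next
      case 2
      then have "?i j * ?i k = 0" using assms(2) by (auto simp: indicator_def)
      moreover have "min (tm j) (tm k) \<le> u" using 2 by linarith
      ultimately show ?thesis using assms(2) by (simp add: min_absorb2)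
    qed
    then show "(if idx j = idx k then l j * l k * (?i j * ?i k) * (v - u) else 0)
      = (if idx j = idx k then l j * l k * min v (min (tm j) (tm k)) else 0)
      - (if idx j = idx k then l j * l k * min u (min (tm j) (tm k)) else 0)"
      by (simp add: mult.assoc right_diff_distrib[symmetric])
  qed
  also have "\<dots> = q v - q u" by (simp add: q_def sum_subtractf)
  finally show ?thesis by simp
qed

section \<open>The exponential martingale in real form\<close>

lemma Xt_measurable_F:
  assumes "0 \<le> t"
  shows "Xt t \<in> borel_measurable (F t)"
  unfolding Xt_def[abs_def] using assms idx tm(1)
  by (intro borel_measurable_sum borel_measurable_times borel_measurable_const B_measurable_F) auto

lemma E0_measurable_F: "0 \<le> t \<Longrightarrow> E0 \<phi> t \<in> borel_measurable (F t)"
  unfolding E0_def[abs_def] using Xt_measurable_F[of t] by measurable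

lemma E0_measurable: "0 \<le> t \<Longrightarrow> t \<le> T \<Longrightarrow> E0 \<phi> t \<in> borel_measurable M"
  by (rule measurable_F_M[OF E0_measurable_F])

lemma E0_bound: "\<bar>E0 \<phi> t \<omega>\<bar> \<le> exp (q t / 2)"
  by (simp add: E0_def abs_mult)

lemma E0_mult_integrable:
  assumes "0 \<le> t" "t \<le> T" "integrable M \<eta>"
  shows "integrable M (\<lambda>\<omega>. E0 \<phi> t \<omega> * \<eta> \<omega>)"
proof (rule Bochner_Integration.integrable_bound[where f = "\<lambda>\<omega>. exp (q t / 2) * \<eta> \<omega>"])
  show "(\<lambda>\<omega>. E0 \<phi> t \<omega> * \<eta> \<omega>) \<in> borel_measurable M"
    using E0_measurable[OF assms(1,2), of \<phi>] assms(3) by measurable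
  show "AE \<omega> in M. norm (E0 \<phi> t \<omega> * \<eta> \<omega>) \<le> norm (exp (q t / 2) * \<eta> \<omega>)"
    using E0_bound[of \<phi> t] by (auto simp: abs_mult intro!: mult_right_mono)
qed (use assms in simp)

lemma sqi_E0: "0 \<le> t \<Longrightarrow> t \<le> T \<Longrightarrow> square_integrable M (E0 \<phi> t)"
  by (rule sqi_bounded[OF E0_measurable E0_bound])

text \<open>Subtracting pi/2 from the phase turns the real part into the imaginary part.\<close>

lemma E0_pythagoras: "(E0 \<phi> t \<omega>)\<^sup>2 + (E0 (\<phi> - pi / 2) t \<omega>)\<^sup>2 = exp (q t)"
proof -
  have s: "cos (x + (\<phi> - pi / 2)) = sin (x + \<phi>)" for x
    by (simp add: sin_cos_eq algebra_simps) (metis cos_minus minus_diff_eq diff_diff_eq2 add.commute)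
  have "(E0 \<phi> t \<omega>)\<^sup>2 + (E0 (\<phi> - pi / 2) t \<omega>)\<^sup>2
      = (exp (q t / 2))\<^sup>2 * ((cos (Xt t \<omega> + \<phi>))\<^sup>2 + (sin (Xt t \<omega> + \<phi>))\<^sup>2)"
    by (simp only: E0_def s power_mult_distrib distrib_left)
  also have "\<dots> = exp (q t)" by (simp add: power2_eq_square flip: exp_add)
  finally show ?thesis .
qed

lemma E0_opposite: "E0 (\<phi> - pi / 2 - pi / 2) t \<omega> = - E0 \<phi> t \<omega>"
proof -
  have "cos (Xt t \<omega> + (\<phi> - pi / 2 - pi / 2)) = cos ((Xt t \<omega> + \<phi>) - pi)" by (simp add: algebra_simps)
  then show ?thesis by (simp add: E0_def cos_diff)
qed

lemma E0_elem:
  assumes uv: "elem u v" "u < v"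
  defines "D \<equiv> \<lambda>\<omega>. \<Sum>a=1..d. theta a v * (B a v \<omega> - B a u \<omega>)"
  shows "E0 \<phi> v \<omega> = E0 \<phi> u \<omega> * (exp ((q v - q u) / 2) * cos (D \<omega>))
    - E0 (\<phi> - pi / 2) u \<omega> * (exp ((q v - q u) / 2) * sin (D \<omega>))"
proof -
  have s: "cos (Xt u \<omega> + (\<phi> - pi / 2)) = sin (Xt u \<omega> + \<phi>)"
  proof -
    have "cos (Xt u \<omega> + (\<phi> - pi / 2)) = cos ((Xt u \<omega> + \<phi>) - pi / 2)" by (simp add: algebra_simps)
    then show ?thesis by (simp add: cos_diff)
  qed
  have "Xt v \<omega> + \<phi> = (Xt u \<omega> + \<phi>) + D \<omega>"
    unfolding D_def Xt_elem[OF uv] by simp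
  then have c_eq: "cos (Xt v \<omega> + \<phi>) = cos (Xt u \<omega> + \<phi>) * cos (D \<omega>) - sin (Xt u \<omega> + \<phi>) * sin (D \<omega>)"
    by (simp only: cos_add)
  have e_eq: "exp (q v / 2) = exp (q u / 2) * exp ((q v - q u) / 2)"
    by (simp add: diff_divide_distrib flip: exp_add)
  show ?thesis unfolding E0_def s c_eq e_eq by (simp only: right_diff_distrib mult_ac)
qed

text \<open>The addition theorem separates the values at \<open>u\<close> from the increment of
  \<open>Xt\<close>, which is independent of \<open>F u\<close> and has explicit Gaussian
  moments.\<close>

lemma E0_elem_expectation:
  assumes uv: "elem u v" "u < v" and u: "0 \<le> u" and v: "v \<le> T"
    and \<eta>: "\<eta> \<in> borel_measurable (F u)" "integrable M \<eta>"
  shows "expectation (\<lambda>\<omega>. E0 \<phi> v \<omega> * \<eta> \<omega>) = expectation (\<lambda>\<omega>. E0 \<phi> u \<omega> * \<eta> \<omega>)"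
    "a \<in> {1..d} \<Longrightarrow> expectation (\<lambda>\<omega>. E0 \<phi> v \<omega> * (\<eta> \<omega> * (B a v \<omega> - B a u \<omega>)))
      = - (theta a v * (v - u)) * expectation (\<lambda>\<omega>. E0 (\<phi> - pi / 2) u \<omega> * \<eta> \<omega>)"
proof -
  let ?\<psi> = "\<phi> - pi / 2"
  define e where "e = exp ((q v - q u) / 2)"
  define D where "D x = (\<Sum>a=1..d. theta a v * x a)" for x :: "nat \<Rightarrow> real"
  have D: "D (incr u v \<omega>) = (\<Sum>a=1..d. theta a v * (B a v \<omega> - B a u \<omega>))" for \<omega>
    unfolding D_def by (intro sum.cong refl) (simp only: incr_apply)
  have [measurable]: "D \<in> borel_measurable (\<Pi>\<^sub>M i\<in>{1..d}. borel)"
    unfolding D_def[abs_def]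
    by (intro borel_measurable_sum borel_measurable_times borel_measurable_const measurable_component_singleton)
  have [measurable]: "incr u v \<in> measurable M (\<Pi>\<^sub>M i\<in>{1..d}. borel)"
    using incr_measurable[of u v] u v uv by simp
  have T: "expectation (\<lambda>\<omega>. cos (D (incr u v \<omega>))) = exp (- ((q v - q u) / 2))"
    "expectation (\<lambda>\<omega>. sin (D (incr u v \<omega>))) = 0"
    using incr_trig(1,2)[OF u uv(2) v, of "\<lambda>a. theta a v"] unfolding D q_elem[OF uv] by simp_all
  have T2: "expectation (\<lambda>\<omega>. (B a v \<omega> - B a u \<omega>) * cos (D (incr u v \<omega>))) = 0"
    "expectation (\<lambda>\<omega>. (B a v \<omega> - B a u \<omega>) * sin (D (incr u v \<omega>))) = theta a v * (v - u) * exp (- ((q v - q u) / 2))"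
    if "a \<in> {1..d}" for a
    using incr_trig(3,4)[OF u uv(2) v that, of "\<lambda>a. theta a v"] unfolding D q_elem[OF uv] by simp_all
  \<comment> \<open>The growth of \<open>exp (q / 2)\<close> exactly compensates the decay of the
    Gaussian expectation.\<close>
  have ee: "e * exp (- ((q v - q u) / 2)) = 1" by (simp add: e_def flip: exp_add)
  have b: "\<eta>' \<in> borel_measurable (F u)" "integrable M \<eta>'" if "\<eta>' = (\<lambda>\<omega>. E0 \<phi>' u \<omega> * \<eta> \<omega>)" for \<phi>' \<eta>'
    using E0_measurable_F[OF u, of \<phi>'] \<eta>(1) E0_mult_integrable[OF u _ \<eta>(2), of \<phi>'] uv v by (auto simp: that)
  note b1 = b[OF refl, of \<phi>] and b2 = b[OF refl, of ?\<psi>]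
  have gm: "(\<lambda>x. e * cos (D x)) \<in> borel_measurable (\<Pi>\<^sub>M i\<in>{1..d}. borel)"
    "(\<lambda>x. e * sin (D x)) \<in> borel_measurable (\<Pi>\<^sub>M i\<in>{1..d}. borel)" by measurable
  have gi: "integrable M (\<lambda>\<omega>. e * cos (D (incr u v \<omega>)))" "integrable M (\<lambda>\<omega>. e * sin (D (incr u v \<omega>)))"
    by (intro integrable_mult_right integrable_const_bound[where B = 1]; simp)+
  note c1 = F_incr_expectation[OF u uv(2) v b1 gm(1) gi(1)] and c2 = F_incr_expectation[OF u uv(2) v b2 gm(2) gi(2)]
  have "expectation (\<lambda>\<omega>. E0 \<phi> v \<omega> * \<eta> \<omega>)
    = expectation (\<lambda>\<omega>. (E0 \<phi> u \<omega> * \<eta> \<omega>) * (e * cos (D (incr u v \<omega>))) - (E0 ?\<psi> u \<omega> * \<eta> \<omega>) * (e * sin (D (incr u v \<omega>))))"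
    unfolding E0_elem[OF uv] D e_def by (simp add: algebra_simps)
  also have "\<dots> = expectation (\<lambda>\<omega>. E0 \<phi> u \<omega> * \<eta> \<omega>)"
    using c1 c2 T ee by simp
  finally show "expectation (\<lambda>\<omega>. E0 \<phi> v \<omega> * \<eta> \<omega>) = expectation (\<lambda>\<omega>. E0 \<phi> u \<omega> * \<eta> \<omega>)" .
  assume a: "a \<in> {1..d}"
  have gm: "(\<lambda>x. e * (x a * cos (D x))) \<in> borel_measurable (\<Pi>\<^sub>M i\<in>{1..d}. borel)"
    "(\<lambda>x. e * (x a * sin (D x))) \<in> borel_measurable (\<Pi>\<^sub>M i\<in>{1..d}. borel)"
    using measurable_component_singleton[OF a, of "\<lambda>_. borel"] by measurable
  have iB: "integrable M (\<lambda>\<omega>. B a v \<omega> - B a u \<omega>)"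
    using u v uv by (intro sqi_integrable incr_moments a) auto
  have [measurable]: "(\<lambda>\<omega>. B a v \<omega> - B a u \<omega>) \<in> borel_measurable M" using iB by simp
  have gi: "integrable M (\<lambda>\<omega>. e * (incr u v \<omega> a * cos (D (incr u v \<omega>))))" "integrable M (\<lambda>\<omega>. e * (incr u v \<omega> a * sin (D (incr u v \<omega>))))"
    unfolding incr_apply[OF a]
    by (intro integrable_mult_right Bochner_Integration.integrable_bound[OF iB] AE_I2; simp add: abs_mult mult_left_le)+
  note c1 = F_incr_expectation[OF u uv(2) v b1 gm(1) gi(1), unfolded incr_apply[OF a]]
    and c2 = F_incr_expectation[OF u uv(2) v b2 gm(2) gi(2), unfolded incr_apply[OF a]]
  have "expectation (\<lambda>\<omega>. E0 \<phi> v \<omega> * (\<eta> \<omega> * (B a v \<omega> - B a u \<omega>)))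
    = expectation (\<lambda>\<omega>. (E0 \<phi> u \<omega> * \<eta> \<omega>) * (e * ((B a v \<omega> - B a u \<omega>) * cos (D (incr u v \<omega>))))
        - (E0 ?\<psi> u \<omega> * \<eta> \<omega>) * (e * ((B a v \<omega> - B a u \<omega>) * sin (D (incr u v \<omega>)))))"
    unfolding E0_elem[OF uv] D e_def by (simp add: algebra_simps)
  also have "\<dots> = - (expectation (\<lambda>\<omega>. E0 ?\<psi> u \<omega> * \<eta> \<omega>) * (theta a v * (v - u) * (e * exp (- ((q v - q u) / 2)))))"
  proof -
    have i1: "expectation (\<lambda>\<omega>. e * ((B a v \<omega> - B a u \<omega>) * cos (D (incr u v \<omega>)))) = 0"
      using T2(1)[OF a] by simp
    have i2: "expectation (\<lambda>\<omega>. e * ((B a v \<omega> - B a u \<omega>) * sin (D (incr u v \<omega>))))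
        = theta a v * (v - u) * (e * exp (- ((q v - q u) / 2)))"
      using T2(2)[OF a] by (simp add: mult_ac)
    show ?thesis
      unfolding Bochner_Integration.integral_diff[OF c1(1) c2(1)] c1(2) c2(2) i1 i2 by simp
  qed
  finally show "expectation (\<lambda>\<omega>. E0 \<phi> v \<omega> * (\<eta> \<omega> * (B a v \<omega> - B a u \<omega>)))
      = - (theta a v * (v - u)) * expectation (\<lambda>\<omega>. E0 ?\<psi> u \<omega> * \<eta> \<omega>)"
    unfolding ee by simp
qed

lemma E0_martingale:
  assumes uv: "0 \<le> u" "u \<le> v" "v \<le> T" and \<eta>: "\<eta> \<in> borel_measurable (F u)" "integrable M \<eta>"
  shows "expectation (\<lambda>\<omega>. E0 \<phi> v \<omega> * \<eta> \<omega>) = expectation (\<lambda>\<omega>. E0 \<phi> u \<omega> * \<eta> \<omega>)"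
proof -
  have "\<forall>\<eta>. \<eta> \<in> borel_measurable (F u) \<and> integrable M \<eta> \<longrightarrow>
      expectation (\<lambda>\<omega>. E0 \<phi> v \<omega> * \<eta> \<omega>) = expectation (\<lambda>\<omega>. E0 \<phi> u \<omega> * \<eta> \<omega>)"
    using uv
  proof (rule elementary_induct)
    fix u v :: real assume "0 \<le> u" "u \<le> v" "v \<le> T" "elem u v"
    then show "\<forall>\<eta>. \<eta> \<in> borel_measurable (F u) \<and> integrable M \<eta> \<longrightarrow>
      expectation (\<lambda>\<omega>. E0 \<phi> v \<omega> * \<eta> \<omega>) = expectation (\<lambda>\<omega>. E0 \<phi> u \<omega> * \<eta> \<omega>)"
      using E0_elem_expectation(1)[of u v] by (cases "u = v") auto
  next
    fix u w v :: real assume "u \<le> w" and 1: "\<forall>\<eta>. \<eta> \<in> borel_measurable (F u) \<and> integrable M \<eta> \<longrightarrow>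
      expectation (\<lambda>\<omega>. E0 \<phi> w \<omega> * \<eta> \<omega>) = expectation (\<lambda>\<omega>. E0 \<phi> u \<omega> * \<eta> \<omega>)"
      and 2: "\<forall>\<eta>. \<eta> \<in> borel_measurable (F w) \<and> integrable M \<eta> \<longrightarrow>
      expectation (\<lambda>\<omega>. E0 \<phi> v \<omega> * \<eta> \<omega>) = expectation (\<lambda>\<omega>. E0 \<phi> w \<omega> * \<eta> \<omega>)"
    show "\<forall>\<eta>. \<eta> \<in> borel_measurable (F u) \<and> integrable M \<eta> \<longrightarrow>
      expectation (\<lambda>\<omega>. E0 \<phi> v \<omega> * \<eta> \<omega>) = expectation (\<lambda>\<omega>. E0 \<phi> u \<omega> * \<eta> \<omega>)"
    proof (intro allI impI, elim conjE)
      fix \<eta> :: "'a \<Rightarrow> real" assume \<eta>: "\<eta> \<in> borel_measurable (F u)" "integrable M \<eta>"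
      show "expectation (\<lambda>\<omega>. E0 \<phi> v \<omega> * \<eta> \<omega>) = expectation (\<lambda>\<omega>. E0 \<phi> u \<omega> * \<eta> \<omega>)"
        using 1[rule_format, of \<eta>] 2[rule_format, of \<eta>] \<eta> measurable_F_mono[OF \<eta>(1) \<open>u \<le> w\<close>] by simp
    qed
  qed
  then show ?thesis using \<eta> by blast
qed

text \<open>The equation tested against one term of a simple process. Written with real phases it
  reads dE(\<phi>) = - \<theta> E(\<phi> - pi/2) dB, whence the sign.\<close>

lemma E0_incr_has_integral:
  assumes uv: "0 \<le> u" "u \<le> v" "v \<le> T" and \<eta>: "\<eta> \<in> borel_measurable (F u)" "square_integrable M \<eta>"
    and a: "a \<in> {1..d}"
  shows "((\<lambda>r. theta a r * expectation (\<lambda>\<omega>. E0 (\<phi> - pi / 2) r \<omega> * \<eta> \<omega>)) has_integral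
    - expectation (\<lambda>\<omega>. E0 \<phi> v \<omega> * (\<eta> \<omega> * (B a v \<omega> - B a u \<omega>)))) {u..v}"
proof -
  let ?\<psi> = "\<phi> - pi / 2"
  let ?Q = "\<lambda>u v. \<forall>\<eta>. \<eta> \<in> borel_measurable (F u) \<and> square_integrable M \<eta> \<longrightarrow>
    ((\<lambda>r. theta a r * expectation (\<lambda>\<omega>. E0 ?\<psi> r \<omega> * \<eta> \<omega>)) has_integral
    - expectation (\<lambda>\<omega>. E0 \<phi> v \<omega> * (\<eta> \<omega> * (B a v \<omega> - B a u \<omega>)))) {u..v}"
  have "?Q u v"
    using uv
  proof (rule elementary_induct)
    fix u v :: real assume uv: "0 \<le> u" "u \<le> v" "v \<le> T" "elem u v"
    show "?Q u v"
    proof (cases "u = v")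
      case False
      with uv have "u < v" by simp
      show ?thesis
      proof (intro allI impI, elim conjE)
        fix \<eta> :: "'a \<Rightarrow> real" assume \<eta>: "\<eta> \<in> borel_measurable (F u)" "square_integrable M \<eta>"
        note i\<eta> = sqi_integrable[OF \<eta>(2)]
        let ?K = "theta a v * expectation (\<lambda>\<omega>. E0 ?\<psi> u \<omega> * \<eta> \<omega>)"
        have "((\<lambda>r. ?K) has_integral (?K * (v - u))) {u..v}"
          using has_integral_const_real[of ?K u v] uv by (simp add: mult.commute)
        then have "((\<lambda>r. theta a r * expectation (\<lambda>\<omega>. E0 ?\<psi> r \<omega> * \<eta> \<omega>)) has_integral (?K * (v - u))) {u..v}"
        \<comment> \<open>\<open>theta\<close> is left-continuous, so at \<open>u\<close> it may
          still have its previous value; a single point does not affect the integral.\<close>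
        proof (rule has_integral_spike_finite[of "{u}", rotated 2])
          fix r assume r: "r \<in> {u..v} - {u}"
          then show "theta a r * expectation (\<lambda>\<omega>. E0 ?\<psi> r \<omega> * \<eta> \<omega>) = ?K"
            using theta_elem[OF uv(4), of r a] E0_martingale[OF uv(1) _ _ \<eta>(1) i\<eta>, of r ?\<psi>] uv by simp
        qed simp
        then show "((\<lambda>r. theta a r * expectation (\<lambda>\<omega>. E0 ?\<psi> r \<omega> * \<eta> \<omega>)) has_integral
          - expectation (\<lambda>\<omega>. E0 \<phi> v \<omega> * (\<eta> \<omega> * (B a v \<omega> - B a u \<omega>)))) {u..v}"
          unfolding E0_elem_expectation(2)[OF uv(4) \<open>u < v\<close> uv(1,3) \<eta>(1) i\<eta> a] by (simp add: mult_ac)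
      qed
    qed (auto intro: has_integral_negligible[of "{v}"])
  next
    fix u w v :: real assume uv: "0 \<le> u" "u \<le> w" "w \<le> v" "v \<le> T" and 1: "?Q u w" and 2: "?Q w v"
    show "?Q u v"
    proof (intro allI impI, elim conjE)
      fix \<eta> :: "'a \<Rightarrow> real" assume \<eta>: "\<eta> \<in> borel_measurable (F u)" "square_integrable M \<eta>"
      have \<eta>w: "\<eta> \<in> borel_measurable (F w)" using \<eta>(1) uv(2) by (rule measurable_F_mono)
      have [measurable]: "B a w \<in> borel_measurable (F w)" "B a u \<in> borel_measurable (F w)"
        using uv a by (auto intro!: B_measurable_F)
      have m: "(\<lambda>\<omega>. \<eta> \<omega> * (B a w \<omega> - B a u \<omega>)) \<in> borel_measurable (F w)" using \<eta>w by measurable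
      have i1: "integrable M (\<lambda>\<omega>. \<eta> \<omega> * (B a w \<omega> - B a u \<omega>))" "integrable M (\<lambda>\<omega>. \<eta> \<omega> * (B a v \<omega> - B a w \<omega>))"
        using uv \<eta>(2) a by (intro sqi_mult incr_moments; simp)+
      have "expectation (\<lambda>\<omega>. E0 \<phi> v \<omega> * (\<eta> \<omega> * (B a v \<omega> - B a u \<omega>)))
        = expectation (\<lambda>\<omega>. E0 \<phi> v \<omega> * (\<eta> \<omega> * (B a w \<omega> - B a u \<omega>)) + E0 \<phi> v \<omega> * (\<eta> \<omega> * (B a v \<omega> - B a w \<omega>)))"
        by (rule Bochner_Integration.integral_cong) (auto simp: algebra_simps)
      also have "\<dots> = expectation (\<lambda>\<omega>. E0 \<phi> v \<omega> * (\<eta> \<omega> * (B a w \<omega> - B a u \<omega>)))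
          + expectation (\<lambda>\<omega>. E0 \<phi> v \<omega> * (\<eta> \<omega> * (B a v \<omega> - B a w \<omega>)))"
        using uv by (intro Bochner_Integration.integral_add E0_mult_integrable i1) auto
      \<comment> \<open>The increment up to \<open>w\<close> is known at time \<open>w\<close>, so
        the martingale property replaces \<open>v\<close> by \<open>w\<close>.\<close>
      also have "expectation (\<lambda>\<omega>. E0 \<phi> v \<omega> * (\<eta> \<omega> * (B a w \<omega> - B a u \<omega>)))
          = expectation (\<lambda>\<omega>. E0 \<phi> w \<omega> * (\<eta> \<omega> * (B a w \<omega> - B a u \<omega>)))"
        using uv by (intro E0_martingale m i1) auto
      finally have e: "- expectation (\<lambda>\<omega>. E0 \<phi> v \<omega> * (\<eta> \<omega> * (B a v \<omega> - B a u \<omega>)))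
        = - expectation (\<lambda>\<omega>. E0 \<phi> w \<omega> * (\<eta> \<omega> * (B a w \<omega> - B a u \<omega>)))
          + - expectation (\<lambda>\<omega>. E0 \<phi> v \<omega> * (\<eta> \<omega> * (B a v \<omega> - B a w \<omega>)))" by simp
      show "((\<lambda>r. theta a r * expectation (\<lambda>\<omega>. E0 ?\<psi> r \<omega> * \<eta> \<omega>)) has_integral
          - expectation (\<lambda>\<omega>. E0 \<phi> v \<omega> * (\<eta> \<omega> * (B a v \<omega> - B a u \<omega>)))) {u..v}"
        unfolding e using 1 2 \<eta> \<eta>w uv by (intro has_integral_combine[of u w v]) auto
    qed
  qed
  then show ?thesis using \<eta> by blast
qed

text \<open>Where \<open>theta\<close> is constant, \<open>q\<close> is affine with slope
  |\<theta>|^2. As \<open>exp (q t)\<close> is the sum of the squares of real and imaginary part,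
  this governs both the mean-square increments of the exponential and the norm of its stochastic
  integrand.\<close>

lemma exp_q_has_integral:
  assumes uv: "0 \<le> u" "u \<le> v" "v \<le> T"
  shows "((\<lambda>r. (\<Sum>a=1..d. (theta a r)\<^sup>2) * exp (q r)) has_integral (exp (q v) - exp (q u))) {u..v}"
  using uv
proof (rule elementary_induct)
  fix u v :: real assume uv: "0 \<le> u" "u \<le> v" "v \<le> T" "elem u v"
  show "((\<lambda>r. (\<Sum>a=1..d. (theta a r)\<^sup>2) * exp (q r)) has_integral (exp (q v) - exp (q u))) {u..v}"
  proof (cases "u = v")
    case False
    with uv have less: "u < v" by simp
    define L where "L = (\<Sum>a=1..d. (theta a v)\<^sup>2)"
    have th: "(\<Sum>a=1..d. (theta a r)\<^sup>2) = L" if "u < r" "r \<le> v" for r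
      unfolding L_def using theta_elem[OF uv(4) that] by simp
    have qr: "q r = q u + L * (r - u)" if "u < r" "r \<le> v" for r
      using q_elem[OF elem_subinterval[OF uv(4)], of r] that th[OF that] by simp
    have "((\<lambda>r. L * exp (q u + L * (r - u))) has_integral (exp (q u + L * (v - u)) - exp (q u + L * (u - u)))) {u..v}"
      by (rule fundamental_theorem_of_calculus[OF uv(2)])
        (auto intro!: derivative_eq_intros simp: has_real_derivative_iff_has_vector_derivative[symmetric])
    then have "((\<lambda>r. L * exp (q u + L * (r - u))) has_integral (exp (q v) - exp (q u))) {u..v}"
      using qr[OF less] by simp
    then show ?thesis
    proof (rule has_integral_spike_finite[of "{u}", rotated 2])
      fix r assume "r \<in> {u..v} - {u}"
      then have r: "u < r" "r \<le> v" by auto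
      show "(\<Sum>a=1..d. (theta a r)\<^sup>2) * exp (q r) = L * exp (q u + L * (r - u))"
        unfolding th[OF r] qr[OF r] ..
    qed simp
  qed (auto intro: has_integral_negligible[of "{v}"])
next
  fix u w v :: real assume "0 \<le> u" "u \<le> w" "w \<le> v" "v \<le> T"
    and 1: "((\<lambda>r. (\<Sum>a=1..d. (theta a r)\<^sup>2) * exp (q r)) has_integral (exp (q w) - exp (q u))) {u..w}"
    and 2: "((\<lambda>r. (\<Sum>a=1..d. (theta a r)\<^sup>2) * exp (q r)) has_integral (exp (q v) - exp (q w))) {w..v}"
  then show "((\<lambda>r. (\<Sum>a=1..d. (theta a r)\<^sup>2) * exp (q r)) has_integral (exp (q v) - exp (q u))) {u..v}"
    using has_integral_combine[OF _ _ 1 2] by simp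
qed

section \<open>A version with continuous paths\<close>

definition good :: "'a set" where
  "good = (SOME G. G \<in> events \<and> (AE \<omega> in M. \<omega> \<in> G) \<and> (\<forall>\<omega>\<in>G. \<forall>i\<in>{1..d}. continuous_on {0..T} (\<lambda>t. B i t \<omega>)))"

text \<open>Paths are continuous only off a null set. Cutting down to an event of full measure makes
  the exponential continuous for every \<omega>, as \<open>nice\<close> demands, without losing
  measurability.\<close>

lemma good: "good \<in> events" "AE \<omega> in M. \<omega> \<in> good"
  "\<omega> \<in> good \<Longrightarrow> i \<in> {1..d} \<Longrightarrow> continuous_on {0..T} (\<lambda>t. B i t \<omega>)"
proof -
  have "AE \<omega> in M. \<forall>i\<in>{1..d}. continuous_on {0..T} (\<lambda>t. B i t \<omega>)"
    using AE_B_continuous by (intro AE_finite_allI) auto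
  then obtain N where N: "{\<omega> \<in> space M. \<not> (\<forall>i\<in>{1..d}. continuous_on {0..T} (\<lambda>t. B i t \<omega>))} \<subseteq> N"
    "emeasure M N = 0" "N \<in> events" by (rule AE_E)
  have "AE \<omega> in M. \<omega> \<notin> N" using N(2,3) by (intro AE_not_in) auto
  then have "AE \<omega> in M. \<omega> \<in> space M - N" using AE_space by eventually_elim auto
  then have "\<exists>G. G \<in> events \<and> (AE \<omega> in M. \<omega> \<in> G) \<and> (\<forall>\<omega>\<in>G. \<forall>i\<in>{1..d}. continuous_on {0..T} (\<lambda>t. B i t \<omega>))"
    using N by (intro exI[of _ "space M - N"]) auto
  from someI_ex[OF this] show "good \<in> events" "AE \<omega> in M. \<omega> \<in> good"
    "\<omega> \<in> good \<Longrightarrow> i \<in> {1..d} \<Longrightarrow> continuous_on {0..T} (\<lambda>t. B i t \<omega>)" unfolding good_def by blast+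
qed

definition Ec :: "real \<Rightarrow> real \<Rightarrow> 'a \<Rightarrow> real" where
  "Ec \<phi> t \<omega> = indicator good \<omega> * E0 \<phi> t \<omega>"

lemma AE_Ec: "AE \<omega> in M. \<forall>\<phi> t. Ec \<phi> t \<omega> = E0 \<phi> t \<omega>"
  using good(2) by eventually_elim (simp add: Ec_def)

lemma AE_Ec_eq: "AE \<omega> in M. Ec \<phi> t \<omega> = E0 \<phi> t \<omega>" "AE \<omega> in M. E0 \<phi> t \<omega> = Ec \<phi> t \<omega>"
  using AE_Ec by (eventually_elim, simp)+

lemma sqi_Ec: "0 \<le> t \<Longrightarrow> t \<le> T \<Longrightarrow> square_integrable M (Ec \<phi> t)"
  unfolding Ec_def[abs_def]
  by (rule sqi_mult_bounded[OF sqi_E0 borel_measurable_indicator[OF good(1)], where c = 1]) (auto simp: indicator_def)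

lemma Ec_expectation:
  assumes "0 \<le> t" "t \<le> T" "\<eta> \<in> borel_measurable M"
  shows "expectation (\<lambda>\<omega>. Ec \<phi> t \<omega> * \<eta> \<omega>) = expectation (\<lambda>\<omega>. E0 \<phi> t \<omega> * \<eta> \<omega>)"
proof (rule integral_cong_AE)
  show "AE \<omega> in M. Ec \<phi> t \<omega> * \<eta> \<omega> = E0 \<phi> t \<omega> * \<eta> \<omega>"
    using AE_Ec_eq(1)[of \<phi> t] by eventually_elim simp
qed (intro borel_measurable_times assms(3) E0_measurable[OF assms(1,2)] sqi_measurable[OF sqi_Ec[OF assms(1,2)]])+

lemma Ec_opposite: "Ec (\<phi> - pi / 2 - pi / 2) t \<omega> = - Ec \<phi> t \<omega>"
  unfolding Ec_def E0_opposite by simp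

lemma q_continuous: "continuous_on S q"
proof -
  have "continuous_on S (\<lambda>x. if idx j = idx k then l j * l k * min x (min (tm j) (tm k)) else 0)" for j k
    by (cases "idx j = idx k") (auto intro!: continuous_intros)
  then show ?thesis unfolding q_def by (intro continuous_on_sum)
qed

lemma q_bound: obtains K where "\<And>t. 0 \<le> t \<Longrightarrow> t \<le> T \<Longrightarrow> exp (q t) \<le> K"
proof -
  have "continuous_on {0..T} (\<lambda>t. exp (q t))" by (intro continuous_intros q_continuous)
  then have "compact ((\<lambda>t. exp (q t)) ` {0..T})" by (intro compact_continuous_image) auto
  then have "bounded ((\<lambda>t. exp (q t)) ` {0..T})" by (rule compact_imp_bounded)
  then obtain K where "\<forall>x\<in>(\<lambda>t. exp (q t)) ` {0..T}. norm x \<le> K" unfolding bounded_iff by blast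
  then show ?thesis by (intro that[of K]) auto
qed

lemma theta_bound: "\<bar>theta a r\<bar> \<le> (\<Sum>j<n. \<bar>l j\<bar>)"
  unfolding theta_def by (rule order_trans[OF sum_abs]) (auto intro!: sum_mono simp: indicator_def)

lemma theta_measurable [measurable]: "theta a \<in> borel_measurable borel"
  unfolding theta_def[abs_def] by measurable

lemma nice_Ec: "nice (Ec \<phi>)"
  unfolding nice_def
proof (intro conjI ballI)
  fix \<omega> assume "\<omega> \<in> space M"
  show "continuous_on {0..T} (\<lambda>t. Ec \<phi> t \<omega>)"
  proof (cases "\<omega> \<in> good")
    case True
    have "continuous_on {0..T} (\<lambda>t. B (idx j) (min t (tm j)) \<omega>)" if "j < n" for j
      by (rule continuous_on_compose2[OF good(3)[OF True idx[OF that]]]) (use tm[OF that] in \<open>auto intro!: continuous_intros\<close>)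
    then have X: "continuous_on {0..T} (\<lambda>t. Xt t \<omega>)" unfolding Xt_def by (intro continuous_intros) auto
    have "continuous_on {0..T} (\<lambda>t. 1 * (exp (q t / 2) * cos (Xt t \<omega> + \<phi>)))"
      by (intro continuous_on_mult continuous_on_exp continuous_on_cos continuous_on_add continuous_on_const
          continuous_on_divide q_continuous X) simp
    then show ?thesis using True unfolding Ec_def E0_def by simp
  qed (simp add: Ec_def)
next
  fix t assume t: "t \<in> {0..T}"
  have "E0 \<phi> t \<in> ad t" using t by (intro L2cl.base E0_measurable_F sqi_E0) auto
  then show "Ec \<phi> t \<in> ad t"
    by (rule L2cl_AE_cong[OF _ sqi_measurable[OF sqi_Ec] AE_Ec_eq(2)]) (use t in auto)
next
  obtain K where K: "\<And>t. 0 \<le> t \<Longrightarrow> t \<le> T \<Longrightarrow> exp (q t) \<le> K" using q_bound by blast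
  define L where "L = (\<Sum>a=1..d. (\<Sum>j<n. \<bar>l j\<bar>)\<^sup>2) * K"
  have K0: "0 \<le> K" using K[of 0] T_pos exp_ge_zero[of "q 0"] by linarith
  have L0: "0 \<le> L" unfolding L_def using K0 by (intro mult_nonneg_nonneg sum_nonneg) auto
  have *: "l2d M (Ec \<phi> t) (Ec \<phi> s) \<le> L * (t - s)" if st: "0 \<le> s" "s \<le> t" "t \<le> T" for s t
  proof -
    have sq: "square_integrable M (E0 \<phi> s)" "square_integrable M (E0 \<phi> t)" for \<phi> using st by (auto intro!: sqi_E0)
    \<comment> \<open>By the martingale property the squared distance is the increase of the second
      moment.\<close>
    have d: "l2d M (E0 \<phi> t) (E0 \<phi> s) = expectation (\<lambda>\<omega>. (E0 \<phi> t \<omega>)\<^sup>2) - expectation (\<lambda>\<omega>. (E0 \<phi> s \<omega>)\<^sup>2)" for \<phi>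
      unfolding l2d_expand[OF sq(2,1)]
      using E0_martingale[OF st E0_measurable_F[OF st(1)] sqi_integrable[OF sq(1)], of \<phi>]
      by (simp add: power2_eq_square)
    have p: "expectation (\<lambda>\<omega>. (E0 \<phi> r \<omega>)\<^sup>2) + expectation (\<lambda>\<omega>. (E0 (\<phi> - pi/2) r \<omega>)\<^sup>2) = exp (q r)" if "0 \<le> r" "r \<le> T" for r
    proof -
      have "expectation (\<lambda>\<omega>. (E0 \<phi> r \<omega>)\<^sup>2) + expectation (\<lambda>\<omega>. (E0 (\<phi> - pi/2) r \<omega>)\<^sup>2)
        = expectation (\<lambda>\<omega>. (E0 \<phi> r \<omega>)\<^sup>2 + (E0 (\<phi> - pi/2) r \<omega>)\<^sup>2)"
        by (rule Bochner_Integration.integral_add[symmetric]; intro sqi_integrable_sq sqi_E0 that)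
      then show ?thesis by (simp add: E0_pythagoras prob_space)
    qed
    have "l2d M (Ec \<phi> t) (Ec \<phi> s) = l2d M (E0 \<phi> t) (E0 \<phi> s)"
      using st by (intro l2d_AE_cong sqi_E0 sqi_Ec AE_Ec_eq(1)) auto
    \<comment> \<open>The other phase is added because the two second moments sum up to
      \<open>exp (q r)\<close>, whose increments are controlled by the bound on
      \<open>theta\<close>.\<close>
    also have "\<dots> \<le> l2d M (E0 \<phi> t) (E0 \<phi> s) + l2d M (E0 (\<phi> - pi/2) t) (E0 (\<phi> - pi/2) s)" by simp
    also have "\<dots> = exp (q t) - exp (q s)" unfolding d using p[of t] p[of s] st by simp
    also have "\<dots> \<le> norm (exp (q t) - exp (q s))" by simp
    also have "\<dots> \<le> L * Henstock_Kurzweil_Integration.content {s..t}"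
    proof (rule has_integral_bound_real[OF L0 finite.emptyI exp_q_has_integral[OF st]])
      fix r assume "r \<in> {s..t} - {}"
      then have r: "0 \<le> r" "r \<le> T" using st by auto
      have "(\<Sum>a=1..d. (theta a r)\<^sup>2) \<le> (\<Sum>a=1..d. (\<Sum>j<n. \<bar>l j\<bar>)\<^sup>2)"
        using theta_bound by (intro sum_mono) (metis abs_ge_zero power2_abs power_mono)
      then have "(\<Sum>a=1..d. (theta a r)\<^sup>2) * exp (q r) \<le> L"
        unfolding L_def by (intro mult_mono K[OF r] sum_nonneg) auto
      then show "norm ((\<Sum>a=1..d. (theta a r)\<^sup>2) * exp (q r)) \<le> L" by (simp add: sum_nonneg)
    qed
    finally show ?thesis using st by simp
  qed
  then have "l2d M (Ec \<phi> s) (Ec \<phi> t) \<le> L * \<bar>t - s\<bar>" if "s \<in> {0..T}" "t \<in> {0..T}" for s t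
    using *[of s t] *[of t s] that by (cases "s \<le> t") (auto simp: l2d_commute)
  then show "\<exists>C\<ge>0. \<forall>s\<in>{0..T}. \<forall>t\<in>{0..T}. l2d M (Ec \<phi> s) (Ec \<phi> t) \<le> C * \<bar>t - s\<bar>"
    using L0 by blast
qed

section \<open>The stochastic differential equation in weak form\<close>

definition thE :: "nat \<Rightarrow> real \<Rightarrow> real \<Rightarrow> 'a \<Rightarrow> real" where
  "thE a \<phi> r \<omega> = theta a r * Ec \<phi> r \<omega>"

lemma adm_times_atMost:
  assumes X: "adm X" and r: "r \<le> T"
  shows "adm (\<lambda>s \<omega>. indicator {..r} s * X s \<omega>)"
proof -
  have "(\<lambda>p. indicator ({..r} \<times> UNIV) p * cut T X p) \<in> L2cl P simple_values"
  proof (rule L2cl_image[OF X[unfolded adm_def], where C = 1 and \<Phi> = "\<lambda>f p. indicator ({..r} \<times> UNIV) p * f p"])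
    fix f assume "f \<in> simple_values" "square_integrable P f"
    then obtain H where H: "simple_process M F T H" "f = sv H" by (auto simp: simple_values_def)
    have "simple_process M F T (trunc r H)"
      by (rule simple_process_mono[OF simple_process_trunc[OF H(1) r] r])
    then show "(\<lambda>p. indicator ({..r} \<times> UNIV) p * f p) \<in> L2cl P simple_values"
      unfolding H(2) sv_trunc_eq[symmetric] by (intro L2cl.base sqi_sv) (auto simp: simple_values_def)
  next
    fix f g assume fg: "f \<in> L2cl P simple_values" "g \<in> L2cl P simple_values"
    have "l2d P (\<lambda>p. indicator ({..r} \<times> UNIV) p * f p) (\<lambda>p. indicator ({..r} \<times> UNIV) p * g p) \<le> 1\<^sup>2 * l2d P f g"
      by (rule l2d_mult_bounded[OF L2cl_sqi[OF fg(1)] L2cl_sqi[OF fg(2)] atMost_Times_measurable]) (simp add: indicator_def)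
    then show "l2d P (\<lambda>p. indicator ({..r} \<times> UNIV) p * f p) (\<lambda>p. indicator ({..r} \<times> UNIV) p * g p) \<le> 1 * l2d P f g" by simp
  next
    fix f assume "f \<in> L2cl P simple_values"
    then show "square_integrable P (\<lambda>p. indicator ({..r} \<times> UNIV) p * f p)"
      by (intro sqi_mult_bounded[OF L2cl_sqi atMost_Times_measurable, where c = 1]) (auto simp: indicator_def)
  qed (simp_all add: l2d_def distrib_left mult.left_commute)
  moreover have "(\<lambda>p. indicator ({..r} \<times> UNIV) p * cut T X p) = cut T (\<lambda>s \<omega>. indicator {..r} s * X s \<omega>)"
    by (auto simp: cut_def fun_eq_iff indicator_def)
  ultimately show ?thesis by (simp add: adm_def)
qed

lemma adm_sum: "(\<And>i. i \<in> I \<Longrightarrow> adm (f i)) \<Longrightarrow> adm (\<lambda>s \<omega>. \<Sum>i\<in>I. f i s \<omega>)"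
  by (induction I rule: infinite_finite_induct) (auto intro: adm_zero adm_add)

lemma adm_theta:
  assumes X: "adm X"
  shows "adm (\<lambda>s \<omega>. theta a s * X s \<omega>)"
  unfolding theta_def sum_distrib_right mult.assoc
  by (intro adm_sum adm_scale adm_times_atMost X) (auto simp: tm)

lemma KP_theta:
  assumes X: "KP X"
  shows "KP (\<lambda>s \<omega>. theta a s * X s \<omega>)"
  unfolding theta_def sum_distrib_right mult.assoc
  by (intro KP_sum KP.scale KP_times_atMost X)

lemma adm_thE: "adm (thE a \<phi>)"
  unfolding thE_def[abs_def] by (intro adm_theta nice_adm nice_Ec)

text \<open>\<open>E0_incr_has_integral\<close> summed over the terms; the martingale property moves
  the exponential from the end of each term to \<open>t\<close>.\<close>

lemma Ec_simple_integral:
  assumes H: "simple_process M F t H" and t: "0 \<le> t" "t \<le> T" and a: "a \<in> {1..d}"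
  shows "expectation (\<lambda>\<omega>. simple_integral (B a) H \<omega> * Ec \<phi> t \<omega>)
    = - (\<integral>p. sv H p * cut t (thE a (\<phi> - pi / 2)) p \<partial>P)"
  using H
proof (induction H)
  case Nil
  then show ?case by (simp add: simple_integral_def sv_def simple_value_def case_prod_unfold)
next
  case (Cons p H)
  let ?\<psi> = "\<phi> - pi / 2"
  obtain u v \<xi> where p: "p = (u, v, \<xi>)" by (cases p) auto
  have uv: "0 \<le> u" "u \<le> v" "v \<le> t" "v \<le> T" and \<xi>: "\<xi> \<in> borel_measurable (F u)" "square_integrable M \<xi>"
    using Cons.prems t by (auto simp: p simple_process_def)
  have H: "simple_process M F t H" using Cons.prems by (auto simp: simple_process_def)
  have p1: "simple_process M F t [(u, v, \<xi>)]" using uv \<xi> by (simp add: simple_process_def)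
  note sc = sqi_cut[OF adm_sqi[OF adm_thE] t(2), of a ?\<psi>]
  have sB: "square_integrable M (\<lambda>\<omega>. \<xi> \<omega> * (B a v \<omega> - B a u \<omega>))"
    by (rule sqi_mult_incr[OF uv(1,2,4) a \<xi>])
  have [measurable]: "B a v \<in> borel_measurable (F v)" "B a u \<in> borel_measurable (F v)" "\<xi> \<in> borel_measurable (F v)"
    using uv a measurable_F_mono[OF \<xi>(1)] by (auto intro!: B_measurable_F)
  have m: "(\<lambda>\<omega>. \<xi> \<omega> * (B a v \<omega> - B a u \<omega>)) \<in> borel_measurable (F v)" by measurable
  have iP: "integrable P (\<lambda>p. sv [(u, v, \<xi>)] p * cut t (thE a ?\<psi>) p)" by (rule sqi_mult[OF sqi_sv[OF p1] sc])
  have eq: "(\<integral>\<omega>. sv [(u, v, \<xi>)] (r, \<omega>) * cut t (thE a ?\<psi>) (r, \<omega>) \<partial>M)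
      = indicator {u<..v} r *\<^sub>R (theta a r * expectation (\<lambda>\<omega>. E0 ?\<psi> r \<omega> * \<xi> \<omega>))" for r
  proof (cases "r \<in> {u<..v}")
    case True
    then have r: "0 \<le> r" "r \<le> T" "r \<le> t" using uv by auto
    have "(\<lambda>\<omega>. sv [(u, v, \<xi>)] (r, \<omega>) * cut t (thE a ?\<psi>) (r, \<omega>)) = (\<lambda>\<omega>. theta a r * (Ec ?\<psi> r \<omega> * \<xi> \<omega>))"
      using True r by (auto simp: sv_def simple_value_def cut_def thE_def fun_eq_iff)
    then show ?thesis
      using True Ec_expectation[OF r(1,2) sqi_measurable[OF \<xi>(2)], of ?\<psi>] by simp
  qed (simp add: sv_def simple_value_def)
  have "(\<integral>p. sv [(u, v, \<xi>)] p * cut t (thE a ?\<psi>) p \<partial>P)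
      = (\<integral>r. indicator {u<..v} r *\<^sub>R (theta a r * expectation (\<lambda>\<omega>. E0 ?\<psi> r \<omega> * \<xi> \<omega>)) \<partial>lborel)"
    unfolding P.integral_fst'[OF iP, symmetric] eq ..
  also have "\<dots> = integral {u<..v} (\<lambda>r. theta a r * expectation (\<lambda>\<omega>. E0 ?\<psi> r \<omega> * \<xi> \<omega>))"
  proof -
    have "set_integrable lborel {u<..v} (\<lambda>r. theta a r * expectation (\<lambda>\<omega>. E0 ?\<psi> r \<omega> * \<xi> \<omega>))"
      using P.integrable_fst'[OF iP] unfolding set_integrable_def eq .
    from set_borel_integral_eq_integral(2)[OF this] show ?thesis by (simp add: set_lebesgue_integral_def)
  qed
  also have "\<dots> = integral {u..v} (\<lambda>r. theta a r * expectation (\<lambda>\<omega>. E0 ?\<psi> r \<omega> * \<xi> \<omega>))"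
    by (rule integral_subset_negligible) (auto intro: negligible_subset[of "{u}"])
  also have "\<dots> = - expectation (\<lambda>\<omega>. E0 \<phi> v \<omega> * (\<xi> \<omega> * (B a v \<omega> - B a u \<omega>)))"
    by (rule integral_unique[OF E0_incr_has_integral[OF uv(1,2,4) \<xi> a]])
  also have "\<dots> = - expectation (\<lambda>\<omega>. E0 \<phi> t \<omega> * (\<xi> \<omega> * (B a v \<omega> - B a u \<omega>)))"
    using uv t E0_martingale[OF _ uv(3) t(2) m sqi_integrable[OF sB], of \<phi>] by simp
  also have "\<dots> = - expectation (\<lambda>\<omega>. \<xi> \<omega> * (B a v \<omega> - B a u \<omega>) * Ec \<phi> t \<omega>)"
    using Ec_expectation[OF t sqi_measurable[OF sB], of \<phi>] by (simp add: mult.commute)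
  finally have trm: "expectation (\<lambda>\<omega>. \<xi> \<omega> * (B a v \<omega> - B a u \<omega>) * Ec \<phi> t \<omega>)
      = - (\<integral>p. sv [(u, v, \<xi>)] p * cut t (thE a ?\<psi>) p \<partial>P)" by simp
  have i1: "integrable M (\<lambda>\<omega>. \<xi> \<omega> * (B a v \<omega> - B a u \<omega>) * Ec \<phi> t \<omega>)"
    "integrable M (\<lambda>\<omega>. simple_integral (B a) H \<omega> * Ec \<phi> t \<omega>)"
    by (rule sqi_mult[OF sB sqi_Ec[OF t]], rule sqi_mult[OF sqi_simple_integral[OF H t(2) a] sqi_Ec[OF t]])
  have "simple_integral (B a) (p # H) \<omega> * Ec \<phi> t \<omega>
      = \<xi> \<omega> * (B a v \<omega> - B a u \<omega>) * Ec \<phi> t \<omega> + simple_integral (B a) H \<omega> * Ec \<phi> t \<omega>" for \<omega>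
    by (simp add: simple_integral_def p algebra_simps)
  moreover have "sv (p # H) z = sv [(u, v, \<xi>)] z + sv H z" for z
    using sv_append[of "[(u, v, \<xi>)]" H] by (simp add: p)
  ultimately show ?case
    using trm i1 iP sqi_mult[OF sqi_sv[OF H] sc] Cons.IH[OF H] by (simp add: distrib_right)
qed

text \<open>The limit from simple integrands gives the covariance of the exponential with any
  stochastic integral. Together with the first two moments it determines the norm of the
  residual.\<close>

lemma Ec_J:
  assumes Y: "adm Y" and t: "0 \<le> t" "t \<le> T" and a: "a \<in> {1..d}"
  shows "expectation (\<lambda>\<omega>. J a Y t \<omega> * Ec \<phi> t \<omega>) = - (\<integral>p. cut t Y p * cut t (thE a (\<phi> - pi / 2)) p \<partial>P)"
proof -
  obtain H where H: "\<And>n. simple_process M F t (H n)" "(\<lambda>n. l2d P (sv (H n)) (cut t Y)) \<longlonglongrightarrow> 0"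
    "(\<lambda>n. l2d M (simple_integral (B a) (H n)) (J a Y t)) \<longlonglongrightarrow> 0" using J_limit[OF Y a t] by blast
  have "(\<lambda>n. expectation (\<lambda>\<omega>. simple_integral (B a) (H n) \<omega> * Ec \<phi> t \<omega>)) \<longlonglongrightarrow> expectation (\<lambda>\<omega>. J a Y t \<omega> * Ec \<phi> t \<omega>)"
    by (rule inner_tendsto_left[OF sqi_simple_integral[OF H(1) t(2) a] sqi_J[OF Y a t] sqi_Ec[OF t] H(3)])
  moreover have "(\<lambda>n. - (\<integral>p. sv (H n) p * cut t (thE a (\<phi> - pi / 2)) p \<partial>P)) \<longlonglongrightarrow> - (\<integral>p. cut t Y p * cut t (thE a (\<phi> - pi / 2)) p \<partial>P)"
    by (rule tendsto_minus, rule inner_tendsto_left[OF sqi_sv[OF H(1)] sqi_cut[OF adm_sqi[OF Y] t(2)]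
          sqi_cut[OF adm_sqi[OF adm_thE] t(2)] H(2)])
  ultimately show ?thesis
    unfolding Ec_simple_integral[OF H(1) t a] by (rule LIMSEQ_unique)
qed

definition Jsum :: "(nat \<Rightarrow> real \<Rightarrow> 'a \<Rightarrow> real) \<Rightarrow> real \<Rightarrow> 'a \<Rightarrow> real" where
  "Jsum Y t \<omega> = (\<Sum>a=1..d. J a (Y a) t \<omega>)"

lemma Ec_expectation_1:
  assumes t: "0 \<le> t" "t \<le> T"
  shows "expectation (Ec \<phi> t) = cos \<phi>"
proof -
  have "expectation (Ec \<phi> t) = expectation (\<lambda>\<omega>. Ec \<phi> t \<omega> * 1)" by simp
  also have "\<dots> = expectation (\<lambda>\<omega>. E0 \<phi> t \<omega> * 1)" by (rule Ec_expectation[OF t]) simp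
  also have "\<dots> = expectation (\<lambda>\<omega>. E0 \<phi> 0 \<omega> * 1)" using t by (intro E0_martingale) auto
  also have "\<dots> = expectation (\<lambda>\<omega>. cos \<phi>)"
  proof (rule integral_cong_AE)
    have "AE \<omega> in M. \<forall>i\<in>{1..d}. B i 0 \<omega> = 0" using AE_B_0 by (intro AE_finite_allI) auto
    then show "AE \<omega> in M. E0 \<phi> 0 \<omega> * 1 = cos \<phi>"
    proof eventually_elim
      case (elim \<omega>)
      have "Xt 0 \<omega> = 0" unfolding Xt_def using elim idx tm by (intro sum.neutral) (auto simp: min_absorb1)
      moreover have "q 0 = 0" unfolding q_def using tm by (intro sum.neutral ballI) (auto simp: min_absorb1)
      ultimately show ?case by (simp add: E0_def)
    qed
  qed (use E0_measurable[of 0 \<phi>] T_pos in auto)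
  finally show ?thesis by (simp add: prob_space)
qed

text \<open>Let S be the sum of the squared norms of the integrands. The isometry gives S for the
  square of the stochastic part, and the weak equation - S for its covariance with
  \<open>Ec\<close>, so S - 2 S = - S remains. The constant likewise leaves (cos \<phi>)^2 - 2 (cos
  \<phi>)^2.\<close>

lemma Ec_residual:
  fixes \<phi> :: real
  assumes t: "0 \<le> t" "t \<le> T"
  defines "Y \<equiv> \<lambda>a. thE a (\<phi> - pi / 2)"
  shows "l2d M (\<lambda>\<omega>. Ec \<phi> t \<omega> + Jsum Y t \<omega>) (\<lambda>\<omega>. cos \<phi>)
    = expectation (\<lambda>\<omega>. (Ec \<phi> t \<omega>)\<^sup>2) - (cos \<phi>)\<^sup>2 - (\<Sum>a=1..d. \<integral>p. (cut t (Y a) p)\<^sup>2 \<partial>P)"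
proof -
  have aY: "adm (Y a)" for a unfolding Y_def by (rule adm_thE)
  let ?S = "\<Sum>a=1..d. \<integral>p. (cut t (Y a) p)\<^sup>2 \<partial>P"
  have sJ: "square_integrable M (J a (Y a) t)" if "a \<in> {1..d}" for a by (rule sqi_J[OF aY that t])
  have sS: "square_integrable M (Jsum Y t)" unfolding Jsum_def[abs_def] by (intro sqi_sum sJ)
  have JJ: "expectation (\<lambda>\<omega>. Jsum Y t \<omega> * Jsum Y t \<omega>) = ?S"
  proof -
    have "expectation (\<lambda>\<omega>. Jsum Y t \<omega> * Jsum Y t \<omega>)
      = expectation (\<lambda>\<omega>. \<Sum>a=1..d. \<Sum>b=1..d. J a (Y a) t \<omega> * J b (Y b) t \<omega>)"
      unfolding Jsum_def sum_product ..
    also have "\<dots> = (\<Sum>a=1..d. \<Sum>b=1..d. expectation (\<lambda>\<omega>. J a (Y a) t \<omega> * J b (Y b) t \<omega>))"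
      by (subst Bochner_Integration.integral_sum Bochner_Integration.integrable_sum; intro sum.cong refl
          Bochner_Integration.integral_sum Bochner_Integration.integrable_sum sqi_mult sJ; assumption)
    also have "\<dots> = (\<Sum>a=1..d. \<Sum>b=1..d. if a = b then \<integral>p. cut t (Y a) p * cut t (Y b) p \<partial>P else 0)"
      by (intro sum.cong refl J_inner[OF aY aY _ _ t t])
    also have "\<dots> = ?S" by (simp add: power2_eq_square)
    finally show ?thesis .
  qed
  have EJ: "expectation (\<lambda>\<omega>. Ec \<phi> t \<omega> * Jsum Y t \<omega>) = - ?S"
  proof -
    have "expectation (\<lambda>\<omega>. Ec \<phi> t \<omega> * Jsum Y t \<omega>) = expectation (\<lambda>\<omega>. \<Sum>a=1..d. J a (Y a) t \<omega> * Ec \<phi> t \<omega>)"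
      unfolding Jsum_def by (simp add: sum_distrib_left mult.commute)
    also have "\<dots> = (\<Sum>a=1..d. expectation (\<lambda>\<omega>. J a (Y a) t \<omega> * Ec \<phi> t \<omega>))"
      by (intro Bochner_Integration.integral_sum sqi_mult sJ sqi_Ec t)
    also have "\<dots> = (\<Sum>a=1..d. - (\<integral>p. cut t (Y a) p * cut t (thE a (\<phi> - pi / 2)) p \<partial>P))"
      by (intro sum.cong refl Ec_J[OF aY t])
    finally show ?thesis by (simp add: Y_def power2_eq_square sum_negf)
  qed
  have J1: "expectation (\<lambda>\<omega>. Jsum Y t \<omega> * cos \<phi>) = 0"
  proof -
    have "expectation (Jsum Y t) = (\<Sum>a=1..d. expectation (J a (Y a) t))"
      unfolding Jsum_def[abs_def] by (intro Bochner_Integration.integral_sum sqi_integrable sJ)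
    also have "\<dots> = 0" by (intro sum.neutral ballI J_expectation[OF aY _ t])
    finally show ?thesis by simp
  qed
  have E1: "expectation (\<lambda>\<omega>. Ec \<phi> t \<omega> * cos \<phi>) = cos \<phi> * cos \<phi>"
    using Ec_expectation_1[OF t] by simp
  show ?thesis
    unfolding l2d_add_expand[OF sqi_Ec[OF t] sS sqi_const] JJ EJ J1 E1
    by (simp add: power2_eq_square prob_space)
qed

text \<open>The equation \<open>dZ = i \<theta> Z dB\<close> for the complex exponential, in real form: by the isometry the
  residuals of its real and imaginary parts have squared norms that add up to \<open>0\<close>.\<close>

lemma Ec_equation:
  assumes t: "0 \<le> t" "t \<le> T"
  shows "l2d M (\<lambda>\<omega>. Ec \<phi> t \<omega> + Jsum (\<lambda>a. thE a (\<phi> - pi / 2)) t \<omega>) (\<lambda>\<omega>. cos \<phi>) = 0"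
proof -
  let ?\<psi> = "\<phi> - pi / 2"
  let ?S = "\<lambda>\<phi>. \<Sum>a=1..d. \<integral>p. (cut t (thE a \<phi>) p)\<^sup>2 \<partial>P"
  have i: "integrable P (\<lambda>p. (cut t (thE a \<phi>) p)\<^sup>2)" for a \<phi>
    by (rule sqi_integrable_sq[OF sqi_cut[OF adm_sqi[OF adm_thE] t(2)]])
  \<comment> \<open>Two shifts only change the sign, so the residual of the imaginary part involves
    the integrands of the real part again.\<close>
  have opp: "thE a (?\<psi> - pi / 2) = (\<lambda>r \<omega>. - thE a \<phi> r \<omega>)" for a
    unfolding thE_def[abs_def] Ec_opposite by simp
  have cos2: "(cos \<phi>)\<^sup>2 + (cos ?\<psi>)\<^sup>2 = 1" by (simp add: cos_diff)
  have iG: "integrable P (\<lambda>p. \<Sum>a=1..d. (cut t (thE a \<phi>) p)\<^sup>2 + (cut t (thE a ?\<psi>) p)\<^sup>2)"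
    by (intro Bochner_Integration.integrable_sum Bochner_Integration.integrable_add i)
  \<comment> \<open>Summing over both phases removes the randomness, by
    \<open>E0_pythagoras\<close>.\<close>
  have eq: "(\<integral>\<omega>. (\<Sum>a=1..d. (cut t (thE a \<phi>) (r, \<omega>))\<^sup>2 + (cut t (thE a ?\<psi>) (r, \<omega>))\<^sup>2) \<partial>M)
      = indicator {0..t} r *\<^sub>R ((\<Sum>a=1..d. (theta a r)\<^sup>2) * exp (q r))" for r
  proof (cases "r \<in> {0..t}")
    case True
    then have r: "0 \<le> r" "r \<le> T" using t by auto
    have "(\<integral>\<omega>. (\<Sum>a=1..d. (cut t (thE a \<phi>) (r, \<omega>))\<^sup>2 + (cut t (thE a ?\<psi>) (r, \<omega>))\<^sup>2) \<partial>M)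
        = (\<integral>\<omega>. (\<Sum>a=1..d. (theta a r)\<^sup>2) * exp (q r) \<partial>M)"
    proof (rule integral_cong_AE)
      have [measurable]: "Ec \<phi> r \<in> borel_measurable M" for \<phi> by (rule sqi_measurable[OF sqi_Ec[OF r]])
      show "(\<lambda>\<omega>. \<Sum>a=1..d. (cut t (thE a \<phi>) (r, \<omega>))\<^sup>2 + (cut t (thE a ?\<psi>) (r, \<omega>))\<^sup>2) \<in> borel_measurable M"
        unfolding cut_def thE_def prod.case by measurable
      show "AE \<omega> in M. (\<Sum>a=1..d. (cut t (thE a \<phi>) (r, \<omega>))\<^sup>2 + (cut t (thE a ?\<psi>) (r, \<omega>))\<^sup>2)
          = (\<Sum>a=1..d. (theta a r)\<^sup>2) * exp (q r)"
        using AE_Ec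
      proof eventually_elim
        case (elim \<omega>)
        show ?case
          unfolding sum_distrib_right
        proof (rule sum.cong[OF refl])
          fix a
          have "(cut t (thE a \<phi>) (r, \<omega>))\<^sup>2 + (cut t (thE a ?\<psi>) (r, \<omega>))\<^sup>2
              = (theta a r)\<^sup>2 * ((E0 \<phi> r \<omega>)\<^sup>2 + (E0 ?\<psi> r \<omega>)\<^sup>2)"
            using True elim by (simp add: cut_def thE_def power_mult_distrib distrib_left)
          then show "(cut t (thE a \<phi>) (r, \<omega>))\<^sup>2 + (cut t (thE a ?\<psi>) (r, \<omega>))\<^sup>2 = (theta a r)\<^sup>2 * exp (q r)"
            unfolding E0_pythagoras .
        qed
      qed
    qed simp
    then show ?thesis using True by (simp add: prob_space)
  qed (simp add: cut_def)
  have "?S \<phi> + ?S ?\<psi> = (\<integral>p. (\<Sum>a=1..d. (cut t (thE a \<phi>) p)\<^sup>2 + (cut t (thE a ?\<psi>) p)\<^sup>2) \<partial>P)"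
    using i by (subst Bochner_Integration.integral_sum) (simp_all add: sum.distrib)
  also have "\<dots> = (\<integral>r. indicator {0..t} r *\<^sub>R ((\<Sum>a=1..d. (theta a r)\<^sup>2) * exp (q r)) \<partial>lborel)"
    unfolding P.integral_fst'[OF iG, symmetric] eq ..
  also have "\<dots> = integral {0..t} (\<lambda>r. (\<Sum>a=1..d. (theta a r)\<^sup>2) * exp (q r))"
  proof -
    have "set_integrable lborel {0..t} (\<lambda>r. (\<Sum>a=1..d. (theta a r)\<^sup>2) * exp (q r))"
      using P.integrable_fst'[OF iG] unfolding set_integrable_def eq .
    from set_borel_integral_eq_integral(2)[OF this] show ?thesis by (simp add: set_lebesgue_integral_def)
  qed
  also have "\<dots> = exp (q t) - exp (q 0)"
    using t by (intro integral_unique exp_q_has_integral) auto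
  also have "q 0 = 0" unfolding q_def using tm by (intro sum.neutral ballI) (auto simp: min_absorb1)
  finally have S: "?S \<phi> + ?S ?\<psi> = exp (q t) - 1" by simp
  have E: "expectation (\<lambda>\<omega>. (Ec \<phi> t \<omega>)\<^sup>2) + expectation (\<lambda>\<omega>. (Ec ?\<psi> t \<omega>)\<^sup>2) = exp (q t)"
  proof -
    note [measurable] = sqi_measurable[OF sqi_Ec[OF t]]
    have "expectation (\<lambda>\<omega>. (Ec \<phi> t \<omega>)\<^sup>2) + expectation (\<lambda>\<omega>. (Ec ?\<psi> t \<omega>)\<^sup>2)
        = expectation (\<lambda>\<omega>. (Ec \<phi> t \<omega>)\<^sup>2 + (Ec ?\<psi> t \<omega>)\<^sup>2)"
      by (rule Bochner_Integration.integral_add[symmetric]; rule sqi_integrable_sq[OF sqi_Ec[OF t]])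
    also have "\<dots> = expectation (\<lambda>\<omega>. exp (q t))"
    proof (rule integral_cong_AE)
      show "AE \<omega> in M. (Ec \<phi> t \<omega>)\<^sup>2 + (Ec ?\<psi> t \<omega>)\<^sup>2 = exp (q t)"
        using AE_Ec by eventually_elim (simp only: E0_pythagoras)
    qed measurable
    finally show ?thesis by (simp add: prob_space)
  qed
  let ?R = "\<lambda>\<phi>. l2d M (\<lambda>\<omega>. Ec \<phi> t \<omega> + Jsum (\<lambda>a. thE a (\<phi> - pi / 2)) t \<omega>) (\<lambda>\<omega>. cos \<phi>)"
  have o: "(\<Sum>a=1..d. \<integral>p. (cut t (thE a (?\<psi> - pi / 2)) p)\<^sup>2 \<partial>P) = ?S \<phi>"
    unfolding opp by (simp add: cut_def case_prod_unfold)
  \<comment> \<open>Both phases together give \<open>exp (q t)\<close> from the second moments,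
    minus 1 from the cosines, minus \<open>exp (q t) - 1\<close> from the integrands.\<close>
  have "?R \<phi> + ?R ?\<psi> = 0"
    using Ec_residual[OF t, of \<phi>] Ec_residual[OF t, of ?\<psi>] o S E cos2 by linarith
  then show ?thesis using l2d_nonneg[of M "\<lambda>\<omega>. Ec \<phi> t \<omega> + Jsum (\<lambda>a. thE a (\<phi> - pi / 2)) t \<omega>" "\<lambda>\<omega>. cos \<phi>"]
      l2d_nonneg[of M "\<lambda>\<omega>. Ec ?\<psi> t \<omega> + Jsum (\<lambda>a. thE a (?\<psi> - pi / 2)) t \<omega>" "\<lambda>\<omega>. cos ?\<psi>"] by linarith
qed

section \<open>Picard iteration\<close>

definition thB :: real where "thB = (\<Sum>j<n. \<bar>l j\<bar>)"

lemma theta_l2d: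
  assumes X: "square_integrable P (cut T X)" and Y: "square_integrable P (cut T Y)" and s: "s \<le> T"
  shows "l2d P (cut s (\<lambda>r \<omega>. theta a r * X r \<omega>)) (cut s (\<lambda>r \<omega>. theta a r * Y r \<omega>)) \<le> thB\<^sup>2 * l2d P (cut s X) (cut s Y)"
proof -
  have eq: "cut s (\<lambda>r \<omega>. theta a r * Z r \<omega>) = (\<lambda>p. theta a (fst p) * cut s Z p)" for Z
    by (auto simp: cut_def fun_eq_iff)
  show ?thesis
    unfolding eq by (rule l2d_mult_bounded[OF sqi_cut[OF X s] sqi_cut[OF Y s]]) (simp_all add: thB_def theta_bound)
qed

text \<open>The equation for phase \<phi> involves the exponential of phase \<phi> - pi/2;
  \<open>Y\<close> approximates the latter and the result the former.\<close>

definition Picard :: "real \<Rightarrow> (real \<Rightarrow> 'a \<Rightarrow> real) \<Rightarrow> real \<Rightarrow> 'a \<Rightarrow> real" where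
  "Picard \<phi> Y s \<omega> = cos \<phi> - Jsum (\<lambda>a r \<omega>. theta a r * Y r \<omega>) s \<omega>"

lemma KP_const: "KP (\<lambda>s \<omega>. c)"
  using KP.scale[OF KP.base[of "[]"], of c] by simp

lemma Picard_step:
  assumes Y: "KP Y"
  shows "KP (Picard \<phi> Y)" "0 \<le> s \<Longrightarrow> s \<le> T \<Longrightarrow> square_integrable M (Picard \<phi> Y s)"
    "0 \<le> s \<Longrightarrow> s \<le> T \<Longrightarrow> l2d M (Ec \<phi> s) (Picard \<phi> Y s) \<le> (real d * real d * thB\<^sup>2) * l2d P (cut s (Ec (\<phi> - pi / 2))) (cut s Y)"
proof -
  let ?\<psi> = "\<phi> - pi / 2"
  let ?Y = "\<lambda>a r \<omega>. theta a r * Y r \<omega>"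
  have KY: "KP (?Y a)" for a by (rule KP_theta[OF Y])
  note aY = KP_adm[OF KY]
  show "KP (Picard \<phi> Y)"
    unfolding Picard_def[abs_def] Jsum_def by (intro KP_diff KP_const KP_sum KP_J KY)
  assume s: "0 \<le> s" "s \<le> T"
  have sJ: "square_integrable M (J a (?Y a) s)" "square_integrable M (J a (thE a ?\<psi>) s)" if "a \<in> {1..d}" for a
    by (rule sqi_J[OF aY that s], rule sqi_J[OF adm_thE that s])
  have sS: "square_integrable M (Jsum ?Y s)" "square_integrable M (Jsum (\<lambda>a. thE a ?\<psi>) s)"
    unfolding Jsum_def[abs_def] by (intro sqi_sum sJ; assumption)+
  show sP: "square_integrable M (Picard \<phi> Y s)"
    unfolding Picard_def[abs_def] by (intro sqi_diff sqi_const sS)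
  let ?G = "\<lambda>\<omega>. cos \<phi> - Jsum (\<lambda>a. thE a ?\<psi>) s \<omega>"
  have sG: "square_integrable M ?G" by (intro sqi_diff sqi_const sS)
  have AE: "AE \<omega> in M. Ec \<phi> s \<omega> = ?G \<omega>"
    using Ec_equation[OF s, of \<phi>] l2d_eq_0_iff_AE[OF sqi_add[OF sqi_Ec[OF s] sS(2)] sqi_const, of \<phi> "cos \<phi>"]
    by (auto elim!: eventually_mono)
  have "l2d M (Ec \<phi> s) (Picard \<phi> Y s) = l2d M ?G (Picard \<phi> Y s)"
    by (rule l2d_AE_cong[OF sqi_Ec[OF s] sG sP sP AE]) simp
  also have "\<dots> = expectation (\<lambda>\<omega>. (\<Sum>a=1..d. J a (?Y a) s \<omega> - J a (thE a ?\<psi>) s \<omega>)\<^sup>2)"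
    unfolding l2d_def Picard_def Jsum_def by (simp add: sum_subtractf)
  \<comment> \<open>One factor \<open>d\<close> comes from squaring a sum of \<open>d\<close> terms,
    the other from adding \<open>d\<close> equal bounds, and the square of \<open>thB\<close> from
    bounding \<open>theta\<close>.\<close>
  also have "\<dots> \<le> expectation (\<lambda>\<omega>. real d * (\<Sum>a=1..d. (J a (?Y a) s \<omega> - J a (thE a ?\<psi>) s \<omega>)\<^sup>2))"
  proof (rule integral_mono)
    show "integrable M (\<lambda>\<omega>. (\<Sum>a=1..d. J a (?Y a) s \<omega> - J a (thE a ?\<psi>) s \<omega>)\<^sup>2)"
      by (intro sqi_integrable_sq sqi_sum sqi_diff sJ)
    show "integrable M (\<lambda>\<omega>. real d * (\<Sum>a=1..d. (J a (?Y a) s \<omega> - J a (thE a ?\<psi>) s \<omega>)\<^sup>2))"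
      by (intro integrable_mult_right Bochner_Integration.integrable_sum sqi_integrable_sq sqi_diff sJ)
    show "(\<Sum>a=1..d. J a (?Y a) s \<omega> - J a (thE a ?\<psi>) s \<omega>)\<^sup>2
        \<le> real d * (\<Sum>a=1..d. (J a (?Y a) s \<omega> - J a (thE a ?\<psi>) s \<omega>)\<^sup>2)" for \<omega>
      using square_sum_le[of "\<lambda>a. J a (?Y a) s \<omega> - J a (thE a ?\<psi>) s \<omega>" "{1..d}"] by simp
  qed
  also have "\<dots> = real d * (\<Sum>a=1..d. l2d M (J a (?Y a) s) (J a (thE a ?\<psi>) s))"
    unfolding l2d_def integral_mult_right_zero
    by (subst Bochner_Integration.integral_sum) (auto intro!: sqi_integrable_sq sqi_diff sJ)
  also have "\<dots> = real d * (\<Sum>a=1..d. l2d P (cut s (?Y a)) (cut s (thE a ?\<psi>)))"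
    by (intro arg_cong2[where f = "(*)"] refl sum.cong J_l2d[OF aY adm_thE _ s s])
  also have "\<dots> \<le> real d * (\<Sum>a=1..d. thB\<^sup>2 * l2d P (cut s Y) (cut s (Ec ?\<psi>)))"
    unfolding thE_def[abs_def]
    by (intro mult_left_mono sum_mono theta_l2d KP_sqi Y nice_sqi_cut nice_Ec s) simp
  also have "\<dots> = (real d * real d * thB\<^sup>2) * l2d P (cut s (Ec ?\<psi>)) (cut s Y)"
    by (simp add: l2d_commute)
  finally show "l2d M (Ec \<phi> s) (Picard \<phi> Y s) \<le> (real d * real d * thB\<^sup>2) * l2d P (cut s (Ec ?\<psi>)) (cut s Y)" .
qed

text \<open>The weight \<open>exp (\<beta> * t)\<close> makes the iteration contract on all of
  \<open>[0, T]\<close> at once. Integrating the weight gains 1/\<beta>, so with \<beta> = 4 L a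
  step with constant L leaves the factor 1/4 for each phase, and 1/2 for their sum. The summand 1 in
  L keeps \<beta> positive.\<close>

lemma Picard_approx:
  defines "\<beta> \<equiv> 4 * (real d * real d * thB\<^sup>2 + 1)"
  shows "\<exists>Y Y'. KP Y \<and> KP Y' \<and> (\<forall>t. 0 \<le> t \<and> t \<le> T \<longrightarrow>
     l2d P (cut t (Ec \<phi>)) (cut t Y) + l2d P (cut t (Ec (\<phi> - pi / 2))) (cut t Y')
     \<le> (l2d P (cut T (Ec \<phi>)) (\<lambda>p. 0) + l2d P (cut T (Ec (\<phi> - pi / 2))) (\<lambda>p. 0)) * exp (\<beta> * t) / 2 ^ k)"
    (is "\<exists>Y Y'. KP Y \<and> KP Y' \<and> (\<forall>t. 0 \<le> t \<and> t \<le> T \<longrightarrow> _ \<le> ?K * exp (\<beta> * t) / 2 ^ k)")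
proof (induction k)
  case 0
  have z: "l2d P (cut t (Ec \<phi>)) (cut t (\<lambda>s \<omega>. 0)) \<le> l2d P (cut T (Ec \<phi>)) (\<lambda>p. 0)" if "t \<le> T" for t \<phi>
    using cut_l2d_mono[OF nice_sqi_cut[OF nice_Ec] nice_sqi_cut[OF nice_const], of t T \<phi> 0] that
    by (simp add: cut_zero)
  have "l2d P (cut t (Ec \<phi>)) (cut t (\<lambda>s \<omega>. 0)) + l2d P (cut t (Ec (\<phi> - pi / 2))) (cut t (\<lambda>s \<omega>. 0))
      \<le> ?K * exp (\<beta> * t) / 2 ^ 0" if t: "0 \<le> t" "t \<le> T" for t
  proof -
    have "?K * 1 \<le> ?K * exp (\<beta> * t)"
      using t by (intro mult_left_mono) (auto simp: \<beta>_def)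
    then show ?thesis using z[OF t(2), of \<phi>] z[OF t(2), of "\<phi> - pi / 2"] by simp
  qed
  then show ?case using KP.zero by blast
next
  case (Suc k)
  let ?\<psi> = "\<phi> - pi / 2"
  let ?L = "real d * real d * thB\<^sup>2 + 1"
  obtain Y Y' where Y: "KP Y" and Y': "KP Y'" and le: "\<And>t. 0 \<le> t \<Longrightarrow> t \<le> T \<Longrightarrow>
     l2d P (cut t (Ec \<phi>)) (cut t Y) + l2d P (cut t (Ec ?\<psi>)) (cut t Y') \<le> ?K * exp (\<beta> * t) / 2 ^ k"
    using Suc.IH by blast
  have \<beta>: "0 < \<beta>" "\<beta> = 4 * ?L" "0 < ?L" unfolding \<beta>_def by (auto intro!: add_nonneg_pos mult_nonneg_nonneg)
  \<comment> \<open>The phase after \<phi> - pi/2 is \<phi> - pi, whose exponential is minus that of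
    \<phi>; the second component is therefore iterated from minus \<open>Y\<close>.\<close>
  let ?N = "\<lambda>s \<omega>. - 1 * Y s \<omega>"
  have N: "KP ?N" by (rule KP.scale[OF Y])
  have K0: "0 \<le> ?K" by simp
  let ?b = "\<lambda>s. ?L * (?K * exp (\<beta> * s) / 2 ^ k)"
  have b0: "0 \<le> ?b s" for s using \<beta> K0 by (intro mult_nonneg_nonneg divide_nonneg_nonneg) auto
  have int: "(?b has_integral (?L * ?K / 2 ^ k / \<beta> * exp (\<beta> * t) - ?L * ?K / 2 ^ k / \<beta> * exp (\<beta> * 0))) {0..t}" if "0 \<le> t" for t
    using that \<beta>(1) by (intro fundamental_theorem_of_calculus)
      (auto intro!: derivative_eq_intros simp: has_real_derivative_iff_has_vector_derivative[symmetric] field_simps)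
  have bound: "l2d P (cut t (Ec \<phi>')) (cut t (Picard \<phi>' Z)) \<le> ?K * exp (\<beta> * t) / 2 ^ Suc (Suc k)"
    if Z: "KP Z" and t: "0 \<le> t" "t \<le> T"
      and lz: "\<And>s. 0 \<le> s \<Longrightarrow> s \<le> T \<Longrightarrow> l2d P (cut s (Ec (\<phi>' - pi / 2))) (cut s Z) \<le> ?K * exp (\<beta> * s) / 2 ^ k"
    for \<phi>' Z t
  proof -
    have "l2d P (cut t (Ec \<phi>')) (cut t (Picard \<phi>' Z)) \<le> ?L * ?K / 2 ^ k / \<beta> * exp (\<beta> * t) - ?L * ?K / 2 ^ k / \<beta> * exp (\<beta> * 0)"
    proof (rule P_l2d_le(1)[OF nice_cut_measurable[OF nice_Ec] sqi_measurable[OF KP_sqi[OF Picard_step(1)[OF Z]]] t _ _ _ int[OF t(1)] _ b0])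
      fix s assume s: "0 \<le> s" "s \<le> t"
      then have sT: "s \<le> T" using t by simp
      show "square_integrable M (Ec \<phi>' s)" by (rule sqi_Ec[OF s(1) sT])
      show "square_integrable M (Picard \<phi>' Z s)" by (rule Picard_step(2)[OF Z s(1) sT])
      have "l2d M (Ec \<phi>' s) (Picard \<phi>' Z s) \<le> (real d * real d * thB\<^sup>2) * l2d P (cut s (Ec (\<phi>' - pi / 2))) (cut s Z)"
        by (rule Picard_step(3)[OF Z s(1) sT])
      also have "\<dots> \<le> ?L * (?K * exp (\<beta> * s) / 2 ^ k)"
        by (intro mult_mono lz s sT) auto
      finally show "l2d M (Ec \<phi>' s) (Picard \<phi>' Z s) \<le> ?b s" .
    qed simp
    also have "\<dots> \<le> ?L * ?K / 2 ^ k / \<beta> * exp (\<beta> * t)"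
      using \<beta>(1,3) K0 by simp
    also have "\<dots> = ?K * exp (\<beta> * t) / 2 ^ Suc (Suc k)"
    proof -
      have "L * K / p / (4 * L) * x = K * x / (4 * p)" if "0 < L" for L K p x :: real
        using that by simp
      from this[OF \<beta>(3), of ?K "2 ^ k" "exp (\<beta> * t)"] show ?thesis
        unfolding \<beta>(2)[symmetric] by simp
    qed
    finally show ?thesis .
  qed
  have 1: "l2d P (cut t (Ec \<phi>)) (cut t (Picard \<phi> Y')) \<le> ?K * exp (\<beta> * t) / 2 ^ Suc (Suc k)" if "0 \<le> t" "t \<le> T" for t
  proof (rule bound[OF Y' that])
    fix s assume "0 \<le> s" "s \<le> T"
    then show "l2d P (cut s (Ec ?\<psi>)) (cut s Y') \<le> ?K * exp (\<beta> * s) / 2 ^ k"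
      using le[of s] l2d_nonneg[of P "cut s (Ec \<phi>)" "cut s Y"] by linarith
  qed
  have 2: "l2d P (cut t (Ec ?\<psi>)) (cut t (Picard ?\<psi> ?N)) \<le> ?K * exp (\<beta> * t) / 2 ^ Suc (Suc k)" if "0 \<le> t" "t \<le> T" for t
  proof (rule bound[OF N that])
    fix s assume s: "0 \<le> s" "s \<le> T"
    have "Ec (?\<psi> - pi / 2) = (\<lambda>s \<omega>. - 1 * Ec \<phi> s \<omega>)" by (intro ext) (simp only: Ec_opposite mult_minus1)
    then have "l2d P (cut s (Ec (?\<psi> - pi / 2))) (cut s ?N) = (- 1)\<^sup>2 * l2d P (cut s (Ec \<phi>)) (cut s Y)"
      by (simp only: cut_scale l2d_scale)
    then have e: "l2d P (cut s (Ec (?\<psi> - pi / 2))) (cut s ?N) = l2d P (cut s (Ec \<phi>)) (cut s Y)" by simp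
    show "l2d P (cut s (Ec (?\<psi> - pi / 2))) (cut s ?N) \<le> ?K * exp (\<beta> * s) / 2 ^ k"
      using le[OF s] l2d_nonneg[of P "cut s (Ec ?\<psi>)" "cut s Y'"] e by linarith
  qed
  have "l2d P (cut t (Ec \<phi>)) (cut t (Picard \<phi> Y')) + l2d P (cut t (Ec ?\<psi>)) (cut t (Picard ?\<psi> ?N))
      \<le> ?K * exp (\<beta> * t) / 2 ^ Suc k" if "0 \<le> t" "t \<le> T" for t
    using add_mono[OF 1[OF that] 2[OF that]] by (simp add: mult.commute)
  then show ?case
    using Picard_step(1)[OF Y', of \<phi>] Picard_step(1)[OF N, of ?\<psi>] by blast
qed

lemma KP_Ec: "KP (Ec \<phi>)"
proof -
  let ?\<beta> = "4 * (real d * real d * thB\<^sup>2 + 1)"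
  let ?K = "l2d P (cut T (Ec \<phi>)) (\<lambda>p. 0) + l2d P (cut T (Ec (\<phi> - pi / 2))) (\<lambda>p. 0)"
  have "\<exists>Y. KP Y \<and> l2d P (cut T Y) (cut T (Ec \<phi>)) \<le> ?K * exp (?\<beta> * T) / 2 ^ k" for k
  proof -
    obtain Y Y' where "KP Y" and le: "l2d P (cut T (Ec \<phi>)) (cut T Y) + l2d P (cut T (Ec (\<phi> - pi / 2))) (cut T Y')
        \<le> ?K * exp (?\<beta> * T) / 2 ^ k"
      using Picard_approx[of \<phi> k] T_pos by (metis less_imp_le order_refl)
    then show ?thesis
      using l2d_nonneg[of P "cut T (Ec (\<phi> - pi / 2))" "cut T Y'"] l2d_commute[of P "cut T Y" "cut T (Ec \<phi>)"]
      by (intro exI[of _ Y] conjI) linarith+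
  qed
  then have "\<forall>k. \<exists>Y. KP Y \<and> l2d P (cut T Y) (cut T (Ec \<phi>)) \<le> ?K * exp (?\<beta> * T) / 2 ^ k" by blast
  from choice[OF this] obtain Y where Y: "\<And>k. KP (Y k)"
    "\<And>k. l2d P (cut T (Y k)) (cut T (Ec \<phi>)) \<le> ?K * exp (?\<beta> * T) / 2 ^ k" by blast
  have lim: "(\<lambda>k. ?K * exp (?\<beta> * T) / 2 ^ k) \<longlonglongrightarrow> 0"
    by (rule LIMSEQ_divide_realpow_zero) simp
  show ?thesis
  proof (rule KP.lim[OF Y(1) nice_sqi_cut[OF nice_Ec]], rule Lim_null_comparison[OF always_eventually lim], rule allI)
    fix k show "norm (l2d P (cut T (Y k)) (cut T (Ec \<phi>))) \<le> ?K * exp (?\<beta> * T) / 2 ^ k"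
      using Y(2)[of k] by (simp only: real_norm_def abs_of_nonneg[OF l2d_nonneg])
  qed
qed

lemma cos_Hcl: "(\<lambda>\<omega>. cos ((\<Sum>j<n. l j * B (idx j) (tm j) \<omega>) + \<phi>)) \<in> Hcl"
proof -
  let ?\<psi> = "\<phi> - pi / 2"
  have T: "0 \<le> T" "T \<le> T" using T_pos by auto
  let ?G = "\<lambda>\<omega>. cos \<phi> - Jsum (\<lambda>a. thE a ?\<psi>) T \<omega>"
  have K: "KP (thE a ?\<psi>)" for a unfolding thE_def[abs_def] by (rule KP_theta[OF KP_Ec])
  have G: "?G \<in> Hcl"
    unfolding Jsum_def Hcl_def
    by (intro L2cl_diff L2cl_sum const_Hcl[unfolded Hcl_def] KP_J_Hcl[OF K, unfolded Hcl_def]; assumption)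
  have sS: "square_integrable M (Jsum (\<lambda>a. thE a ?\<psi>) T)"
    unfolding Jsum_def[abs_def] by (intro sqi_sum sqi_J[OF adm_thE _ T])
  have "AE \<omega> in M. Ec \<phi> T \<omega> + Jsum (\<lambda>a. thE a ?\<psi>) T \<omega> = cos \<phi>"
    using Ec_equation[OF T, of \<phi>] l2d_eq_0_iff_AE[OF sqi_add[OF sqi_Ec[OF T] sS] sqi_const, of \<phi> "cos \<phi>"] by simp
  then have "AE \<omega> in M. ?G \<omega> = E0 \<phi> T \<omega>"
    using AE_Ec_eq(1)[of \<phi> T] by eventually_elim simp
  then have "E0 \<phi> T \<in> Hcl"
    unfolding Hcl_def by (rule L2cl_AE_cong[OF G[unfolded Hcl_def] E0_measurable[OF T]])
  \<comment> \<open>The deterministic factor of the martingale is divided out; as no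
    \<open>tm j\<close> exceeds \<open>T\<close>, what remains is the cosine of the full linear
    combination.\<close>
  then have "(\<lambda>\<omega>. exp (- (q T / 2)) * E0 \<phi> T \<omega>) \<in> Hcl" unfolding Hcl_def by (rule L2cl.scale)
  moreover have "exp (- (q T / 2)) * E0 \<phi> T \<omega> = cos ((\<Sum>j<n. l j * B (idx j) (tm j) \<omega>) + \<phi>)" for \<omega>
  proof -
    have "Xt T \<omega> = (\<Sum>j<n. l j * B (idx j) (tm j) \<omega>)"
      unfolding Xt_def using tm by (intro sum.cong refl) (simp add: min_absorb2)
    moreover have "exp (- (q T / 2)) * exp (q T / 2) = 1" by (simp flip: exp_add)
    ultimately show ?thesis by (simp add: E0_def mult.assoc[symmetric])
  qed
  ultimately show ?thesis by simp
qed

end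

section \<open>Totality of the iterated integrals\<close>

text \<open>The positive and negative parts of \<open>W\<close> are densities with equal total mass,
  by the cosine condition at 0. After normalisation the laws of \<open>X\<close> under them have the
  same characteristic function.\<close>

lemma (in prob_space) signed_Levy_uniqueness:
  fixes W X :: "'a \<Rightarrow> real"
  assumes W: "integrable M W" and X [measurable]: "X \<in> borel_measurable M"
    and cos: "\<And>t. expectation (\<lambda>\<omega>. W \<omega> * cos (t * X \<omega>)) = 0"
    and sin: "\<And>t. expectation (\<lambda>\<omega>. W \<omega> * sin (t * X \<omega>)) = 0"
    and A [measurable]: "A \<in> sets borel"
  shows "expectation (\<lambda>\<omega>. W \<omega> * indicator A (X \<omega>)) = 0"
proof -
  have [measurable]: "W \<in> borel_measurable M" using W by auto
  define U where "U b \<omega> = max 0 (if b then W \<omega> else - W \<omega>)" for b \<omega>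
  have iU: "integrable M (U b)" for b
    by (rule Bochner_Integration.integrable_bound[OF W]) (auto simp: U_def[abs_def])
  have [measurable]: "U b \<in> borel_measurable M" for b unfolding U_def[abs_def] by measurable
  have U0: "0 \<le> U b \<omega>" for b \<omega> by (simp add: U_def)
  have WU: "W \<omega> = U True \<omega> - U False \<omega>" for \<omega> by (auto simp: U_def)
  have bnd: "integrable M (\<lambda>\<omega>. U b \<omega> * f (X \<omega>))" if [measurable]: "f \<in> borel_measurable borel" and "\<And>x. \<bar>f x\<bar> \<le> 1" for b and f :: "real \<Rightarrow> real"
    by (rule Bochner_Integration.integrable_bound[OF iU[of b]]) (use that(2) U0 in \<open>auto simp: abs_mult mult_left_le\<close>)
  have split: "expectation (\<lambda>\<omega>. W \<omega> * f (X \<omega>)) = expectation (\<lambda>\<omega>. U True \<omega> * f (X \<omega>)) - expectation (\<lambda>\<omega>. U False \<omega> * f (X \<omega>))"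
    if "f \<in> borel_measurable borel" "\<And>x. \<bar>f x\<bar> \<le> 1" for f :: "real \<Rightarrow> real"
    using bnd[OF that, of True] bnd[OF that, of False] by (simp add: WU left_diff_distrib)
  define m where "m = expectation (U True)"
  have m: "expectation (U b) = m" for b
    using split[of "\<lambda>x. 1"] cos[of 0] by (cases b) (simp_all add: m_def)
  show ?thesis
  proof (cases "m = 0")
    \<comment> \<open>Both parts have integral 0, so \<open>W\<close> vanishes almost everywhere and
      there is no mass to normalise.\<close>
    case True
    have "AE \<omega> in M. U b \<omega> = 0" for b
      using integral_nonneg_eq_0_iff_AE[OF iU[of b]] U0 m[of b] True by auto
    from this[of True] this[of False] have "AE \<omega> in M. W \<omega> * indicator A (X \<omega>) = 0"
      by eventually_elim (simp add: WU)
    then show ?thesis by (subst integral_cong_AE[of _ _ "\<lambda>_. 0"]) auto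
  next
    case False
    have "0 \<le> m" unfolding m_def by (rule integral_nonneg_AE) (simp add: U0)
    with False have mp: "0 < m" by simp
    define \<mu> where "\<mu> b = distr (density M (\<lambda>\<omega>. ennreal (U b \<omega> / m))) borel X" for b
    have rd: "real_distribution (\<mu> b)" for b
    proof -
      have "prob_space (density M (\<lambda>\<omega>. ennreal (U b \<omega> / m)))"
      proof
        have "(\<integral>\<^sup>+\<omega>. ennreal (U b \<omega> / m) \<partial>M) = ennreal (expectation (\<lambda>\<omega>. U b \<omega> / m))"
          using iU U0 mp by (intro nn_integral_eq_integral) auto
        also have "\<dots> = 1" using m mp by simp
        finally show "emeasure (density M (\<lambda>\<omega>. ennreal (U b \<omega> / m))) (space (density M (\<lambda>\<omega>. ennreal (U b \<omega> / m)))) = 1"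
          by (simp add: emeasure_density cong: nn_integral_cong)
      qed
      then have "prob_space (\<mu> b)" unfolding \<mu>_def by (rule prob_space.prob_space_distr) simp
      then show ?thesis by (simp add: real_distribution_def real_distribution_axioms_def \<mu>_def)
    qed
    have int: "(\<integral>x. f x \<partial>\<mu> b) = expectation (\<lambda>\<omega>. (U b \<omega> / m) *\<^sub>R f (X \<omega>))"
      if [measurable]: "f \<in> borel_measurable borel" for f :: "real \<Rightarrow> 'z :: {banach, second_countable_topology}" and b
      unfolding \<mu>_def using U0 mp by (subst integral_distr) (simp_all add: integral_density)
    have "char (\<mu> True) = char (\<mu> False)"
    proof
      fix t
      have i: "integrable M (\<lambda>\<omega>. (U b \<omega> / m) *\<^sub>R iexp (t * X \<omega>))" for b
        by (rule Bochner_Integration.integrable_bound[OF integrable_divide[OF iU[of b], of m]]) auto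
      have cs: "expectation (\<lambda>\<omega>. U True \<omega> * cos (t * X \<omega>)) = expectation (\<lambda>\<omega>. U False \<omega> * cos (t * X \<omega>))"
        "expectation (\<lambda>\<omega>. U True \<omega> * sin (t * X \<omega>)) = expectation (\<lambda>\<omega>. U False \<omega> * sin (t * X \<omega>))"
        using split[of "\<lambda>x. cos (t * x)"] cos[of t] split[of "\<lambda>x. sin (t * x)"] sin[of t] by simp_all
      have re: "Re (char (\<mu> b) t) = expectation (\<lambda>\<omega>. U b \<omega> * cos (t * X \<omega>)) / m"
        and im: "Im (char (\<mu> b) t) = expectation (\<lambda>\<omega>. U b \<omega> * sin (t * X \<omega>)) / m" for b
        unfolding char_def using integral_Re[OF i[of b]] integral_Im[OF i[of b]]
        by (subst int, simp, simp add: Re_exp Im_exp)+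
      show "char (\<mu> True) t = char (\<mu> False) t" by (intro complex_eqI) (simp_all only: re im cs)
    qed
    then have eq: "\<mu> True = \<mu> False" by (intro Levy_uniqueness rd)
    have "expectation (\<lambda>\<omega>. U b \<omega> * indicator A (X \<omega>)) = m * (\<integral>x. indicator A x \<partial>\<mu> b)" for b
      using mp by (subst int) simp_all
    then show ?thesis using split[of "indicator A"] by (simp add: eq)
  qed
qed

text \<open>The variables leave the cosine one at a time and turn into indicators. In the step for
  \<open>V k\<close>, the indicators obtained so far and the cosine of the remaining variables form
  the weight in \<open>signed_Levy_uniqueness\<close>.\<close>

lemma (in prob_space) cos_moments_determine:
  fixes W :: "'a \<Rightarrow> real" and V :: "nat \<Rightarrow> 'a \<Rightarrow> real"
  assumes W: "integrable M W" and V: "\<And>j. j < n \<Longrightarrow> V j \<in> borel_measurable M"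
    and cos: "\<And>l \<phi>. expectation (\<lambda>\<omega>. W \<omega> * cos ((\<Sum>j<n. l j * V j \<omega>) + \<phi>)) = 0"
    and A: "\<And>j. j < n \<Longrightarrow> A j \<in> sets borel"
  shows "expectation (\<lambda>\<omega>. W \<omega> * (\<Prod>j<n. indicator (A j) (V j \<omega>))) = 0"
proof -
  have "k \<le> n \<Longrightarrow> \<forall>l \<phi>. expectation (\<lambda>\<omega>. W \<omega> * (\<Prod>j<k. indicator (A j) (V j \<omega>)) * cos ((\<Sum>j\<in>{k..<n}. l j * V j \<omega>) + \<phi>)) = 0" for k
  proof (induction k)
    case 0
    then show ?case using cos by (simp add: atLeast0LessThan)
  next
    case (Suc k)
    then have k: "k < n" by simp
    have m: "(\<lambda>\<omega>. \<Prod>j<m. indicator (A j) (V j \<omega>) :: real) \<in> borel_measurable M" if "m \<le> n" for m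
      using that V A by (intro borel_measurable_prod measurable_compose[OF V] borel_measurable_indicator) auto
    have Y: "(\<lambda>\<omega>. (\<Sum>j\<in>{m..<n}. l j * V j \<omega>) + \<phi>) \<in> borel_measurable M" for m \<phi> and l :: "nat \<Rightarrow> real"
      using V by (intro borel_measurable_add borel_measurable_sum borel_measurable_times borel_measurable_const) auto
    have b1: "\<bar>\<Prod>j<m. indicator (A j) (V j \<omega>) :: real\<bar> \<le> 1" for m \<omega>
      unfolding abs_prod by (rule prod_le_1) (auto simp: indicator_def)
    have iW: "integrable M (\<lambda>\<omega>. W \<omega> * (\<Prod>j<k. indicator (A j) (V j \<omega>)) * cos ((\<Sum>j\<in>{m..<n}. l j * V j \<omega>) + \<phi>))" for m \<phi> and l :: "nat \<Rightarrow> real"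
    proof (rule Bochner_Integration.integrable_bound[OF W])
      show "(\<lambda>\<omega>. W \<omega> * (\<Prod>j<k. indicator (A j) (V j \<omega>)) * cos ((\<Sum>j\<in>{m..<n}. l j * V j \<omega>) + \<phi>)) \<in> borel_measurable M"
        using W m[of k] k Y[of l m \<phi>] by (intro borel_measurable_times borel_measurable_cos) auto
      have "\<bar>W \<omega>\<bar> * (\<bar>\<Prod>j<k. indicator (A j) (V j \<omega>)\<bar> * \<bar>cos ((\<Sum>j\<in>{m..<n}. l j * V j \<omega>) + \<phi>)\<bar>) \<le> \<bar>W \<omega>\<bar>" for \<omega>
        by (intro mult_left_le mult_le_one b1) auto
      then show "AE \<omega> in M. norm (W \<omega> * (\<Prod>j<k. indicator (A j) (V j \<omega>)) * cos ((\<Sum>j\<in>{m..<n}. l j * V j \<omega>) + \<phi>)) \<le> norm (W \<omega>)"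
        by (simp add: abs_mult mult.assoc)
    qed
    show ?case
    proof (intro allI)
      fix l :: "nat \<Rightarrow> real" and \<phi> :: real
      let ?Y = "\<lambda>\<omega>. (\<Sum>j\<in>{Suc k..<n}. l j * V j \<omega>) + \<phi>"
      let ?W = "\<lambda>\<omega>. W \<omega> * (\<Prod>j<k. indicator (A j) (V j \<omega>))"
      have IH: "expectation (\<lambda>\<omega>. ?W \<omega> * cos (t * V k \<omega> + ?Y \<omega> + \<psi>)) = 0"
        and iIH: "integrable M (\<lambda>\<omega>. ?W \<omega> * cos (t * V k \<omega> + ?Y \<omega> + \<psi>))" for t \<psi>
      proof -
        have e: "(\<Sum>j\<in>{k..<n}. (l(k := t)) j * V j \<omega>) + (\<phi> + \<psi>) = t * V k \<omega> + ?Y \<omega> + \<psi>" for \<omega>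
        proof -
          have "{k..<n} = insert k {Suc k..<n}" using k by auto
          moreover have "(\<Sum>j\<in>{Suc k..<n}. (l(k := t)) j * V j \<omega>) = (\<Sum>j\<in>{Suc k..<n}. l j * V j \<omega>)"
            by (intro sum.cong) auto
          ultimately show ?thesis by simp
        qed
        show "expectation (\<lambda>\<omega>. ?W \<omega> * cos (t * V k \<omega> + ?Y \<omega> + \<psi>)) = 0"
          "integrable M (\<lambda>\<omega>. ?W \<omega> * cos (t * V k \<omega> + ?Y \<omega> + \<psi>))"
          using Suc.IH[rule_format, of "l(k := t)" "\<phi> + \<psi>"] iW[of "l(k := t)" k "\<phi> + \<psi>"] k
          unfolding e by simp_all
      qed
      have "expectation (\<lambda>\<omega>. (?W \<omega> * cos (?Y \<omega>)) * indicator (A k) (V k \<omega>)) = 0"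
      proof (rule signed_Levy_uniqueness[OF _ V[OF k] _ _ A[OF k]])
        show "integrable M (\<lambda>\<omega>. ?W \<omega> * cos (?Y \<omega>))" by (rule iW)
        fix t
        \<comment> \<open>Products of trigonometric functions become sums of cosines covered by the
          induction hypothesis; for the sine below, its free phase is shifted by pi/2.\<close>
        have "?W \<omega> * cos (?Y \<omega>) * cos (t * V k \<omega>)
          = (1/2) * (?W \<omega> * cos (t * V k \<omega> + ?Y \<omega> + 0)) + (1/2) * (?W \<omega> * cos (- t * V k \<omega> + ?Y \<omega> + 0))" for \<omega>
        proof -
          have "x * cos b * cos a = (1/2) * (x * cos (a + b + 0)) + (1/2) * (x * cos (- a + b + 0))" for a b x :: real
            by (simp only: cos_add add_0_right) (simp add: algebra_simps)
          from this[of "?W \<omega>" "?Y \<omega>" "t * V k \<omega>"] show ?thesis by (simp only: mult_minus_left)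
        qed
        then have "expectation (\<lambda>\<omega>. ?W \<omega> * cos (?Y \<omega>) * cos (t * V k \<omega>))
          = expectation (\<lambda>\<omega>. (1/2) * (?W \<omega> * cos (t * V k \<omega> + ?Y \<omega> + 0)) + (1/2) * (?W \<omega> * cos (- t * V k \<omega> + ?Y \<omega> + 0)))"
          by (simp only:)
        also have "\<dots> = (1/2) * expectation (\<lambda>\<omega>. ?W \<omega> * cos (t * V k \<omega> + ?Y \<omega> + 0)) + (1/2) * expectation (\<lambda>\<omega>. ?W \<omega> * cos (- t * V k \<omega> + ?Y \<omega> + 0))"
          using iIH[of t 0] iIH[of "- t" 0] by (subst Bochner_Integration.integral_add) (simp_all del: add_0_right mult_minus_left)
        finally show "expectation (\<lambda>\<omega>. ?W \<omega> * cos (?Y \<omega>) * cos (t * V k \<omega>)) = 0"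
          using IH[of t 0] IH[of "- t" 0] by (simp only: mult_zero_right add_0)
        have "?W \<omega> * cos (?Y \<omega>) * sin (t * V k \<omega>)
          = (1/2) * (?W \<omega> * cos (t * V k \<omega> + ?Y \<omega> + (- pi / 2))) + (1/2) * (?W \<omega> * cos (- t * V k \<omega> + ?Y \<omega> + pi / 2))" for \<omega>
        proof -
          have "cos (x + (- pi / 2)) = sin x" "cos (x + pi / 2) = - sin x" for x :: real
            by (simp_all add: cos_add cos_diff)
          then have "x * cos b * sin a = (1/2) * (x * cos (a + b + (- pi / 2))) + (1/2) * (x * cos (- a + b + pi / 2))" for a b x :: real
            by (simp only: sin_add) (simp add: algebra_simps)
          from this[of "?W \<omega>" "?Y \<omega>" "t * V k \<omega>"] show ?thesis by (simp only: mult_minus_left)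
        qed
        then have "expectation (\<lambda>\<omega>. ?W \<omega> * cos (?Y \<omega>) * sin (t * V k \<omega>))
          = expectation (\<lambda>\<omega>. (1/2) * (?W \<omega> * cos (t * V k \<omega> + ?Y \<omega> + (- pi / 2))) + (1/2) * (?W \<omega> * cos (- t * V k \<omega> + ?Y \<omega> + pi / 2)))"
          by (simp only:)
        also have "\<dots> = (1/2) * expectation (\<lambda>\<omega>. ?W \<omega> * cos (t * V k \<omega> + ?Y \<omega> + (- pi / 2))) + (1/2) * expectation (\<lambda>\<omega>. ?W \<omega> * cos (- t * V k \<omega> + ?Y \<omega> + pi / 2))"
          using iIH[of t "- pi / 2"] iIH[of "- t" "pi / 2"] by (subst Bochner_Integration.integral_add) (simp_all del: mult_minus_left)
        finally show "expectation (\<lambda>\<omega>. ?W \<omega> * cos (?Y \<omega>) * sin (t * V k \<omega>)) = 0"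
          using IH[of t "- pi / 2"] IH[of "- t" "pi / 2"] by (simp only: mult_zero_right add_0)
      qed
      then show "expectation (\<lambda>\<omega>. W \<omega> * (\<Prod>j<Suc k. indicator (A j) (V j \<omega>)) * cos ((\<Sum>j\<in>{Suc k..<n}. l j * V j \<omega>) + \<phi>)) = 0"
        by (simp add: mult_ac)
    qed
  qed
  from this[of n, OF order_refl, rule_format, of "\<lambda>_. 0" 0] show ?thesis by simp
qed

context brownian
begin

lemma orthogonal_Hcl_cylinder:
  assumes W: "square_integrable M W" and orth: "\<And>g. g \<in> Hcl \<Longrightarrow> expectation (\<lambda>\<omega>. g \<omega> * W \<omega>) = 0"
    and K: "finite K" "K \<subseteq> {1..d} \<times> {0..T}" and X: "\<And>p. p \<in> K \<Longrightarrow> X p \<in> sets borel"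
  shows "expectation (\<lambda>\<omega>. W \<omega> * indicator {\<omega> \<in> space M. \<forall>p\<in>K. B (fst p) (snd p) \<omega> \<in> X p} \<omega>) = 0"
proof -
  obtain n :: nat and f where f: "K = f ` {i. i < n}" using finite_imp_nat_seg_image_inj_on[OF K(1)] by blast
  have fJ: "f j \<in> K" if "j < n" for j using that f by auto
  have r: "fst (f j) \<in> {1..d}" "0 \<le> snd (f j)" "snd (f j) \<le> T" if "j < n" for j
    using fJ[OF that] K(2) by auto
  have "expectation (\<lambda>\<omega>. W \<omega> * (\<Prod>j<n. indicator (X (f j)) (B (fst (f j)) (snd (f j)) \<omega>))) = 0"
  proof (rule cos_moments_determine[OF sqi_integrable[OF W]])
    show "B (fst (f j)) (snd (f j)) \<in> borel_measurable M" if "j < n" for j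
      using r[OF that] by (intro B_measurable)
    fix l :: "nat \<Rightarrow> real" and \<phi> :: real
    interpret Z: brownian_exponential M d T B n "\<lambda>j. fst (f j)" "\<lambda>j. snd (f j)" l
      by unfold_locales (use r in auto)
    show "expectation (\<lambda>\<omega>. W \<omega> * cos ((\<Sum>j<n. l j * B (fst (f j)) (snd (f j)) \<omega>) + \<phi>)) = 0"
      using orth[OF Z.cos_Hcl[of \<phi>]] by (simp add: mult.commute)
  qed (use fJ X in auto)
  also have "expectation (\<lambda>\<omega>. W \<omega> * (\<Prod>j<n. indicator (X (f j)) (B (fst (f j)) (snd (f j)) \<omega>)))
    = expectation (\<lambda>\<omega>. W \<omega> * indicator {\<omega> \<in> space M. \<forall>p\<in>K. B (fst p) (snd p) \<omega> \<in> X p} \<omega>)"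
  proof (rule Bochner_Integration.integral_cong[OF refl])
    fix \<omega> assume \<omega>: "\<omega> \<in> space M"
    have "(\<Prod>j<n. indicator (X (f j)) (B (fst (f j)) (snd (f j)) \<omega>) :: real)
        = (if \<forall>j<n. B (fst (f j)) (snd (f j)) \<omega> \<in> X (f j) then 1 else 0)"
      by (auto simp: indicator_def prod_zero_iff intro!: prod.neutral)
    then show "W \<omega> * (\<Prod>j<n. indicator (X (f j)) (B (fst (f j)) (snd (f j)) \<omega>))
      = W \<omega> * indicator {\<omega> \<in> space M. \<forall>p\<in>K. B (fst p) (snd p) \<omega> \<in> X p} \<omega>"
      using \<omega> by (simp add: indicator_def f)
  qed
  finally show ?thesis .
qed

text \<open>Cylinder events are an intersection-stable generator, so Dynkin's induction applies. Its
  step for complements uses that constants belong to \<open>Hcl\<close>.\<close>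

lemma orthogonal_Hcl_F:
  assumes W: "square_integrable M W" and orth: "\<And>g. g \<in> Hcl \<Longrightarrow> expectation (\<lambda>\<omega>. g \<omega> * W \<omega>) = 0"
    and A: "A \<in> sets (F T)"
  shows "expectation (\<lambda>\<omega>. indicator A \<omega> * W \<omega>) = 0"
proof -
  let ?\<G> = "{{\<omega> \<in> space M. \<forall>p\<in>K. B (fst p) (snd p) \<omega> \<in> X p} | K X.
     finite K \<and> K \<subseteq> {1..d} \<times> {0..T} \<and> (\<forall>p\<in>K. X p \<in> sets borel)}"
  have stable: "Int_stable ?\<G>"
  proof (rule Int_stableI)
    fix a b assume "a \<in> ?\<G>" "b \<in> ?\<G>"
    then obtain K X K' X' where
      a: "a = {\<omega> \<in> space M. \<forall>p\<in>K. B (fst p) (snd p) \<omega> \<in> X p}" "finite K" "K \<subseteq> {1..d} \<times> {0..T}"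
        "\<forall>p\<in>K. X p \<in> sets borel" and
      b: "b = {\<omega> \<in> space M. \<forall>p\<in>K'. B (fst p) (snd p) \<omega> \<in> X' p}" "finite K'" "K' \<subseteq> {1..d} \<times> {0..T}"
        "\<forall>p\<in>K'. X' p \<in> sets borel" by auto
    let ?X = "\<lambda>p. (if p \<in> K then X p else UNIV) \<inter> (if p \<in> K' then X' p else UNIV)"
    have "a \<inter> b = {\<omega> \<in> space M. \<forall>p\<in>K \<union> K'. B (fst p) (snd p) \<omega> \<in> ?X p}"
      unfolding a b by (auto split: if_splits)
    then show "a \<inter> b \<in> ?\<G>"
      using a(2-4) b(2-4) by (intro CollectI exI[of _ "K \<union> K'"] exI[of _ ?X]) auto
  qed
  have "sets (F T) \<subseteq> sigma_sets (space M) ?\<G>"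
    unfolding sets_F
  proof (rule sigma_sets_mono, safe)
    fix i r and A :: "real set" assume "i \<in> {1..d}" "r \<in> {0..T}" "A \<in> sets borel"
    then have "B i r -` A \<inter> space M \<in> ?\<G>"
      by (intro CollectI exI[of _ "{(i, r)}"] exI[of _ "\<lambda>_. A"]) auto
    then show "B i r -` A \<inter> space M \<in> sigma_sets (space M) ?\<G>" by (rule sigma_sets.Basic)
  qed
  with A have A': "A \<in> sigma_sets (space M) ?\<G>" by blast
  have \<G>M: "?\<G> \<subseteq> events"
  proof safe
    fix K and X :: "nat \<times> real \<Rightarrow> real set" assume K: "finite K" "K \<subseteq> {1..d} \<times> {0..T}" "\<forall>p\<in>K. X p \<in> sets borel"
    show "{\<omega> \<in> space M. \<forall>p\<in>K. B (fst p) (snd p) \<omega> \<in> X p} \<in> events"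
      using K(1)
    proof (rule sets.sets_Collect_finite_All[rotated])
      fix p assume "p \<in> K"
      then show "{\<omega> \<in> space M. B (fst p) (snd p) \<omega> \<in> X p} \<in> events"
        using K(2,3) by (intro sets_Collect_mem[of _ _ borel] B_measurable) auto
    qed
  qed
  then have \<sigma>M: "sigma_sets (space M) ?\<G> \<subseteq> events" by (rule sets.sigma_sets_subset)
  note iW = sqi_integrable[OF W]
  have iA: "integrable M (\<lambda>\<omega>. indicator A \<omega> * W \<omega>)" if "A \<in> events" for A
    using integrable_mult_indicator[OF that iW] by simp
  have EW: "expectation W = 0" using orth[OF const_Hcl[of 1]] by simp
  have "?\<G> \<subseteq> Pow (space M)" by auto
  from stable this A' show ?thesis
  proof (induction rule: sigma_sets_induct_disjoint)
    case (basic A)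
    then show ?case using orthogonal_Hcl_cylinder[OF W orth] by (auto simp: mult.commute)
  next
    case empty
    then show ?case by simp
  next
    case (compl A)
    then have "A \<in> events" using \<sigma>M by blast
    have "expectation (\<lambda>\<omega>. indicator (space M - A) \<omega> * W \<omega>) = expectation (\<lambda>\<omega>. W \<omega> - indicator A \<omega> * W \<omega>)"
      by (rule Bochner_Integration.integral_cong) (auto simp: indicator_def)
    then show ?case using compl.IH iA[OF \<open>A \<in> events\<close>] iW EW by simp
  next
    case (union A)
    have AM: "A i \<in> events" for i using union.hyps \<sigma>M by blast
    have "(LINT \<omega>:(\<Union>i. A i)|M. W \<omega>) = (suminf (\<lambda>i. LINT \<omega>:(A i)|M. W \<omega>))"
    proof (rule lebesgue_integral_countable_add)
      show "set_integrable M (\<Union>i. A i) W"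
        unfolding set_integrable_def using integrable_mult_indicator[of "\<Union>i. A i" M W] AM iW by auto
      show "A i \<inter> A j = {}" if "i \<noteq> j" for i j using union.hyps(1) that by (auto simp: disjoint_family_on_def)
    qed (rule AM)
    also have "\<dots> = 0" using union.IH by (simp add: set_lebesgue_integral_def)
    finally show ?case by (simp add: set_lebesgue_integral_def)
  qed
qed

text \<open>Orthogonality to the indicators of \<open>F T\<close> says that the conditional
  expectation of \<open>W\<close> vanishes. Hence \<open>W\<close> is orthogonal to every
  square-integrable \<open>F T\<close>-measurable function and, being in the closed span of these,
  to itself.\<close>

theorem total_in_L2:
  assumes W: "W \<in> ad T" and orth: "\<And>g. g \<in> Hcl \<Longrightarrow> expectation (\<lambda>\<omega>. g \<omega> * W \<omega>) = 0"
  shows "expectation (\<lambda>\<omega>. W \<omega> * W \<omega>) = 0"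
proof (rule L2cl_orthogonal[OF W L2cl_sqi[OF W]])
  note sW = L2cl_sqi[OF W]
  fix g assume g: "g \<in> borel_measurable (F T)" "square_integrable M g"
  have sub: "subalgebra M (F T)"
    using sets_F_subset[of T] by (simp add: subalgebra_def)
  interpret finite_measure_subalgebra M "F T" by unfold_locales (rule sub)
  have "AE \<omega> in M. real_cond_exp M (F T) W \<omega> = 0"
  proof (rule real_cond_exp_charact)
    show "(LINT \<omega>:A|M. W \<omega>) = (LINT \<omega>:A|M. 0)" if "A \<in> sets (F T)" for A
      using orthogonal_Hcl_F[OF sW orth that] by (simp add: set_lebesgue_integral_def)
  qed (auto intro: sqi_integrable[OF sW])
  then have "expectation (\<lambda>\<omega>. g \<omega> * real_cond_exp M (F T) W \<omega>) = expectation (\<lambda>\<omega>. 0)"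
    using measurable_F_M[OF g(1)] by (intro integral_cong_AE) auto
  then show "expectation (\<lambda>\<omega>. g \<omega> * W \<omega>) = 0"
    using real_cond_exp_intg(2)[OF sqi_mult[OF g(2) sW] g(1) sqi_measurable[OF sW]] by simp
qed

end

section \<open>Gram--Schmidt orthogonalisation of words\<close>

text \<open>Agrees with \<^const>\<open>sig_inner\<close>, but involves neither the Brownian motion nor its dimension.\<close>

definition word_inner :: "real \<Rightarrow> (nat list \<Rightarrow>\<^sub>0 real) \<Rightarrow> (nat list \<Rightarrow>\<^sub>0 real) \<Rightarrow> real" where
  "word_inner T p q = lin_ext (\<lambda>u. lin_ext (\<lambda>v. kern (rev u) (rev v) T T) q) p"

lemma linear_word_inner_left: "linear (\<lambda>p. word_inner T p q)"
  unfolding word_inner_def by (rule linear_lin_ext)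

lemma linear_word_inner_right: "linear (word_inner T p)"
proof (rule linearI)
  show "word_inner T p (q + r) = word_inner T p q + word_inner T p r" for q r
    unfolding word_inner_def linear_add[OF linear_lin_ext] by (simp add: lin_ext_def distrib_left sum.distrib)
  show "word_inner T p (c *\<^sub>R q) = c *\<^sub>R word_inner T p q" for c q
    unfolding word_inner_def linear_scale[OF linear_lin_ext]
    by (simp add: lin_ext_def sum_distrib_left mult_ac)
qed

lemma word_inner_word: "word_inner T (word u) (word v) = kern (rev u) (rev v) T T"
  by (simp add: word_inner_def)

lemma word_inner_eq_0:
  assumes "\<And>u v. u \<in> Poly_Mapping.keys p \<Longrightarrow> v \<in> Poly_Mapping.keys q \<Longrightarrow> \<not> equiv0 u v"
  shows "word_inner T p q = 0"
proof -
  have "kern (rev u) (rev v) T T = 0" if "u \<in> Poly_Mapping.keys p" "v \<in> Poly_Mapping.keys q" for u v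
    using assms[OF that] by (intro kern_eq_0) (simp add: equiv0_def flip: rev_filter)
  then show ?thesis unfolding word_inner_def lin_ext_def by (intro sum.neutral ballI) (simp add: sum.neutral)
qed

lemma words0_rev: "w \<in> words0 d \<longleftrightarrow> set (rev w) \<subseteq> {0..d} \<and> (rev w \<noteq> [] \<longrightarrow> hd (rev w) \<noteq> 0)"
  by (simp add: words0_def hd_rev)

lemma wf_less0: "wf {(u, v). less0 u v}"
  by (simp add: less0_def wf_lenlex)

lemma less0_total: "u \<noteq> v \<Longrightarrow> less0 u v \<or> less0 v u"
  using total_lenlex[of less_than] by (auto simp: less0_def total_on_def linorder_neq_iff)

lemma less0_length: "less0 u v \<Longrightarrow> length u \<le> length v"
  unfolding less0_def by (rule lenlex_length)

lemma finite_less0: "finite {v \<in> words0 d. equiv0 v w \<and> less0 v w}"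
  by (rule finite_subset[OF _ finite_lists_length_le[of "{0..d}" "length w"]])
    (auto simp: words0_def dest: less0_length)

lemma keys_diff_sum_subset:
  assumes "Poly_Mapping.keys p \<subseteq> S" "\<And>i. i \<in> I \<Longrightarrow> Poly_Mapping.keys (q i) \<subseteq> S"
  shows "Poly_Mapping.keys (p - (\<Sum>i\<in>I. c i *\<^sub>R q i)) \<subseteq> S"
proof
  fix k assume k: "k \<in> Poly_Mapping.keys (p - (\<Sum>i\<in>I. c i *\<^sub>R q i))"
  show "k \<in> S"
  proof (rule ccontr)
    assume "k \<notin> S"
    then have "k \<notin> Poly_Mapping.keys p" "\<And>i. i \<in> I \<Longrightarrow> k \<notin> Poly_Mapping.keys (q i)"
      using assms by blast+
    then have "Poly_Mapping.lookup p k = 0" "\<And>i. i \<in> I \<Longrightarrow> Poly_Mapping.lookup (q i) k = 0"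
      by (simp_all add: in_keys_iff)
    then have "Poly_Mapping.lookup (p - (\<Sum>i\<in>I. c i *\<^sub>R q i)) k = 0"
      by (simp add: lookup_minus lookup_sum)
    with k show False by (simp add: in_keys_iff)
  qed
qed

lemma keys_phat:
  assumes "w \<in> words0 d"
  shows "Poly_Mapping.keys (phat M d T B w) \<subseteq> {v \<in> words0 d. equiv0 v w}"
  using assms
proof (induction w rule: wf_induct_rule[OF wf_less0])
  case (1 w)
  show ?case
  proof (subst phat.simps, rule keys_diff_sum_subset)
    fix v assume v: "v \<in> {v \<in> words0 d. equiv0 v w \<and> less0 v w}"
    then have "Poly_Mapping.keys (phat M d T B v) \<subseteq> {u \<in> words0 d. equiv0 u v}" by (intro 1) auto
    also have "\<dots> \<subseteq> {u \<in> words0 d. equiv0 u w}" using v by (auto simp: equiv0_def)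
    finally show "Poly_Mapping.keys (phat M d T B v) \<subseteq> {u \<in> words0 d. equiv0 u w}" .
  qed (use 1 in \<open>auto simp: equiv0_def\<close>)
qed

context brownian
begin

lemma linear_signature: "linear (\<lambda>p. ito_signature M d T B p \<omega>)"
  unfolding ito_signature_def by (rule linear_lin_ext)

lemma ito_signature_word: "ito_signature M d T B (word w) = Iw (rev w) T"
  by (intro ext) (simp add: ito_signature_def)

lemma ad_signature:
  assumes "Poly_Mapping.keys p \<subseteq> words0 d"
  shows "ito_signature M d T B p \<in> ad T"
proof -
  have "Iw (rev w) T \<in> ad T" if "w \<in> Poly_Mapping.keys p" for w
    using that assms T_pos by (intro niceD(2) nice_Iw) (auto simp: words0_def)
  then show ?thesis
    unfolding ito_signature_def[abs_def] lin_ext_def real_scaleR_def by (intro L2cl_sum L2cl.scale)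
qed

lemma sqi_signature: "Poly_Mapping.keys p \<subseteq> words0 d \<Longrightarrow> square_integrable M (ito_signature M d T B p)"
  by (rule L2cl_sqi[OF ad_signature])

lemma sig_inner_eq:
  assumes "Poly_Mapping.keys p \<subseteq> words0 d" "Poly_Mapping.keys q \<subseteq> words0 d"
  shows "sig_inner M d T B p q = word_inner T p q"
proof -
  let ?I = "\<lambda>u v \<omega>. Iw (rev u) T \<omega> * Iw (rev v) T \<omega>"
  have sub: "set (rev w) \<subseteq> {0..d}" if "w \<in> words0 d" for w using that by (simp add: words0_def)
  have I: "integrable M (?I u v)" "expectation (?I u v) = kern (rev u) (rev v) T T"
    if "u \<in> Poly_Mapping.keys p" "v \<in> Poly_Mapping.keys q" for u v
  proof -
    have r: "set (rev u) \<subseteq> {0..d}" "set (rev v) \<subseteq> {0..d}" and T: "0 \<le> T" "T \<le> T"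
      using that assms sub T_pos by (blast, blast, simp_all)
    show "integrable M (?I u v)"
      by (intro sqi_mult niceD(3)[OF nice_Iw[OF r(1)] T] niceD(3)[OF nice_Iw[OF r(2)] T])
    show "expectation (?I u v) = kern (rev u) (rev v) T T" by (rule Iw_inner[OF r T T])
  qed
  have "sig_inner M d T B p q = expectation (\<lambda>\<omega>. \<Sum>u\<in>Poly_Mapping.keys p. \<Sum>v\<in>Poly_Mapping.keys q.
      (Poly_Mapping.lookup p u * Poly_Mapping.lookup q v) * ?I u v \<omega>)"
    unfolding sig_inner_def ito_signature_def lin_ext_def real_scaleR_def sum_product
    by (simp only: mult_ac)
  also have "\<dots> = (\<Sum>u\<in>Poly_Mapping.keys p. \<Sum>v\<in>Poly_Mapping.keys q.
      (Poly_Mapping.lookup p u * Poly_Mapping.lookup q v) * kern (rev u) (rev v) T T)"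
    using I by (subst Bochner_Integration.integral_sum; (intro sum.cong refl)?)
      (auto intro!: Bochner_Integration.integrable_sum sum.cong simp: Bochner_Integration.integral_sum)
  finally show ?thesis
    by (simp add: word_inner_def lin_ext_def sum_distrib_left mult_ac)
qed

lemma sig_inner_commute: "sig_inner M d T B p q = sig_inner M d T B q p"
  by (simp add: sig_inner_def mult.commute)

text \<open>Keeps Gram--Schmidt valid at a vanishing denominator: the numerator vanishes too, in
  accordance with x / 0 = 0.\<close>

lemma sig_inner_null:
  assumes "Poly_Mapping.keys p \<subseteq> words0 d" "Poly_Mapping.keys q \<subseteq> words0 d" "sig_inner M d T B q q = 0"
  shows "sig_inner M d T B p q = 0"
proof -
  have "(sig_inner M d T B p q)\<^sup>2 \<le> 0"
    using sqi_Cauchy_Schwarz[OF sqi_signature[OF assms(1)] sqi_signature[OF assms(2)]] assms(3)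
    by (simp add: sig_inner_def power2_eq_square)
  then show ?thesis by simp
qed

lemma keys_phat_words0: "w \<in> words0 d \<Longrightarrow> Poly_Mapping.keys (phat M d T B w) \<subseteq> words0 d"
  using keys_phat by blast

text \<open>The usual Gram--Schmidt induction. Linearity is taken from \<open>word_inner\<close>,
  which is bilinear without any integrability condition.\<close>

lemma phat_orthogonal_class:
  assumes "w \<in> words0 d" "u \<in> words0 d" "equiv0 u w" "less0 u w"
  shows "sig_inner M d T B (phat M d T B w) (phat M d T B u) = 0"
  using assms
proof (induction w arbitrary: u rule: wf_induct_rule[OF wf_less0])
  case (1 w)
  let ?p = "phat M d T B" and ?D = "{v \<in> words0 d. equiv0 v w \<and> less0 v w}"
  let ?c = "\<lambda>v. sig_inner M d T B (word w) (?p v) / sig_inner M d T B (?p v) (?p v)"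
  note k = keys_phat_words0
  have u: "u \<in> ?D" using 1 by simp
  have kw: "Poly_Mapping.keys (word w) \<subseteq> words0 d" using 1 by simp
  \<comment> \<open>Two earlier vectors are orthogonal by the induction hypothesis for the later one
    of them.\<close>
  have orth: "sig_inner M d T B (?p v) (?p u) = 0" if "v \<in> ?D" "v \<noteq> u" for v
    using less0_total[OF that(2)]
  proof
    assume "less0 v u"
    then have "sig_inner M d T B (?p u) (?p v) = 0"
      using that u by (intro "1.IH") (auto simp: equiv0_def)
    then show ?thesis by (simp add: sig_inner_commute)
  next
    assume "less0 u v"
    then show ?thesis using that u by (intro "1.IH") (auto simp: equiv0_def)
  qed
  have "sig_inner M d T B (?p w) (?p u) = word_inner T (?p w) (?p u)"
    using 1 k by (intro sig_inner_eq)
  also have "\<dots> = word_inner T (word w) (?p u) - (\<Sum>v\<in>?D. ?c v * word_inner T (?p v) (?p u))"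
    by (subst phat.simps[of M d T B w])
      (simp only: linear_diff[OF linear_word_inner_left] linear_sum[OF linear_word_inner_left]
        linear_scale[OF linear_word_inner_left] real_scaleR_def)
  also have "\<dots> = sig_inner M d T B (word w) (?p u) - (\<Sum>v\<in>?D. ?c v * sig_inner M d T B (?p v) (?p u))"
    using 1 k kw by (simp add: sig_inner_eq)
  also have "(\<Sum>v\<in>?D. ?c v * sig_inner M d T B (?p v) (?p u))
      = (\<Sum>v\<in>{u}. ?c v * sig_inner M d T B (?p v) (?p u))"
    using u orth by (intro sum.mono_neutral_right finite_less0) auto
  also have "\<dots> = sig_inner M d T B (word w) (?p u)"
    using sig_inner_null[OF kw k[OF 1(3)]] by simp
  finally show ?case by simp
qed

lemma phat_orthogonal:
  assumes "u \<in> words0 d" "v \<in> words0 d" "u \<noteq> v"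
  shows "sig_inner M d T B (phat M d T B u) (phat M d T B v) = 0"
proof (cases "equiv0 u v")
  case True
  then have e: "equiv0 v u" by (simp add: equiv0_def)
  from less0_total[OF assms(3)] show ?thesis
  proof
    assume "less0 u v"
    from phat_orthogonal_class[OF assms(2,1) True this] show ?thesis by (simp add: sig_inner_commute)
  next
    assume "less0 v u"
    from phat_orthogonal_class[OF assms(1,2) e this] show ?thesis .
  qed
next
  case False
  have "word_inner T (phat M d T B u) (phat M d T B v) = 0"
  proof (rule word_inner_eq_0)
    fix x y assume "x \<in> Poly_Mapping.keys (phat M d T B u)" "y \<in> Poly_Mapping.keys (phat M d T B v)"
    then have "equiv0 x u" "equiv0 y v" using keys_phat[OF assms(1)] keys_phat[OF assms(2)] by blast+
    with False show "\<not> equiv0 x y" by (simp add: equiv0_def)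
  qed
  then show ?thesis by (simp add: sig_inner_eq keys_phat_words0 assms)
qed

end

section \<open>Orthogonal series\<close>

text \<open>Members of the family may vanish almost everywhere; then the corresponding coefficient is
  \<open>0\<close> because of \<open>x / 0 = 0\<close>.\<close>

lemma (in prob_space) orthogonal_series:
  fixes e :: "'i::countable \<Rightarrow> 'a \<Rightarrow> real"
  assumes e: "\<And>i. i \<in> I \<Longrightarrow> e i \<in> L2cl M S" and Y: "Y \<in> L2cl M S"
    and orth: "\<And>i j. i \<in> I \<Longrightarrow> j \<in> I \<Longrightarrow> i \<noteq> j \<Longrightarrow> expectation (\<lambda>\<omega>. e i \<omega> * e j \<omega>) = 0"
    and total: "\<And>W. W \<in> L2cl M S \<Longrightarrow> (\<And>i. i \<in> I \<Longrightarrow> expectation (\<lambda>\<omega>. e i \<omega> * W \<omega>) = 0)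
      \<Longrightarrow> expectation (\<lambda>\<omega>. W \<omega> * W \<omega>) = 0"
  defines "c \<equiv> \<lambda>i. expectation (\<lambda>\<omega>. Y \<omega> * e i \<omega>) / expectation (\<lambda>\<omega>. e i \<omega> * e i \<omega>)"
  shows "((\<lambda>A. expectation (\<lambda>\<omega>. (Y \<omega> - (\<Sum>i\<in>A. c i * e i \<omega>))\<^sup>2)) \<longlongrightarrow> 0) (finite_subsets_at_top I)"
proof -
  note se = L2cl_sqi[OF e] and sY = L2cl_sqi[OF Y]
  define s where "s A \<omega> = (\<Sum>i\<in>A. c i * e i \<omega>)" for A \<omega>
  define b where "b i = (c i)\<^sup>2 * expectation (\<lambda>\<omega>. e i \<omega> * e i \<omega>)" for i
  have b0: "0 \<le> b i" for i unfolding b_def by (intro mult_nonneg_nonneg integral_nonneg_AE) auto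
  have sS: "s A \<in> L2cl M S" if "A \<subseteq> I" for A
    unfolding s_def[abs_def] using that by (intro L2cl_sum L2cl.scale e) auto
  note ss = L2cl_sqi[OF sS]
  \<comment> \<open>If \<open>e i\<close> has norm 0, Cauchy--Schwarz makes the left-hand side
    vanish as well.\<close>
  have Ye: "expectation (\<lambda>\<omega>. Y \<omega> * e i \<omega>) = c i * expectation (\<lambda>\<omega>. e i \<omega> * e i \<omega>)" if "i \<in> I" for i
  proof -
    have "expectation (\<lambda>\<omega>. e i \<omega> * e i \<omega>) = 0 \<Longrightarrow> (expectation (\<lambda>\<omega>. Y \<omega> * e i \<omega>))\<^sup>2 \<le> 0"
      using sqi_Cauchy_Schwarz[OF sY se[OF that]] by (simp add: power2_eq_square)
    then show ?thesis by (cases "expectation (\<lambda>\<omega>. e i \<omega> * e i \<omega>) = 0") (simp_all add: c_def)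
  qed
  have es: "expectation (\<lambda>\<omega>. e i \<omega> * s A \<omega>) = (if i \<in> A then c i * expectation (\<lambda>\<omega>. e i \<omega> * e i \<omega>) else 0)"
    if "finite A" "A \<subseteq> I" "i \<in> I" for A i
  proof -
    have "expectation (\<lambda>\<omega>. e i \<omega> * s A \<omega>) = expectation (\<lambda>\<omega>. \<Sum>j\<in>A. c j * (e i \<omega> * e j \<omega>))"
      by (simp add: s_def sum_distrib_left mult_ac)
    also have "\<dots> = (\<Sum>j\<in>A. c j * expectation (\<lambda>\<omega>. e i \<omega> * e j \<omega>))"
      using that by (subst Bochner_Integration.integral_sum) (auto intro!: sqi_mult se)
    also have "\<dots> = (\<Sum>j\<in>A. if j = i then c i * expectation (\<lambda>\<omega>. e i \<omega> * e i \<omega>) else 0)"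
      using that orth[OF that(3)] by (intro sum.cong) auto
    finally show ?thesis using that by simp
  qed
  have norm_s: "expectation (\<lambda>\<omega>. s A \<omega> * s A \<omega>) = sum b A" if "finite A" "A \<subseteq> I" for A
  proof -
    have "expectation (\<lambda>\<omega>. s A \<omega> * s A \<omega>) = expectation (\<lambda>\<omega>. \<Sum>i\<in>A. c i * (e i \<omega> * s A \<omega>))"
      by (subst (1) s_def) (simp add: sum_distrib_right mult.assoc)
    also have "\<dots> = (\<Sum>i\<in>A. c i * expectation (\<lambda>\<omega>. e i \<omega> * s A \<omega>))"
      using that by (subst Bochner_Integration.integral_sum) (auto intro!: sqi_mult se ss)
    also have "\<dots> = sum b A"
      using that es[OF that] by (intro sum.cong) (auto simp: b_def power2_eq_square)
    finally show ?thesis .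
  qed
  have Ys: "expectation (\<lambda>\<omega>. Y \<omega> * s A \<omega>) = sum b A" if "finite A" "A \<subseteq> I" for A
  proof -
    have "expectation (\<lambda>\<omega>. Y \<omega> * s A \<omega>) = expectation (\<lambda>\<omega>. \<Sum>i\<in>A. c i * (Y \<omega> * e i \<omega>))"
      by (simp add: s_def sum_distrib_left mult_ac)
    also have "\<dots> = (\<Sum>i\<in>A. c i * expectation (\<lambda>\<omega>. Y \<omega> * e i \<omega>))"
      using that by (subst Bochner_Integration.integral_sum) (auto intro!: sqi_mult se sY)
    also have "\<dots> = sum b A"
      using that Ye by (intro sum.cong) (auto simp: b_def power2_eq_square)
    finally show ?thesis .
  qed
  have res: "l2d M Y (s A) = expectation (\<lambda>\<omega>. Y \<omega> * Y \<omega>) - sum b A" if "finite A" "A \<subseteq> I" for A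
    using l2d_expand[OF sY ss[OF that(2)]] norm_s[OF that] Ys[OF that] by (simp add: power2_eq_square)
  have diff: "l2d M (s A) (s A') = sum b A' - sum b A" if "finite A'" "A \<subseteq> A'" "A' \<subseteq> I" for A A'
  proof -
    have "s A' \<omega> - s A \<omega> = s (A' - A) \<omega>" for \<omega>
      unfolding s_def using that by (simp add: sum_diff)
    then have "l2d M (s A') (s A) = expectation (\<lambda>\<omega>. s (A' - A) \<omega> * s (A' - A) \<omega>)"
      by (simp add: l2d_def power2_eq_square)
    also have "\<dots> = sum b (A' - A)" using that by (intro norm_s) auto
    also have "\<dots> = sum b A' - sum b A" using that by (intro sum_diff) auto
    finally show ?thesis by (simp add: l2d_commute)
  qed
  \<comment> \<open>An exhaustion of the index set by finite sets, so that completeness can be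
    applied to a sequence.\<close>
  define A where "A n = {i \<in> I. to_nat i < n}" for n
  have finA: "finite (A n)" for n
    unfolding A_def by (rule finite_subset[OF _ finite_vimageI[of "{..<n}" to_nat]]) auto
  have AI: "A n \<subseteq> I" for n by (auto simp: A_def)
  have Amono: "A m \<subseteq> A n" if "m \<le> n" for m n using that by (auto simp: A_def)
  let ?a = "\<lambda>n. sum b (A n)"
  \<comment> \<open>Bessel's inequality, read off from \<open>res\<close>, bounds these sums. They
    converge, and by \<open>diff\<close> the partial sums of the series are Cauchy.\<close>
  have "incseq ?a" using Amono finA b0 by (intro incseq_SucI sum_mono2) auto
  moreover have "?a n \<le> expectation (\<lambda>\<omega>. Y \<omega> * Y \<omega>)" for n
    using res[OF finA AI, of n] l2d_nonneg[of M Y "s (A n)"] by linarith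
  ultimately obtain L where "?a \<longlonglongrightarrow> L" using incseq_convergent[of ?a] by blast
  then have "Cauchy ?a" by (rule LIMSEQ_imp_Cauchy)
  then have Cauchy: "\<exists>K. \<forall>m\<ge>K. \<forall>n\<ge>K. l2d M (s (A m)) (s (A n)) < r" if "0 < r" for r
  proof -
    from \<open>Cauchy ?a\<close> that obtain K where K: "\<And>m n. m \<ge> K \<Longrightarrow> n \<ge> K \<Longrightarrow> dist (?a m) (?a n) < r"
      unfolding Cauchy_def by meson
    have "l2d M (s (A m)) (s (A n)) \<le> dist (?a m) (?a n)" for m n
    proof (cases "m \<le> n")
      case True
      then show ?thesis using diff[OF finA[of n] Amono[OF True] AI] by (simp add: dist_real_def)
    next
      case False
      then have "n \<le> m" by simp
      then show ?thesis using diff[OF finA[of m] Amono[OF \<open>n \<le> m\<close>] AI] by (simp add: dist_real_def l2d_commute[of M "s (A m)"])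
    qed
    with K show ?thesis by (meson le_less_trans)
  qed
  obtain Z where sZ: "square_integrable M Z" and Z: "(\<lambda>n. l2d M (s (A n)) Z) \<longlonglongrightarrow> 0"
    using l2_complete[OF ss[OF AI] Cauchy] by blast
  have ZS: "Z \<in> L2cl M S" by (rule L2cl.lim[OF sS[OF AI] sZ Z])
  have eZ: "expectation (\<lambda>\<omega>. e i \<omega> * (Y \<omega> - Z \<omega>)) = 0" if i: "i \<in> I" for i
  proof -
    have "(\<lambda>n. expectation (\<lambda>\<omega>. s (A n) \<omega> * e i \<omega>)) \<longlonglongrightarrow> expectation (\<lambda>\<omega>. Z \<omega> * e i \<omega>)"
      by (rule inner_tendsto_left[OF ss[OF AI] sZ se[OF i] Z])
    moreover have "eventually (\<lambda>n. expectation (\<lambda>\<omega>. s (A n) \<omega> * e i \<omega>) = expectation (\<lambda>\<omega>. Y \<omega> * e i \<omega>)) sequentially"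
    proof (rule eventually_sequentiallyI[of "Suc (to_nat i)"])
      fix n assume "Suc (to_nat i) \<le> n"
      then have "i \<in> A n" using i by (simp add: A_def)
      then show "expectation (\<lambda>\<omega>. s (A n) \<omega> * e i \<omega>) = expectation (\<lambda>\<omega>. Y \<omega> * e i \<omega>)"
        using es[OF finA AI i, of n] Ye[OF i] by (simp add: mult.commute)
    qed
    then have "(\<lambda>n. expectation (\<lambda>\<omega>. s (A n) \<omega> * e i \<omega>)) \<longlonglongrightarrow> expectation (\<lambda>\<omega>. Y \<omega> * e i \<omega>)"
      by (rule tendsto_eventually)
    ultimately have "expectation (\<lambda>\<omega>. Z \<omega> * e i \<omega>) = expectation (\<lambda>\<omega>. Y \<omega> * e i \<omega>)"
      by (rule LIMSEQ_unique)
    then show ?thesis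
      using sqi_mult[OF sY se[OF i]] sqi_mult[OF sZ se[OF i]] by (simp add: right_diff_distrib mult.commute)
  qed
  have "expectation (\<lambda>\<omega>. (Y \<omega> - Z \<omega>) * (Y \<omega> - Z \<omega>)) = 0"
    by (rule total[OF L2cl_diff[OF Y ZS] eZ])
  then have "l2d M Y Z = 0" by (simp add: l2d_def power2_eq_square)
  then have YZ: "l2d M Z Y = 0" by (simp only: l2d_commute)
  have lim: "(\<lambda>n. l2d M Y (s (A n))) \<longlonglongrightarrow> 0"
  proof (rule tendsto_sandwich[OF _ _ tendsto_const])
    show "(\<lambda>n. 2 * l2d M (s (A n)) Z + 2 * l2d M Z Y) \<longlonglongrightarrow> 0"
      using tendsto_mult[OF tendsto_const[of 2] Z] YZ by simp
    have "l2d M Y (s (A n)) \<le> 2 * l2d M (s (A n)) Z + 2 * l2d M Z Y" for n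
      using l2d_triangle[OF ss[OF AI] sZ sY] by (simp add: l2d_commute[of M Y])
    then show "eventually (\<lambda>n. l2d M Y (s (A n)) \<le> 2 * l2d M (s (A n)) Z + 2 * l2d M Z Y) sequentially"
      by simp
  qed simp
  show ?thesis
  proof (rule tendstoI)
    fix r :: real assume "0 < r"
    with lim obtain n where n: "l2d M Y (s (A n)) < r"
      using order_tendstoD(2)[of _ 0 sequentially r] eventually_happens trivial_limit_sequentially by blast
    \<comment> \<open>By \<open>res\<close> a larger index set has a smaller error, so convergence
      along one exhaustion implies convergence of the net of finite subsets.\<close>
    have "l2d M Y (s A') < r" if "finite A'" "A n \<subseteq> A'" "A' \<subseteq> I" for A'
      using n res[OF finA AI, of n] res[OF that(1,3)] sum_mono2[OF that(1,2), of b] b0 by simp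
    then show "eventually (\<lambda>A. dist (expectation (\<lambda>\<omega>. (Y \<omega> - (\<Sum>i\<in>A. c i * e i \<omega>))\<^sup>2)) 0 < r) (finite_subsets_at_top I)"
      unfolding eventually_finite_subsets_at_top
      using finA[of n] AI[of n] by (intro exI[of _ "A n"]) (auto simp: l2d_def s_def dist_real_def)
  qed
qed

context brownian
begin

lemma chaos_summand_eq:
  "chaos_summand M d T B Y w = (\<lambda>\<omega>. expectation (\<lambda>\<omega>. Y \<omega> * ito_signature M d T B (phat M d T B w) \<omega>)
     / expectation (\<lambda>\<omega>. ito_signature M d T B (phat M d T B w) \<omega> * ito_signature M d T B (phat M d T B w) \<omega>)
     * ito_signature M d T B (phat M d T B w) \<omega>)"
  by (intro ext) (simp add: chaos_summand_def sig_inner_def)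

lemma sqi_chaos_summand: "w \<in> words0 d \<Longrightarrow> square_integrable M (chaos_summand M d T B Y w)"
  unfolding chaos_summand_def[abs_def] by (intro sqi_scale sqi_signature keys_phat_words0)

lemma chaos_summand_orthogonal:
  assumes "u \<in> words0 d" "v \<in> words0 d" "u \<noteq> v"
  shows "expectation (\<lambda>\<omega>. chaos_summand M d T B Y u \<omega> * chaos_summand M d T B Y v \<omega>) = 0"
proof -
  have "expectation (\<lambda>\<omega>. (a * ito_signature M d T B (phat M d T B u) \<omega>) * (b * ito_signature M d T B (phat M d T B v) \<omega>))
    = a * b * sig_inner M d T B (phat M d T B u) (phat M d T B v)" for a b
    unfolding sig_inner_def by (subst Bochner_Integration.integral_mult_right_zero[symmetric]) (simp only: mult_ac)
  then show ?thesis unfolding chaos_summand_def using phat_orthogonal[OF assms] by simp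
qed

text \<open>By its recursion, \<open>phat\<close> of a word differs from the word by a combination
  of \<open>phat\<close> of earlier words. Orthogonality to all of these is therefore orthogonality
  to all words.\<close>

lemma signature_total:
  assumes W: "W \<in> ad T"
    and orth: "\<And>w. w \<in> words0 d \<Longrightarrow> expectation (\<lambda>\<omega>. ito_signature M d T B (phat M d T B w) \<omega> * W \<omega>) = 0"
  shows "expectation (\<lambda>\<omega>. W \<omega> * W \<omega>) = 0"
proof (rule total_in_L2[OF W])
  let ?p = "phat M d T B"
  fix g assume "g \<in> Hcl"
  then show "expectation (\<lambda>\<omega>. g \<omega> * W \<omega>) = 0"
    unfolding Hcl_def
  proof (rule L2cl_orthogonal[OF _ L2cl_sqi[OF W]])
    fix h assume "h \<in> {Iw w T | w. set w \<subseteq> {0..d} \<and> (w \<noteq> [] \<longrightarrow> hd w \<noteq> 0)}"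
    then obtain w where w: "rev w \<in> words0 d" and h: "h = Iw w T"
      by (auto simp: words0_rev)
    let ?D = "{v \<in> words0 d. equiv0 v (rev w) \<and> less0 v (rev w)}"
    have hw: "h = ito_signature M d T B (word (rev w))" by (simp add: h ito_signature_word)
    obtain c where "?p (rev w) = word (rev w) - (\<Sum>v\<in>?D. c v *\<^sub>R ?p v)"
      using phat.simps[of M d T B "rev w"] by auto
    then have "word (rev w) = ?p (rev w) + (\<Sum>v\<in>?D. c v *\<^sub>R ?p v)" by simp
    then have "ito_signature M d T B (word (rev w)) \<omega>
        = ito_signature M d T B (?p (rev w)) \<omega> + (\<Sum>v\<in>?D. c v * ito_signature M d T B (?p v) \<omega>)" for \<omega>
      by (simp add: linear_add[OF linear_signature] linear_sum[OF linear_signature] linear_scale[OF linear_signature])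
    then have "h \<omega> * W \<omega> = ito_signature M d T B (?p (rev w)) \<omega> * W \<omega>
        + (\<Sum>v\<in>?D. c v * (ito_signature M d T B (?p v) \<omega> * W \<omega>))" for \<omega>
      by (simp add: distrib_right sum_distrib_right mult.assoc hw)
    moreover have i: "integrable M (\<lambda>\<omega>. ito_signature M d T B (?p v) \<omega> * W \<omega>)" if "v \<in> words0 d" for v
      using that by (intro sqi_mult sqi_signature keys_phat_words0 L2cl_sqi[OF W])
    moreover have "expectation (\<lambda>\<omega>. \<Sum>v\<in>?D. c v * (ito_signature M d T B (?p v) \<omega> * W \<omega>)) = 0"
      using orth i by (subst Bochner_Integration.integral_sum) auto
    ultimately show "expectation (\<lambda>\<omega>. h \<omega> * W \<omega>) = 0"
      using orth[OF w] w
      by (simp only:) (subst Bochner_Integration.integral_add; auto)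
  qed
qed

theorem chaos_expansion:
  assumes Y: "Y \<in> borel_measurable (F T)" "square_integrable M Y"
  shows "((\<lambda>A. expectation (\<lambda>\<omega>. (Y \<omega> - (\<Sum>w\<in>A. chaos_summand M d T B Y w \<omega>))\<^sup>2)) \<longlongrightarrow> 0)
    (finite_subsets_at_top (words0 d))"
  unfolding chaos_summand_eq
proof (rule orthogonal_series)
  show "ito_signature M d T B (phat M d T B w) \<in> ad T" if "w \<in> words0 d" for w
    using that by (intro ad_signature keys_phat_words0)
  show "Y \<in> ad T" by (rule L2cl.base[OF Y])
  show "expectation (\<lambda>\<omega>. ito_signature M d T B (phat M d T B u) \<omega> * ito_signature M d T B (phat M d T B v) \<omega>) = 0"
    if "u \<in> words0 d" "v \<in> words0 d" "u \<noteq> v" for u v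
    using phat_orthogonal[OF that] by (simp add: sig_inner_def)
qed (rule signature_total)

end

section \<open>Linear independence of words in the tensor algebra\<close>

text \<open>The tensor product of linear functionals, evaluated on tuples; being multilinear it
  descends to the tensor algebra, where it serves to separate words.\<close>

fun tensor_pairing :: "('w \<Rightarrow> real) list \<Rightarrow> 'w list \<Rightarrow> real" where
  "tensor_pairing [] [] = 1"
| "tensor_pairing (l # ls) (v # vs) = l v * tensor_pairing ls vs"
| "tensor_pairing _ _ = 0"

lemma tensor_pairing_add:
  assumes "\<And>l. l \<in> set ls \<Longrightarrow> linear l"
  shows "tensor_pairing ls (xs @ (a + b) # ys) = tensor_pairing ls (xs @ a # ys) + tensor_pairing ls (xs @ b # ys)"
  using assms
proof (induction xs arbitrary: ls)
  case Nil
  then show ?case by (cases ls) (simp_all add: linear_add distrib_right)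
next
  case (Cons x xs)
  then show ?case by (cases ls) (simp_all add: distrib_left)
qed

lemma tensor_pairing_scale:
  assumes "\<And>l. l \<in> set ls \<Longrightarrow> linear l"
  shows "tensor_pairing ls (xs @ (c *\<^sub>R a) # ys) = c * tensor_pairing ls (xs @ a # ys)"
  using assms
proof (induction xs arbitrary: ls)
  case Nil
  then show ?case by (cases ls) (simp_all add: linear_scale)
next
  case (Cons x xs)
  then show ?case by (cases ls) simp_all
qed

lift_definition tensor_dual :: "('w::real_vector \<Rightarrow> real) list \<Rightarrow> 'w tensor_alg \<Rightarrow> real"
  is "\<lambda>ls p. if \<forall>l\<in>set ls. linear l then lin_ext (tensor_pairing ls) p else 0"
proof -
  fix ls :: "('w \<Rightarrow> real) list" and p q :: "'w list \<Rightarrow>\<^sub>0 real"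
  assume pq: "tensor_eq p q"
  show "(if \<forall>l\<in>set ls. linear l then lin_ext (tensor_pairing ls) p else 0)
    = (if \<forall>l\<in>set ls. linear l then lin_ext (tensor_pairing ls) q else 0)"
  proof (cases "\<forall>l\<in>set ls. linear l")
    case True
    have "lin_ext (tensor_pairing ls) r = 0" if "r \<in> tensor_relations" for r
      using that[unfolded tensor_relations_def]
    proof (induction rule: span_induct)
      case base
      show "subspace {r. lin_ext (tensor_pairing ls) r = 0}"
        by (rule linear_subspace_kernel[OF linear_lin_ext])
    next
      case (step r)
      then show ?case
        using True by (auto simp: linear_diff[OF linear_lin_ext] linear_scale[OF linear_lin_ext]
          tensor_pairing_add tensor_pairing_scale)
    qed
    with pq have "lin_ext (tensor_pairing ls) (p - q) = 0" by (simp add: tensor_eq_def)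
    then show ?thesis by (simp add: linear_diff[OF linear_lin_ext])
  qed (simp only: if_False)
qed

lemma linear_tensor_dual: "linear (tensor_dual ls)"
proof (rule linearI)
  show "tensor_dual ls (x + y) = tensor_dual ls x + tensor_dual ls y" for x y
    by transfer (simp add: linear_add[OF linear_lin_ext])
  show "tensor_dual ls (c *\<^sub>R x) = c *\<^sub>R tensor_dual ls x" for c x
    by transfer (simp add: linear_scale[OF linear_lin_ext])
qed

lemma tensor_dual_tensor: "(\<And>l. l \<in> set ls \<Longrightarrow> linear l) \<Longrightarrow> tensor_dual ls (tensor vs) = tensor_pairing ls vs"
  by transfer simp

lemma linear_tensor_slot: "linear (\<lambda>x. tensor (xs @ x # ys))"
proof (rule linearI)
  show "tensor (xs @ (a + b) # ys) = tensor (xs @ a # ys) + tensor (xs @ b # ys)" for a b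
    by (transfer, unfold tensor_eq_def diff_diff_eq[symmetric], rule tensor_relations_add)
  show "tensor (xs @ (c *\<^sub>R a) # ys) = c *\<^sub>R tensor (xs @ a # ys)" for a c
    by (transfer, unfold tensor_eq_def, rule tensor_relations_scale)
qed

lemma linear_realise: "linear (realise f)"
  unfolding realise_def by (rule linear_lin_ext)

lemma realise_word: "realise f (word w) = tensor (map (letter f) w)"
  by (simp add: realise_def)

definition letter_dual :: "(nat \<Rightarrow> 'v::euclidean_space) \<Rightarrow> nat \<Rightarrow> real \<times> 'v \<Rightarrow> real" where
  "letter_dual f a x = (if a = 0 then fst x else f a \<bullet> snd x)"

lemma linear_letter_dual: "linear (letter_dual f a)"
  by (rule linearI) (auto simp: letter_dual_def inner_add_right)

lemma tensor_dual_word: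
  assumes f: "orthonormal_basis V d f" and "set u \<subseteq> {0..d}" "set v \<subseteq> {0..d}"
  shows "tensor_dual (map (letter_dual f) u) (realise f (word v)) = (if u = v then 1 else 0)"
proof -
  have l: "letter_dual f a (letter f b) = (if a = b then 1 else 0)" if "a \<le> d" "b \<le> d" for a b
  proof (cases "a = 0 \<or> b = 0")
    case False
    then have "a \<in> {1..d}" "b \<in> {1..d}" using that by auto
    then have "f a \<bullet> f b = (if a = b then 1 else 0)" using f unfolding orthonormal_basis_def by blast
    then show ?thesis using False by (simp add: letter_dual_def letter_def)
  qed (auto simp: letter_dual_def letter_def)
  have "tensor_pairing (map (letter_dual f) u) (map (letter f) v) = (if u = v then 1 else 0)"
    using assms(2,3)
  proof (induction u arbitrary: v)
    case Nil
    then show ?case by (cases v) simp_all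
  next
    case (Cons a u)
    then show ?case by (cases v) (auto simp: l)
  qed
  then show ?thesis
    by (subst realise_word, subst tensor_dual_tensor) (auto simp: linear_letter_dual)
qed

text \<open>Words in an orthonormal basis are linearly independent, because the tensor product of
  the dual letters of a word is 1 on this word and 0 on all others. The choice in
  \<open>phat_map\<close> is thereby justified.\<close>

lemma words_linear_extension:
  assumes f: "orthonormal_basis V d f"
  shows "\<exists>P. linear P \<and> (\<forall>w\<in>words0 d. P (realise f (word w)) = g w)"
proof -
  let ?r = "\<lambda>w. realise f (word w)"
  have sub: "set w \<subseteq> {0..d}" if "w \<in> words0 d" for w using that by (simp add: words0_def)
  have dual: "tensor_dual (map (letter_dual f) u) (?r v) = (if u = v then 1 else 0)"
    if "u \<in> words0 d" "v \<in> words0 d" for u v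
    by (rule tensor_dual_word[OF f sub[OF that(1)] sub[OF that(2)]])
  have inj: "inj_on ?r (words0 d)"
    by (rule inj_onI) (metis dual zero_neq_one)
  have "independent (?r ` words0 d)"
    unfolding dependent_def
  proof safe
    fix w assume w: "w \<in> words0 d" and s: "?r w \<in> span (?r ` words0 d - {?r w})"
    from s have "tensor_dual (map (letter_dual f) w) (?r w) = 0"
    proof (induction rule: span_induct)
      case base
      show ?case by (rule linear_subspace_kernel[OF linear_tensor_dual])
    next
      case (step x)
      then show ?case using w dual by auto
    qed
    then show False using dual[OF w w] by simp
  qed
  from linear_independent_extend[OF this, of "\<lambda>x. g (the_inv_into (words0 d) ?r x)"]
  show ?thesis using the_inv_into_f_f[OF inj] by auto
qed

lemma phat_map_spec:
  assumes "orthonormal_basis V d f"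
  shows "linear (phat_map M d T B f)"
    and "w \<in> words0 d \<Longrightarrow> phat_map M d T B f (realise f (word w)) = realise f (phat M d T B w)"
  using someI_ex[OF words_linear_extension[OF assms, of "\<lambda>w. realise f (phat M d T B w)"]]
  unfolding phat_map_def by blast+


section \<open>Naturality\<close>

text \<open>A word is determined by its pattern of zeros and by the list of its nonzero letters. Lists over
  \<open>{0, 1}\<close> serve as patterns, \<open>fill z p xs\<close> puts \<open>z\<close> at the zeros of \<open>p\<close> and the entries of \<open>xs\<close>
  elsewhere. Words with the same nonzero letters are ordered by their patterns, and their inner
  products depend on the patterns only, hence so do the coefficients of \<^const>\<open>phat\<close>.\<close>

abbreviation ones :: "nat list \<Rightarrow> nat" where
  "ones p \<equiv> length (filter (\<lambda>a. a \<noteq> 0) p)"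

primrec fill :: "'x \<Rightarrow> nat list \<Rightarrow> 'x list \<Rightarrow> 'x list" where
  "fill z [] xs = []"
| "fill z (a # p) xs = (if a = 0 then z # fill z p xs else hd xs # fill z p (tl xs))"

lemma length_fill [simp]: "length (fill z p xs) = length p"
  by (induction p arbitrary: xs) auto

lemma map_fill: "length xs = ones p \<Longrightarrow> map h (fill z p xs) = fill (h z) p (map h xs)"
proof (induction p arbitrary: xs)
  case (Cons a p)
  then show ?case by (cases xs) auto
qed simp

lemma filter_fill:
  "length xs = ones p \<Longrightarrow> 0 \<notin> set xs \<Longrightarrow> filter (\<lambda>a. a \<noteq> 0) (fill 0 p xs) = xs"
proof (induction p arbitrary: xs)
  case (Cons a p)
  then show ?case
    using Cons.IH[of xs] Cons.IH[of "tl xs"]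
    by (cases "a = 0"; cases xs) (auto simp del: neq0_conv)
qed simp

lemma zero_pattern_fill:
  "length xs = ones p \<Longrightarrow> 0 \<notin> set xs \<Longrightarrow> set p \<subseteq> {0..1} \<Longrightarrow> zero_pattern (fill 0 p xs) = p"
proof (induction p arbitrary: xs)
  case (Cons a p)
  then show ?case
    using Cons.IH[of xs] Cons.IH[of "tl xs"]
    by (cases "a = 0"; cases xs) (auto simp del: neq0_conv)
qed simp

lemma fill_zero_pattern: "fill 0 (zero_pattern w) (filter (\<lambda>a. a \<noteq> 0) w) = w"
  by (induction w) (auto simp: zero_pattern_def)

lemma ones_zero_pattern: "filter (\<lambda>a. a \<noteq> 0) (zero_pattern w) = replicate (ones w) 1"
  by (induction w) (auto simp: zero_pattern_def)

lemma filter_pattern: "set p \<subseteq> {0..1} \<Longrightarrow> filter (\<lambda>a. a \<noteq> 0) p = replicate (ones p) 1"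
  by (induction p) auto

lemma zero_pattern_rev: "zero_pattern (rev w) = rev (zero_pattern w)"
  by (simp add: zero_pattern_def rev_map)

lemma zero_pattern_words0: "w \<in> words0 d \<Longrightarrow> zero_pattern w \<in> words0 1"
  by (auto simp: words0_def zero_pattern_def last_map)

lemma fill_words0:
  assumes "p \<in> words0 1" "length xs = ones p" "set xs \<subseteq> {1..d}"
  shows "fill 0 p xs \<in> words0 d"
proof -
  have nz: "0 \<notin> set xs" using assms(3) by auto
  have p: "set p \<subseteq> {0..1}" using assms by (simp add: words0_def)
  let ?w = "fill 0 p xs"
  note zp = zero_pattern_fill[OF assms(2) nz p]
  have "a = 0 \<or> a \<in> set xs" if "a \<in> set ?w" for a
  proof -
    have "{a \<in> set ?w. a \<noteq> 0} = set xs" unfolding set_filter[symmetric] filter_fill[OF assms(2) nz] ..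
    with that show ?thesis by blast
  qed
  then have "set ?w \<subseteq> {0..d}" using assms(3) by fastforce
  moreover have "last ?w \<noteq> 0" if "?w \<noteq> []"
  proof -
    have "last p = (if last ?w = 0 then 0 else 1)"
      using that by (subst zp[symmetric]) (simp add: zero_pattern_def last_map)
    moreover have "p \<noteq> []" using that by auto
    then have "last p \<noteq> 0" using assms(1) by (simp add: words0_def)
    ultimately show ?thesis by (auto split: if_splits)
  qed
  ultimately show ?thesis by (simp add: words0_def)
qed

text \<open>Up to the first position where the patterns differ, both words have used equally many
  letters of \<open>xs\<close> and agree. At this position one has 0 and the other a nonzero letter,
  exactly as the patterns do.\<close>

lemma less0_fill:
  assumes "ones p = length xs" "ones q = length xs" "set p \<subseteq> {0..1}" "set q \<subseteq> {0..1}"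
    and "0 \<notin> set xs"
  shows "less0 (fill 0 p xs) (fill 0 q xs) \<longleftrightarrow> less0 p q"
proof -
  have "(fill 0 p xs, fill 0 q xs) \<in> lex less_than \<longleftrightarrow> (p, q) \<in> lex less_than" if "length p = length q"
    using that assms
  proof (induction p q arbitrary: xs rule: list_induct2)
    case (Cons a p b q)
    show ?case
    proof (cases "a = 0")
      case True
      then show ?thesis using Cons by (cases "b = 0"; cases xs) auto
    next
      case False
      then show ?thesis using Cons by (cases "b = 0"; cases xs) auto
    qed
  qed simp
  then show ?thesis by (auto simp: less0_def lenlex_conv)
qed

text \<open>Gram--Schmidt for words over {0, 1} with respect to \<open>word_inner\<close>. As no
  Brownian motion occurs in it, its coefficients can be shared by both sides of the naturality
  statement.\<close>

function pattern_phat :: "real \<Rightarrow> nat list \<Rightarrow> nat list \<Rightarrow>\<^sub>0 real" where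
  "pattern_phat T p = word p -
     (\<Sum>q\<in>{q\<in>words0 1. equiv0 q p \<and> less0 q p}.
        (word_inner T (word p) (pattern_phat T q) /
         word_inner T (pattern_phat T q) (pattern_phat T q)) *\<^sub>R pattern_phat T q)"
  by pat_completeness auto
termination
  by (relation "inv_image (lenlex less_than) snd") (auto simp: less0_def intro: wf_lenlex)

declare pattern_phat.simps [simp del]

lemma keys_pattern_phat:
  assumes "p \<in> words0 1"
  shows "Poly_Mapping.keys (pattern_phat T p) \<subseteq> {q \<in> words0 1. equiv0 q p}"
  using assms
proof (induction p rule: wf_induct_rule[OF wf_less0])
  case (1 w)
  show ?case
  proof (subst pattern_phat.simps, rule keys_diff_sum_subset)
    fix v assume v: "v \<in> {v \<in> words0 1. equiv0 v w \<and> less0 v w}"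
    then have "Poly_Mapping.keys (pattern_phat T v) \<subseteq> {u \<in> words0 1. equiv0 u v}" by (intro 1) auto
    also have "\<dots> \<subseteq> {u \<in> words0 1. equiv0 u w}" using v by (auto simp: equiv0_def)
    finally show "Poly_Mapping.keys (pattern_phat T v) \<subseteq> {u \<in> words0 1. equiv0 u w}" .
  qed (use 1 in \<open>auto simp: equiv0_def\<close>)
qed

lemma pattern_phat_ones:
  assumes "p \<in> words0 1" "q \<in> Poly_Mapping.keys (pattern_phat T p)"
  shows "ones q = ones p" "q \<in> words0 1"
proof -
  have "q \<in> {q \<in> words0 1. equiv0 q p}" using keys_pattern_phat[OF assms(1)] assms(2) by blast
  then show "ones q = ones p" "q \<in> words0 1" by (simp_all add: equiv0_def)
qed

lemma word_inner_fill:
  assumes "\<And>q. q \<in> Poly_Mapping.keys p \<Longrightarrow> ones q = length xs \<and> q \<in> words0 1"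
    and "\<And>q. q \<in> Poly_Mapping.keys r \<Longrightarrow> ones q = length xs \<and> q \<in> words0 1"
    and nz: "0 \<notin> set xs"
  shows "word_inner T (lin_ext (\<lambda>q. word (fill 0 q xs)) p) (lin_ext (\<lambda>q. word (fill 0 q xs)) r) = word_inner T p r"
proof -
  have "kern (rev (fill 0 u xs)) (rev (fill 0 v xs)) T T = kern (rev u) (rev v) T T"
    if "u \<in> Poly_Mapping.keys p" "v \<in> Poly_Mapping.keys r" for u v
  proof -
    have u: "length xs = ones u" "set u \<subseteq> {0..1}" using assms(1)[OF that(1)] by (auto simp: words0_def)
    have v: "length xs = ones v" "set v \<subseteq> {0..1}" using assms(2)[OF that(2)] by (auto simp: words0_def)
    have "kern (rev (fill 0 u xs)) (rev (fill 0 v xs)) T T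
        = kern (zero_pattern (rev (fill 0 u xs))) (zero_pattern (rev (fill 0 v xs))) T T"
      by (rule kern_zero_pattern)
        (simp only: rev_filter[symmetric] filter_fill[OF u(1) nz] filter_fill[OF v(1) nz])
    then show ?thesis
      by (simp only: zero_pattern_rev zero_pattern_fill[OF u(1) nz u(2)] zero_pattern_fill[OF v(1) nz v(2)])
  qed
  then show ?thesis
    unfolding lin_ext_def[of "\<lambda>q. word (fill 0 q xs)"]
    unfolding linear_sum[OF linear_word_inner_left] linear_scale[OF linear_word_inner_left]
    unfolding linear_sum[OF linear_word_inner_right]
      linear_scale[OF linear_word_inner_right] word_inner_word
    by (simp add: word_inner_def lin_ext_def)
qed

context brownian
begin

text \<open>Filling in \<open>xs\<close> maps the predecessors of a pattern in its class onto those
  of the word and preserves order and inner products, so both recursions have the same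
  coefficients.\<close>

lemma phat_fill:
  assumes "p \<in> words0 1" "length xs = ones p" and xs: "set xs \<subseteq> {1..d}"
  shows "phat M d T B (fill 0 p xs) = lin_ext (\<lambda>q. word (fill 0 q xs)) (pattern_phat T p)"
  using assms(1,2)
proof (induction p rule: wf_induct_rule[OF wf_less0])
  case (1 p)
  let ?f = "\<lambda>q. fill 0 q xs" and ?g = "pattern_phat T" and ?p = "phat M d T B"
  let ?R = "lin_ext (\<lambda>q. word (fill 0 q xs))" and ?D = "{q \<in> words0 1. equiv0 q p \<and> less0 q p}"
  have nz: "0 \<notin> set xs" using xs by auto
  have pat: "set q \<subseteq> {0..1}" if "q \<in> words0 1" for q using that by (simp add: words0_def)
  have D: "q \<in> words0 1" "length xs = ones q" "less0 q p" if "q \<in> ?D" for q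
    using that 1 by (auto simp: equiv0_def)
  have IH: "?p (?f q) = ?R (?g q)" if "q \<in> ?D" for q
    using "1.IH"[of q] D[OF that] by simp
  have keys: "ones q' = length xs \<and> q' \<in> words0 1" if "q \<in> insert p ?D" "q' \<in> Poly_Mapping.keys (?g q)" for q q'
  proof -
    have q: "q \<in> words0 1" "length xs = ones q" using that(1) D 1(2,3) by blast+
    show ?thesis using pattern_phat_ones[OF q(1) that(2)] q(2) by simp
  qed
  \<comment> \<open>The index sets of the two recursions correspond to each other under filling,
    with \<open>zero_pattern\<close> as the inverse.\<close>
  have eq: "{v \<in> words0 d. equiv0 v (?f p) \<and> less0 v (?f p)} = ?f ` ?D"
  proof (intro equalityI subsetI)
    fix v assume "v \<in> {v \<in> words0 d. equiv0 v (?f p) \<and> less0 v (?f p)}"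
    then have v: "v \<in> words0 d" "filter (\<lambda>a. a \<noteq> 0) v = xs" "less0 v (?f p)"
      using filter_fill[OF 1(3) nz] by (auto simp: equiv0_def)
    let ?q = "zero_pattern v"
    have fv: "?f ?q = v" using fill_zero_pattern[of v] v(2) by simp
    have q: "?q \<in> words0 1" by (rule zero_pattern_words0[OF v(1)])
    have fq: "filter (\<lambda>a. a \<noteq> 0) ?q = filter (\<lambda>a. a \<noteq> 0) p"
    proof -
      have "ones v = ones p" using v(2) 1(3) by simp
      then have "replicate (ones v) (1::nat) = replicate (ones p) 1" by (simp only:)
      then show ?thesis
        by (rule trans[OF ones_zero_pattern trans[OF _ filter_pattern[OF pat[OF 1(2)], symmetric]]])
    qed
    have "less0 ?q p"
      using v(3) fv less0_fill[of ?q xs p] fq 1(3) pat[OF q] pat[OF 1(2)] nz by simp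
    with q fq have "?q \<in> ?D" by (simp add: equiv0_def)
    with fv show "v \<in> ?f ` ?D" by force
  next
    fix v assume "v \<in> ?f ` ?D"
    then obtain q where q: "q \<in> ?D" "v = ?f q" by auto
    note q' = D[OF q(1)]
    have "equiv0 v (?f p)"
      unfolding q(2) equiv0_def filter_fill[OF 1(3) nz] filter_fill[OF q'(2) nz] ..
    moreover have "less0 v (?f p)"
      using less0_fill[of q xs p] q' 1(2,3) pat nz q(2) by simp
    ultimately show "v \<in> {v \<in> words0 d. equiv0 v (?f p) \<and> less0 v (?f p)}"
      using fill_words0[OF q'(1,2) xs] q(2) by simp
  qed
  have inj: "inj_on ?f ?D"
  proof (rule inj_onI)
    fix q r assume "q \<in> ?D" "r \<in> ?D" "?f q = ?f r"
    then show "q = r"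
      using zero_pattern_fill[OF D(2) nz pat[OF D(1)]] by metis
  qed
  have Rw: "?R (word q) = word (?f q)" for q by simp
  have inner: "sig_inner M d T B (?p (?f q)) (?p (?f q)) = word_inner T (?g q) (?g q)"
    "sig_inner M d T B (word (?f p)) (?p (?f q)) = word_inner T (word p) (?g q)" if q: "q \<in> ?D" for q
  proof -
    have k: "Poly_Mapping.keys (?p (?f q)) \<subseteq> words0 d"
      by (rule keys_phat_words0[OF fill_words0[OF D(1,2)[OF q] xs]])
    have kw: "Poly_Mapping.keys (word (?f p)) \<subseteq> words0 d" using fill_words0[OF 1(2,3) xs] by simp
    note kq = keys[OF insertI2[OF q]]
    show "sig_inner M d T B (?p (?f q)) (?p (?f q)) = word_inner T (?g q) (?g q)"
      unfolding sig_inner_eq[OF k k] unfolding IH[OF q] by (rule word_inner_fill[OF kq kq nz])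
    show "sig_inner M d T B (word (?f p)) (?p (?f q)) = word_inner T (word p) (?g q)"
      unfolding sig_inner_eq[OF kw k] unfolding IH[OF q] Rw[of p, symmetric]
      by (rule word_inner_fill[OF _ kq nz]) (use 1 in auto)
  qed
  have "?p (?f p) = word (?f p) - (\<Sum>q\<in>?D. (sig_inner M d T B (word (?f p)) (?p (?f q)) /
      sig_inner M d T B (?p (?f q)) (?p (?f q))) *\<^sub>R ?p (?f q))"
    by (subst phat.simps) (simp only: eq sum.reindex[OF inj] o_def)
  also have "(\<Sum>q\<in>?D. (sig_inner M d T B (word (?f p)) (?p (?f q)) /
      sig_inner M d T B (?p (?f q)) (?p (?f q))) *\<^sub>R ?p (?f q))
    = (\<Sum>q\<in>?D. (word_inner T (word p) (?g q) / word_inner T (?g q) (?g q)) *\<^sub>R ?R (?g q))"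
    by (rule sum.cong[OF refl]) (simp only: inner, simp only: IH)
  also have "word (?f p) - \<dots> = ?R (?g p)"
    by (subst (3) pattern_phat.simps)
      (simp only: linear_diff[OF linear_lin_ext] linear_sum[OF linear_lin_ext] linear_scale[OF linear_lin_ext] Rw)
  finally show ?case .
qed

end

section \<open>Multilinearity in the nonzero letters\<close>

lemma fill_slot:
  assumes "ones q = length xs + Suc (length ys)"
  shows "\<exists>A C. \<forall>x. fill z q (xs @ x # ys) = A @ x # C"
  using assms
proof (induction q arbitrary: xs)
  case (Cons a q)
  show ?case
  proof (cases "a = 0")
    case True
    from True Cons.prems have "ones q = length xs + Suc (length ys)" by simp
    from Cons.IH[OF this] obtain A C where "\<forall>x. fill z q (xs @ x # ys) = A @ x # C" by blast
    with True show ?thesis by (intro exI[of _ "z # A"] exI[of _ C]) simp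
  next
    case False
    show ?thesis
    proof (cases xs)
      case Nil
      with False show ?thesis by (intro exI[of _ "[]"] exI[of _ "fill z q ys"]) simp
    next
      case xs: (Cons y xs')
      with False xs Cons.prems have "ones q = length xs' + Suc (length ys)" by simp
      from Cons.IH[OF this] obtain A C where "\<forall>x. fill z q (xs' @ x # ys) = A @ x # C" by blast
      with False xs show ?thesis by (intro exI[of _ "y # A"] exI[of _ C]) simp
    qed
  qed
qed simp

abbreviation fill_tensor :: "'v::euclidean_space list \<Rightarrow> nat list \<Rightarrow> (real \<times> 'v) tensor_alg" where
  "fill_tensor xs q \<equiv> tensor (fill (1, 0) q (map (Pair 0) xs))"

text \<open>The slot that receives \<open>x\<close> does not depend on \<open>x\<close>, so this is
  a slot of a tensor composed with the embedding of vectors.\<close>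

lemma linear_fill_tensor:
  assumes "ones q = length xs + Suc (length ys)"
  shows "linear (\<lambda>x. fill_tensor (xs @ x # ys) q)"
proof -
  have "ones q = length (map (Pair (0::real)) xs) + Suc (length (map (Pair (0::real)) ys))"
    using assms by (simp only: length_map)
  from fill_slot[OF this, of "(1, 0)"] obtain A C
    where "\<And>x. fill (1::real, 0) q (map (Pair 0) xs @ x # map (Pair 0) ys) = A @ x # C" by blast
  then have "(\<lambda>x. fill_tensor (xs @ x # ys) q) = (\<lambda>x. tensor (A @ x # C)) \<circ> Pair 0"
    by (intro ext) simp
  moreover have "linear (Pair (0::real) :: 'a \<Rightarrow> _)" by (rule linearI) simp_all
  ultimately show ?thesis by (simp only: linear_compose linear_tensor_slot)
qed

lemma realise_fill:
  assumes "length xs = ones q" "set xs \<subseteq> {1..d}"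
  shows "tensor (map (letter f) (fill 0 q xs)) = fill_tensor (map f xs) q"
proof -
  have "map (letter f) xs = map (Pair 0) (map f xs)"
    using assms(2) by (auto simp: letter_def)
  moreover have "letter f 0 = (1, 0)" by (simp add: letter_def)
  ultimately show ?thesis by (simp only: map_fill[OF assms(1)])
qed

context brownian
begin

text \<open>Both sides are multilinear in \<open>xs\<close>, hence it suffices to consider lists of basis vectors.\<close>

lemma phat_map_fill_tensor:
  assumes f: "orthonormal_basis V d f" and p: "p \<in> words0 1" and "ones p = length xs" "set xs \<subseteq> V"
  shows "fill_tensor xs p \<in> sh_circ d f \<and>
    phat_map M d T B f (fill_tensor xs p) = lin_ext (fill_tensor xs) (pattern_phat T p)"
proof -
  let ?P = "\<lambda>xs. fill_tensor xs p \<in> sh_circ d f \<and>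
    phat_map M d T B f (fill_tensor xs p) = lin_ext (fill_tensor xs) (pattern_phat T p)"
  note lin = phat_map_spec(1)[OF f, of M T B]
  \<comment> \<open>Arbitrary vectors followed by basis vectors: in each step linearity replaces the
    last vector of \<open>xs\<close> by a basis vector, whose index joins \<open>js\<close>.\<close>
  have "ones p = length xs + length js \<Longrightarrow> set js \<subseteq> {1..d} \<Longrightarrow> set xs \<subseteq> V \<Longrightarrow> ?P (xs @ map f js)" for js
  proof (induction xs arbitrary: js rule: rev_induct)
    case Nil
    then have l: "length js = ones p" by simp
    let ?w = "fill 0 p js"
    have w: "?w \<in> words0 d" by (rule fill_words0[OF p l Nil(2)])
    have t: "fill_tensor (map f js) p = realise f (word ?w)"
      by (simp only: realise_word realise_fill[OF l Nil(2)])
    have "phat_map M d T B f (fill_tensor (map f js) p)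
        = realise f (lin_ext (\<lambda>q. word (fill 0 q js)) (pattern_phat T p))"
      unfolding t phat_map_spec(2)[OF f w] by (simp only: phat_fill[OF p l Nil(2)])
    also have "\<dots> = lin_ext (\<lambda>q. tensor (map (letter f) (fill 0 q js))) (pattern_phat T p)"
      by (simp only: lin_ext_def[of "\<lambda>q. word (fill 0 q js)"] linear_sum[OF linear_realise] linear_scale[OF linear_realise] realise_word)
        (simp only: lin_ext_def)
    also have "\<dots> = lin_ext (fill_tensor (map f js)) (pattern_phat T p)"
      unfolding lin_ext_def
      by (intro sum.cong refl arg_cong2[of _ _ _ _ scaleR] realise_fill[OF _ Nil(2)])
        (simp only: l pattern_phat_ones[OF p])
    finally have "phat_map M d T B f (fill_tensor (map f js) p) = lin_ext (fill_tensor (map f js)) (pattern_phat T p)" .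
    moreover have "fill_tensor (map f js) p \<in> sh_circ d f"
      unfolding t sh_circ_def using w by (intro span_base imageI)
    ultimately show ?case by (simp only: append_Nil)
  next
    case (snoc x xs)
    have n: "ones q = length xs + Suc (length (map f js))" if "q \<in> insert p (Poly_Mapping.keys (pattern_phat T p))" for q
      using that pattern_phat_ones[OF p] snoc.prems(1) by auto
    let ?F = "\<lambda>q x. fill_tensor (xs @ x # map f js) q"
    let ?L = "\<lambda>x. lin_ext (fill_tensor (xs @ x # map f js)) (pattern_phat T p)"
    have Fp: "linear (?F p)" by (rule linear_fill_tensor[OF n]) simp
    have L: "linear ?L"
      unfolding lin_ext_def by (intro linear_compose_sum ballI linear_compose_scale_right linear_fill_tensor n insertI2)
    have "x \<in> span (f ` {1..d})" using snoc.prems(3) f by (auto simp: orthonormal_basis_def)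
    then have "?P (xs @ x # map f js)"
    proof (induction rule: span_induct)
      case base
      have "subspace {x. ?F p x \<in> sh_circ d f}"
        using linear_subspace_vimage[OF Fp, of "sh_circ d f"] by (simp add: sh_circ_def vimage_def)
      moreover have "subspace {x. phat_map M d T B f (?F p x) - ?L x = 0}"
        using linear_compose[OF Fp lin] L by (intro linear_subspace_kernel linear_compose_sub) (simp_all add: o_def)
      ultimately show ?case using subspace_inter by (fastforce simp: Collect_conj_eq)
    next
      case (step y)
      then obtain i where "i \<in> {1..d}" "y = f i" by auto
      with snoc.IH[of "i # js"] snoc.prems show ?case by simp
    qed
    then show ?case by simp
  qed
  from this[of "[]"] assms show ?thesis by simp
qed

end

text \<open>On \<open>fill_tensor xs p\<close> the map \<open>phat_map\<close> acts with
  coefficients that depend on \<open>p\<close> and \<open>T\<close> only, while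
  \<open>sh_map \<phi>\<close> acts on the entries of \<open>xs\<close>; hence they commute. The
  images of the basis \<open>e\<close> need not belong to the basis \<open>f\<close>, which is why
  the formula is used for arbitrary vectors.\<close>

theorem sh_map_phat_map:
  fixes U :: "'u::euclidean_space set" and V :: "'v::euclidean_space set"
  assumes "brownian M d T B" "brownian M' m T B'"
    and e: "orthonormal_basis U m e" and f: "orthonormal_basis V d f"
    and \<phi>: "linear \<phi>" "\<phi> ` U \<subseteq> V"
  shows "sh_map \<phi> ` sh_circ m e \<subseteq> sh_circ d f"
    and "x \<in> sh_circ m e \<Longrightarrow> sh_map \<phi> (phat_map M' m T B' e x) = phat_map M d T B f (sh_map \<phi> x)"
proof -
  interpret B: brownian M d T B by fact
  interpret B': brownian M' m T B' by fact
  have l: "linear (map_prod id \<phi>)"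
    by (rule linearI) (auto simp: linear_add[OF \<phi>(1)] linear_scale[OF \<phi>(1)])
  have sh: "linear (sh_map \<phi>)" unfolding sh_map_def by (rule linear_tensor_map)
  have sf: "sh_map \<phi> (fill_tensor xs q) = fill_tensor (map \<phi> xs) q" if "ones q = length xs" for xs q
    unfolding sh_map_def tensor_map_tensor[OF l]
    using that linear_0[OF \<phi>(1)] by (subst map_fill) (simp_all add: o_def)
  have w: "sh_map \<phi> (realise e (word w)) \<in> sh_circ d f \<and>
      sh_map \<phi> (phat_map M' m T B' e (realise e (word w))) = phat_map M d T B f (sh_map \<phi> (realise e (word w)))"
    if w: "w \<in> words0 m" for w
  proof -
    let ?p = "zero_pattern w" and ?js = "filter (\<lambda>a. a \<noteq> 0) w"
    have p: "?p \<in> words0 1" by (rule zero_pattern_words0[OF w])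
    have n: "length ?js = ones ?p" by (simp only: ones_zero_pattern length_replicate)
    have js: "set ?js \<subseteq> {1..m}" using w by (auto simp: words0_def)
    have eU: "set (map e ?js) \<subseteq> U"
      using js e by (auto simp: orthonormal_basis_def intro!: span_base)
    then have \<phi>V: "set (map \<phi> (map e ?js)) \<subseteq> V" using \<phi>(2) by auto
    have r: "realise e (word w) = fill_tensor (map e ?js) ?p"
      unfolding realise_word realise_fill[OF n js, symmetric] by (simp only: fill_zero_pattern)
    have n': "ones q = length (map e ?js)" if "q \<in> insert ?p (Poly_Mapping.keys (pattern_phat T ?p))" for q
      using that pattern_phat_ones[OF p] n by auto
    have s: "sh_map \<phi> (realise e (word w)) = fill_tensor (map \<phi> (map e ?js)) ?p"
      unfolding r by (rule sf[OF n']) simp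
    have n1: "ones ?p = length (map \<phi> (map e ?js))" using n by simp
    note 1 = B.phat_map_fill_tensor[OF f p n1 \<phi>V]
    have "sh_map \<phi> (phat_map M' m T B' e (realise e (word w)))
        = lin_ext (fill_tensor (map \<phi> (map e ?js))) (pattern_phat T ?p)"
      unfolding r conjunct2[OF B'.phat_map_fill_tensor[OF e p n' eU], OF insertI1] lin_ext_def linear_sum[OF sh] linear_scale[OF sh]
      by (intro sum.cong refl arg_cong2[of _ _ _ _ scaleR] sf n' insertI2)
    with 1 show ?thesis unfolding s by simp
  qed
  have "sh_map \<phi> x \<in> sh_circ d f \<and> sh_map \<phi> (phat_map M' m T B' e x) = phat_map M d T B f (sh_map \<phi> x)"
    if "x \<in> sh_circ m e" for x
    using that unfolding sh_circ_def[of m e]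
  proof (induction rule: span_induct)
    case base
    have "subspace {x. sh_map \<phi> x \<in> sh_circ d f}"
      using linear_subspace_vimage[OF sh, of "sh_circ d f"] by (simp add: sh_circ_def vimage_def)
    moreover have "subspace {x. sh_map \<phi> (phat_map M' m T B' e x) - phat_map M d T B f (sh_map \<phi> x) = 0}"
      using linear_compose[OF phat_map_spec(1)[OF e] sh] linear_compose[OF sh phat_map_spec(1)[OF f]]
      by (intro linear_subspace_kernel linear_compose_sub) (simp_all add: o_def)
    ultimately show ?case using subspace_inter by (fastforce simp: Collect_conj_eq)
  next
    case (step x)
    then show ?case using w by auto
  qed
  then show "sh_map \<phi> ` sh_circ m e \<subseteq> sh_circ d f"
    and "x \<in> sh_circ m e \<Longrightarrow> sh_map \<phi> (phat_map M' m T B' e x) = phat_map M d T B f (sh_map \<phi> x)"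
    by auto
qed

theorem theorem4p6:
  fixes M :: "'a measure" and d :: nat and T :: real and B :: "nat \<Rightarrow> real \<Rightarrow> 'a \<Rightarrow> real"
  assumes "T > 0" and "standard_brownian_motion M d T B"
  shows
    "(\<forall>Y. Y \<in> borel_measurable (brownian_filtration M d B T) \<and> square_integrable M Y \<longrightarrow>
        (\<forall>w\<in>words0 d. square_integrable M (chaos_summand M d T B Y w)) \<and>
        (\<forall>u\<in>words0 d. \<forall>v\<in>words0 d. u \<noteq> v \<longrightarrow>
           (\<integral>\<omega>. chaos_summand M d T B Y u \<omega> * chaos_summand M d T B Y v \<omega> \<partial>M) = 0) \<and>
        ((\<lambda>A. \<integral>\<omega>. (Y \<omega> - (\<Sum>w\<in>A. chaos_summand M d T B Y w \<omega>))\<^sup>2 \<partial>M) \<longlongrightarrow> 0)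
          (finite_subsets_at_top (words0 d))) \<and>
     (\<forall>u\<in>words0 d. \<forall>v\<in>words0 d. u \<noteq> v \<longrightarrow>
        sig_inner M d T B (phat M d T B u) (phat M d T B v) = 0) \<and>
     (\<forall>(U :: 'u::euclidean_space set) (V :: 'v::euclidean_space set) m e f
        (M' :: 'b measure) B' \<phi>.
        orthonormal_basis U m e \<and> orthonormal_basis V d f \<and>
        standard_brownian_motion M' m T B' \<and>
        linear \<phi> \<and> \<phi> ` U \<subseteq> V \<and> inj_on \<phi> U \<and> (\<forall>x\<in>U. norm (\<phi> x) = norm x) \<longrightarrow>
        sh_map \<phi> ` sh_circ m e \<subseteq> sh_circ d f \<and>
        (\<forall>x\<in>sh_circ m e.
           sh_map \<phi> (phat_map M' m T B' e x) = phat_map M d T B f (sh_map \<phi> x)))"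
proof (intro conjI allI impI ballI; (elim conjE)?)
  interpret brownian M d T B using assms by unfold_locales
  show "square_integrable M (chaos_summand M d T B Y w)" if "w \<in> words0 d" for Y w
    by (rule sqi_chaos_summand[OF that])
  show "(\<integral>\<omega>. chaos_summand M d T B Y u \<omega> * chaos_summand M d T B Y v \<omega> \<partial>M) = 0"
    if "u \<in> words0 d" "v \<in> words0 d" "u \<noteq> v" for Y u v
    by (rule chaos_summand_orthogonal[OF that])
  show "((\<lambda>A. \<integral>\<omega>. (Y \<omega> - (\<Sum>w\<in>A. chaos_summand M d T B Y w \<omega>))\<^sup>2 \<partial>M) \<longlongrightarrow> 0) (finite_subsets_at_top (words0 d))"
    if "Y \<in> borel_measurable (brownian_filtration M d B T)" "square_integrable M Y" for Y
    by (rule chaos_expansion[OF that])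
  show "sig_inner M d T B (phat M d T B u) (phat M d T B v) = 0" if "u \<in> words0 d" "v \<in> words0 d" "u \<noteq> v" for u v
    by (rule phat_orthogonal[OF that])
  fix U :: "'u set" and V :: "'v set" and m e f B' \<phi> and M' :: "'b measure"
  assume a: "orthonormal_basis U m e" "orthonormal_basis V d f" "linear \<phi>" "\<phi> ` U \<subseteq> V"
    and B': "standard_brownian_motion M' m T B'"
  have b: "brownian M' m T B'" using assms(1) B' by unfold_locales
  note nat = sh_map_phat_map[OF brownian_axioms b a(1,2,3,4)]
  show "sh_map \<phi> ` sh_circ m e \<subseteq> sh_circ d f" by (rule nat(1))
  show "sh_map \<phi> (phat_map M' m T B' e x) = phat_map M d T B f (sh_map \<phi> x)" if "x \<in> sh_circ m e" for x
    by (rule nat(2)[OF that])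
qed

end
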